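(* Let $\mathcal B$ be a unital $C^*$-algebra. The index is a covariant functor from the category of continuous product systems over $\mathcal B$ to the category of left-right $\mathcal B$-$\mathcal B$ modules. Here a continuous product system $E$ is sent to $\operatorname{ind}(E)=\operatorname{ind}(E,\omega)$, and a morphism $\theta:E\to F$ is sent to the map $\operatorname{ind}(\theta):\operatorname{ind}(E,\omega)\to\operatorname{ind}(F,\theta(\omega))$ which is the continuous extension of $[x]\mapsto[\theta(x)]$, $x\in\mathcal U_\omega$, $\theta(x)=(\theta_t(x_t))_{t\ge0}$. That is, $\operatorname{ind}(\theta)$ is a well-defined bounded adjointable $\mathcal B$-$\mathcal B$ linear map, $\operatorname{ind}(\operatorname{id}_E)=\operatorname{id}_{\operatorname{ind}(E)}$, and $\operatorname{ind}(\psi\theta)=\operatorname{ind}(\psi)\operatorname{ind}(\theta)$ for all morphisms $\theta:E\to F$ and $\psi:F\to G$.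
   Context: $\mathcal B$ is a unital $C^*$-algebra with unit $1$. A Hilbert $\mathcal B$-$\mathcal B$ module is a right Hilbert $\mathcal B$-module (inner product $\mathcal B$-valued, linear in the second variable) with a unital left action of $\mathcal B$ by adjointable operators. A product system over $\mathcal B$ is a family $E=(E_t)_{t\ge0}$ of Hilbert $\mathcal B$-$\mathcal B$ modules with $E_0\cong\mathcal B$ and (associative) bilinear unitary isomorphisms $\varphi_{t,s}:E_t\otimes E_s\to E_{t+s}$, where $\otimes$ is the inner tensor product over $\mathcal B$ with $\langle u\otimes v,u_1\otimes v_1\rangle=\langle v,\langle u,u_1\rangle v_1\rangle$; one identifies $E_t\otimes E_s$ with $E_{t+s}$. A unit on $E$ is a family $u=(u_t)_{t\ge0}$, $u_t\in E_t$, with $u_0=1$ and $u_t\otimes u_s=u_{t+s}$. For units $u,v$ put $\mathcal K^{u,v}_t(b)=\langle u_t,bv_t\rangle$; these are bounded linear operators on $\mathcal B$ forming a semigroup in $t$. A set $S$ of units is continuous if for all $\xi,\eta\in S$ the semigroup $\mathcal K_t^{\xi,\eta}$ is uniformly continuous (continuous in the norm of $L(\mathcal B)$); then $\mathcal L^{\xi,\eta}=\frac{d}{dt}\mathcal K^{\xi,\eta}_t|_{t=0}\in L(\mathcal B)$. A unit $u$ is continuous if $\{u\}$ is continuous. For a continuous unit $\omega$, $\mathcal U_\omega$ is the set of all continuous units $x$ such that $\{x,\omega\}$ is a continuous set; it is the maximal continuous set of units containing $\omega$. For $x^1,\dots,x^n\in\mathcal U_\omega$ and $\varkappa_1,\dots,\varkappa_n\in\mathcal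 B$ with $\sum_j\varkappa_j=1$, $\varkappa_1x^1\boxplus\dots\boxplus\varkappa_nx^n$ denotes the unit $\zeta$ with $\zeta_t=\lim_{m\to\infty}\big(\sum_j\varkappa_jx^j_{t/m}\big)^{\otimes m}$ (norm limit), and $x^1\varkappa_1\boxplus\dots\boxplus x^n\varkappa_n$ the unit obtained from $\sum_jx^j_{t/m}\varkappa_j$ in the same way; it is known that these limits exist and the units belong to $\mathcal U_\omega$. $\mathcal U_\omega$ is a $\mathcal B$-$\mathcal B$ module with $x+y=x\boxplus y\boxplus(-\omega)$, $b\cdot x=bx\boxplus(1-b)\omega$, $x\cdot b=xb\boxplus\omega(1-b)$ and neutral element $\omega$. For $\xi\in\mathcal U_\omega$, $a,c\in\mathcal B$: $\mathcal L^{x+y,\xi}=\mathcal L^{x,\xi}+\mathcal L^{y,\xi}-\mathcal L^{\omega,\xi}$, $\mathcal L^{x\cdot a,\xi}(c)=a^*\mathcal L^{x,\xi}(c)+(1-a)^*\mathcal L^{\omega,\xi}(c)$, $\mathcal L^{a\cdot x,\xi}(c)=\mathcal L^{x,\xi}(a^*c)+\mathcal L^{\omega,\xi}((1-a^* )c)$. Index: with $\langle x,y\rangle=(\mathcal L^{x,y}-\mathcal L^{x,\omega}-\mathcal L^{\omega,y}+\mathcal L^{\omega,\omega})(1)$ (a $\mathcal B$-valued semi-inner product on $\mathcal U_\omega$), $N=\{x\in\mathcal U_\omega:\langle x,x\rangle=0\}$ (a submodule) and $x\sim y$ iff $x-y\in N$, $\operatorname{ind}(E,\omega)$ is the completion of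 the pre-Hilbert $\mathcal B$-$\mathcal B$ module $\mathcal U_\omega/\sim$; $[x]$ is the class of $x$. If $\{\omega,\omega'\}$ is continuous then $\operatorname{ind}(E,\omega)\cong\operatorname{ind}(E,\omega')$ via $x\mapsto x\boxplus(-\omega)\boxplus\omega'$. A continuous product system is a product system $E=(E_t)$ with isometric embeddings $i_t:E_t\to\hat E$ into a unital Hilbert $\mathcal B$-$\mathcal B$ module $\hat E$ such that, with $CS_i(E)=\{(x_t)_{t\ge0}: x_t\in E_t,\ t\mapsto i_tx_t\text{ continuous}\}$: (1) for every $s$ and $y_s\in E_s$ there is $(x_t)\in CS_i(E)$ with $x_s=y_s$; (2) for all $x,y\in CS_i(E)$ the function $(s,t)\mapsto i_{s+t}(x_s\otimes y_t)$ is continuous. The continuous product systems considered have at least one continuous unit in $CS_i(E)$, and $\operatorname{ind}(E)=\operatorname{ind}(E,\omega)$ for a continuous unit $\omega\in CS_i(E)$; the set $\mathcal U_\omega$ is then exactly the set of all continuous units belonging to $CS_i(E)$, so $\operatorname{ind}(E)$ does not depend on $\omega$ up to the isomorphism $\operatorname{ind}(E,\omega)\cong\operatorname{ind}(E,\omega')$ induced by $x\mapsto x\boxplus(-\omega)\boxplus\omega'$ (for continuous units $\omega,\omega'\in CS_i(E)$). A morphism $\theta:E\to F$ of continuous product systems (with embeddings $i$, $j$) is a family of bounded adjointable $\mathcal B$-$\mathcal B$ linear maps $\theta_t:E_t\to F_t$ with $\theta_{t+s}=\theta_t\otimes\theta_s$, $\theta_0=\operatorname{id}_{\mathcal B}$,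 such that $(\theta_t x_t)\in CS_j(F)$ for $(x_t)\in CS_i(E)$ and $(\theta_t^*y_t)\in CS_i(E)$ for $(y_t)\in CS_j(F)$, and $\limsup_{t\to0+}\|\theta_t\|<+\infty$. Morphisms of left-right $\mathcal B$-$\mathcal B$ (Hilbert) modules are bounded adjointable $\mathcal B$-$\mathcal B$ linear maps. *)

theory Defs
  imports "HOL-Analysis.Analysis"
begin

section \<open>Unital C*-algebras\<close>

text \<open>The unit is taken from \<^class>\<open>monoid_mult\<close> rather than \<^class>\<open>real_normed_algebra_1\<close>, so
  that the zero algebra is not excluded; \<open>norm 1 = 1\<close> follows from the C*-identity otherwise.\<close>

class unital_cstar_algebra = real_normed_algebra + monoid_mult + banach +
  fixes scaleC :: "complex \<Rightarrow> 'a \<Rightarrow> 'a"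
    and star :: "'a \<Rightarrow> 'a"
  assumes scaleC_add_right: "scaleC c (x + y) = scaleC c x + scaleC c y"
    and scaleC_add_left: "scaleC (c + d) x = scaleC c x + scaleC d x"
    and scaleC_scaleC: "scaleC c (scaleC d x) = scaleC (c * d) x"
    and scaleR_scaleC: "scaleR r x = scaleC (complex_of_real r) x"
    and mult_scaleC_left: "scaleC c x * y = scaleC c (x * y)"
    and mult_scaleC_right: "x * scaleC c y = scaleC c (x * y)"
    and norm_scaleC: "norm (scaleC c x) = cmod c * norm x"
    and star_add: "star (x + y) = star x + star y"
    and star_scaleC: "star (scaleC c x) = scaleC (cnj c) (star x)"
    and star_mult: "star (x * y) = star y * star x"
    and star_star: "star (star x) = x"
    and norm_star_mult_self: "norm (star x * x) = (norm x)\<^sup>2"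

definition positive :: "'b::unital_cstar_algebra \<Rightarrow> bool" where
  "positive a \<longleftrightarrow> (\<exists>b. a = star b * b)"

section \<open>Hilbert bimodules\<close>

record ('b, 'm) bimod =
  mcarrier :: "'m set"
  madd :: "'m \<Rightarrow> 'm \<Rightarrow> 'm"
  mzero :: 'm
  mlact :: "'b \<Rightarrow> 'm \<Rightarrow> 'm"
  mract :: "'m \<Rightarrow> 'b \<Rightarrow> 'm"
  mip :: "'m \<Rightarrow> 'm \<Rightarrow> 'b"

definition msub :: "('b::unital_cstar_algebra, 'm) bimod \<Rightarrow> 'm \<Rightarrow> 'm \<Rightarrow> 'm" where
  "msub M x y = madd M x (mlact M (- 1) y)"

definition msum :: "('b, 'm) bimod \<Rightarrow> 'm list \<Rightarrow> 'm" where
  "msum M xs = foldr (madd M) xs (mzero M)"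

definition mnorm :: "('b::unital_cstar_algebra, 'm) bimod \<Rightarrow> 'm \<Rightarrow> real" where
  "mnorm M x = sqrt (norm (mip M x x))"

definition mdist :: "('b::unital_cstar_algebra, 'm) bimod \<Rightarrow> 'm \<Rightarrow> 'm \<Rightarrow> real" where
  "mdist M x y = mnorm M (msub M x y)"

definition mCauchy :: "('b::unital_cstar_algebra, 'm) bimod \<Rightarrow> (nat \<Rightarrow> 'm) set" where
  "mCauchy M = {s. (\<forall>n. s n \<in> mcarrier M) \<and>
     (\<forall>e>0. \<exists>N. \<forall>m\<ge>N. \<forall>n\<ge>N. mdist M (s m) (s n) < e)}"

definition mconv :: "('b::unital_cstar_algebra, 'm) bimod \<Rightarrow> (nat \<Rightarrow> 'm) \<Rightarrow> 'm \<Rightarrow> bool" where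
  "mconv M s l \<longleftrightarrow> l \<in> mcarrier M \<and> (\<lambda>n. mdist M (s n) l) \<longlonglongrightarrow> 0"

definition mlim :: "('b::unital_cstar_algebra, 'm) bimod \<Rightarrow> (nat \<Rightarrow> 'm) \<Rightarrow> 'm" where
  "mlim M s = (THE l. mconv M s l)"

text \<open>Complex scalars act on the right through \<open>scaleC c 1\<close>; the axiom \<open>scalar\<close> says that the left
  action, as a map into the adjointable operators, is complex linear.\<close>

locale hilbert_bimodule =
  fixes M :: "('b::unital_cstar_algebra, 'm) bimod"
  assumes add_closed: "x \<in> mcarrier M \<Longrightarrow> y \<in> mcarrier M \<Longrightarrow> madd M x y \<in> mcarrier M"
    and zero_closed: "mzero M \<in> mcarrier M"
    and add_assoc: "x \<in> mcarrier M \<Longrightarrow> y \<in> mcarrier M \<Longrightarrow> z \<in> mcarrier M \<Longrightarrow>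
          madd M (madd M x y) z = madd M x (madd M y z)"
    and add_comm: "x \<in> mcarrier M \<Longrightarrow> y \<in> mcarrier M \<Longrightarrow> madd M x y = madd M y x"
    and add_zero: "x \<in> mcarrier M \<Longrightarrow> madd M x (mzero M) = x"
    and add_inverse: "x \<in> mcarrier M \<Longrightarrow> \<exists>y\<in>mcarrier M. madd M x y = mzero M"
    and ract_closed: "x \<in> mcarrier M \<Longrightarrow> mract M x b \<in> mcarrier M"
    and ract_add_left: "x \<in> mcarrier M \<Longrightarrow> y \<in> mcarrier M \<Longrightarrow>
          mract M (madd M x y) b = madd M (mract M x b) (mract M y b)"
    and ract_add_right: "x \<in> mcarrier M \<Longrightarrow> mract M x (a + b) = madd M (mract M x a) (mract M x b)"
    and ract_mult: "x \<in> mcarrier M \<Longrightarrow> mract M x (a * b) = mract M (mract M x a) b"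
    and ract_one: "x \<in> mcarrier M \<Longrightarrow> mract M x 1 = x"
    and lact_closed: "x \<in> mcarrier M \<Longrightarrow> mlact M b x \<in> mcarrier M"
    and lact_add_right: "x \<in> mcarrier M \<Longrightarrow> y \<in> mcarrier M \<Longrightarrow>
          mlact M b (madd M x y) = madd M (mlact M b x) (mlact M b y)"
    and lact_add_left: "x \<in> mcarrier M \<Longrightarrow> mlact M (a + b) x = madd M (mlact M a x) (mlact M b x)"
    and lact_mult: "x \<in> mcarrier M \<Longrightarrow> mlact M (a * b) x = mlact M a (mlact M b x)"
    and lact_one: "x \<in> mcarrier M \<Longrightarrow> mlact M 1 x = x"
    and lact_ract: "x \<in> mcarrier M \<Longrightarrow> mlact M a (mract M x b) = mract M (mlact M a x) b"
    and scalar: "x \<in> mcarrier M \<Longrightarrow> mlact M (scaleC c 1) x = mract M x (scaleC c 1)"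
    and ip_add_right: "x \<in> mcarrier M \<Longrightarrow> y \<in> mcarrier M \<Longrightarrow> z \<in> mcarrier M \<Longrightarrow>
          mip M x (madd M y z) = mip M x y + mip M x z"
    and ip_ract_right: "x \<in> mcarrier M \<Longrightarrow> y \<in> mcarrier M \<Longrightarrow> mip M x (mract M y b) = mip M x y * b"
    and ip_star: "x \<in> mcarrier M \<Longrightarrow> y \<in> mcarrier M \<Longrightarrow> star (mip M x y) = mip M y x"
    and ip_positive: "x \<in> mcarrier M \<Longrightarrow> positive (mip M x x)"
    and ip_definite: "x \<in> mcarrier M \<Longrightarrow> mip M x x = 0 \<Longrightarrow> x = mzero M"
    and ip_lact: "x \<in> mcarrier M \<Longrightarrow> y \<in> mcarrier M \<Longrightarrow>
          mip M (mlact M b x) y = mip M x (mlact M (star b) y)"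
    and complete: "s \<in> mCauchy M \<Longrightarrow> \<exists>l. mconv M s l"

definition regular_bimod :: "('b::unital_cstar_algebra, 'b) bimod" where
  "regular_bimod = \<lparr> mcarrier = UNIV, madd = (+), mzero = 0, mlact = (*), mract = (*),
     mip = (\<lambda>a b. star a * b) \<rparr>"

definition right_linear ::
  "('b, 'm) bimod \<Rightarrow> ('b, 'n) bimod \<Rightarrow> ('m \<Rightarrow> 'n) \<Rightarrow> bool" where
  "right_linear M N T \<longleftrightarrow> T \<in> mcarrier M \<rightarrow> mcarrier N \<and>
     (\<forall>x\<in>mcarrier M. \<forall>y\<in>mcarrier M. T (madd M x y) = madd N (T x) (T y)) \<and>
     (\<forall>x\<in>mcarrier M. \<forall>b. T (mract M x b) = mract N (T x) b)"

definition bimod_linear ::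
  "('b, 'm) bimod \<Rightarrow> ('b, 'n) bimod \<Rightarrow> ('m \<Rightarrow> 'n) \<Rightarrow> bool" where
  "bimod_linear M N T \<longleftrightarrow> right_linear M N T \<and>
     (\<forall>x\<in>mcarrier M. \<forall>b. T (mlact M b x) = mlact N b (T x))"

definition ip_preserving ::
  "('b, 'm) bimod \<Rightarrow> ('b, 'n) bimod \<Rightarrow> ('m \<Rightarrow> 'n) \<Rightarrow> bool" where
  "ip_preserving M N T \<longleftrightarrow> (\<forall>x\<in>mcarrier M. \<forall>y\<in>mcarrier M. mip N (T x) (T y) = mip M x y)"

definition bimod_unitary ::
  "('b, 'm) bimod \<Rightarrow> ('b, 'n) bimod \<Rightarrow> ('m \<Rightarrow> 'n) \<Rightarrow> bool" where
  "bimod_unitary M N T \<longleftrightarrow>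
     bimod_linear M N T \<and> ip_preserving M N T \<and> T ` mcarrier M = mcarrier N"

definition bounded_map ::
  "('b::unital_cstar_algebra, 'm) bimod \<Rightarrow> ('b, 'n) bimod \<Rightarrow> ('m \<Rightarrow> 'n) \<Rightarrow> bool" where
  "bounded_map M N T \<longleftrightarrow> (\<exists>C. \<forall>x\<in>mcarrier M. mnorm N (T x) \<le> C * mnorm M x)"

definition adjointable ::
  "('b, 'm) bimod \<Rightarrow> ('b, 'n) bimod \<Rightarrow> ('m \<Rightarrow> 'n) \<Rightarrow> bool" where
  "adjointable M N T \<longleftrightarrow> (\<exists>S. S \<in> mcarrier N \<rightarrow> mcarrier M \<and>
     (\<forall>x\<in>mcarrier M. \<forall>y\<in>mcarrier N. mip N (T x) y = mip M x (S y)))"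

definition bimod_morphism ::
  "('b::unital_cstar_algebra, 'm) bimod \<Rightarrow> ('b, 'n) bimod \<Rightarrow> ('m \<Rightarrow> 'n) \<Rightarrow> bool" where
  "bimod_morphism M N T \<longleftrightarrow> bimod_linear M N T \<and> bounded_map M N T \<and> adjointable M N T"

definition madjoint ::
  "('b, 'm) bimod \<Rightarrow> ('b, 'n) bimod \<Rightarrow> ('m \<Rightarrow> 'n) \<Rightarrow> 'n \<Rightarrow> 'm" where
  "madjoint M N T y =
     (THE z. z \<in> mcarrier M \<and> (\<forall>x\<in>mcarrier M. mip N (T x) y = mip M x z))"

definition mopnorm ::
  "('b::unital_cstar_algebra, 'm) bimod \<Rightarrow> ('b, 'n) bimod \<Rightarrow> ('m \<Rightarrow> 'n) \<Rightarrow> real" where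
  "mopnorm M N T = Sup {mnorm N (T x) | x. x \<in> mcarrier M \<and> mnorm M x \<le> 1}"

definition mcont_on ::
  "'p::topological_space set \<Rightarrow> ('b::unital_cstar_algebra, 'm) bimod \<Rightarrow> ('p \<Rightarrow> 'm) \<Rightarrow> bool" where
  "mcont_on S M f \<longleftrightarrow> (\<forall>p\<in>S. ((\<lambda>q. mdist M (f q) (f p)) \<longlongrightarrow> 0) (at p within S))"

definition mcont_map ::
  "('b::unital_cstar_algebra, 'm) bimod \<Rightarrow> ('b, 'n) bimod \<Rightarrow> ('m \<Rightarrow> 'n) \<Rightarrow> bool" where
  "mcont_map M N T \<longleftrightarrow> (\<forall>x\<in>mcarrier M. \<forall>e>0. \<exists>d>0. \<forall>y\<in>mcarrier M.
     mdist M y x < d \<longrightarrow> mdist N (T y) (T x) < e)"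

section \<open>Separation and completion of a semi-inner product bimodule\<close>

text \<open>\<open>x ~ y\<close> iff \<open>x - y\<close> lies in the null space \<open>{z. \<langle>z, z\<rangle> = 0}\<close>.\<close>

definition null_rel :: "('b::unital_cstar_algebra, 'm) bimod \<Rightarrow> ('m \<times> 'm) set" where
  "null_rel M = {(x, y). x \<in> mcarrier M \<and> y \<in> mcarrier M \<and>
     mip M (msub M x y) (msub M x y) = 0}"

definition quotient_bimod ::
  "('b::unital_cstar_algebra, 'm) bimod \<Rightarrow> ('b, 'm set) bimod" where
  "quotient_bimod M = \<lparr>
     mcarrier = mcarrier M // null_rel M,
     madd = (\<lambda>X Y. \<Union>x\<in>X. \<Union>y\<in>Y. null_rel M `` {madd M x y}),
     mzero = null_rel M `` {mzero M},
     mlact = (\<lambda>b X. \<Union>x\<in>X. null_rel M `` {mlact M b x}),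
     mract = (\<lambda>X b. \<Union>x\<in>X. null_rel M `` {mract M x b}),
     mip = (\<lambda>X Y. THE b. \<exists>x\<in>X. \<exists>y\<in>Y. b = mip M x y) \<rparr>"

definition cauchy_rel ::
  "('b::unital_cstar_algebra, 'm) bimod \<Rightarrow> ((nat \<Rightarrow> 'm) \<times> (nat \<Rightarrow> 'm)) set" where
  "cauchy_rel M = {(s, r). s \<in> mCauchy M \<and> r \<in> mCauchy M \<and>
     (\<lambda>n. mdist M (s n) (r n)) \<longlonglongrightarrow> 0}"

definition completion_bimod ::
  "('b::unital_cstar_algebra, 'm) bimod \<Rightarrow> ('b, (nat \<Rightarrow> 'm) set) bimod" where
  "completion_bimod M = \<lparr>
     mcarrier = mCauchy M // cauchy_rel M,
     madd = (\<lambda>X Y. \<Union>s\<in>X. \<Union>r\<in>Y. cauchy_rel M `` {\<lambda>n. madd M (s n) (r n)}),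
     mzero = cauchy_rel M `` {\<lambda>n. mzero M},
     mlact = (\<lambda>b X. \<Union>s\<in>X. cauchy_rel M `` {\<lambda>n. mlact M b (s n)}),
     mract = (\<lambda>X b. \<Union>s\<in>X. cauchy_rel M `` {\<lambda>n. mract M (s n) b}),
     mip = (\<lambda>X Y. THE b. \<exists>s\<in>X. \<exists>r\<in>Y. (\<lambda>n. mip M (s n) (r n)) \<longlonglongrightarrow> b) \<rparr>"

type_synonym 'm hcompl = "(nat \<Rightarrow> 'm set) set"

definition hcompletion ::
  "('b::unital_cstar_algebra, 'm) bimod \<Rightarrow> ('b, 'm hcompl) bimod" where
  "hcompletion M = completion_bimod (quotient_bimod M)"

definition hclass :: "('b::unital_cstar_algebra, 'm) bimod \<Rightarrow> 'm \<Rightarrow> 'm hcompl" where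
  "hclass M x = cauchy_rel (quotient_bimod M) `` {\<lambda>n. null_rel M `` {x}}"

definition is_cont_ext ::
  "('b::unital_cstar_algebra, 'm) bimod \<Rightarrow> ('b, 'n) bimod \<Rightarrow> ('m \<Rightarrow> 'n)
     \<Rightarrow> ('m hcompl \<Rightarrow> 'n hcompl) \<Rightarrow> bool" where
  "is_cont_ext M N f T \<longleftrightarrow>
     T \<in> mcarrier (hcompletion M) \<rightarrow>\<^sub>E mcarrier (hcompletion N) \<and>
     mcont_map (hcompletion M) (hcompletion N) T \<and>
     (\<forall>x\<in>mcarrier M. T (hclass M x) = hclass N (f x))"

definition cont_ext ::
  "('b::unital_cstar_algebra, 'm) bimod \<Rightarrow> ('b, 'n) bimod \<Rightarrow> ('m \<Rightarrow> 'n)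
     \<Rightarrow> 'm hcompl \<Rightarrow> 'n hcompl" where
  "cont_ext M N f = (THE T. is_cont_ext M N f T)"

section \<open>Inner tensor product\<close>

text \<open>A list of pairs stands for the formal sum of the corresponding elementary tensors. The
  relations of the algebraic tensor product over the algebra need not be imposed separately, since
  they hold modulo the null space of the semi-inner product.\<close>

definition pre_tensor ::
  "('b::unital_cstar_algebra, 'm) bimod \<Rightarrow> ('b, 'n) bimod \<Rightarrow> ('b, ('m \<times> 'n) list) bimod" where
  "pre_tensor M N = \<lparr>
     mcarrier = lists (mcarrier M \<times> mcarrier N),
     madd = (@),
     mzero = [],
     mlact = (\<lambda>b. map (\<lambda>(x, y). (mlact M b x, y))),
     mract = (\<lambda>p b. map (\<lambda>(x, y). (x, mract N y b)) p),
     mip = (\<lambda>p q. \<Sum>(x, y)\<leftarrow>p. \<Sum>(x', y')\<leftarrow>q. mip N y (mlact N (mip M x x') y')) \<rparr>"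

definition tensor ::
  "('b::unital_cstar_algebra, 'm) bimod \<Rightarrow> ('b, 'n) bimod \<Rightarrow> ('b, ('m \<times> 'n) list hcompl) bimod" where
  "tensor M N = hcompletion (pre_tensor M N)"

definition elem_tensor ::
  "('b::unital_cstar_algebra, 'm) bimod \<Rightarrow> ('b, 'n) bimod \<Rightarrow> 'm \<Rightarrow> 'n \<Rightarrow> ('m \<times> 'n) list hcompl" where
  "elem_tensor M N x y = hclass (pre_tensor M N) [(x, y)]"

section \<open>Product systems and units\<close>

text \<open>\<open>alg_iso\<close> is the identification of the algebra with the fibre at 0, \<open>mult_iso t s\<close> is the
  unitary \<open>\<phi>\<^sub>t\<^sub>,\<^sub>s\<close>. Fibres at negative parameters are irrelevant.\<close>

record ('b, 'e) psys =
  fib :: "real \<Rightarrow> ('b, 'e) bimod"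
  alg_iso :: "'b \<Rightarrow> 'e"
  mult_iso :: "real \<Rightarrow> real \<Rightarrow> ('e \<times> 'e) list hcompl \<Rightarrow> 'e"

text \<open>The element \<open>x \<otimes> y\<close> after identifying the tensor product of the fibres at \<open>t\<close> and \<open>s\<close> with the
  fibre at \<open>t + s\<close>.\<close>

definition ptens ::
  "('b::unital_cstar_algebra, 'e, 'z) psys_scheme \<Rightarrow> real \<Rightarrow> real \<Rightarrow> 'e \<Rightarrow> 'e \<Rightarrow> 'e" where
  "ptens E t s x y = mult_iso E t s (elem_tensor (fib E t) (fib E s) x y)"

text \<open>The last two axioms make the identifications of the algebra with the fibre at 0 and of the
  tensor products with fibres compatible. They follow from the others as soon as a unit exists.\<close>

locale product_system =
  fixes E :: "('b::unital_cstar_algebra, 'e, 'z) psys_scheme"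
  assumes fibre: "t \<ge> 0 \<Longrightarrow> hilbert_bimodule (fib E t)"
    and alg_iso: "bimod_unitary regular_bimod (fib E 0) (alg_iso E)"
    and mult_iso: "t \<ge> 0 \<Longrightarrow> s \<ge> 0 \<Longrightarrow>
          bimod_unitary (tensor (fib E t) (fib E s)) (fib E (t + s)) (mult_iso E t s)"
    and assoc: "t \<ge> 0 \<Longrightarrow> s \<ge> 0 \<Longrightarrow> r \<ge> 0 \<Longrightarrow>
          x \<in> mcarrier (fib E t) \<Longrightarrow> y \<in> mcarrier (fib E s) \<Longrightarrow> z \<in> mcarrier (fib E r) \<Longrightarrow>
          ptens E (t + s) r (ptens E t s x y) z = ptens E t (s + r) x (ptens E s r y z)"
    and alg_left: "t \<ge> 0 \<Longrightarrow> x \<in> mcarrier (fib E t) \<Longrightarrow>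
          ptens E 0 t (alg_iso E b) x = mlact (fib E t) b x"
    and alg_right: "t \<ge> 0 \<Longrightarrow> x \<in> mcarrier (fib E t) \<Longrightarrow>
          ptens E t 0 x (alg_iso E b) = mract (fib E t) x b"

definition is_unit ::
  "('b::unital_cstar_algebra, 'e, 'z) psys_scheme \<Rightarrow> (real \<Rightarrow> 'e) \<Rightarrow> bool" where
  "is_unit E u \<longleftrightarrow> u \<in> (\<Pi>\<^sub>E t\<in>{0..}. mcarrier (fib E t)) \<and> u 0 = alg_iso E 1 \<and>
     (\<forall>t\<ge>0. \<forall>s\<ge>0. ptens E t s (u t) (u s) = u (t + s))"

definition kernel ::
  "('b::unital_cstar_algebra, 'e, 'z) psys_scheme \<Rightarrow> (real \<Rightarrow> 'e) \<Rightarrow> (real \<Rightarrow> 'e) \<Rightarrow> real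
     \<Rightarrow> 'b \<Rightarrow>\<^sub>L 'b" where
  "kernel E u v t = Blinfun (\<lambda>b. mip (fib E t) (u t) (mlact (fib E t) b (v t)))"

definition continuous_units ::
  "('b::unital_cstar_algebra, 'e, 'z) psys_scheme \<Rightarrow> (real \<Rightarrow> 'e) set \<Rightarrow> bool" where
  "continuous_units E S \<longleftrightarrow> (\<forall>u\<in>S. is_unit E u) \<and>
     (\<forall>u\<in>S. \<forall>v\<in>S. continuous_on {0..} (kernel E u v))"

definition generator ::
  "('b::unital_cstar_algebra, 'e, 'z) psys_scheme \<Rightarrow> (real \<Rightarrow> 'e) \<Rightarrow> (real \<Rightarrow> 'e) \<Rightarrow> 'b \<Rightarrow>\<^sub>L 'b" where
  "generator E u v = vector_derivative (kernel E u v) (at 0 within {0..})"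

definition units_cont_with ::
  "('b::unital_cstar_algebra, 'e, 'z) psys_scheme \<Rightarrow> (real \<Rightarrow> 'e) \<Rightarrow> (real \<Rightarrow> 'e) set" where
  "units_cont_with E \<omega> = {x. continuous_units E {x} \<and> continuous_units E {x, \<omega>}}"

section \<open>The module of units and the index\<close>

text \<open>\<open>tpow E s z m\<close> is the \<open>m\<close>-fold tensor power of \<open>z\<close>, where \<open>z\<close> lies in the fibre at \<open>s\<close>; it lies
  in the fibre at \<open>m s\<close>.\<close>

primrec tpow ::
  "('b::unital_cstar_algebra, 'e, 'z) psys_scheme \<Rightarrow> real \<Rightarrow> 'e \<Rightarrow> nat \<Rightarrow> 'e" where
  "tpow E s z 0 = alg_iso E 1"
| "tpow E s z (Suc m) = ptens E (real m * s) s (tpow E s z m) z"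

definition trotter_limit ::
  "('b::unital_cstar_algebra, 'e, 'z) psys_scheme \<Rightarrow> (real \<Rightarrow> 'e) \<Rightarrow> real \<Rightarrow> 'e" where
  "trotter_limit E z = (\<lambda>t\<in>{0..}. mlim (fib E t) (\<lambda>m. tpow E (t / real m) (z (t / real m)) m))"

text \<open>\<open>lbox E [(k\<^sub>1, x\<^sub>1), \<dots>, (k\<^sub>n, x\<^sub>n)]\<close> is \<open>k\<^sub>1x\<^sub>1 \<boxplus> \<dots> \<boxplus> k\<^sub>nx\<^sub>n\<close>, and \<open>rbox\<close> is the version with
  coefficients on the right.\<close>

definition lbox ::
  "('b::unital_cstar_algebra, 'e, 'z) psys_scheme \<Rightarrow> ('b \<times> (real \<Rightarrow> 'e)) list \<Rightarrow> real \<Rightarrow> 'e" where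
  "lbox E ps =
     trotter_limit E (\<lambda>s. msum (fib E s) (map (\<lambda>(k, x). mlact (fib E s) k (x s)) ps))"

definition rbox ::
  "('b::unital_cstar_algebra, 'e, 'z) psys_scheme \<Rightarrow> ((real \<Rightarrow> 'e) \<times> 'b) list \<Rightarrow> real \<Rightarrow> 'e" where
  "rbox E ps =
     trotter_limit E (\<lambda>s. msum (fib E s) (map (\<lambda>(x, k). mract (fib E s) (x s) k) ps))"

definition unit_bimod ::
  "('b::unital_cstar_algebra, 'e, 'z) psys_scheme \<Rightarrow> (real \<Rightarrow> 'e) \<Rightarrow> ('b, real \<Rightarrow> 'e) bimod" where
  "unit_bimod E \<omega> = \<lparr>
     mcarrier = units_cont_with E \<omega>,
     madd = (\<lambda>x y. lbox E [(1, x), (1, y), (- 1, \<omega>)]),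
     mzero = \<omega>,
     mlact = (\<lambda>b x. lbox E [(b, x), (1 - b, \<omega>)]),
     mract = (\<lambda>x b. rbox E [(x, b), (\<omega>, 1 - b)]),
     mip = (\<lambda>x y. blinfun_apply
        (generator E x y - generator E x \<omega> - generator E \<omega> y + generator E \<omega> \<omega>) 1) \<rparr>"

definition ind ::
  "('b::unital_cstar_algebra, 'e, 'z) psys_scheme \<Rightarrow> (real \<Rightarrow> 'e)
     \<Rightarrow> ('b, (real \<Rightarrow> 'e) hcompl) bimod" where
  "ind E \<omega> = hcompletion (unit_bimod E \<omega>)"

text \<open>The canonical isomorphism from \<open>ind E \<omega>\<close> to \<open>ind E \<omega>'\<close>, induced by \<open>x \<mapsto> x \<boxplus> (-\<omega>) \<boxplus> \<omega>'\<close>.\<close>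

definition ind_base_change ::
  "('b::unital_cstar_algebra, 'e, 'z) psys_scheme \<Rightarrow> (real \<Rightarrow> 'e) \<Rightarrow> (real \<Rightarrow> 'e)
     \<Rightarrow> (real \<Rightarrow> 'e) hcompl \<Rightarrow> (real \<Rightarrow> 'e) hcompl" where
  "ind_base_change E \<omega> \<omega>' =
     cont_ext (unit_bimod E \<omega>) (unit_bimod E \<omega>') (\<lambda>x. lbox E [(1, x), (- 1, \<omega>), (1, \<omega>')])"

section \<open>Continuous product systems and their morphisms\<close>

record ('b, 'e, 'h) cpsys = "('b, 'e) psys" +
  amb :: "('b, 'h) bimod"
  emb :: "real \<Rightarrow> 'e \<Rightarrow> 'h"

definition cont_sections :: "('b::unital_cstar_algebra, 'e, 'h) cpsys \<Rightarrow> (real \<Rightarrow> 'e) set" where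
  "cont_sections E = {x. x \<in> (\<Pi>\<^sub>E t\<in>{0..}. mcarrier (fib E t)) \<and>
     mcont_on {0..} (amb E) (\<lambda>t. emb E t (x t))}"

definition base_units :: "('b::unital_cstar_algebra, 'e, 'h) cpsys \<Rightarrow> (real \<Rightarrow> 'e) set" where
  "base_units E = {u \<in> cont_sections E. continuous_units E {u}}"

text \<open>An isometric embedding preserves the algebra-valued inner product (and is right linear);
  compatibility with the left actions is not required.\<close>

locale continuous_product_system = product_system E
  for E :: "('b::unital_cstar_algebra, 'e, 'h) cpsys" +
  assumes amb: "hilbert_bimodule (amb E)"
    and emb: "t \<ge> 0 \<Longrightarrow> right_linear (fib E t) (amb E) (emb E t) \<and>
          ip_preserving (fib E t) (amb E) (emb E t)"
    and section_through: "s \<ge> 0 \<Longrightarrow> y \<in> mcarrier (fib E s) \<Longrightarrow> \<exists>x\<in>cont_sections E. x s = y"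
    and tensor_cont: "x \<in> cont_sections E \<Longrightarrow> x' \<in> cont_sections E \<Longrightarrow>
          mcont_on ({0..} \<times> {0..}) (amb E) (\<lambda>(s, t). emb E (s + t) (ptens E s t (x s) (x' t)))"
    and base_unit: "base_units E \<noteq> {}"

definition family_map :: "(real \<Rightarrow> 'e \<Rightarrow> 'f) \<Rightarrow> (real \<Rightarrow> 'e) \<Rightarrow> real \<Rightarrow> 'f" where
  "family_map \<theta> x = (\<lambda>t\<in>{0..}. \<theta> t (x t))"

text \<open>\<open>\<theta>\<^sub>t\<^sub>+\<^sub>s = \<theta>\<^sub>t \<otimes> \<theta>\<^sub>s\<close> is stated on elementary tensors, which determine the bounded linear map
  \<open>\<theta>\<^sub>t \<otimes> \<theta>\<^sub>s\<close>.\<close>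

definition cps_morphism ::
  "('b::unital_cstar_algebra, 'e, 'h) cpsys \<Rightarrow> ('b, 'f, 'k) cpsys \<Rightarrow> (real \<Rightarrow> 'e \<Rightarrow> 'f) \<Rightarrow> bool" where
  "cps_morphism E F \<theta> \<longleftrightarrow>
     (\<forall>t\<ge>0. bimod_morphism (fib E t) (fib F t) (\<theta> t)) \<and>
     (\<forall>t\<ge>0. \<forall>s\<ge>0. \<forall>x\<in>mcarrier (fib E t). \<forall>y\<in>mcarrier (fib E s).
        \<theta> (t + s) (ptens E t s x y) = ptens F t s (\<theta> t x) (\<theta> s y)) \<and>
     (\<forall>b. \<theta> 0 (alg_iso E b) = alg_iso F b) \<and>
     (\<forall>x\<in>cont_sections E. family_map \<theta> x \<in> cont_sections F) \<and>
     (\<forall>y\<in>cont_sections F.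
        family_map (\<lambda>t. madjoint (fib E t) (fib F t) (\<theta> t)) y \<in> cont_sections E) \<and>
     Limsup (at_right 0) (\<lambda>t. ereal (mopnorm (fib E t) (fib F t) (\<theta> t))) < \<infinity>"

definition ind_map ::
  "('b::unital_cstar_algebra, 'e, 'h) cpsys \<Rightarrow> ('b, 'f, 'k) cpsys \<Rightarrow> (real \<Rightarrow> 'e)
     \<Rightarrow> (real \<Rightarrow> 'e \<Rightarrow> 'f) \<Rightarrow> (real \<Rightarrow> 'e) hcompl \<Rightarrow> (real \<Rightarrow> 'f) hcompl" where
  "ind_map E F \<omega> \<theta> =
     cont_ext (unit_bimod E \<omega>) (unit_bimod F (family_map \<theta> \<omega>)) (family_map \<theta>)"

end

theory Submission
  imports Defs
begin

text \<open>The units \<open>x\<close> that are continuous together with a continuous unit \<open>\<omega>\<close> are exactly those with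
  \<open>x\<^sub>r - \<omega>\<^sub>r \<rightarrow> 0\<close> as \<open>r \<rightarrow> 0\<close>, and the semi-inner product of the index is the limit of
  \<open>\<langle>x\<^sub>r - \<omega>\<^sub>r, y\<^sub>r - \<omega>\<^sub>r\<rangle> / r\<close>. Since \<open>\<parallel>\<theta>\<^sub>r\<parallel>\<close> is bounded near \<open>0\<close>, a morphism \<open>\<theta>\<close> is therefore
  Lipschitz on units. An affine combination of units is a limit of tensor products over ever finer
  partitions: the operator \<open>b \<mapsto> \<langle>u, b v\<rangle>\<close> of two such products is a product of operators with a common
  first-order expansion \<open>1 + r L + o(r)\<close>, hence close to \<open>exp (t L)\<close>. As \<open>\<theta>\<close> is additive and
  multiplicative it commutes with these limits, so it induces a bimodule map. The adjoint of the
  induced map comes in the same way from \<open>\<theta>\<^sup>*\<close>, followed by a change of the base unit from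
  \<open>\<theta>\<^sup>*\<theta>\<omega>\<close> back to \<open>\<omega>\<close>.\<close>

section \<open>Positivity in unital C*-algebras\<close>

text \<open>Positivity only means being of the form \<open>star b * b\<close>; that sums and limits
  keep this form must be proved first, and Cauchy-Schwarz, the tensor product and the index rest on
  it. Neither formal sums of tensors nor units obey the module laws literally, hence
  \<open>semi_bimod\<close> states these laws inside the inner product, and separation turns them
  into equations. The limits behind affine combinations are controlled over all partitions, not only
  equidistant ones: partitions of [0, t] and [0, s] concatenate, which gives multiplicativity, and
  two partitions have a common refinement, which gives convergence. The bound on \<theta> near 0
  controls difference quotients, whereas commuting with a limit at fixed t rests on boundedness of
  the single map \<open>\<theta> t\<close>. Continuous sections enter through one fact: two of them
  with the same value at 0 are close near 0. It places the adjoint of \<theta>, applied to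
  \<theta>\<omega>, next to \<omega>, from which continuity of \<theta>\<omega> follows, and it
  makes any two base units comparable.\<close>

lemma star_zero [simp]: "star (0::'b::unital_cstar_algebra) = 0"
  using star_add[of "0::'b" 0] by simp

lemma star_minus: "star (- x :: 'b::unital_cstar_algebra) = - star x"
proof -
  have "star x + star (- x) = 0"
    by (metis star_add star_zero add.right_inverse)
  then show ?thesis
    by (metis minus_unique)
qed

lemma star_diff: "star (x - y :: 'b::unital_cstar_algebra) = star x - star y"
  using star_add[of x "- y"] by (simp add: star_minus)

lemma star_one [simp]: "star (1::'b::unital_cstar_algebra) = 1"
  by (metis mult.right_neutral star_mult star_star)

lemma star_scaleR: "star (r *\<^sub>R x :: 'b::unital_cstar_algebra) = r *\<^sub>R star x"
  by (simp add: scaleR_scaleC star_scaleC)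

lemma scaleC_one: "scaleC 1 x = (x :: 'b::unital_cstar_algebra)"
  using scaleR_scaleC[of 1 x] by simp

lemma scaleC_zero_left: "scaleC 0 x = (0 :: 'b::unital_cstar_algebra)"
  using scaleR_scaleC[of 0 x] by simp

lemma scaleC_minus_left: "scaleC (- c) x = - scaleC c (x :: 'b::unital_cstar_algebra)"
proof -
  have "scaleC c x + scaleC (- c) x = 0"
    using scaleC_add_left[of c "- c" x] by (simp add: scaleC_zero_left)
  then show ?thesis by (simp add: add_eq_0_iff)
qed

lemma scaleC_diff_right:
  "scaleC c (x - y) = scaleC c x - scaleC c (y :: 'b::unital_cstar_algebra)"
  using scaleC_add_right[of c "x - y" y] by (simp add: eq_diff_eq)

text \<open>The C*-identity bounds the square of norm x by the product of the norms of
  \<open>star x\<close> and x; cancelling, and repeating the argument with \<open>star x\<close>,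
  gives both inequalities.\<close>

lemma norm_star [simp]: "norm (star x :: 'b::unital_cstar_algebra) = norm x"
proof -
  have *: "norm x \<le> norm (star x)" for x :: 'b
  proof (cases "norm x = 0")
    case False
    have "norm x * norm x \<le> norm (star x) * norm x"
      using norm_star_mult_self[of x] norm_mult_ineq[of "star x" x]
      by (simp add: power2_eq_square)
    with False show ?thesis
      by (metis mult_right_le_imp_le norm_ge_zero order_le_less)
  qed simp
  show ?thesis
    using *[of x] *[of "star x"] by (simp add: star_star)
qed

lemma norm_one_cstar_le: "norm (1::'b::unital_cstar_algebra) \<le> 1"
proof -
  have "norm (1::'b) = (norm (1::'b))\<^sup>2"
    using norm_star_mult_self[of "1::'b"] by simp
  then show ?thesis
    by (metis less_eq_real_def mult_cancel_left1 order_refl power2_eq_square zero_le_one)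
qed

lemma norm_selfadjoint_square:
  "star h = h \<Longrightarrow> norm (h * h :: 'b::unital_cstar_algebra) = (norm h)\<^sup>2"
  using norm_star_mult_self[of h] by simp

lemma selfadjoint_square_eq_0: "star h = h \<Longrightarrow> h * h = 0 \<Longrightarrow> (h :: 'b::unital_cstar_algebra) = 0"
  using norm_selfadjoint_square[of h] by simp

lemma bounded_linear_star: "bounded_linear (star :: 'b::unital_cstar_algebra \<Rightarrow> 'b)"
  by (rule bounded_linear_intro[where K = 1]) (auto simp: star_add star_scaleR)

lemmas tendsto_star [tendsto_intros] = bounded_linear.tendsto[OF bounded_linear_star]

section \<open>Square roots by a fixed point iteration\<close>

primrec sqrt_iter :: "'a::real_algebra \<Rightarrow> nat \<Rightarrow> 'a" where
  "sqrt_iter a 0 = 0"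
| "sqrt_iter a (Suc n) = (1 / 2) *\<^sub>R (a + sqrt_iter a n * sqrt_iter a n)"

lemma sqrt_iter_commute: "c * a = a * c \<Longrightarrow> c * sqrt_iter a n = sqrt_iter a n * c"
proof (induction n)
  case (Suc n)
  then have "c * (sqrt_iter a n * sqrt_iter a n) = (sqrt_iter a n * sqrt_iter a n) * c"
    by (metis mult.assoc)
  with Suc show ?case
    by (simp add: distrib_left distrib_right)
qed simp

lemma star_sqrt_iter:
  "star a = a \<Longrightarrow> star (sqrt_iter a n) = (sqrt_iter a n :: 'b::unital_cstar_algebra)"
  by (induction n) (simp_all add: star_scaleR star_add star_mult)

lemma sqrt_iter_one: "0 \<le> sqrt_iter (1::real) n" "sqrt_iter (1::real) n \<le> 1"
proof -
  show "0 \<le> sqrt_iter (1::real) n" by (cases n) auto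
  show "sqrt_iter (1::real) n \<le> 1"
  proof (induction n)
    case (Suc n)
    have "0 \<le> sqrt_iter (1::real) n" by (cases n) auto
    then have "sqrt_iter (1::real) n * sqrt_iter 1 n \<le> 1 * 1"
      using Suc by (intro mult_mono) auto
    then show ?case by simp
  qed simp
qed

text \<open>The iterates are polynomials in a with nonnegative coefficients, so the scalar iteration
  with parameter 1 majorises them.\<close>

lemma norm_sqrt_iter:
  fixes a :: "'b::unital_cstar_algebra"
  assumes "norm a \<le> 1"
  shows "norm (sqrt_iter a n) \<le> sqrt_iter 1 n"
proof (induction n)
  case (Suc n)
  have "norm (sqrt_iter a (Suc n)) \<le> (1/2) * (norm a + norm (sqrt_iter a n * sqrt_iter a n))"
    using norm_triangle_ineq[of a "sqrt_iter a n * sqrt_iter a n"] by simp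
  also have "norm (sqrt_iter a n * sqrt_iter a n) \<le> sqrt_iter 1 n * sqrt_iter 1 n"
    by (rule order_trans[OF norm_mult_ineq]) (intro mult_mono Suc, auto simp: sqrt_iter_one)
  finally show ?case using assms by (simp add: field_simps)
qed simp

text \<open>Iterates commute, so x x - y y = (x - y)(x + y) for consecutive ones, and the scalar
  increments majorise those in the algebra. This replaces a contraction estimate: the map y -> (a +
  y y) / 2 need not be a strict contraction on the unit ball.\<close>

lemma norm_sqrt_iter_diff:
  fixes a :: "'b::unital_cstar_algebra"
  assumes "norm a \<le> 1"
  shows "norm (sqrt_iter a (Suc n) - sqrt_iter a n) \<le> sqrt_iter 1 (Suc n) - sqrt_iter 1 n"
proof (induction n)
  case 0
  show ?case using assms by simp
next
  case (Suc n)
  define x y where "x = sqrt_iter a (Suc n)" and "y = sqrt_iter a n"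
  define s t where "s = sqrt_iter (1::real) (Suc n)" and "t = sqrt_iter (1::real) n"
  have xy: "x * y = y * x"
    unfolding x_def y_def by (intro sqrt_iter_commute sqrt_iter_commute[symmetric] refl)
  have "sqrt_iter a (Suc (Suc n)) - sqrt_iter a (Suc n) = (1/2) *\<^sub>R (x * x - y * y)"
    unfolding x_def y_def sqrt_iter.simps(2)[of a "Suc n"]
    by (subst (3) sqrt_iter.simps(2)) (simp add: algebra_simps)
  also have "x * x - y * y = (x - y) * (x + y)"
    using xy by (simp add: algebra_simps)
  finally have "norm (sqrt_iter a (Suc (Suc n)) - sqrt_iter a (Suc n)) = norm ((x - y) * (x + y)) / 2"
    by simp
  also have "\<dots> \<le> norm (x - y) * norm (x + y) / 2"
    using norm_mult_ineq[of "x - y" "x + y"] by simp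
  also have "\<dots> \<le> (s - t) * (s + t) / 2"
  proof -
    have "norm (x + y) \<le> s + t"
      unfolding x_def y_def s_def t_def
      by (rule norm_triangle_le) (intro add_mono norm_sqrt_iter assms)
    moreover have "norm (x - y) \<le> s - t"
      using Suc unfolding x_def y_def s_def t_def .
    moreover from this have "t \<le> s"
      using norm_ge_zero[of "x - y"] by linarith
    ultimately show ?thesis
      by (intro divide_right_mono mult_mono) auto
  qed
  also have "\<dots> = sqrt_iter 1 (Suc (Suc n)) - sqrt_iter 1 (Suc n)"
  proof -
    have "2 * s = 1 + t * t"
      unfolding s_def t_def by simp
    moreover have "sqrt_iter 1 (Suc (Suc n)) = (1 + s * s) / 2"
      unfolding s_def using sqrt_iter.simps(2)[of "1::real" "Suc n"] by simp
    ultimately show ?thesis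
      unfolding s_def[symmetric] by (simp add: field_simps)
  qed
  finally show ?case .
qed

text \<open>A fixed point of y -> (a + y y) / 2 satisfies (1 - y)(1 - y) = 1 - a. As a limit of
  polynomials in a it inherits self-adjointness, the norm bound and commutation with whatever
  commutes with a.\<close>

lemma ex_sqrt_one_minus:
  fixes a :: "'b::unital_cstar_algebra"
  assumes a: "star a = a" "norm a \<le> 1"
  obtains y where "star y = y" "norm y \<le> 1" "(1 - y) * (1 - y) = 1 - a"
    "\<And>c. c * a = a * c \<Longrightarrow> c * y = y * c"
proof -
  have inc: "incseq (sqrt_iter (1::real))"
  proof (rule incseq_SucI)
    \<comment> \<open>The scalar increments are nonnegative because they dominate a norm.\<close>
    fix n show "sqrt_iter (1::real) n \<le> sqrt_iter 1 (Suc n)"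
      using norm_sqrt_iter_diff[OF a(2), of n] norm_ge_zero[of "sqrt_iter a (Suc n) - sqrt_iter a n"]
      by linarith
  qed
  have "convergent (sqrt_iter (1::real))"
    by (rule incseq_convergent[OF inc, of 1]) (auto simp: sqrt_iter_one convergent_def)
  then obtain l where "sqrt_iter (1::real) \<longlonglongrightarrow> l"
    unfolding convergent_def by blast
  then have "summable (\<lambda>n. sqrt_iter (1::real) (Suc n) - sqrt_iter 1 n)"
    by (rule telescope_summable)
  then have "summable (\<lambda>n. sqrt_iter a (Suc n) - sqrt_iter a n)"
    by (rule summable_comparison_test'[where N = 0]) (rule norm_sqrt_iter_diff[OF a(2)])
  then have "convergent (\<lambda>n. \<Sum>k<n. sqrt_iter a (Suc k) - sqrt_iter a k)"
    by (simp add: summable_iff_convergent)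
  then have "convergent (sqrt_iter a)"
    unfolding sum_lessThan_telescope by simp
  then obtain y where y: "sqrt_iter a \<longlonglongrightarrow> y"
    unfolding convergent_def by blast
  have "(\<lambda>n. sqrt_iter a (Suc n)) \<longlonglongrightarrow> (1/2) *\<^sub>R (a + y * y)"
    unfolding sqrt_iter.simps by (intro tendsto_intros y)
  then have fixpt: "y = (1/2) *\<^sub>R (a + y * y)"
    by (rule LIMSEQ_unique[OF LIMSEQ_Suc[OF y]])
  have twice: "y + y = a + y * y"
    using arg_cong[OF fixpt, of "\<lambda>z. 2 *\<^sub>R z"] by (simp add: scaleR_2)
  show thesis
  proof (rule that)
    have "(\<lambda>n. star (sqrt_iter a n)) \<longlonglongrightarrow> star y"
      by (intro tendsto_intros y)
    then show "star y = y"
      using y LIMSEQ_unique by (simp add: star_sqrt_iter[OF a(1)]) blast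
    have "norm (sqrt_iter a n) \<le> 1" for n
      using norm_sqrt_iter[OF a(2), of n] sqrt_iter_one(2)[of n] by linarith
    then show "norm y \<le> 1"
      by (intro LIMSEQ_le_const2[OF tendsto_norm[OF y]]) blast
    show "(1 - y) * (1 - y) = 1 - a"
      using twice by (simp add: algebra_simps)
    fix c assume c: "c * a = a * c"
    have "(\<lambda>n. c * sqrt_iter a n) \<longlonglongrightarrow> c * y" "(\<lambda>n. sqrt_iter a n * c) \<longlonglongrightarrow> y * c"
      by (intro tendsto_intros y)+
    then show "c * y = y * c"
      using LIMSEQ_unique by (simp add: sqrt_iter_commute[OF c]) blast
  qed
qed

text \<open>\<open>h + i s\<close> is a multiple of a unitary.\<close>

lemma norm_le_if_square_sum:
  fixes h s :: "'b::unital_cstar_algebra"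
  assumes "star h = h" "star s = s" "h * s = s * h" "h * h + s * s = t *\<^sub>R 1" "0 \<le> t"
  shows "(norm h)\<^sup>2 \<le> t"
proof -
  define u where "u = h + scaleC \<i> s"
  have su: "star u = h + scaleC (- \<i>) s"
    unfolding u_def by (simp add: star_add star_scaleC assms)
  have ss: "scaleC (- \<i>) (scaleC \<i> (s * s)) = s * s" "scaleC \<i> (scaleC (- \<i>) (s * s)) = s * s"
    by (simp_all add: scaleC_scaleC scaleC_one)
  have neg: "scaleC (- \<i>) x + scaleC \<i> x = 0" for x :: 'b
    by (simp add: scaleC_minus_left)
  have "star u * u = h * h + (scaleC (- \<i>) (h * s) + scaleC \<i> (h * s)) + s * s"
    unfolding su unfolding u_def
    by (simp add: distrib_left distrib_right mult_scaleC_left mult_scaleC_right ss assms(3)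
        add_ac scaleC_add_right)
  then have "star u * u = t *\<^sub>R 1"
    using neg assms(4) by simp
  then have "(norm u)\<^sup>2 \<le> t"
    using norm_star_mult_self[of u] norm_one_cstar_le[where 'b = 'b] \<open>0 \<le> t\<close>
    by (metis abs_of_nonneg mult_left_le norm_scaleR)
  moreover have "2 *\<^sub>R h = u + star u"
    unfolding su unfolding u_def using neg[of s] by (simp add: scaleR_2 algebra_simps)
  then have "2 * norm h \<le> norm u + norm u"
    by (metis norm_triangle_ineq norm_star norm_scaleR abs_numeral)
  then have "norm h \<le> norm u" by simp
  ultimately show ?thesis
    by (meson norm_ge_zero order_trans power_mono)
qed

text \<open>Writing p = t (1 - a) reduces to the root of 1 - a. The condition
  \<open>norm (t *\<^sub>R 1 - p) \<le> t\<close> plays the role of nonnegative spectrum; the root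
  satisfies it with \<open>sqrt t\<close>, so it is positive itself.\<close>

lemma ex_sqrt_cstar:
  fixes p :: "'b::unital_cstar_algebra"
  assumes "star p = p" "norm (t *\<^sub>R 1 - p) \<le> t"
  obtains h where "star h = h" "h * h = p" "norm (sqrt t *\<^sub>R 1 - h) \<le> sqrt t"
    "\<And>c. c * p = p * c \<Longrightarrow> c * h = h * c"
proof (cases "t = 0")
  case True
  with assms have "p = 0" by simp
  with True show thesis by (intro that[of 0]) auto
next
  case False
  have "0 \<le> t" using assms(2) norm_ge_zero order_trans by blast
  with False have t: "0 < t" by simp
  define a where "a = 1 - (1/t) *\<^sub>R p"
  have "norm a = norm ((1/t) *\<^sub>R (t *\<^sub>R 1 - p))"
    unfolding a_def using t by (simp add: scaleR_diff_right)
  also have "\<dots> \<le> 1" using assms(2) t by simp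
  finally have a: "norm a \<le> 1" "star a = a"
    unfolding a_def by (auto simp: star_diff star_scaleR assms(1))
  obtain y where y: "star y = y" "norm y \<le> 1" "(1 - y) * (1 - y) = 1 - a"
    "\<And>c. c * a = a * c \<Longrightarrow> c * y = y * c"
    using ex_sqrt_one_minus[OF a(2,1)] by blast
  show thesis
  proof (rule that[of "sqrt t *\<^sub>R (1 - y)"])
    show "star (sqrt t *\<^sub>R (1 - y)) = sqrt t *\<^sub>R (1 - y)"
      by (simp add: star_scaleR star_diff y)
    have "sqrt t *\<^sub>R (1 - y) * sqrt t *\<^sub>R (1 - y) = t *\<^sub>R ((1 - y) * (1 - y))"
      using t by simp
    then show "sqrt t *\<^sub>R (1 - y) * sqrt t *\<^sub>R (1 - y) = p"
      unfolding y(3) a_def using t by simp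
    have "norm (sqrt t *\<^sub>R 1 - sqrt t *\<^sub>R (1 - y)) = sqrt t * norm y"
      using t by (simp add: scaleR_diff_right)
    then show "norm (sqrt t *\<^sub>R 1 - sqrt t *\<^sub>R (1 - y)) \<le> sqrt t"
      using y(2) t by (simp add: mult_left_le)
    fix c assume "c * p = p * c"
    then have "c * a = a * c" unfolding a_def by (simp add: algebra_simps)
    then have "c * y = y * c" by (rule y(4))
    then show "c * sqrt t *\<^sub>R (1 - y) = sqrt t *\<^sub>R (1 - y) * c"
      by (simp add: algebra_simps)
  qed
qed

text \<open>The bound on h makes \<open>t *\<^sub>R 1 - h * h\<close> eligible for a root s. Then h
  and s commute and their squares add up to t, which bounds s. Squares thus meet the very condition
  under which roots exist.\<close>

lemma norm_diff_selfadjoint_square: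
  fixes h :: "'b::unital_cstar_algebra"
  assumes h: "star h = h" and t: "(norm h)\<^sup>2 \<le> t"
  shows "norm (t *\<^sub>R 1 - h * h) \<le> t"
proof -
  have t0: "0 \<le> t" using t zero_le_power2 order_trans by blast
  have "norm (t *\<^sub>R 1 - (t *\<^sub>R 1 - h * h)) \<le> t"
    using t by (simp add: norm_selfadjoint_square[OF h])
  moreover have "star (t *\<^sub>R 1 - h * h) = t *\<^sub>R 1 - h * h"
    by (simp add: star_diff star_scaleR star_mult h)
  ultimately obtain s where s: "star s = s" "s * s = t *\<^sub>R 1 - h * h"
    "\<And>c. c * (t *\<^sub>R 1 - h * h) = (t *\<^sub>R 1 - h * h) * c \<Longrightarrow> c * s = s * c"
    using ex_sqrt_cstar by blast
  have "h * s = s * h"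
    by (rule s(3)) (simp add: algebra_simps)
  then have "(norm s)\<^sup>2 \<le> t"
    using s(1,2) t0 h by (intro norm_le_if_square_sum[of s h]) auto
  then show ?thesis
    using norm_selfadjoint_square[OF s(1)] s(2) by simp
qed

section \<open>Positive elements as squares of self-adjoint elements\<close>

definition selfadjoint_square :: "'b::unital_cstar_algebra \<Rightarrow> bool" where
  "selfadjoint_square p \<longleftrightarrow> (\<exists>h. star h = h \<and> p = h * h)"

lemma selfadjoint_squareI: "star h = h \<Longrightarrow> selfadjoint_square (h * h)"
  unfolding selfadjoint_square_def by blast

lemma star_selfadjoint_square: "selfadjoint_square p \<Longrightarrow> star p = p"
  unfolding selfadjoint_square_def by (auto simp: star_mult)

text \<open>Together with \<open>norm_diff_selfadjoint_square'\<close> this describes squares by a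
  norm inequality, which passes to sums and limits although the form h h does not visibly do
  so.\<close>

lemma selfadjoint_square_if_norm: "star p = p \<Longrightarrow> norm (t *\<^sub>R 1 - p) \<le> t \<Longrightarrow> selfadjoint_square p"
  using ex_sqrt_cstar[of p t] unfolding selfadjoint_square_def by metis

lemma norm_diff_selfadjoint_square':
  "selfadjoint_square p \<Longrightarrow> norm p \<le> t \<Longrightarrow> norm (t *\<^sub>R 1 - p) \<le> t"
  unfolding selfadjoint_square_def
  using norm_diff_selfadjoint_square norm_selfadjoint_square by metis

lemma selfadjoint_square_add:
  assumes "selfadjoint_square p" "selfadjoint_square q"
  shows "selfadjoint_square (p + q)"
proof (rule selfadjoint_square_if_norm)
  show "star (p + q) = p + q"
    using assms by (simp add: star_add star_selfadjoint_square)
  have "norm ((norm p + norm q) *\<^sub>R 1 - (p + q)) = norm ((norm p *\<^sub>R 1 - p) + (norm q *\<^sub>R 1 - q))"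
    by (simp add: algebra_simps)
  also have "\<dots> \<le> norm p + norm q"
    using assms by (intro norm_triangle_le add_mono norm_diff_selfadjoint_square') auto
  finally show "norm ((norm p + norm q) *\<^sub>R 1 - (p + q)) \<le> norm p + norm q" .
qed

lemma selfadjoint_square_scaleR:
  assumes "selfadjoint_square p" "0 \<le> r"
  shows "selfadjoint_square (r *\<^sub>R p)"
proof -
  obtain h where h: "star h = h" "p = h * h"
    using assms(1) unfolding selfadjoint_square_def by blast
  have "r *\<^sub>R p = (sqrt r *\<^sub>R h) * (sqrt r *\<^sub>R h)"
    using assms(2) h by simp
  moreover have "star (sqrt r *\<^sub>R h) = sqrt r *\<^sub>R h"
    by (simp add: star_scaleR h)
  ultimately show ?thesis
    by (metis selfadjoint_squareI)
qed

lemma selfadjoint_square_one: "selfadjoint_square (1::'b::unital_cstar_algebra)"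
  using selfadjoint_squareI[of "1::'b"] by simp

lemma selfadjoint_square_LIMSEQ:
  fixes p :: "nat \<Rightarrow> 'b::unital_cstar_algebra"
  assumes "p \<longlonglongrightarrow> q" "\<And>n. selfadjoint_square (p n)"
  shows "selfadjoint_square q"
proof (rule selfadjoint_square_if_norm)
  have "(\<lambda>n. star (p n)) \<longlonglongrightarrow> star q"
    by (intro tendsto_intros assms)
  then show "star q = q"
    using assms LIMSEQ_unique by (simp add: star_selfadjoint_square) blast
  have "(\<lambda>n. norm (norm (p n) *\<^sub>R 1 - p n)) \<longlonglongrightarrow> norm (norm q *\<^sub>R 1 - q)"
    "(\<lambda>n. norm (p n)) \<longlonglongrightarrow> norm q"
    by (intro tendsto_intros assms)+
  then show "norm (norm q *\<^sub>R 1 - q) \<le> norm q"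
    using norm_diff_selfadjoint_square'[OF assms(2) order_refl] LIMSEQ_le by blast
qed

text \<open>A root k of r commutes with s - r, hence with the constructed root l of s - r; then k k
  + l l = s and \<open>norm_le_if_square_sum\<close> bounds k.\<close>

lemma norm_le_if_selfadjoint_square:
  fixes r :: "'b::unital_cstar_algebra"
  assumes "selfadjoint_square r" "selfadjoint_square (s *\<^sub>R 1 - r)" "0 \<le> s"
  shows "norm r \<le> s"
proof -
  obtain k where k: "star k = k" "r = k * k"
    using assms(1) unfolding selfadjoint_square_def by blast
  obtain l where l: "star l = l" "l * l = s *\<^sub>R 1 - r"
    "\<And>c. c * (s *\<^sub>R 1 - r) = (s *\<^sub>R 1 - r) * c \<Longrightarrow> c * l = l * c"
    using ex_sqrt_cstar[OF star_selfadjoint_square[OF assms(2)]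
        norm_diff_selfadjoint_square'[OF assms(2) order_refl]] by blast
  have "k * l = l * k"
    by (rule l(3)) (simp add: k algebra_simps)
  then have "(norm k)\<^sup>2 \<le> s"
    using k l(1,2) assms(3) by (intro norm_le_if_square_sum[of k l]) auto
  then show ?thesis
    using k norm_selfadjoint_square by metis
qed

text \<open>The fixed point of the contraction x -> 1 + a x is a right inverse, that of x -> 1 + x a
  a left inverse, and the two coincide. The norm bound is read off the fixed point equation.\<close>

lemma ex_inverse_one_minus:
  fixes a :: "'b::unital_cstar_algebra"
  assumes "norm a < 1"
  obtains r where "(1 - a) * r = 1" "r * (1 - a) = 1" "norm r \<le> 1 / (1 - norm a)"
proof -
  have "\<exists>!x. 1 + a * x = x"
    by (rule banach_fix_type[of "norm a"])
      (use assms in \<open>auto simp: dist_norm norm_mult_ineq simp flip: right_diff_distrib\<close>)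
  then obtain r where r: "1 + a * r = r" by blast
  have "\<exists>!x. 1 + x * a = x"
    by (rule banach_fix_type[of "norm a"])
      (use assms in \<open>auto simp: dist_norm mult.commute[of "norm a"] norm_mult_ineq
        simp flip: left_diff_distrib\<close>)
  then obtain r' where r': "1 + r' * a = r'" by blast
  have 1: "(1 - a) * r = 1" using r by (simp add: algebra_simps add_diff_eq[symmetric] diff_eq_eq)
  have 2: "r' * (1 - a) = 1" using r' by (simp add: algebra_simps diff_eq_eq)
  have "r' = r" using 1 2 by (metis mult.assoc mult.left_neutral mult.right_neutral)
  moreover have "norm r \<le> 1 + norm a * norm r"
    using norm_triangle_ineq[of 1 "a * r"] norm_mult_ineq[of a r] norm_one_cstar_le[where 'b = 'b]
    unfolding r by linarith
  then have "norm r \<le> 1 / (1 - norm a)"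
    using assms by (simp add: field_simps)
  ultimately show thesis using that 1 2 by blast
qed

text \<open>With t the norm of p, positivity says that t - p has norm at most t. So p + e is t + e
  times 1 - a, where a has norm at most t / (t + e), and this ratio produces the bound 1 /
  e.\<close>

lemma ex_inverse_add:
  fixes p :: "'b::unital_cstar_algebra"
  assumes p: "selfadjoint_square p" and e: "0 < e"
  obtains r where "(p + e *\<^sub>R 1) * r = 1" "r * (p + e *\<^sub>R 1) = 1" "norm r \<le> 1 / e" "star r = r"
proof -
  define t where "t = norm p"
  define a where "a = (1 / (t + e)) *\<^sub>R (t *\<^sub>R 1 - p)"
  have te: "0 \<le> t" "0 < t + e" unfolding t_def using e by (auto simp: add_nonneg_pos)
  have "norm a \<le> t / (t + e)"
    using norm_diff_selfadjoint_square'[OF p order_refl] te unfolding a_def t_def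
    by (simp add: divide_right_mono)
  moreover have "t / (t + e) < 1" using te e by simp
  ultimately have a1: "norm a < 1" and a2: "1 / (1 - norm a) \<le> (t + e) / e"
  proof -
    assume *: "norm a \<le> t / (t + e)" "t / (t + e) < 1"
    then show "norm a < 1" by simp
    have "e / (t + e) = 1 - t / (t + e)" using te by (simp add: field_simps)
    then have "e / (t + e) \<le> 1 - norm a" "0 < e / (t + e)" using * e te by simp_all
    then have "1 / (1 - norm a) \<le> 1 / (e / (t + e))"
      by (intro divide_left_mono mult_pos_pos) auto
    then show "1 / (1 - norm a) \<le> (t + e) / e" by simp
  qed
  obtain r where r: "(1 - a) * r = 1" "r * (1 - a) = 1" "norm r \<le> 1 / (1 - norm a)"
    using ex_inverse_one_minus[OF a1] by blast
  have pe: "p + e *\<^sub>R 1 = (t + e) *\<^sub>R (1 - a)"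
  proof -
    have "(t + e) *\<^sub>R a = t *\<^sub>R 1 - p"
      unfolding a_def using te by simp
    then show ?thesis
      by (simp add: scaleR_diff_right scaleR_add_left)
  qed
  define q where "q = (1 / (t + e)) *\<^sub>R r"
  have q: "(p + e *\<^sub>R 1) * q = 1" "q * (p + e *\<^sub>R 1) = 1"
    unfolding pe q_def using r te by auto
  have sp: "star (p + e *\<^sub>R 1) = p + e *\<^sub>R 1"
    by (simp add: star_add star_scaleR star_selfadjoint_square[OF p])
  have "star q * (p + e *\<^sub>R 1) = 1"
    by (metis q(1) sp star_mult star_one)
  then have "star q = q"
    by (metis q(1) mult.assoc mult.left_neutral mult.right_neutral)
  moreover have "norm q \<le> 1 / e"
  proof -
    have "norm q = norm r / (t + e)" unfolding q_def using te by simp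
    also have "\<dots> \<le> ((t + e) / e) / (t + e)"
      using r(3) a2 te by (intro divide_right_mono) auto
    finally show ?thesis using te by simp
  qed
  ultimately show thesis using that q by blast
qed

text \<open>Let p = k k and let j be the inverse of k. For large m the element m - j j has a root l
  commuting with k, and k l is self-adjoint with square m p - 1. Hence d = 1 / m works.\<close>

lemma selfadjoint_square_decrease:
  fixes p :: "'b::unital_cstar_algebra"
  assumes p: "selfadjoint_square p" and r: "p * r = 1" "r * p = 1"
  obtains d where "0 < d" "selfadjoint_square (p - d *\<^sub>R 1)"
proof -
  obtain k where k: "star k = k" "p = k * k"
    using p unfolding selfadjoint_square_def by blast
  define j where "j = k * r"
  have kj: "k * j = 1" unfolding j_def using r k by (simp add: mult.assoc)
  have "r * k = (r * k) * (k * k * r)" using r k by simp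
  also have "\<dots> = (r * (k * k)) * (k * r)" by (simp add: mult.assoc)
  finally have "r * k = j" using r k by (simp add: j_def)
  then have jk: "j * k = 1" using r k by (metis mult.assoc)
  have "star j * k = 1" using kj by (metis k(1) star_mult star_one)
  then have sj: "star j = j" using kj by (metis mult.assoc mult.left_neutral mult.right_neutral)
  define m where "m = norm (j * j) + 1"
  have m: "0 < m" unfolding m_def by (simp add: add_nonneg_pos)
  have "norm (m *\<^sub>R 1 - (m *\<^sub>R 1 - j * j)) \<le> m" unfolding m_def by simp
  moreover have "star (m *\<^sub>R 1 - j * j) = m *\<^sub>R 1 - j * j"
    by (simp add: star_diff star_scaleR star_mult sj)
  ultimately obtain l where l: "star l = l" "l * l = m *\<^sub>R 1 - j * j"
    "\<And>c. c * (m *\<^sub>R 1 - j * j) = (m *\<^sub>R 1 - j * j) * c \<Longrightarrow> c * l = l * c"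
    using ex_sqrt_cstar by blast
  have jjk: "j * j * k = j" "k * (j * j) = j"
    by (simp_all add: mult.assoc jk flip: mult.assoc[of k] add: kj)
  have kl: "k * l = l * k"
    by (rule l(3)) (simp add: right_diff_distrib left_diff_distrib jjk)
  have "(k * l) * (k * l) = k * (l * l) * k"
    by (metis kl mult.assoc)
  also have "\<dots> = m *\<^sub>R p - 1"
    unfolding l(2) by (simp add: k algebra_simps jjk mult.assoc) (simp add: jk kj flip: mult.assoc)
  finally have "selfadjoint_square (m *\<^sub>R p - 1)"
    by (metis kl k(1) l(1) star_mult selfadjoint_squareI)
  then have "selfadjoint_square ((1 / m) *\<^sub>R (m *\<^sub>R p - 1))"
    using m by (intro selfadjoint_square_scaleR) auto
  then have "selfadjoint_square (p - (1 / m) *\<^sub>R 1)"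
    using m by (simp add: scaleR_diff_right)
  with m show thesis by (intro that[of "1 / m"]) auto
qed

text \<open>Stands in for: a self-adjoint element without negative spectrum is positive. A least
  shift s with h + s positive exists because the cone is closed; were s positive, h + s would be
  invertible and the shift could still be decreased.\<close>

lemma selfadjoint_square_if_invertible:
  fixes h :: "'b::unital_cstar_algebra"
  assumes h: "star h = h"
    and inv: "\<And>e. 0 < e \<Longrightarrow> \<exists>r. (h + e *\<^sub>R 1) * r = 1 \<and> r * (h + e *\<^sub>R 1) = 1"
  shows "selfadjoint_square h"
proof -
  define S where "S = {s. 0 \<le> s \<and> selfadjoint_square (h + s *\<^sub>R 1)}"
  have "norm h \<in> S"
    unfolding S_def using h
    by (auto intro!: selfadjoint_square_if_norm[where t = "norm h"] simp: star_add star_scaleR)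
  have "closed S"
    unfolding closed_sequential_limits
  proof (intro allI impI, elim conjE)
    fix x l assume x: "\<forall>n. x n \<in> S" and l: "x \<longlonglongrightarrow> l"
    have "(\<lambda>n. h + x n *\<^sub>R 1) \<longlonglongrightarrow> h + l *\<^sub>R 1"
      by (intro tendsto_intros l)
    then have "selfadjoint_square (h + l *\<^sub>R 1)"
      by (rule selfadjoint_square_LIMSEQ) (use x in \<open>auto simp: S_def\<close>)
    moreover have "0 \<le> l"
      using x l LIMSEQ_le_const unfolding S_def by blast
    ultimately show "l \<in> S" unfolding S_def by blast
  qed
  moreover have bdd: "bdd_below S" unfolding S_def by (rule bdd_belowI[of _ 0]) auto
  ultimately have s: "Inf S \<in> S"
    using \<open>norm h \<in> S\<close> closed_contains_Inf by blast
  define s where "s = Inf S"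
  have sS: "0 \<le> s" "selfadjoint_square (h + s *\<^sub>R 1)"
    using s unfolding s_def[symmetric] by (simp_all add: S_def)
  show ?thesis
  proof (cases "s = 0")
    case True
    with sS show ?thesis by simp
  next
    case False
    with sS have s0: "0 < s" by simp
    obtain r where "(h + s *\<^sub>R 1) * r = 1" "r * (h + s *\<^sub>R 1) = 1"
      using inv[OF s0] by blast
    then obtain d where d: "0 < d" "selfadjoint_square (h + s *\<^sub>R 1 - d *\<^sub>R 1)"
      using selfadjoint_square_decrease sS(2) by blast
    define c where "c = min d s"
    have "selfadjoint_square ((h + s *\<^sub>R 1 - d *\<^sub>R 1) + (d - c) *\<^sub>R 1)"
      by (intro selfadjoint_square_add d selfadjoint_square_scaleR selfadjoint_square_one)
        (simp add: c_def)
    then have "s - c \<in> S"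
      unfolding S_def using s0 by (simp add: c_def algebra_simps)
    then have "s \<le> s - c" unfolding s_def by (rule cInf_lower[OF _ bdd])
    then show ?thesis using d s0 unfolding c_def by auto
  qed
qed

text \<open>Twice this element is the sum of the squares of the self-adjoint elements c + star c and
  i (c - star c).\<close>

lemma selfadjoint_square_mult_star_add:
  fixes c :: "'b::unital_cstar_algebra"
  shows "selfadjoint_square (star c * c + c * star c)"
proof -
  define d where "d = scaleC \<i> (c - star c)"
  have "star d = scaleC (- \<i>) (star c - c)"
    unfolding d_def by (simp add: star_scaleC star_diff star_star)
  also have "\<dots> = d"
    unfolding d_def by (simp add: scaleC_minus_left scaleC_diff_right)
  finally have d: "star d = d" .
  have i2: "scaleC \<i> (scaleC \<i> x) = - x" for x :: 'b
    using scaleR_scaleC[of "- 1" x] by (simp add: scaleC_scaleC)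
  have "d * d = - ((c - star c) * (c - star c))"
    unfolding d_def by (simp add: mult_scaleC_left mult_scaleC_right i2)
  then have *: "(c + star c) * (c + star c) + d * d = 2 *\<^sub>R (star c * c + c * star c)"
    by (simp add: algebra_simps scaleR_2)
  have "star (c + star c) = c + star c" by (simp add: star_add star_star add.commute)
  then have "selfadjoint_square ((1/2) *\<^sub>R ((c + star c) * (c + star c) + d * d))"
    using d by (intro selfadjoint_square_scaleR selfadjoint_square_add selfadjoint_squareI) auto
  then show ?thesis unfolding * by simp
qed

text \<open>If r inverts \<open>c * star c + e *\<^sub>R 1\<close>, then
  \<open>1 - star c * r * c\<close>, divided by e, inverts
  \<open>star c * c + e *\<^sub>R 1\<close>: the resolvent form of the fact that both products have
  the same nonzero spectrum. The second inverse relation follows by taking adjoints.\<close>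

lemma selfadjoint_square_invertible_swap:
  fixes c :: "'b::unital_cstar_algebra"
  assumes "selfadjoint_square (c * star c)" "0 < e"
  shows "\<exists>r. (star c * c + e *\<^sub>R 1) * r = 1 \<and> r * (star c * c + e *\<^sub>R 1) = 1"
proof -
  obtain r where r: "(c * star c + e *\<^sub>R 1) * r = 1" "r * (c * star c + e *\<^sub>R 1) = 1" "star r = r"
    using ex_inverse_add[OF assms] by blast
  define q where "q = (1 / e) *\<^sub>R (1 - star c * r * c)"
  have "(star c * c + e *\<^sub>R 1) * (star c * r * c) = star c * ((c * star c + e *\<^sub>R 1) * r) * c"
    by (simp add: algebra_simps)
  then have "(star c * c + e *\<^sub>R 1) * (1 - star c * r * c) = e *\<^sub>R 1"
    unfolding r by (simp add: right_diff_distrib)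
  then have q: "(star c * c + e *\<^sub>R 1) * q = 1"
    unfolding q_def using assms(2) by simp
  moreover have "star q = q"
    unfolding q_def by (simp add: star_scaleR star_diff star_mult star_star r mult.assoc)
  then have "q * (star c * c + e *\<^sub>R 1) = star ((star c * c + e *\<^sub>R 1) * q)"
    by (simp add: star_mult star_add star_scaleR star_star)
  ultimately show ?thesis by auto
qed

text \<open>Kaplansky's argument: for the negative part \<open>n\<close> of \<open>b\<^sup>*b\<close> and \<open>c = b n\<close>, the element
  \<open>- c\<^sup>*c = n\<^sup>3\<close> is positive, hence so is \<open>c c\<^sup>*\<close>; since \<open>c\<^sup>*c\<close> and \<open>c c\<^sup>*\<close> have the same nonzero
  spectrum, \<open>c\<^sup>*c\<close> is positive as well, which forces \<open>n = 0\<close>.\<close>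

lemma selfadjoint_square_star_mult:
  fixes b :: "'b::unital_cstar_algebra"
  shows "selfadjoint_square (star b * b)"
proof -
  define h where "h = star b * b"
  have h: "star h = h" unfolding h_def by (simp add: star_mult star_star)
  have hh: "selfadjoint_square (h * h)" using h by (rule selfadjoint_squareI)
  define t where "t = norm (h * h)"
  obtain a where a: "star a = a" "a * a = h * h" "norm (sqrt t *\<^sub>R 1 - a) \<le> sqrt t"
    "\<And>c. c * (h * h) = (h * h) * c \<Longrightarrow> c * a = a * c"
    using ex_sqrt_cstar[OF star_selfadjoint_square[OF hh], of t]
      norm_diff_selfadjoint_square'[OF hh order_refl] unfolding t_def by blast
  have apos: "selfadjoint_square a"
    using a(1,3) by (rule selfadjoint_square_if_norm)
  have ha: "h * a = a * h" by (rule a(4)) (simp add: mult.assoc)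
  \<comment> \<open>Since g commutes with a and g g = a a, the product of a - g + e and a + g + e is
    e (2 a + e). The factor 2 a + e is invertible by positivity of a, hence so is a - g + e.\<close>
  have part: "selfadjoint_square (a - g)" if g: "star g = g" "g * a = a * g" "g * g = a * a" for g
  proof (rule selfadjoint_square_if_invertible)
    show "star (a - g) = a - g" by (simp add: star_diff a g)
    fix e :: real assume e: "0 < e"
    have "selfadjoint_square (2 *\<^sub>R a)" using apos by (intro selfadjoint_square_scaleR) auto
    then obtain r where r: "(2 *\<^sub>R a + e *\<^sub>R 1) * r = 1" "r * (2 *\<^sub>R a + e *\<^sub>R 1) = 1" "star r = r"
      using ex_inverse_add[OF _ e] by blast
    define x y w where "x = a - g + e *\<^sub>R 1" and "y = a + g + e *\<^sub>R 1" and "w = 2 *\<^sub>R a + e *\<^sub>R 1"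
    have xy: "x * y = e *\<^sub>R w" "y * x = e *\<^sub>R w"
      unfolding x_def y_def w_def using g by (simp_all add: algebra_simps scaleR_2)
    have w: "w * r = 1" "r * w = 1"
      using r unfolding w_def by auto
    have "x * (y * ((1/e) *\<^sub>R r)) = (1/e) *\<^sub>R ((x * y) * r)"
      by (simp add: mult.assoc)
    then have 1: "x * (y * ((1/e) *\<^sub>R r)) = 1"
      unfolding xy using e w by simp
    have "(((1/e) *\<^sub>R r) * y) * x = (1/e) *\<^sub>R (r * (y * x))"
      by (simp add: mult.assoc)
    then have 2: "(((1/e) *\<^sub>R r) * y) * x = 1"
      unfolding xy using e w by simp
    have "((1/e) *\<^sub>R r) * y = y * ((1/e) *\<^sub>R r)"
      by (metis 1 2 mult.assoc mult.left_neutral mult.right_neutral)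
    with 1 2 have "x * (y * ((1/e) *\<^sub>R r)) = 1 \<and> (y * ((1/e) *\<^sub>R r)) * x = 1"
      by argo
    then show "\<exists>r. (a - g + e *\<^sub>R 1) * r = 1 \<and> r * (a - g + e *\<^sub>R 1) = 1"
      unfolding x_def[symmetric] by blast
  qed
  \<comment> \<open>Here a is the absolute value of h and n is the negative part of h, so h n = - n
    n.\<close>
  define n where "n = (1/2) *\<^sub>R (a - h)"
  have n: "selfadjoint_square n"
    unfolding n_def using part[OF h ha] a(2) by (intro selfadjoint_square_scaleR) auto
  then obtain k where k: "star k = k" "n = k * k" unfolding selfadjoint_square_def by blast
  have hn: "h * n = - (n * n)"
    unfolding n_def using a(2) ha by (simp add: algebra_simps flip: scaleR_add_left)
  define c where "c = b * n"
  have sn: "star n = n" using n by (rule star_selfadjoint_square)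
  have "star c * c = n * (h * n)" unfolding c_def h_def by (simp add: star_mult sn mult.assoc)
  then have cc: "star c * c = - (n * n * n)" unfolding hn by (simp add: mult.assoc)
  have "selfadjoint_square ((k * k * k) * (k * k * k))"
    by (rule selfadjoint_squareI) (simp add: star_mult k mult.assoc)
  then have n3: "selfadjoint_square (n * n * n)" unfolding k by (simp add: mult.assoc)
  \<comment> \<open>The summand n n n cancels \<open>star c * c\<close> and leaves
    \<open>c * star c\<close>.\<close>
  have "selfadjoint_square ((star c * c + c * star c) + n * n * n)"
    by (intro selfadjoint_square_add n3 selfadjoint_square_mult_star_add)
  then have "selfadjoint_square (c * star c)" unfolding cc by simp
  then have "selfadjoint_square (star c * c)"
    using selfadjoint_square_if_invertible[of "star c * c", OF _ selfadjoint_square_invertible_swap]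
      star_mult[of "star c" c] star_star[of c] by metis
  then have "norm (n * n * n) \<le> 0"
    using n3 unfolding cc by (intro norm_le_if_selfadjoint_square) auto
  then have "n * n * n = 0" by simp
  then have "(n * n) * (n * n) = 0" by (simp flip: mult.assoc)
  then have "n * n = 0"
    by (intro selfadjoint_square_eq_0[of "n * n"]) (auto simp: star_mult sn)
  with sn have "n = 0" by (rule selfadjoint_square_eq_0)
  then have "h = a" unfolding n_def by simp
  then show ?thesis using apos unfolding h_def by simp
qed

lemma positive_iff_selfadjoint_square: "positive p \<longleftrightarrow> selfadjoint_square p"
  unfolding positive_def using selfadjoint_square_star_mult
  by (metis selfadjoint_square_def)

lemma positive_star_mult: "positive (star b * b)"
  unfolding positive_def by blast

lemma positive_zero [simp]: "positive 0"
  unfolding positive_def by (rule exI[of _ 0]) simp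

lemma positive_selfadjoint: "positive p \<Longrightarrow> star p = p"
  by (simp add: positive_iff_selfadjoint_square star_selfadjoint_square)

lemma positive_add: "positive p \<Longrightarrow> positive q \<Longrightarrow> positive (p + q)"
  by (simp add: positive_iff_selfadjoint_square selfadjoint_square_add)

lemma positive_scaleR: "positive p \<Longrightarrow> 0 \<le> r \<Longrightarrow> positive (r *\<^sub>R p)"
  by (simp add: positive_iff_selfadjoint_square selfadjoint_square_scaleR)

lemma positive_LIMSEQ: "p \<longlonglongrightarrow> q \<Longrightarrow> (\<And>n. positive (p n)) \<Longrightarrow> positive q"
  unfolding positive_iff_selfadjoint_square by (rule selfadjoint_square_LIMSEQ)

lemma positive_conj: "positive p \<Longrightarrow> positive (star c * p * c)"
  unfolding positive_def by (metis star_mult mult.assoc)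

lemma positive_norm_diff: "positive p \<Longrightarrow> norm p \<le> t \<Longrightarrow> positive (t *\<^sub>R 1 - p)"
  unfolding positive_iff_selfadjoint_square
  by (rule selfadjoint_square_if_norm[where t = t])
    (simp_all add: star_diff star_scaleR star_selfadjoint_square)

text \<open>With t the norm of q, the element t - p is the sum of the positive elements t - q and q
  - p.\<close>

lemma positive_norm_mono:
  assumes "positive p" "positive (q - p)"
  shows "norm p \<le> norm q"
proof -
  have "positive (p + (q - p))" using assms by (rule positive_add)
  then have "positive ((norm q *\<^sub>R 1 - q) + (q - p))"
    using assms by (intro positive_add positive_norm_diff) auto
  then show ?thesis
    using assms(1) unfolding positive_iff_selfadjoint_square
    by (intro norm_le_if_selfadjoint_square) auto
qed

section \<open>Semi-inner product bimodules\<close>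

text \<open>Linearity and the action laws are demanded only after pairing with a vector, because
  formal sums of tensors and units satisfy them only up to vectors of length zero. Rearrangements of
  vectors are then justified through \<open>mnorm_cong\<close>.\<close>

locale semi_bimod =
  fixes M :: "('b::unital_cstar_algebra, 'm) bimod"
  assumes add_closed [simp]: "x \<in> mcarrier M \<Longrightarrow> y \<in> mcarrier M \<Longrightarrow> madd M x y \<in> mcarrier M"
    and zero_closed [simp]: "mzero M \<in> mcarrier M"
    and ract_closed [simp]: "x \<in> mcarrier M \<Longrightarrow> mract M x b \<in> mcarrier M"
    and lact_closed [simp]: "x \<in> mcarrier M \<Longrightarrow> mlact M b x \<in> mcarrier M"
    and ip_add_right: "x \<in> mcarrier M \<Longrightarrow> y \<in> mcarrier M \<Longrightarrow> z \<in> mcarrier M \<Longrightarrow>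
          mip M x (madd M y z) = mip M x y + mip M x z"
    and ip_zero_right: "x \<in> mcarrier M \<Longrightarrow> mip M x (mzero M) = 0"
    and ip_ract_right: "x \<in> mcarrier M \<Longrightarrow> y \<in> mcarrier M \<Longrightarrow> mip M x (mract M y b) = mip M x y * b"
    and ip_star: "x \<in> mcarrier M \<Longrightarrow> y \<in> mcarrier M \<Longrightarrow> star (mip M x y) = mip M y x"
    and ip_positive: "x \<in> mcarrier M \<Longrightarrow> positive (mip M x x)"
    and ip_lact: "x \<in> mcarrier M \<Longrightarrow> y \<in> mcarrier M \<Longrightarrow>
          mip M (mlact M b x) y = mip M x (mlact M (star b) y)"
    and ip_lact_add: "x \<in> mcarrier M \<Longrightarrow> y \<in> mcarrier M \<Longrightarrow>
          mip M x (mlact M (a + b) y) = mip M x (mlact M a y) + mip M x (mlact M b y)"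
    and ip_lact_mult: "x \<in> mcarrier M \<Longrightarrow> y \<in> mcarrier M \<Longrightarrow>
          mip M x (mlact M (a * b) y) = mip M x (mlact M a (mlact M b y))"
    and ip_lact_one: "x \<in> mcarrier M \<Longrightarrow> y \<in> mcarrier M \<Longrightarrow> mip M x (mlact M 1 y) = mip M x y"
    and ip_scalar: "x \<in> mcarrier M \<Longrightarrow> y \<in> mcarrier M \<Longrightarrow>
          mip M x (mlact M (scaleC c 1) y) = mip M x y * scaleC c 1"
begin

lemma ip_add_left:
  "x \<in> mcarrier M \<Longrightarrow> y \<in> mcarrier M \<Longrightarrow> z \<in> mcarrier M \<Longrightarrow>
    mip M (madd M x y) z = mip M x z + mip M y z"
  using ip_add_right[of z x y] by (metis add_closed ip_star star_add)

lemma ip_zero_left: "x \<in> mcarrier M \<Longrightarrow> mip M (mzero M) x = 0"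
  by (metis ip_star ip_zero_right star_zero zero_closed)

lemma ip_ract_left:
  "x \<in> mcarrier M \<Longrightarrow> y \<in> mcarrier M \<Longrightarrow> mip M (mract M x b) y = star b * mip M x y"
  by (metis ip_ract_right ip_star ract_closed star_mult)

lemma ip_lact_scaleC:
  assumes "x \<in> mcarrier M" "y \<in> mcarrier M"
  shows "mip M x (mlact M (scaleC c b) y) = scaleC c (mip M x (mlact M b y))"
proof -
  have "mip M x (mlact M (scaleC c 1 * b) y) = mip M x (mlact M b y) * scaleC c 1"
    using assms by (simp only: ip_lact_mult ip_scalar lact_closed)
  then show ?thesis
    by (simp add: mult_scaleC_left mult_scaleC_right)
qed

lemma ip_lact_scaleR:
  "x \<in> mcarrier M \<Longrightarrow> y \<in> mcarrier M \<Longrightarrow>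
    mip M x (mlact M (r *\<^sub>R b) y) = r *\<^sub>R mip M x (mlact M b y)"
  by (simp add: scaleR_scaleC ip_lact_scaleC)

lemma ip_lact_minus:
  "x \<in> mcarrier M \<Longrightarrow> y \<in> mcarrier M \<Longrightarrow> mip M x (mlact M (- b) y) = - mip M x (mlact M b y)"
  using ip_lact_scaleR[of x y "- 1" b] by simp

lemma ip_lact_diff:
  "x \<in> mcarrier M \<Longrightarrow> y \<in> mcarrier M \<Longrightarrow>
    mip M x (mlact M (a - b) y) = mip M x (mlact M a y) - mip M x (mlact M b y)"
  using ip_lact_add[of x y a "- b"] by (simp add: ip_lact_minus)

lemma ip_lact_right:
  "x \<in> mcarrier M \<Longrightarrow> y \<in> mcarrier M \<Longrightarrow>
    mip M x (mlact M b y) = mip M (mlact M (star b) x) y"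
  by (simp add: ip_lact star_star)

lemma ip_lact_add_right:
  "x \<in> mcarrier M \<Longrightarrow> y \<in> mcarrier M \<Longrightarrow> z \<in> mcarrier M \<Longrightarrow>
    mip M x (mlact M b (madd M y z)) = mip M x (mlact M b y) + mip M x (mlact M b z)"
  by (simp add: ip_lact_right ip_add_right)

lemma ip_lact_ract:
  assumes "x \<in> mcarrier M" "y \<in> mcarrier M"
  shows "mip M x (mlact M a (mract M y b)) = mip M x (mlact M a y) * b"
  using assms by (simp add: ip_lact_right ip_ract_right)

lemma sub_closed [simp]: "x \<in> mcarrier M \<Longrightarrow> y \<in> mcarrier M \<Longrightarrow> msub M x y \<in> mcarrier M"
  by (simp add: msub_def)

lemma ip_sub_right:
  "x \<in> mcarrier M \<Longrightarrow> y \<in> mcarrier M \<Longrightarrow> z \<in> mcarrier M \<Longrightarrow>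
    mip M x (msub M y z) = mip M x y - mip M x z"
  by (simp add: msub_def ip_add_right ip_lact_minus ip_lact_one)

lemma ip_sub_left:
  "x \<in> mcarrier M \<Longrightarrow> y \<in> mcarrier M \<Longrightarrow> z \<in> mcarrier M \<Longrightarrow>
    mip M (msub M x y) z = mip M x z - mip M y z"
  using ip_sub_right[of z x y] by (metis sub_closed ip_star star_diff)

lemma ip_lact_sub_right:
  "x \<in> mcarrier M \<Longrightarrow> y \<in> mcarrier M \<Longrightarrow> z \<in> mcarrier M \<Longrightarrow>
    mip M x (mlact M b (msub M y z)) = mip M x (mlact M b y) - mip M x (mlact M b z)"
  by (simp add: ip_lact_right ip_sub_right)

lemmas ip_simps = ip_add_right ip_add_left ip_sub_right ip_sub_left ip_ract_right ip_ract_left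

section \<open>Cauchy-Schwarz inequality and the induced seminorm\<close>

lemma mnorm_nonneg [simp]: "0 \<le> mnorm M x"
  by (simp add: mnorm_def)

lemma mnorm_square: "(mnorm M x)\<^sup>2 = norm (mip M x x)"
  by (simp add: mnorm_def)

lemma mnorm_mult_self: "mnorm M x * mnorm M x = norm (mip M x x)"
  by (simp add: mnorm_def)

lemma mnorm_eq_0: "mnorm M x = 0 \<longleftrightarrow> mip M x x = 0"
  by (simp add: mnorm_def)

lemma mnorm_le_iff: "0 \<le> c \<Longrightarrow> mnorm M x \<le> c \<longleftrightarrow> norm (mip M x x) \<le> c\<^sup>2"
  unfolding mnorm_def by (metis real_sqrt_le_iff real_sqrt_unique)

text \<open>Positivity of the length of x a - y with a = <x, y> / t yields t (star a) a \<le> <y, y>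
  as soon as t exceeds the norm of <x, x>, and the norm is monotone on positive elements. Letting t
  decrease to that norm covers <x, x> = 0 without division by zero.\<close>

theorem Cauchy_Schwarz:
  assumes x: "x \<in> mcarrier M" and y: "y \<in> mcarrier M"
  shows "norm (mip M x y) \<le> mnorm M x * mnorm M y"
proof -
  define p where "p = mip M x x"
  have *: "(norm (mip M x y))\<^sup>2 \<le> t * norm (mip M y y)" if t: "norm p < t" for t
  proof -
    have t0: "0 < t" using t norm_ge_zero[of p] by linarith
    define a where "a = (1 / t) *\<^sub>R mip M x y"
    have xy: "mip M x y = t *\<^sub>R a" unfolding a_def using t0 by simp
    then have yx: "mip M y x = t *\<^sub>R star a"
      using ip_star[OF x y] by (simp add: star_scaleR)
    define z where "z = msub M (mract M x a) y"
    have "mip M z z = star a * p * a - t *\<^sub>R (star a * a) - t *\<^sub>R (star a * a) + mip M y y"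
      unfolding z_def using x y by (simp add: ip_simps xy yx p_def algebra_simps)
    then have eq: "mip M y y - t *\<^sub>R (star a * a) = mip M z z + star a * (t *\<^sub>R 1 - p) * a"
      by (simp add: algebra_simps)
    have "positive (mip M z z + star a * (t *\<^sub>R 1 - p) * a)"
      using x y t ip_positive[OF x]
      by (intro positive_add positive_conj positive_norm_diff ip_positive) (auto simp: z_def p_def)
    then have "norm (t *\<^sub>R (star a * a)) \<le> norm (mip M y y)"
      unfolding eq[symmetric] using t0
      by (intro positive_norm_mono positive_scaleR positive_star_mult) auto
    then have "t * (t * (norm a)\<^sup>2) \<le> t * norm (mip M y y)"
      using t0 by (simp add: norm_star_mult_self)
    moreover have "(norm (mip M x y))\<^sup>2 = t * (t * (norm a)\<^sup>2)"
      unfolding xy using t0 by (simp add: power2_eq_square)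
    ultimately show ?thesis by simp
  qed
  have "(norm (mip M x y))\<^sup>2 \<le> norm p * norm (mip M y y)"
  proof (rule tendsto_lowerbound)
    show "((\<lambda>t. t * norm (mip M y y)) \<longlongrightarrow> norm p * norm (mip M y y)) (at_right (norm p))"
      by (intro tendsto_intros)
    show "\<forall>\<^sub>F t in at_right (norm p). (norm (mip M x y))\<^sup>2 \<le> t * norm (mip M y y)"
      unfolding eventually_at_right_field using * by (meson gt_ex)
  qed simp
  also have "\<dots> = (mnorm M x * mnorm M y)\<^sup>2"
    by (simp add: p_def power_mult_distrib mnorm_square)
  finally show ?thesis
    by (simp add: power2_le_iff_abs_le)
qed

lemma mnorm_add_le:
  assumes "x \<in> mcarrier M" "y \<in> mcarrier M"
  shows "mnorm M (madd M x y) \<le> mnorm M x + mnorm M y"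
proof (subst mnorm_le_iff)
  have "norm (mip M (madd M x y) (madd M x y))
      \<le> norm (mip M x x) + norm (mip M x y) + (norm (mip M y x) + norm (mip M y y))"
  proof -
    have "mip M (madd M x y) (madd M x y) = (mip M x x + mip M x y) + (mip M y x + mip M y y)"
      using assms by (simp add: ip_simps)
    then show ?thesis
      by (metis norm_triangle_le add_mono norm_triangle_ineq)
  qed
  also have "\<dots> \<le> (mnorm M x)\<^sup>2 + mnorm M x * mnorm M y + (mnorm M y * mnorm M x + (mnorm M y)\<^sup>2)"
    using assms by (intro add_mono Cauchy_Schwarz) (auto simp: mnorm_square)
  finally show "norm (mip M (madd M x y) (madd M x y)) \<le> (mnorm M x + mnorm M y)\<^sup>2"
    by (simp add: power2_eq_square algebra_simps)
qed simp

lemma mnorm_ract_le: "x \<in> mcarrier M \<Longrightarrow> mnorm M (mract M x b) \<le> mnorm M x * norm b"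
proof (subst mnorm_le_iff)
  assume x: "x \<in> mcarrier M"
  have "norm (star b * (mip M x x * b)) \<le> norm b * (norm (mip M x x) * norm b)"
    by (intro order_trans[OF norm_mult_ineq] mult_mono) (auto intro: norm_mult_ineq)
  then show "norm (mip M (mract M x b) (mract M x b)) \<le> (mnorm M x * norm b)\<^sup>2"
    using x by (simp add: ip_simps mnorm_square power_mult_distrib)
      (simp add: power2_eq_square algebra_simps)
qed simp

text \<open>The positive element \<open>(norm b)\<^sup>2 *\<^sub>R 1 - star b * b\<close> has the
  form \<open>star c * c\<close>, so the defect in the inequality between the inner products is <c
  x, c x>.\<close>

lemma mnorm_lact_le:
  assumes x: "x \<in> mcarrier M"
  shows "mnorm M (mlact M b x) \<le> norm b * mnorm M x"
proof (subst mnorm_le_iff)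
  have eq: "mip M (mlact M b x) (mlact M b x) = mip M x (mlact M (star b * b) x)" for b
    using x by (simp add: ip_lact ip_lact_mult)
  have "positive ((norm b)\<^sup>2 *\<^sub>R 1 - star b * b)"
    by (intro positive_norm_diff positive_star_mult) (simp add: norm_star_mult_self)
  then obtain c where c: "(norm b)\<^sup>2 *\<^sub>R 1 - star b * b = star c * c"
    unfolding positive_def by blast
  have "(norm b)\<^sup>2 *\<^sub>R mip M x x - mip M (mlact M b x) (mlact M b x)
      = mip M (mlact M c x) (mlact M c x)"
    unfolding eq c[symmetric] using x
    by (simp add: ip_lact_diff ip_lact_scaleR ip_lact_one)
  then have "positive ((norm b)\<^sup>2 *\<^sub>R mip M x x - mip M (mlact M b x) (mlact M b x))"
    using x by (simp add: ip_positive)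
  then have "norm (mip M (mlact M b x) (mlact M b x)) \<le> norm ((norm b)\<^sup>2 *\<^sub>R mip M x x)"
    using x by (intro positive_norm_mono ip_positive) auto
  then show "norm (mip M (mlact M b x) (mlact M b x)) \<le> (norm b * mnorm M x)\<^sup>2"
    by (simp add: power_mult_distrib mnorm_square)
qed simp

text \<open>Substitute for equality of vectors: rearrangements such as x - z = (x - y) + (y - z)
  hold only modulo null vectors here, which is enough for norms.\<close>

lemma mnorm_cong:
  "x \<in> mcarrier M \<Longrightarrow> y \<in> mcarrier M \<Longrightarrow> (\<And>z. z \<in> mcarrier M \<Longrightarrow> mip M z x = mip M z y) \<Longrightarrow>
    mnorm M x = mnorm M y"
  unfolding mnorm_def by (metis ip_star)

lemma mdist_nonneg [simp]: "0 \<le> mdist M x y"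
  by (simp add: mdist_def)

lemma mdist_self [simp]: "x \<in> mcarrier M \<Longrightarrow> mdist M x x = 0"
  by (simp add: mdist_def mnorm_eq_0 ip_simps)

lemma mdist_commute: "x \<in> mcarrier M \<Longrightarrow> y \<in> mcarrier M \<Longrightarrow> mdist M x y = mdist M y x"
  unfolding mdist_def mnorm_def by (simp add: ip_simps algebra_simps)

lemma mdist_triangle:
  assumes "x \<in> mcarrier M" "y \<in> mcarrier M" "z \<in> mcarrier M"
  shows "mdist M x z \<le> mdist M x y + mdist M y z"
proof -
  have "mdist M x z = mnorm M (madd M (msub M x y) (msub M y z))"
    unfolding mdist_def using assms by (intro mnorm_cong) (auto simp: ip_simps)
  also have "\<dots> \<le> mdist M x y + mdist M y z"
    unfolding mdist_def using assms by (intro mnorm_add_le) auto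
  finally show ?thesis .
qed

lemma mdist_add_le:
  assumes "x \<in> mcarrier M" "y \<in> mcarrier M" "x' \<in> mcarrier M" "y' \<in> mcarrier M"
  shows "mdist M (madd M x y) (madd M x' y') \<le> mdist M x x' + mdist M y y'"
proof -
  have "mdist M (madd M x y) (madd M x' y') = mnorm M (madd M (msub M x x') (msub M y y'))"
    unfolding mdist_def using assms by (intro mnorm_cong) (auto simp: ip_simps)
  also have "\<dots> \<le> mdist M x x' + mdist M y y'"
    unfolding mdist_def using assms by (intro mnorm_add_le) auto
  finally show ?thesis .
qed

lemma mdist_ract_le:
  assumes "x \<in> mcarrier M" "y \<in> mcarrier M"
  shows "mdist M (mract M x b) (mract M y b) \<le> mdist M x y * norm b"
proof -
  have "mdist M (mract M x b) (mract M y b) = mnorm M (mract M (msub M x y) b)"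
    unfolding mdist_def using assms by (intro mnorm_cong) (auto simp: ip_simps left_diff_distrib)
  then show ?thesis
    unfolding mdist_def using assms by (simp add: mnorm_ract_le)
qed

lemma mdist_lact_le:
  assumes "x \<in> mcarrier M" "y \<in> mcarrier M"
  shows "mdist M (mlact M b x) (mlact M b y) \<le> norm b * mdist M x y"
proof -
  have "mdist M (mlact M b x) (mlact M b y) = mnorm M (mlact M b (msub M x y))"
    unfolding mdist_def using assms
    by (intro mnorm_cong) (auto simp: ip_simps ip_lact_sub_right)
  then show ?thesis
    unfolding mdist_def using assms by (simp add: mnorm_lact_le)
qed

lemma mdist_zero_right: "x \<in> mcarrier M \<Longrightarrow> mdist M x (mzero M) = mnorm M x"
  unfolding mdist_def by (intro mnorm_cong) (auto simp: ip_simps ip_zero_right)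

lemma mnorm_diff_le: "x \<in> mcarrier M \<Longrightarrow> y \<in> mcarrier M \<Longrightarrow> mnorm M x \<le> mnorm M y + mdist M x y"
  using mdist_triangle[of x y "mzero M"] by (simp add: mdist_zero_right)

lemma ip_diff_le:
  assumes "x \<in> mcarrier M" "y \<in> mcarrier M" "x' \<in> mcarrier M" "y' \<in> mcarrier M"
  shows "norm (mip M x y - mip M x' y') \<le> mdist M x x' * mnorm M y + mnorm M x' * mdist M y y'"
proof -
  have "mip M x y - mip M x' y' = mip M (msub M x x') y + mip M x' (msub M y y')"
    using assms by (simp add: ip_simps)
  also have "norm \<dots> \<le> mdist M x x' * mnorm M y + mnorm M x' * mdist M y y'"
    unfolding mdist_def using assms by (intro norm_triangle_le add_mono Cauchy_Schwarz) auto
  finally show ?thesis .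
qed

lemma ip_eq_if_mdist_0:
  assumes "x \<in> mcarrier M" "y \<in> mcarrier M" "x' \<in> mcarrier M" "y' \<in> mcarrier M"
    and "mdist M x x' = 0" "mdist M y y' = 0"
  shows "mip M x y = mip M x' y'"
  using ip_diff_le[OF assms(1-4)] assms(5,6) by simp

lemma mdist_eq_0_if_ip_eq:
  assumes "x \<in> mcarrier M" "y \<in> mcarrier M" "\<And>z. z \<in> mcarrier M \<Longrightarrow> mip M z x = mip M z y"
  shows "mdist M x y = 0"
  unfolding mdist_def mnorm_eq_0 using assms by (simp add: ip_sub_right)

lemma mdist_square:
  "x \<in> mcarrier M \<Longrightarrow> y \<in> mcarrier M \<Longrightarrow>
    (mdist M x y)\<^sup>2 = norm (mip M x x - mip M x y - (mip M y x - mip M y y))"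
  unfolding mdist_def mnorm_square by (simp add: ip_simps algebra_simps)

lemma null_rel_iff: "(x, y) \<in> null_rel M \<longleftrightarrow> x \<in> mcarrier M \<and> y \<in> mcarrier M \<and> mdist M x y = 0"
  unfolding null_rel_def mdist_def by (simp add: mnorm_eq_0)

lemma equiv_null_rel: "equiv (mcarrier M) (null_rel M)"
proof (rule equivI)
  show "null_rel M \<subseteq> mcarrier M \<times> mcarrier M" unfolding null_rel_def by blast
  show "refl_on (mcarrier M) (null_rel M)"
    by (rule refl_onI) (auto simp: null_rel_iff)
  show "sym (null_rel M)"
    by (rule symI) (auto simp: null_rel_iff mdist_commute)
  show "trans (null_rel M)"
  proof (rule transI)
    fix x y z assume "(x, y) \<in> null_rel M" "(y, z) \<in> null_rel M"
    then show "(x, z) \<in> null_rel M"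
      using mdist_triangle[of x y z] mdist_nonneg[of x z] unfolding null_rel_iff by auto
  qed
qed

lemma null_class_eq_iff:
  "x \<in> mcarrier M \<Longrightarrow> y \<in> mcarrier M \<Longrightarrow> null_rel M `` {x} = null_rel M `` {y} \<longleftrightarrow> mdist M x y = 0"
  using eq_equiv_class_iff[OF equiv_null_rel] by (simp add: null_rel_iff)

end

lemma hilbert_semi_bimod: "hilbert_bimodule M \<Longrightarrow> semi_bimod M"
proof -
  assume "hilbert_bimodule M"
  then interpret hilbert_bimodule M .
  show "semi_bimod M"
  proof
    fix x assume "x \<in> mcarrier M"
    then have "mip M x (mzero M) + mip M x (mzero M) = mip M x (mzero M)"
      by (metis ip_add_right zero_closed add_zero)
    then show "mip M x (mzero M) = 0" by simp
  qed (simp_all add: add_closed zero_closed ract_closed lact_closed ip_add_right ip_ract_right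
      ip_star ip_positive ip_lact lact_add_left lact_mult lact_one scalar)
qed

locale pre_hilbert_bimod = semi_bimod +
  assumes eq_if_mdist_0: "x \<in> mcarrier M \<Longrightarrow> y \<in> mcarrier M \<Longrightarrow> mdist M x y = 0 \<Longrightarrow> x = y"
begin

lemma ip_ext:
  "x \<in> mcarrier M \<Longrightarrow> y \<in> mcarrier M \<Longrightarrow> (\<And>z. z \<in> mcarrier M \<Longrightarrow> mip M z x = mip M z y) \<Longrightarrow> x = y"
  by (intro eq_if_mdist_0 mdist_eq_0_if_ip_eq)

text \<open>By \<open>ip_ext\<close>, vectors with the same inner products coincide in a definite
  bimodule, so every law that \<open>semi_bimod\<close> states weakly becomes an equation.\<close>

lemma hilbert_bimoduleI:
  assumes "\<And>s. s \<in> mCauchy M \<Longrightarrow> \<exists>l. mconv M s l"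
  shows "hilbert_bimodule M"
proof
  fix x y z and a b :: 'a and c
  assume x: "x \<in> mcarrier M"
  show "madd M x (mzero M) = x"
    using x by (intro ip_ext) (auto simp: ip_simps ip_zero_right)
  show "mlact M (scaleC c 1) x = mract M x (scaleC c 1)"
    using x by (intro ip_ext) (auto simp: ip_simps ip_scalar)
  show "mract M x (a + b) = madd M (mract M x a) (mract M x b)"
    "mract M x (a * b) = mract M (mract M x a) b" "mract M x 1 = x"
    "mlact M (a + b) x = madd M (mlact M a x) (mlact M b x)"
    "mlact M (a * b) x = mlact M a (mlact M b x)" "mlact M 1 x = x"
    "mlact M a (mract M x b) = mract M (mlact M a x) b"
    using x by - (intro ip_ext, auto simp: ip_simps ip_lact_add ip_lact_mult ip_lact_one
        ip_lact_ract distrib_left mult.assoc)+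
  show "\<exists>y\<in>mcarrier M. madd M x y = mzero M"
    using x by (intro bexI[of _ "mlact M (- 1) x"] ip_ext)
      (auto simp: ip_simps ip_zero_right ip_lact_minus ip_lact_one)
  show "mip M x x = 0 \<Longrightarrow> x = mzero M"
    using x by (intro eq_if_mdist_0) (auto simp: mdist_zero_right mnorm_eq_0)
  assume y: "y \<in> mcarrier M"
  show "madd M x y = madd M y x"
    "mract M (madd M x y) b = madd M (mract M x b) (mract M y b)"
    "mlact M b (madd M x y) = madd M (mlact M b x) (mlact M b y)"
    using x y by - (intro ip_ext, auto simp: ip_simps ip_lact_add_right distrib_right)+
  assume z: "z \<in> mcarrier M"
  show "madd M (madd M x y) z = madd M x (madd M y z)"
    using x y z by (intro ip_ext) (auto simp: ip_simps)
qed (use assms in \<open>auto simp: ip_simps ip_star ip_positive ip_lact\<close>)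

end

lemma hilbert_pre_hilbert_bimod: "hilbert_bimodule M \<Longrightarrow> pre_hilbert_bimod M"
proof -
  assume H: "hilbert_bimodule M"
  interpret H: hilbert_bimodule M by fact
  interpret semi_bimod M by (rule hilbert_semi_bimod) fact
  show "pre_hilbert_bimod M"
  proof
    fix x y assume xy: "x \<in> mcarrier M" "y \<in> mcarrier M" and "mdist M x y = 0"
    then have "msub M x y = mzero M"
      unfolding mdist_def by (intro H.ip_definite) (auto simp: mnorm_eq_0)
    moreover have "madd M (mlact M (- 1) y) y = mzero M"
      using xy by (intro H.ip_definite) (auto simp: ip_simps ip_lact_minus ip_lact_one)
    moreover have "madd M (msub M x y) y = madd M x (madd M (mlact M (- 1) y) y)"
      unfolding msub_def using xy by (simp add: H.add_assoc)
    ultimately show "x = y"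
      using xy by (metis H.add_comm H.add_zero zero_closed)
  qed
qed

section \<open>Quotients and completions\<close>

text \<open>Covers two constructions at once: the quotient by null vectors, and the completion,
  which is the quotient of the bimodule of Cauchy sequences by its null vectors.\<close>

locale bimod_separation = M: semi_bimod M
  for M :: "('b::unital_cstar_algebra, 'm) bimod" and Q :: "('b, 'q) bimod" and \<pi> :: "'m \<Rightarrow> 'q" +
  assumes carrier: "mcarrier Q = \<pi> ` mcarrier M"
    and eq_iff: "x \<in> mcarrier M \<Longrightarrow> y \<in> mcarrier M \<Longrightarrow> \<pi> x = \<pi> y \<longleftrightarrow> mdist M x y = 0"
    and add: "x \<in> mcarrier M \<Longrightarrow> y \<in> mcarrier M \<Longrightarrow> madd Q (\<pi> x) (\<pi> y) = \<pi> (madd M x y)"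
    and zero: "mzero Q = \<pi> (mzero M)"
    and lact: "x \<in> mcarrier M \<Longrightarrow> mlact Q b (\<pi> x) = \<pi> (mlact M b x)"
    and ract: "x \<in> mcarrier M \<Longrightarrow> mract Q (\<pi> x) b = \<pi> (mract M x b)"
    and ip: "x \<in> mcarrier M \<Longrightarrow> y \<in> mcarrier M \<Longrightarrow> mip Q (\<pi> x) (\<pi> y) = mip M x y"
begin

lemma sub: "x \<in> mcarrier M \<Longrightarrow> y \<in> mcarrier M \<Longrightarrow> msub Q (\<pi> x) (\<pi> y) = \<pi> (msub M x y)"
  by (simp add: msub_def add lact)

lemma norm: "x \<in> mcarrier M \<Longrightarrow> mnorm Q (\<pi> x) = mnorm M x"
  by (simp add: mnorm_def ip)

lemma dist: "x \<in> mcarrier M \<Longrightarrow> y \<in> mcarrier M \<Longrightarrow> mdist Q (\<pi> x) (\<pi> y) = mdist M x y"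
  by (simp add: mdist_def sub norm)

lemma pre_hilbert: "pre_hilbert_bimod Q"
proof
  fix x y assume "x \<in> mcarrier Q" "y \<in> mcarrier Q" "mdist Q x y = 0"
  then show "x = y" unfolding carrier by (auto simp: dist eq_iff)
qed (auto simp: carrier add zero lact ract ip M.ip_add_right M.ip_zero_right M.ip_ract_right
    M.ip_star M.ip_positive M.ip_lact M.ip_lact_add M.ip_lact_mult M.ip_lact_one M.ip_scalar)

end

lemma (in semi_bimod) bimod_separationI:
  assumes Q: "mcarrier Q = mcarrier M // null_rel M"
    "madd Q = (\<lambda>X Y. \<Union>x\<in>X. \<Union>y\<in>Y. null_rel M `` {madd M x y})"
    "mzero Q = null_rel M `` {mzero M}"
    "mlact Q = (\<lambda>b X. \<Union>x\<in>X. null_rel M `` {mlact M b x})"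
    "mract Q = (\<lambda>X b. \<Union>x\<in>X. null_rel M `` {mract M x b})"
    and ip: "\<And>x y. x \<in> mcarrier M \<Longrightarrow> y \<in> mcarrier M \<Longrightarrow>
      mip Q (null_rel M `` {x}) (null_rel M `` {y}) = mip M x y"
  shows "bimod_separation M Q (\<lambda>x. null_rel M `` {x})"
proof
  note equiv_null_rel [simp]
  show "mcarrier Q = (\<lambda>x. null_rel M `` {x}) ` mcarrier M"
    unfolding Q quotient_def by blast
  fix x y b assume x: "x \<in> mcarrier M"
  have x': "x \<in> null_rel M `` {x}" using x by (simp add: null_rel_iff)
  have "null_rel M `` {mlact M b z} = null_rel M `` {mlact M b x}" if "z \<in> null_rel M `` {x}" for z
    using that mdist_lact_le[of z x b] x
    by (auto simp: null_rel_iff null_class_eq_iff mdist_commute order_antisym)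
  then show "mlact Q b (null_rel M `` {x}) = null_rel M `` {mlact M b x}"
    unfolding Q using x' by blast
  have "null_rel M `` {mract M z b} = null_rel M `` {mract M x b}" if "z \<in> null_rel M `` {x}" for z
    using that mdist_ract_le[of z x b] x
    by (auto simp: null_rel_iff null_class_eq_iff mdist_commute order_antisym)
  then show "mract Q (null_rel M `` {x}) b = null_rel M `` {mract M x b}"
    unfolding Q using x' by blast
  assume y: "y \<in> mcarrier M"
  have y': "y \<in> null_rel M `` {y}" using y by (simp add: null_rel_iff)
  have "null_rel M `` {madd M z w} = null_rel M `` {madd M x y}"
    if "z \<in> null_rel M `` {x}" "w \<in> null_rel M `` {y}" for z w
    using that mdist_add_le[of z w x y] x y
    by (auto simp: null_rel_iff null_class_eq_iff mdist_commute order_antisym)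
  then show "madd Q (null_rel M `` {x}) (null_rel M `` {y}) = null_rel M `` {madd M x y}"
    unfolding Q using x' y' by blast
qed (use Q ip in \<open>auto simp: null_class_eq_iff\<close>)

lemma (in semi_bimod) quotient_separation:
  "bimod_separation M (quotient_bimod M) (\<lambda>x. null_rel M `` {x})"
proof (rule bimod_separationI)
  fix x y assume xy: "x \<in> mcarrier M" "y \<in> mcarrier M"
  have *: "mip M z w = mip M x y" if "z \<in> null_rel M `` {x}" "w \<in> null_rel M `` {y}" for z w
    using that xy by (intro ip_eq_if_mdist_0) (auto simp: null_rel_iff mdist_commute)
  have "x \<in> null_rel M `` {x}" "y \<in> null_rel M `` {y}" using xy by (simp_all add: null_rel_iff)
  then show "mip (quotient_bimod M) (null_rel M `` {x}) (null_rel M `` {y}) = mip M x y"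
    unfolding quotient_bimod_def bimod.simps by (intro the_equality) (use * in blast)+
qed (simp_all add: quotient_bimod_def)

section \<open>Completion as the separation of the Cauchy sequences\<close>

definition cauchy_bimod :: "('b::unital_cstar_algebra, 'm) bimod \<Rightarrow> ('b, nat \<Rightarrow> 'm) bimod" where
  "cauchy_bimod M = \<lparr>
     mcarrier = mCauchy M,
     madd = (\<lambda>s r n. madd M (s n) (r n)),
     mzero = (\<lambda>n. mzero M),
     mlact = (\<lambda>b s n. mlact M b (s n)),
     mract = (\<lambda>s b n. mract M (s n) b),
     mip = (\<lambda>s r. lim (\<lambda>n. mip M (s n) (r n))) \<rparr>"

lemma cauchy_bimod_simps [simp]:
  "mcarrier (cauchy_bimod M) = mCauchy M"
  "madd (cauchy_bimod M) = (\<lambda>s r n. madd M (s n) (r n))"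
  "mzero (cauchy_bimod M) = (\<lambda>n. mzero M)"
  "mlact (cauchy_bimod M) = (\<lambda>b s n. mlact M b (s n))"
  "mract (cauchy_bimod M) = (\<lambda>s b n. mract M (s n) b)"
  "mip (cauchy_bimod M) = (\<lambda>s r. lim (\<lambda>n. mip M (s n) (r n)))"
  by (simp_all add: cauchy_bimod_def)

context semi_bimod
begin

lemma mCauchy_closed: "s \<in> mCauchy M \<Longrightarrow> s n \<in> mcarrier M"
  unfolding mCauchy_def by blast

lemma mCauchyD:
  "s \<in> mCauchy M \<Longrightarrow> 0 < e \<Longrightarrow> \<exists>N. \<forall>m\<ge>N. \<forall>n\<ge>N. mdist M (s m) (s n) < e"
  unfolding mCauchy_def by blast

lemma mCauchyI:
  "(\<And>n. s n \<in> mcarrier M) \<Longrightarrow>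
    (\<And>e. 0 < e \<Longrightarrow> \<exists>N. \<forall>m\<ge>N. \<forall>n\<ge>N. mdist M (s m) (s n) < e) \<Longrightarrow> s \<in> mCauchy M"
  unfolding mCauchy_def by blast

lemma mCauchyI_le:
  assumes "\<And>n. s n \<in> mcarrier M" "r \<in> mCauchy M" "t \<in> mCauchy M"
    and le: "\<And>m n. mdist M (s m) (s n) \<le> K * (mdist M (r m) (r n) + mdist M (t m) (t n))"
  shows "s \<in> mCauchy M"
proof (rule mCauchyI)
  fix e :: real assume e: "0 < e"
  define d where "d = e / (\<bar>K\<bar> + 1) / 2"
  have K: "0 < \<bar>K\<bar> + 1" using abs_ge_zero[of K] by linarith
  then have d: "0 < d" using e unfolding d_def by simp
  obtain N where N: "\<forall>m\<ge>N. \<forall>n\<ge>N. mdist M (r m) (r n) < d"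
    using mCauchyD[OF assms(2) d] by blast
  obtain N' where N': "\<forall>m\<ge>N'. \<forall>n\<ge>N'. mdist M (t m) (t n) < d"
    using mCauchyD[OF assms(3) d] by blast
  have "mdist M (s m) (s n) < e" if "m \<ge> max N N'" "n \<ge> max N N'" for m n
  proof -
    have "mdist M (s m) (s n) \<le> K * (mdist M (r m) (r n) + mdist M (t m) (t n))" by (rule le)
    also have "\<dots> \<le> (\<bar>K\<bar> + 1) * (mdist M (r m) (r n) + mdist M (t m) (t n))"
      by (intro mult_right_mono) auto
    also have "\<dots> < (\<bar>K\<bar> + 1) * (d + d)"
      using N N' that by (intro mult_strict_left_mono add_strict_mono) auto
    also have "\<dots> = e" unfolding d_def field_sum_of_halves using K by simp
    finally show ?thesis .
  qed
  then show "\<exists>N. \<forall>m\<ge>N. \<forall>n\<ge>N. mdist M (s m) (s n) < e" by blast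
qed (rule assms)

lemma mCauchy_const: "x \<in> mcarrier M \<Longrightarrow> (\<lambda>n. x) \<in> mCauchy M"
  by (rule mCauchyI) auto

lemma mCauchy_add:
  "s \<in> mCauchy M \<Longrightarrow> r \<in> mCauchy M \<Longrightarrow> (\<lambda>n. madd M (s n) (r n)) \<in> mCauchy M"
  by (rule mCauchyI_le[of _ s r 1]) (auto simp: mCauchy_closed mdist_add_le)

lemma mCauchy_ract: "s \<in> mCauchy M \<Longrightarrow> (\<lambda>n. mract M (s n) b) \<in> mCauchy M"
  by (rule mCauchyI_le[of _ s s "norm b"])
    (auto simp: mCauchy_closed distrib_left mult.commute intro!: order_trans[OF mdist_ract_le])

lemma mCauchy_lact: "s \<in> mCauchy M \<Longrightarrow> (\<lambda>n. mlact M b (s n)) \<in> mCauchy M"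
  by (rule mCauchyI_le[of _ s s "norm b"])
    (auto simp: mCauchy_closed distrib_left intro!: order_trans[OF mdist_lact_le])

lemma mCauchy_bounded:
  assumes s: "s \<in> mCauchy M"
  obtains B where "0 \<le> B" "\<And>n. mnorm M (s n) \<le> B"
proof -
  obtain N where N: "\<forall>m\<ge>N. \<forall>n\<ge>N. mdist M (s m) (s n) < 1"
    using mCauchyD[OF s, of 1] by auto
  define B where "B = mnorm M (s N) + 1 + (\<Sum>k<N. mnorm M (s k))"
  have "mnorm M (s n) \<le> B" for n
  proof (cases "n < N")
    case True
    then have "mnorm M (s n) \<le> (\<Sum>k<N. mnorm M (s k))"
      by (intro member_le_sum) auto
    then show ?thesis unfolding B_def by (simp add: add_increasing)
  next
    case False
    then have "mnorm M (s n) \<le> mnorm M (s N) + 1"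
      using N mnorm_diff_le[of "s n" "s N"] mCauchy_closed[OF s] by (smt (verit) linorder_not_less order_refl)
    then show ?thesis unfolding B_def by (simp add: add_increasing2 sum_nonneg)
  qed
  moreover have "0 \<le> B" unfolding B_def by (simp add: sum_nonneg)
  ultimately show thesis using that by blast
qed

lemma ip_Cauchy_convergent:
  assumes s: "s \<in> mCauchy M" and r: "r \<in> mCauchy M"
  shows "convergent (\<lambda>n. mip M (s n) (r n))"
proof -
  obtain B where B: "0 \<le> B" "\<And>n. mnorm M (s n) \<le> B" using mCauchy_bounded[OF s] by blast
  obtain C where C: "0 \<le> C" "\<And>n. mnorm M (r n) \<le> C" using mCauchy_bounded[OF r] by blast
  have "Cauchy (\<lambda>n. mip M (s n) (r n))"
  proof (rule CauchyI)
    fix e :: real assume e: "0 < e"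
    define d where "d = e / (B + C + 1)"
    have d: "0 < d" using e B C unfolding d_def by simp
    obtain N where N: "\<forall>m\<ge>N. \<forall>n\<ge>N. mdist M (s m) (s n) < d" using mCauchyD[OF s d] by blast
    obtain N' where N': "\<forall>m\<ge>N'. \<forall>n\<ge>N'. mdist M (r m) (r n) < d" using mCauchyD[OF r d] by blast
    have "norm (mip M (s m) (r m) - mip M (s n) (r n)) < e" if "m \<ge> max N N'" "n \<ge> max N N'" for m n
    proof -
      have "norm (mip M (s m) (r m) - mip M (s n) (r n))
          \<le> mdist M (s m) (s n) * mnorm M (r m) + mnorm M (s n) * mdist M (r m) (r n)"
        by (intro ip_diff_le mCauchy_closed s r)
      also have "\<dots> \<le> d * C + B * d"
        using N N' that B C d by (intro add_mono mult_mono) (auto intro: less_imp_le)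
      also have "\<dots> < d * (B + C + 1)" using d by (simp add: algebra_simps)
      also have "\<dots> = e" unfolding d_def using B C by simp
      finally show ?thesis .
    qed
    then show "\<exists>M'. \<forall>m\<ge>M'. \<forall>n\<ge>M'. norm (mip M (s m) (r m) - mip M (s n) (r n)) < e" by blast
  qed
  then show ?thesis by (rule Cauchy_convergent)
qed

lemma ip_Cauchy_LIMSEQ:
  "s \<in> mCauchy M \<Longrightarrow> r \<in> mCauchy M \<Longrightarrow>
    (\<lambda>n. mip M (s n) (r n)) \<longlonglongrightarrow> lim (\<lambda>n. mip M (s n) (r n))"
  using ip_Cauchy_convergent convergent_LIMSEQ_iff by blast

lemma cauchy_semi_bimod: "semi_bimod (cauchy_bimod M)"
proof
  note [simp] = mCauchy_closed
  fix s r t and a b c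
  assume s: "s \<in> mcarrier (cauchy_bimod M)"
  then have s [simp]: "s \<in> mCauchy M" by simp
  show "mip (cauchy_bimod M) s (mzero (cauchy_bimod M)) = 0"
    by (simp add: ip_zero_right)
  have "positive (lim (\<lambda>n. mip M (s n) (s n)))"
    by (rule positive_LIMSEQ[OF ip_Cauchy_LIMSEQ]) (auto intro: ip_positive)
  then show "positive (mip (cauchy_bimod M) s s)" by simp
  assume "r \<in> mcarrier (cauchy_bimod M)"
  then have r [simp]: "r \<in> mCauchy M" by simp
  note L = ip_Cauchy_LIMSEQ[OF s r]
  show "star (mip (cauchy_bimod M) s r) = mip (cauchy_bimod M) r s"
    using tendsto_star[OF L] by (simp add: ip_star limI)
  show "mip (cauchy_bimod M) s (mract (cauchy_bimod M) r b) = mip (cauchy_bimod M) s r * b"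
    using tendsto_mult_right[OF L, of b] by (simp add: ip_ract_right limI)
  show "mip (cauchy_bimod M) s (mlact (cauchy_bimod M) (scaleC c 1) r) = mip (cauchy_bimod M) s r * scaleC c 1"
    using tendsto_mult_right[OF L, of "scaleC c 1"] by (simp add: ip_scalar limI)
  show "mip (cauchy_bimod M) s (mlact (cauchy_bimod M) (a + b) r) =
      mip (cauchy_bimod M) s (mlact (cauchy_bimod M) a r) + mip (cauchy_bimod M) s (mlact (cauchy_bimod M) b r)"
    using tendsto_add[OF ip_Cauchy_LIMSEQ[OF s mCauchy_lact[OF r, of a]]
        ip_Cauchy_LIMSEQ[OF s mCauchy_lact[OF r, of b]]]
    by (simp add: ip_lact_add limI)
  assume "t \<in> mcarrier (cauchy_bimod M)"
  then have t [simp]: "t \<in> mCauchy M" by simp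
  show "mip (cauchy_bimod M) s (madd (cauchy_bimod M) r t) =
      mip (cauchy_bimod M) s r + mip (cauchy_bimod M) s t"
    using tendsto_add[OF L ip_Cauchy_LIMSEQ[OF s t]] by (simp add: ip_add_right limI)
qed (simp_all add: mCauchy_closed mCauchy_add mCauchy_lact mCauchy_ract mCauchy_const
    ip_lact ip_lact_mult ip_lact_one)

lemma cauchy_norm_LIMSEQ:
  assumes "s \<in> mCauchy M"
  shows "(\<lambda>n. mnorm M (s n)) \<longlonglongrightarrow> mnorm (cauchy_bimod M) s"
  unfolding mnorm_def
  using tendsto_real_sqrt[OF tendsto_norm[OF ip_Cauchy_LIMSEQ[OF assms assms]]] by simp

lemma cauchy_dist_LIMSEQ:
  assumes "s \<in> mCauchy M" "r \<in> mCauchy M"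
  shows "(\<lambda>n. mdist M (s n) (r n)) \<longlonglongrightarrow> mdist (cauchy_bimod M) s r"
  using cauchy_norm_LIMSEQ[of "\<lambda>n. msub M (s n) (r n)"] assms
  by (simp add: mdist_def msub_def mCauchy_add mCauchy_lact)

text \<open>The distance in \<open>cauchy_bimod\<close> is the limit of the termwise distances. This
  identifies the completion as an instance of the separation construction.\<close>

lemma null_rel_cauchy_bimod: "null_rel (cauchy_bimod M) = cauchy_rel M"
proof -
  interpret C: semi_bimod "cauchy_bimod M" by (rule cauchy_semi_bimod)
  have "(s, r) \<in> null_rel (cauchy_bimod M) \<longleftrightarrow> (s, r) \<in> cauchy_rel M" for s r
    using cauchy_dist_LIMSEQ[of s r] LIMSEQ_unique
    unfolding C.null_rel_iff cauchy_rel_def by auto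
  then show ?thesis by auto
qed

lemma completion_separation:
  "bimod_separation (cauchy_bimod M) (completion_bimod M) (\<lambda>s. cauchy_rel M `` {s})"
proof -
  interpret C: semi_bimod "cauchy_bimod M" by (rule cauchy_semi_bimod)
  have "bimod_separation (cauchy_bimod M) (completion_bimod M) (\<lambda>s. null_rel (cauchy_bimod M) `` {s})"
  proof (rule C.bimod_separationI)
    fix s r assume "s \<in> mcarrier (cauchy_bimod M)" "r \<in> mcarrier (cauchy_bimod M)"
    then have sr: "s \<in> mCauchy M" "r \<in> mCauchy M" by auto
    have *: "mip (cauchy_bimod M) s' r' = mip (cauchy_bimod M) s r"
      if "(s, s') \<in> null_rel (cauchy_bimod M)" "(r, r') \<in> null_rel (cauchy_bimod M)" for s' r'
      using that sr by (intro C.ip_eq_if_mdist_0) (auto simp: C.null_rel_iff C.mdist_commute)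
    have self: "(s, s) \<in> null_rel (cauchy_bimod M)" "(r, r) \<in> null_rel (cauchy_bimod M)"
      using sr by (simp_all add: C.null_rel_iff)
    have lims: "(\<lambda>n. mip M (s' n) (r' n)) \<longlonglongrightarrow> b \<longleftrightarrow> b = mip (cauchy_bimod M) s r"
      if "(s, s') \<in> null_rel (cauchy_bimod M)" "(r, r') \<in> null_rel (cauchy_bimod M)" for s' r' b
      using *[OF that] ip_Cauchy_LIMSEQ[of s' r'] that LIMSEQ_unique
      unfolding C.null_rel_iff by auto
    have "(THE b. \<exists>s'\<in>null_rel (cauchy_bimod M) `` {s}. \<exists>r'\<in>null_rel (cauchy_bimod M) `` {r}.
        (\<lambda>n. mip M (s' n) (r' n)) \<longlonglongrightarrow> b) = mip (cauchy_bimod M) s r"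
      by (intro the_equality) (use lims self in blast)+
    then show "mip (completion_bimod M) (null_rel (cauchy_bimod M) `` {s}) (null_rel (cauchy_bimod M) `` {r})
        = mip (cauchy_bimod M) s r"
      by (simp add: completion_bimod_def)
  qed (simp_all add: completion_bimod_def null_rel_cauchy_bimod)
  then show ?thesis by (simp only: null_rel_cauchy_bimod)
qed

lemma completion_dense_const:
  assumes X: "X \<in> mcarrier (completion_bimod M)" and e: "0 < e"
  shows "\<exists>x\<in>mcarrier M. mdist (completion_bimod M) X (cauchy_rel M `` {\<lambda>n. x}) < e"
proof -
  interpret S: bimod_separation "cauchy_bimod M" "completion_bimod M" "\<lambda>s. cauchy_rel M `` {s}"
    by (rule completion_separation)
  obtain s where s: "s \<in> mCauchy M" "X = cauchy_rel M `` {s}"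
    using X unfolding S.carrier by auto
  \<comment> \<open>A term far out in a representing sequence, repeated constantly, is the
    approximation.\<close>
  obtain N where N: "\<forall>m\<ge>N. \<forall>n\<ge>N. mdist M (s m) (s n) < e / 2"
    using mCauchyD[OF s(1), of "e / 2"] e by auto
  have x: "s N \<in> mcarrier M" using s mCauchy_closed by blast
  have "mdist (cauchy_bimod M) s (\<lambda>n. s N) \<le> e / 2"
    using N by (intro LIMSEQ_le_const2[OF cauchy_dist_LIMSEQ] exI[of _ N])
      (auto intro: less_imp_le s mCauchy_const x)
  then show ?thesis
    using s x e mCauchy_const[OF x] by (intro bexI[of _ "s N"]) (simp_all add: S.dist)
qed

text \<open>Completeness: approximate the members of a Cauchy sequence by constants.\<close>

theorem completion_complete:
  assumes X: "X \<in> mCauchy (completion_bimod M)"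
  shows "\<exists>l. mconv (completion_bimod M) X l"
proof -
  let ?H = "completion_bimod M" and ?c = "\<lambda>x. cauchy_rel M `` {\<lambda>n. x}"
  interpret S: bimod_separation "cauchy_bimod M" "completion_bimod M" "\<lambda>s. cauchy_rel M `` {s}"
    by (rule completion_separation)
  interpret H: pre_hilbert_bimod ?H by (rule S.pre_hilbert)
  have "\<exists>x\<in>mcarrier M. mdist ?H (X n) (?c x) < inverse (real (Suc n))" for n
    using X H.mCauchy_closed by (intro completion_dense_const) auto
  then obtain x where x: "\<And>n. x n \<in> mcarrier M"
    and Xx: "\<And>n. mdist ?H (X n) (?c (x n)) < inverse (real (Suc n))" by metis
  have c: "?c y \<in> mcarrier ?H" if "y \<in> mcarrier M" for y
    unfolding S.carrier using mCauchy_const[OF that] by simp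
  have cdist: "mdist ?H (?c y) (?c z) = mdist M y z" if "y \<in> mcarrier M" "z \<in> mcarrier M" for y z
    using that cauchy_dist_LIMSEQ[of "\<lambda>n. y" "\<lambda>n. z"]
    by (simp add: S.dist mCauchy_const LIMSEQ_const_iff)
  have small: "\<exists>N. \<forall>n\<ge>N. inverse (real (Suc n)) < e" if "0 < e" for e :: real
  proof -
    obtain N where N: "inverse (real (Suc N)) < e" using reals_Archimedean[OF \<open>0 < e\<close>] by blast
    have "inverse (real (Suc n)) < e" if "N \<le> n" for n
      by (rule order.strict_trans1[OF le_imp_inverse_le N]) (use that in auto)
    then show ?thesis by blast
  qed
  have xC: "x \<in> mCauchy M"
  proof (rule mCauchyI)
    fix e :: real assume e: "0 < e"
    then have e3: "0 < e / 3" by simp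
    obtain N where N: "\<forall>m\<ge>N. \<forall>n\<ge>N. mdist ?H (X m) (X n) < e / 3" using H.mCauchyD[OF X e3] by blast
    obtain N' where N': "\<forall>n\<ge>N'. inverse (real (Suc n)) < e / 3" using small[OF e3] by blast
    have "mdist M (x m) (x n) < e" if "m \<ge> max N N'" "n \<ge> max N N'" for m n
    proof -
      have "mdist M (x m) (x n) = mdist ?H (?c (x m)) (?c (x n))" using cdist x by simp
      also have "\<dots> \<le> mdist ?H (X m) (?c (x m)) + mdist ?H (X m) (?c (x n))"
        using H.mdist_triangle[of "?c (x m)" "X m" "?c (x n)"] x c H.mCauchy_closed[OF X]
        by (simp add: H.mdist_commute)
      also have "mdist ?H (X m) (?c (x n)) \<le> mdist ?H (X m) (X n) + mdist ?H (X n) (?c (x n))"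
        using x c H.mCauchy_closed[OF X] by (intro H.mdist_triangle) auto
      finally have "mdist M (x m) (x n)
          \<le> mdist ?H (X m) (?c (x m)) + (mdist ?H (X m) (X n) + mdist ?H (X n) (?c (x n)))"
        by simp
      moreover have "mdist ?H (X m) (X n) < e / 3" "inverse (real (Suc m)) < e / 3" "inverse (real (Suc n)) < e / 3"
        using N N' that by auto
      ultimately show ?thesis
        using Xx[of m] Xx[of n] by linarith
    qed
    then show "\<exists>N. \<forall>m\<ge>N. \<forall>n\<ge>N. mdist M (x m) (x n) < e" by blast
  qed (rule x)
  define l where "l = cauchy_rel M `` {x}"
  have l: "l \<in> mcarrier ?H" unfolding S.carrier l_def using xC by simp
  have "(\<lambda>n. mdist ?H (X n) l) \<longlonglongrightarrow> 0"
  proof (rule LIMSEQ_I)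
    fix e :: real assume e: "0 < e"
    then have e2: "0 < e / 2" by simp
    obtain N where N: "\<forall>m\<ge>N. \<forall>n\<ge>N. mdist M (x m) (x n) < e / 2" using mCauchyD[OF xC e2] by blast
    obtain N' where N': "\<forall>n\<ge>N'. inverse (real (Suc n)) < e / 2" using small[OF e2] by blast
    have "mdist ?H (X n) l < e" if n: "n \<ge> max N N'" for n
    proof -
      have "mdist (cauchy_bimod M) (\<lambda>k. x n) x \<le> e / 2"
        using N n by (intro LIMSEQ_le_const2[OF cauchy_dist_LIMSEQ] exI[of _ N])
          (auto intro: less_imp_le xC mCauchy_const x)
      then have "mdist ?H (?c (x n)) l \<le> e / 2"
        unfolding l_def using xC x by (simp add: S.dist mCauchy_const)
      moreover have "mdist ?H (X n) l \<le> mdist ?H (X n) (?c (x n)) + mdist ?H (?c (x n)) l"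
        using x c l H.mCauchy_closed[OF X] by (intro H.mdist_triangle) auto
      moreover have "mdist ?H (X n) (?c (x n)) < e / 2"
        using N' n Xx[of n] by force
      ultimately show ?thesis by simp
    qed
    then show "\<exists>N. \<forall>n\<ge>N. norm (mdist ?H (X n) l - 0) < e"
      by (intro exI[of _ "max N N'"]) simp
  qed
  then show ?thesis using l unfolding mconv_def by blast
qed

end

section \<open>The Hilbert bimodule obtained from a semi-inner product\<close>

context semi_bimod
begin

lemma quotient_semi_bimod: "semi_bimod (quotient_bimod M)"
  using bimod_separation.pre_hilbert[OF quotient_separation] by (simp add: pre_hilbert_bimod_def)

theorem hilbert_hcompletion: "hilbert_bimodule (hcompletion M)"
proof -
  interpret Q: semi_bimod "quotient_bimod M" by (rule quotient_semi_bimod)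
  interpret H: pre_hilbert_bimod "hcompletion M"
    unfolding hcompletion_def by (rule bimod_separation.pre_hilbert[OF Q.completion_separation])
  show ?thesis
    by (rule H.hilbert_bimoduleI) (simp add: hcompletion_def Q.completion_complete)
qed

lemma hclass_closed: "x \<in> mcarrier M \<Longrightarrow> hclass M x \<in> mcarrier (hcompletion M)"
  and hclass_ip: "x \<in> mcarrier M \<Longrightarrow> y \<in> mcarrier M \<Longrightarrow>
    mip (hcompletion M) (hclass M x) (hclass M y) = mip M x y"
  and hclass_add: "x \<in> mcarrier M \<Longrightarrow> y \<in> mcarrier M \<Longrightarrow>
    madd (hcompletion M) (hclass M x) (hclass M y) = hclass M (madd M x y)"
  and hclass_lact: "x \<in> mcarrier M \<Longrightarrow> mlact (hcompletion M) b (hclass M x) = hclass M (mlact M b x)"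
  and hclass_ract: "x \<in> mcarrier M \<Longrightarrow> mract (hcompletion M) (hclass M x) b = hclass M (mract M x b)"
  and hclass_zero: "mzero (hcompletion M) = hclass M (mzero M)"
  and hclass_dense: "X \<in> mcarrier (hcompletion M) \<Longrightarrow> 0 < e \<Longrightarrow>
    \<exists>x\<in>mcarrier M. mdist (hcompletion M) X (hclass M x) < e"
proof -
  interpret Q: bimod_separation M "quotient_bimod M" "\<lambda>x. null_rel M `` {x}"
    by (rule quotient_separation)
  interpret Q': semi_bimod "quotient_bimod M" by (rule quotient_semi_bimod)
  interpret H: bimod_separation "cauchy_bimod (quotient_bimod M)" "completion_bimod (quotient_bimod M)"
    "\<lambda>s. cauchy_rel (quotient_bimod M) `` {s}"
    by (rule Q'.completion_separation)
  have C: "(\<lambda>n. null_rel M `` {x}) \<in> mCauchy (quotient_bimod M)" if "x \<in> mcarrier M" for x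
    by (rule Q'.mCauchy_const) (simp add: Q.carrier that)
  note simps = hcompletion_def hclass_def C
  show "hclass M x \<in> mcarrier (hcompletion M)" if "x \<in> mcarrier M" for x
    using that by (simp add: simps H.carrier)
  show "mip (hcompletion M) (hclass M x) (hclass M y) = mip M x y"
    if "x \<in> mcarrier M" "y \<in> mcarrier M" for x y
    using that by (simp add: simps H.ip Q.ip)
  show "madd (hcompletion M) (hclass M x) (hclass M y) = hclass M (madd M x y)"
    if "x \<in> mcarrier M" "y \<in> mcarrier M" for x y
    using that by (simp add: simps H.add Q.add)
  show "mlact (hcompletion M) b (hclass M x) = hclass M (mlact M b x)" if "x \<in> mcarrier M" for x b
    using that by (simp add: simps H.lact Q.lact)
  show "mract (hcompletion M) (hclass M x) b = hclass M (mract M x b)" if "x \<in> mcarrier M" for x b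
    using that by (simp add: simps H.ract Q.ract)
  show "mzero (hcompletion M) = hclass M (mzero M)"
    by (simp add: simps H.zero Q.zero)
  show "\<exists>x\<in>mcarrier M. mdist (hcompletion M) X (hclass M x) < e"
    if "X \<in> mcarrier (hcompletion M)" "0 < e" for X e
    using Q'.completion_dense_const[of X e] that by (auto simp: simps Q.carrier)
qed

lemma hclass_sub:
  "x \<in> mcarrier M \<Longrightarrow> y \<in> mcarrier M \<Longrightarrow>
    msub (hcompletion M) (hclass M x) (hclass M y) = hclass M (msub M x y)"
  by (simp add: msub_def hclass_add hclass_lact)

lemma hclass_norm: "x \<in> mcarrier M \<Longrightarrow> mnorm (hcompletion M) (hclass M x) = mnorm M x"
  by (simp add: mnorm_def hclass_ip)

lemma hclass_dist:
  "x \<in> mcarrier M \<Longrightarrow> y \<in> mcarrier M \<Longrightarrow>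
    mdist (hcompletion M) (hclass M x) (hclass M y) = mdist M x y"
  by (simp add: mdist_def hclass_sub hclass_norm)

end

lemma le_if_le_add_mult_epsilon:
  fixes r s K :: real
  assumes "\<And>e. 0 < e \<Longrightarrow> r \<le> s + K * e"
  shows "r \<le> s"
proof (rule field_le_epsilon)
  fix e :: real assume e: "0 < e"
  have K: "0 < \<bar>K\<bar> + 1" using abs_ge_zero[of K] by linarith
  have "r \<le> s + K * (e / (\<bar>K\<bar> + 1))" using e K by (intro assms) simp
  also have "\<dots> \<le> s + (\<bar>K\<bar> + 1) * (e / (\<bar>K\<bar> + 1))"
    using e K by (intro add_left_mono mult_right_mono) auto
  also have "\<dots> = s + e" using K by simp
  finally show "r \<le> s + e" .
qed

section \<open>Extension of Lipschitz maps to completions\<close>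

locale lipschitz_map = M: semi_bimod M + N: semi_bimod N
  for M :: "('b::unital_cstar_algebra, 'm) bimod" and N :: "('b, 'n) bimod" +
  fixes f :: "'m \<Rightarrow> 'n" and C :: real
  assumes closed [simp]: "x \<in> mcarrier M \<Longrightarrow> f x \<in> mcarrier N"
    and C_nonneg: "0 \<le> C"
    and lipschitz: "x \<in> mcarrier M \<Longrightarrow> y \<in> mcarrier M \<Longrightarrow> mdist N (f x) (f y) \<le> C * mdist M x y"
begin

sublocale HM: pre_hilbert_bimod "hcompletion M"
  by (intro hilbert_pre_hilbert_bimod M.hilbert_hcompletion)

sublocale HN: pre_hilbert_bimod "hcompletion N"
  by (intro hilbert_pre_hilbert_bimod N.hilbert_hcompletion)

declare M.hclass_closed [simp] N.hclass_closed [simp]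

text \<open>The value at X is characterised by its distances to the images of all classes instead of
  as a limit along a chosen sequence. The same inequality yields the Lipschitz bound and, for X =
  \<open>hclass M x\<close>, the value prescribed by f.\<close>

definition ext :: "'m hcompl \<Rightarrow> 'n hcompl" where
  "ext = (\<lambda>X\<in>mcarrier (hcompletion M). SOME Y. Y \<in> mcarrier (hcompletion N) \<and>
    (\<forall>x\<in>mcarrier M. mdist (hcompletion N) Y (hclass N (f x)) \<le> C * mdist (hcompletion M) X (hclass M x)))"

text \<open>Classes of elements x n approaching X have images forming a Cauchy sequence; the
  distance estimate for its limit Y is inherited from the Lipschitz bound between x n and the test
  element.\<close>

lemma ex_ext:
  assumes X: "X \<in> mcarrier (hcompletion M)"
  shows "\<exists>Y. Y \<in> mcarrier (hcompletion N) \<and>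
    (\<forall>x\<in>mcarrier M. mdist (hcompletion N) Y (hclass N (f x)) \<le> C * mdist (hcompletion M) X (hclass M x))"
proof -
  have "\<exists>x\<in>mcarrier M. mdist (hcompletion M) X (hclass M x) < inverse (real (Suc n))" for n
    using X by (intro M.hclass_dense) auto
  then obtain x where x [simp]: "\<And>n. x n \<in> mcarrier M"
    and Xx: "\<And>n. mdist (hcompletion M) X (hclass M (x n)) < inverse (real (Suc n))" by metis
  have fx: "mdist (hcompletion N) (hclass N (f (x n))) (hclass N (f y))
      \<le> C * mdist (hcompletion M) X (hclass M y) + C * inverse (real (Suc n))"
    if y: "y \<in> mcarrier M" for n y
  proof -
    have "mdist (hcompletion N) (hclass N (f (x n))) (hclass N (f y)) \<le> C * mdist M (x n) y"
      using y by (simp add: N.hclass_dist lipschitz)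
    also have "mdist M (x n) y = mdist (hcompletion M) (hclass M (x n)) (hclass M y)"
      using y by (simp add: M.hclass_dist)
    also have "C * \<dots> \<le> C * (mdist (hcompletion M) X (hclass M y) + inverse (real (Suc n)))"
      using C_nonneg Xx[of n] HM.mdist_triangle[of "hclass M (x n)" X "hclass M y"] X y
      by (intro mult_left_mono) (auto simp: HM.mdist_commute)
    finally show ?thesis by (simp add: distrib_left)
  qed
  have inv0: "(\<lambda>n. C * inverse (real (Suc n))) \<longlonglongrightarrow> C * 0"
    by (intro tendsto_intros LIMSEQ_inverse_real_of_nat)
  have "(\<lambda>n. hclass N (f (x n))) \<in> mCauchy (hcompletion N)"
  proof (rule HN.mCauchyI)
    fix e :: real assume e: "0 < e"
    obtain k where k: "\<And>n. n \<ge> k \<Longrightarrow> C * inverse (real (Suc n)) < e / 2"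
      using order_tendstoD(2)[OF inv0, of "e / 2"] e unfolding eventually_sequentially by auto
    have "mdist (hcompletion N) (hclass N (f (x m))) (hclass N (f (x n))) < e" if "m \<ge> k" "n \<ge> k" for m n
    proof -
      have "mdist (hcompletion N) (hclass N (f (x m))) (hclass N (f (x n)))
          \<le> C * mdist (hcompletion M) X (hclass M (x n)) + C * inverse (real (Suc m))"
        by (rule fx) simp
      also have "\<dots> \<le> C * inverse (real (Suc n)) + C * inverse (real (Suc m))"
        using Xx[of n] C_nonneg by (intro add_right_mono mult_left_mono) auto
      finally show ?thesis using k[OF that(1)] k[OF that(2)] by linarith
    qed
    then show "\<exists>k. \<forall>m\<ge>k. \<forall>n\<ge>k. mdist (hcompletion N) (hclass N (f (x m))) (hclass N (f (x n))) < e"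
      by blast
  qed simp
  then obtain Y where Y: "Y \<in> mcarrier (hcompletion N)"
    "(\<lambda>n. mdist (hcompletion N) (hclass N (f (x n))) Y) \<longlonglongrightarrow> 0"
    using hilbert_bimodule.complete[OF N.hilbert_hcompletion] unfolding mconv_def by blast
  have "mdist (hcompletion N) Y (hclass N (f y)) \<le> C * mdist (hcompletion M) X (hclass M y)"
    if y: "y \<in> mcarrier M" for y
  proof (rule LIMSEQ_le_const)
    show "(\<lambda>n. mdist (hcompletion N) (hclass N (f (x n))) Y
        + (C * mdist (hcompletion M) X (hclass M y) + C * inverse (real (Suc n))))
      \<longlonglongrightarrow> C * mdist (hcompletion M) X (hclass M y)"
      using tendsto_add[OF Y(2) tendsto_add[OF tendsto_const inv0]] by simp
    have "mdist (hcompletion N) Y (hclass N (f y)) \<le> mdist (hcompletion N) (hclass N (f (x n))) Y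
        + (C * mdist (hcompletion M) X (hclass M y) + C * inverse (real (Suc n)))" for n
      using HN.mdist_triangle[of Y "hclass N (f (x n))" "hclass N (f y)"] fx[OF y, of n] Y(1) y
      by (simp add: HN.mdist_commute)
    then show "\<exists>k. \<forall>n\<ge>k. mdist (hcompletion N) Y (hclass N (f y)) \<le> mdist (hcompletion N) (hclass N (f (x n))) Y
        + (C * mdist (hcompletion M) X (hclass M y) + C * inverse (real (Suc n)))" by blast
  qed
  with Y(1) show ?thesis by blast
qed

lemma ext_closed [simp]: "X \<in> mcarrier (hcompletion M) \<Longrightarrow> ext X \<in> mcarrier (hcompletion N)"
  and ext_near: "X \<in> mcarrier (hcompletion M) \<Longrightarrow> x \<in> mcarrier M \<Longrightarrow>
    mdist (hcompletion N) (ext X) (hclass N (f x)) \<le> C * mdist (hcompletion M) X (hclass M x)"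
  using someI_ex[OF ex_ext[of X]] unfolding ext_def by auto

lemma ext_hclass: "x \<in> mcarrier M \<Longrightarrow> ext (hclass M x) = hclass N (f x)"
  using ext_near[of "hclass M x" x]
  by (intro HN.eq_if_mdist_0) (auto intro: order_antisym)

lemma ext_lipschitz:
  assumes "X \<in> mcarrier (hcompletion M)" "Y \<in> mcarrier (hcompletion M)"
  shows "mdist (hcompletion N) (ext X) (ext Y) \<le> C * mdist (hcompletion M) X Y"
proof (rule le_if_le_add_mult_epsilon)
  fix e :: real assume "0 < e"
  then obtain x where x: "x \<in> mcarrier M" "mdist (hcompletion M) X (hclass M x) < e"
    using M.hclass_dense assms(1) by blast
  have "mdist (hcompletion N) (ext X) (ext Y)
      \<le> C * mdist (hcompletion M) X (hclass M x) + C * mdist (hcompletion M) Y (hclass M x)"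
    using HN.mdist_triangle[of "ext X" "hclass N (f x)" "ext Y"] ext_near[of X x] ext_near[of Y x] x assms
    by (simp add: HN.mdist_commute)
  also have "\<dots> \<le> C * e + C * (mdist (hcompletion M) X Y + e)"
    using HM.mdist_triangle[of Y X "hclass M x"] x assms C_nonneg
    by (intro add_mono mult_left_mono) (auto simp: HM.mdist_commute)
  finally show "mdist (hcompletion N) (ext X) (ext Y) \<le> C * mdist (hcompletion M) X Y + (2 * C) * e"
    by (simp add: algebra_simps)
qed

lemma is_cont_ext_ext: "is_cont_ext M N f ext"
  unfolding is_cont_ext_def
proof (intro conjI ballI)
  show "ext \<in> mcarrier (hcompletion M) \<rightarrow>\<^sub>E mcarrier (hcompletion N)"
    by (intro PiE_I) (simp, simp add: ext_def)
  show "mcont_map (hcompletion M) (hcompletion N) ext"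
    unfolding mcont_map_def
  proof (intro ballI allI impI)
    fix X and e :: real assume X: "X \<in> mcarrier (hcompletion M)" and e: "0 < e"
    have "mdist (hcompletion N) (ext Y) (ext X) < e"
      if "Y \<in> mcarrier (hcompletion M)" "mdist (hcompletion M) Y X < e / (C + 1)" for Y
    proof -
      have "mdist (hcompletion N) (ext Y) (ext X) \<le> (C + 1) * mdist (hcompletion M) Y X"
        unfolding distrib_right using ext_lipschitz[OF that(1) X] HM.mdist_nonneg[of Y X] by linarith
      also have "\<dots> < e"
        using that(2) C_nonneg by (simp add: field_simps)
      finally show ?thesis .
    qed
    moreover have "0 < e / (C + 1)" using e C_nonneg by simp
    ultimately show "\<exists>d>0. \<forall>Y\<in>mcarrier (hcompletion M). mdist (hcompletion M) Y X < d \<longrightarrow>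
        mdist (hcompletion N) (ext Y) (ext X) < e" by blast
  qed
qed (rule ext_hclass)

text \<open>Continuous maps agreeing on the dense set of classes agree on the carrier, and
  extensionality fixes the values elsewhere.\<close>

lemma is_cont_ext_unique:
  assumes T: "is_cont_ext M N f T"
  shows "T = ext"
proof (rule PiE_ext[of _ "mcarrier (hcompletion M)" "\<lambda>_. mcarrier (hcompletion N)"])
  show TE: "T \<in> mcarrier (hcompletion M) \<rightarrow>\<^sub>E mcarrier (hcompletion N)"
    using T unfolding is_cont_ext_def by blast
  show "ext \<in> mcarrier (hcompletion M) \<rightarrow>\<^sub>E mcarrier (hcompletion N)"
    using is_cont_ext_ext unfolding is_cont_ext_def by blast
  fix X assume X: "X \<in> mcarrier (hcompletion M)"
  have TX: "T X \<in> mcarrier (hcompletion N)" using TE X by blast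
  have "mdist (hcompletion N) (T X) (ext X) \<le> 0"
  proof (rule le_if_le_add_mult_epsilon)
    fix e :: real assume e: "0 < e"
    obtain d where d: "0 < d" "\<And>Y. Y \<in> mcarrier (hcompletion M) \<Longrightarrow>
        mdist (hcompletion M) Y X < d \<Longrightarrow> mdist (hcompletion N) (T Y) (T X) < e"
      using T X e unfolding is_cont_ext_def mcont_map_def by blast
    obtain x where x: "x \<in> mcarrier M" "mdist (hcompletion M) X (hclass M x) < min d e"
      using M.hclass_dense[OF X, of "min d e"] d e by auto
    have "mdist (hcompletion N) (T X) (hclass N (f x)) < e"
      using d(2)[of "hclass M x"] x X T TX unfolding is_cont_ext_def
      by (auto simp: HM.mdist_commute HN.mdist_commute)
    moreover have "mdist (hcompletion N) (ext X) (hclass N (f x)) \<le> C * e"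
      using ext_near[OF X x(1)] x(2) C_nonneg by (meson less_imp_le min.strict_boundedE mult_left_mono order_trans)
    ultimately show "mdist (hcompletion N) (T X) (ext X) \<le> 0 + (1 + C) * e"
      using HN.mdist_triangle[of "T X" "hclass N (f x)" "ext X"] X x TX
      by (simp add: HN.mdist_commute distrib_right)
  qed
  then show "T X = ext X"
    using X TX by (intro HN.eq_if_mdist_0) (auto intro: order_antisym)
qed

theorem ex1_cont_ext: "\<exists>!T. is_cont_ext M N f T"
  using is_cont_ext_ext is_cont_ext_unique by blast

lemma cont_ext_eq: "cont_ext M N f = ext"
  unfolding cont_ext_def using is_cont_ext_ext is_cont_ext_unique by (rule the_equality)

lemma ext_bounded:
  assumes X: "X \<in> mcarrier (hcompletion M)" and f0: "\<And>x. x \<in> mcarrier M \<Longrightarrow> mnorm N (f x) \<le> C * mnorm M x"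
  shows "mnorm (hcompletion N) (ext X) \<le> C * mnorm (hcompletion M) X"
proof (rule le_if_le_add_mult_epsilon)
  fix e :: real assume "0 < e"
  then obtain x where x: "x \<in> mcarrier M" "mdist (hcompletion M) X (hclass M x) < e"
    using M.hclass_dense X by blast
  have "mnorm (hcompletion N) (ext X) \<le> mnorm N (f x) + mdist (hcompletion N) (ext X) (hclass N (f x))"
    using HN.mnorm_diff_le[of "ext X" "hclass N (f x)"] X x by (simp add: N.hclass_norm)
  also have "\<dots> \<le> C * mnorm M x + C * e"
    using ext_near[OF X x(1)] x(2) C_nonneg f0[OF x(1)]
    by (meson less_imp_le mult_left_mono order_trans add_mono)
  also have "C * mnorm M x \<le> C * (mnorm (hcompletion M) X + e)"
    using HM.mnorm_diff_le[of "hclass M x" X] X x C_nonneg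
    by (intro mult_left_mono) (auto simp: M.hclass_norm HM.mdist_commute)
  finally show "mnorm (hcompletion N) (ext X) \<le> C * mnorm (hcompletion M) X + (2 * C) * e"
    by (simp add: algebra_simps)
qed

text \<open>Each law holds exactly on nearby classes, where f is linear, hence up to a multiple of e
  for arbitrary arguments.\<close>

lemma ext_bimod_linear:
  assumes "bimod_linear M N f"
  shows "bimod_linear (hcompletion M) (hcompletion N) ext"
proof -
  have f: "\<And>x y. x \<in> mcarrier M \<Longrightarrow> y \<in> mcarrier M \<Longrightarrow> f (madd M x y) = madd N (f x) (f y)"
    "\<And>x b. x \<in> mcarrier M \<Longrightarrow> f (mract M x b) = mract N (f x) b"
    "\<And>x b. x \<in> mcarrier M \<Longrightarrow> f (mlact M b x) = mlact N b (f x)"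
    using assms unfolding bimod_linear_def right_linear_def by auto
  have near: "\<exists>x\<in>mcarrier M. mdist (hcompletion M) X (hclass M x) < e \<and>
      mdist (hcompletion N) (ext X) (hclass N (f x)) \<le> C * e"
    if X: "X \<in> mcarrier (hcompletion M)" and e: "0 < e" for X e
  proof -
    obtain x where x: "x \<in> mcarrier M" "mdist (hcompletion M) X (hclass M x) < e"
      using M.hclass_dense[OF X e] by blast
    then have "mdist (hcompletion N) (ext X) (hclass N (f x)) \<le> C * e"
      using ext_near[OF X x(1)] C_nonneg by (meson less_imp_le mult_left_mono order_trans)
    with x show ?thesis by blast
  qed
  have "ext (madd (hcompletion M) X Y) = madd (hcompletion N) (ext X) (ext Y)"
    if X: "X \<in> mcarrier (hcompletion M)" and Y: "Y \<in> mcarrier (hcompletion M)" for X Y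
  proof -
    have "mdist (hcompletion N) (ext (madd (hcompletion M) X Y)) (madd (hcompletion N) (ext X) (ext Y)) \<le> 0"
    proof (rule le_if_le_add_mult_epsilon)
      fix e :: real assume e: "0 < e"
      obtain x where x: "x \<in> mcarrier M" "mdist (hcompletion M) X (hclass M x) < e"
        "mdist (hcompletion N) (ext X) (hclass N (f x)) \<le> C * e" using near[OF X e] by blast
      obtain y where y: "y \<in> mcarrier M" "mdist (hcompletion M) Y (hclass M y) < e"
        "mdist (hcompletion N) (ext Y) (hclass N (f y)) \<le> C * e" using near[OF Y e] by blast
      let ?z = "madd M x y"
      have "mdist (hcompletion N) (ext (madd (hcompletion M) X Y)) (hclass N (f ?z))
          \<le> C * mdist (hcompletion M) (madd (hcompletion M) X Y) (hclass M ?z)"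
        using X Y x y by (intro ext_near) auto
      also have "\<dots> \<le> C * (e + e)"
        using HM.mdist_add_le[of X Y "hclass M x" "hclass M y"] X Y x y C_nonneg
        by (intro mult_left_mono) (auto simp: M.hclass_add)
      finally have 1: "mdist (hcompletion N) (ext (madd (hcompletion M) X Y)) (hclass N (f ?z)) \<le> C * (e + e)" .
      have 2: "mdist (hcompletion N) (madd (hcompletion N) (ext X) (ext Y)) (hclass N (f ?z)) \<le> C * e + C * e"
        using HN.mdist_add_le[of "ext X" "ext Y" "hclass N (f x)" "hclass N (f y)"] X Y x y
        by (simp add: f N.hclass_add)
      show "mdist (hcompletion N) (ext (madd (hcompletion M) X Y)) (madd (hcompletion N) (ext X) (ext Y))
          \<le> 0 + (4 * C) * e"
        using HN.mdist_triangle[of "ext (madd (hcompletion M) X Y)" "hclass N (f ?z)"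
            "madd (hcompletion N) (ext X) (ext Y)"] 1 2 X Y x y
        by (simp add: HN.mdist_commute algebra_simps)
    qed
    then show ?thesis
      using X Y by (intro HN.eq_if_mdist_0) (auto intro: order_antisym)
  qed
  moreover have "ext (mract (hcompletion M) X b) = mract (hcompletion N) (ext X) b"
    if X: "X \<in> mcarrier (hcompletion M)" for X b
  proof -
    have "mdist (hcompletion N) (ext (mract (hcompletion M) X b)) (mract (hcompletion N) (ext X) b) \<le> 0"
    proof (rule le_if_le_add_mult_epsilon)
      fix e :: real assume e: "0 < e"
      obtain x where x: "x \<in> mcarrier M" "mdist (hcompletion M) X (hclass M x) < e"
        "mdist (hcompletion N) (ext X) (hclass N (f x)) \<le> C * e" using near[OF X e] by blast
      let ?z = "mract M x b"
      have "mdist (hcompletion N) (ext (mract (hcompletion M) X b)) (hclass N (f ?z))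
          \<le> C * mdist (hcompletion M) (mract (hcompletion M) X b) (hclass M ?z)"
        using X x by (intro ext_near) auto
      also have "\<dots> \<le> C * (e * norm b)"
        using HM.mdist_ract_le[of X "hclass M x" b] X x C_nonneg
          mult_right_mono[OF less_imp_le[OF x(2)] norm_ge_zero[of b]]
        by (intro mult_left_mono) (auto simp: M.hclass_ract)
      finally have 1: "mdist (hcompletion N) (ext (mract (hcompletion M) X b)) (hclass N (f ?z)) \<le> C * (e * norm b)" .
      have 2: "mdist (hcompletion N) (mract (hcompletion N) (ext X) b) (hclass N (f ?z)) \<le> C * e * norm b"
        using HN.mdist_ract_le[of "ext X" "hclass N (f x)" b] X x mult_right_mono[OF x(3) norm_ge_zero[of b]]
        by (simp add: f N.hclass_ract)
      show "mdist (hcompletion N) (ext (mract (hcompletion M) X b)) (mract (hcompletion N) (ext X) b)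
          \<le> 0 + (2 * C * norm b) * e"
        using HN.mdist_triangle[of "ext (mract (hcompletion M) X b)" "hclass N (f ?z)"
            "mract (hcompletion N) (ext X) b"] 1 2 X x
        by (simp add: HN.mdist_commute algebra_simps)
    qed
    then show ?thesis
      using X by (intro HN.eq_if_mdist_0) (auto intro: order_antisym)
  qed
  moreover have "ext (mlact (hcompletion M) b X) = mlact (hcompletion N) b (ext X)"
    if X: "X \<in> mcarrier (hcompletion M)" for X b
  proof -
    have "mdist (hcompletion N) (ext (mlact (hcompletion M) b X)) (mlact (hcompletion N) b (ext X)) \<le> 0"
    proof (rule le_if_le_add_mult_epsilon)
      fix e :: real assume e: "0 < e"
      obtain x where x: "x \<in> mcarrier M" "mdist (hcompletion M) X (hclass M x) < e"
        "mdist (hcompletion N) (ext X) (hclass N (f x)) \<le> C * e" using near[OF X e] by blast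
      let ?z = "mlact M b x"
      have "mdist (hcompletion N) (ext (mlact (hcompletion M) b X)) (hclass N (f ?z))
          \<le> C * mdist (hcompletion M) (mlact (hcompletion M) b X) (hclass M ?z)"
        using X x by (intro ext_near) auto
      also have "\<dots> \<le> C * (norm b * e)"
        using HM.mdist_lact_le[of X "hclass M x" b] X x C_nonneg
          mult_left_mono[OF less_imp_le[OF x(2)] norm_ge_zero[of b]]
        by (intro mult_left_mono) (auto simp: M.hclass_lact)
      finally have 1: "mdist (hcompletion N) (ext (mlact (hcompletion M) b X)) (hclass N (f ?z)) \<le> C * (norm b * e)" .
      have 2: "mdist (hcompletion N) (mlact (hcompletion N) b (ext X)) (hclass N (f ?z)) \<le> norm b * (C * e)"
        using HN.mdist_lact_le[of "ext X" "hclass N (f x)" b] X x mult_left_mono[OF x(3) norm_ge_zero[of b]]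
        by (simp add: f N.hclass_lact)
      show "mdist (hcompletion N) (ext (mlact (hcompletion M) b X)) (mlact (hcompletion N) b (ext X))
          \<le> 0 + (2 * C * norm b) * e"
        using HN.mdist_triangle[of "ext (mlact (hcompletion M) b X)" "hclass N (f ?z)"
            "mlact (hcompletion N) b (ext X)"] 1 2 X x
        by (simp add: HN.mdist_commute algebra_simps)
    qed
    then show ?thesis
      using X by (intro HN.eq_if_mdist_0) (auto intro: order_antisym)
  qed
  ultimately show ?thesis
    unfolding bimod_linear_def right_linear_def by auto
qed

end

text \<open>Both sides depend continuously on X and Y, so adjointness on the dense sets of classes
  carries over.\<close>

lemma ext_adjoint:
  assumes "lipschitz_map M N f C" "lipschitz_map N M g D"
    and adj: "\<And>x y. x \<in> mcarrier M \<Longrightarrow> y \<in> mcarrier N \<Longrightarrow> mip N (f x) y = mip M x (g y)"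
    and X: "X \<in> mcarrier (hcompletion M)" and Y: "Y \<in> mcarrier (hcompletion N)"
  shows "mip (hcompletion N) (lipschitz_map.ext M N f C X) Y
    = mip (hcompletion M) X (lipschitz_map.ext N M g D Y)"
proof -
  interpret f: lipschitz_map M N f C by fact
  interpret g: lipschitz_map N M g D by fact
  let ?A = "mip (hcompletion N) (f.ext X) Y" and ?B = "mip (hcompletion M) X (g.ext Y)"
  have "norm (?A - ?B) \<le> 0"
  proof (rule le_if_le_add_mult_epsilon)
    fix e :: real assume "0 < e"
    \<comment> \<open>The cap at 1 bounds the norms of the approximating classes, so that the total
      error is linear in d.\<close>
    define d where "d = min e 1"
    have d: "0 < d" "d \<le> e" "d \<le> 1" using \<open>0 < e\<close> unfolding d_def by auto
    obtain x where x: "x \<in> mcarrier M" "mdist (hcompletion M) X (hclass M x) < d"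
      using f.M.hclass_dense[OF X d(1)] by blast
    obtain y where y: "y \<in> mcarrier N" "mdist (hcompletion N) Y (hclass N y) < d"
      using f.N.hclass_dense[OF Y d(1)] by blast
    have fx: "mdist (hcompletion N) (f.ext X) (hclass N (f x)) \<le> C * d"
      using f.ext_near[OF X x(1)] x(2) f.C_nonneg by (meson less_imp_le mult_left_mono order_trans)
    have gy: "mdist (hcompletion M) (g.ext Y) (hclass M (g y)) \<le> D * d"
      using g.ext_near[OF Y y(1)] y(2) g.C_nonneg by (meson less_imp_le mult_left_mono order_trans)
    have nfx: "mnorm (hcompletion N) (hclass N (f x)) \<le> mnorm (hcompletion N) (f.ext X) + C"
    proof -
      have "mnorm (hcompletion N) (hclass N (f x)) \<le> mnorm (hcompletion N) (f.ext X) + C * d"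
        using f.HN.mnorm_diff_le[of "hclass N (f x)" "f.ext X"] fx X x by (simp add: f.HN.mdist_commute)
      also have "C * d \<le> C" using d f.C_nonneg by (simp add: mult_left_le)
      finally show ?thesis by simp
    qed
    have nx: "mnorm (hcompletion M) (hclass M x) \<le> mnorm (hcompletion M) X + 1"
      using f.HM.mnorm_diff_le[of "hclass M x" X] x d X by (simp add: f.HM.mdist_commute)
    have eq: "mip (hcompletion N) (hclass N (f x)) (hclass N y) = mip (hcompletion M) (hclass M x) (hclass M (g y))"
      using x y adj by (simp add: f.N.hclass_ip f.M.hclass_ip)
    have "norm (?A - ?B) \<le> norm (?A - mip (hcompletion N) (hclass N (f x)) (hclass N y))
        + norm (?B - mip (hcompletion M) (hclass M x) (hclass M (g y)))"
      unfolding eq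
      using norm_triangle_ineq4[of "?A - mip (hcompletion M) (hclass M x) (hclass M (g y))"
          "?B - mip (hcompletion M) (hclass M x) (hclass M (g y))"] by simp
    also have "\<dots> \<le> (mdist (hcompletion N) (f.ext X) (hclass N (f x)) * mnorm (hcompletion N) Y
          + mnorm (hcompletion N) (hclass N (f x)) * mdist (hcompletion N) Y (hclass N y))
        + (mdist (hcompletion M) X (hclass M x) * mnorm (hcompletion M) (g.ext Y)
          + mnorm (hcompletion M) (hclass M x) * mdist (hcompletion M) (g.ext Y) (hclass M (g y)))"
      using X Y x y by (intro add_mono f.HN.ip_diff_le f.HM.ip_diff_le) auto
    also have "\<dots> \<le> ((C * d) * mnorm (hcompletion N) Y + (mnorm (hcompletion N) (f.ext X) + C) * d)
        + (d * mnorm (hcompletion M) (g.ext Y) + (mnorm (hcompletion M) X + 1) * (D * d))"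
      using fx gy nfx nx x y d f.C_nonneg g.C_nonneg
      by (intro add_mono mult_mono) (auto intro: less_imp_le)
    also have "\<dots> = (C * mnorm (hcompletion N) Y + mnorm (hcompletion N) (f.ext X) + C
        + mnorm (hcompletion M) (g.ext Y) + (mnorm (hcompletion M) X + 1) * D) * d"
      by (simp add: algebra_simps)
    also have "\<dots> \<le> (C * mnorm (hcompletion N) Y + mnorm (hcompletion N) (f.ext X) + C
        + mnorm (hcompletion M) (g.ext Y) + (mnorm (hcompletion M) X + 1) * D) * e"
      using d f.C_nonneg g.C_nonneg by (intro mult_left_mono add_nonneg_nonneg mult_nonneg_nonneg) auto
    finally show "norm (?A - ?B) \<le> 0 + (C * mnorm (hcompletion N) Y + mnorm (hcompletion N) (f.ext X) + C
        + mnorm (hcompletion M) (g.ext Y) + (mnorm (hcompletion M) X + 1) * D) * e" by simp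
  qed
  then show ?thesis by simp
qed

section \<open>Composition of continuous extensions\<close>

lemma mcont_map_comp:
  assumes "mcont_map M N T" "mcont_map N L S" "T \<in> mcarrier M \<rightarrow> mcarrier N"
  shows "mcont_map M L (\<lambda>x. S (T x))"
  unfolding mcont_map_def
proof (intro ballI allI impI)
  fix x and e :: real assume x: "x \<in> mcarrier M" and "0 < e"
  then obtain d where d: "0 < d" "\<And>y. y \<in> mcarrier N \<Longrightarrow> mdist N y (T x) < d \<Longrightarrow> mdist L (S y) (S (T x)) < e"
    using assms(2,3) unfolding mcont_map_def by blast
  obtain c where c: "0 < c" "\<And>y. y \<in> mcarrier M \<Longrightarrow> mdist M y x < c \<Longrightarrow> mdist N (T y) (T x) < d"
    using assms(1) x d(1) unfolding mcont_map_def by blast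
  have "mdist L (S (T y)) (S (T x)) < e" if "y \<in> mcarrier M" "mdist M y x < c" for y
    using d(2)[OF _ c(2)[OF that]] assms(3) that(1) by blast
  then show "\<exists>d>0. \<forall>y\<in>mcarrier M. mdist M y x < d \<longrightarrow> mdist L (S (T y)) (S (T x)) < e"
    using c(1) by blast
qed

lemma mcont_map_cong:
  "(\<And>x. x \<in> mcarrier M \<Longrightarrow> T x = S x) \<Longrightarrow> mcont_map M N T \<longleftrightarrow> mcont_map M N S"
  unfolding mcont_map_def by simp

lemma is_cont_ext_comp:
  assumes M: "semi_bimod M" and T: "is_cont_ext M N f T" and S: "is_cont_ext N L g S" and f: "f \<in> mcarrier M \<rightarrow> mcarrier N"
  shows "is_cont_ext M L (\<lambda>x. g (f x)) (\<lambda>X\<in>mcarrier (hcompletion M). S (T X))"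
proof -
  have TE: "T \<in> mcarrier (hcompletion M) \<rightarrow> mcarrier (hcompletion N)"
    using T unfolding is_cont_ext_def by blast
  have "mcont_map (hcompletion M) (hcompletion L) (\<lambda>X. S (T X))"
    by (rule mcont_map_comp[OF _ _ TE]) (use T S in \<open>simp_all add: is_cont_ext_def\<close>)
  moreover have "mcont_map (hcompletion M) (hcompletion L) (\<lambda>X\<in>mcarrier (hcompletion M). S (T X))
      \<longleftrightarrow> mcont_map (hcompletion M) (hcompletion L) (\<lambda>X. S (T X))"
    by (rule mcont_map_cong) simp
  ultimately have c: "mcont_map (hcompletion M) (hcompletion L) (\<lambda>X\<in>mcarrier (hcompletion M). S (T X))"
    by blast
  show ?thesis
    unfolding is_cont_ext_def
  proof (intro conjI ballI c)
    show "(\<lambda>X\<in>mcarrier (hcompletion M). S (T X)) \<in> mcarrier (hcompletion M) \<rightarrow>\<^sub>E mcarrier (hcompletion L)"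
      using TE S unfolding is_cont_ext_def by auto
    fix x assume x: "x \<in> mcarrier M"
    then show "(\<lambda>X\<in>mcarrier (hcompletion M). S (T X)) (hclass M x) = hclass L (g (f x))"
      using T S f semi_bimod.hclass_closed[OF M x] unfolding is_cont_ext_def by auto
  qed
qed

section \<open>Tensor products\<close>

lemma positive_if_approximable:
  fixes a :: "'b::unital_cstar_algebra"
  assumes "\<And>e. 0 < e \<Longrightarrow> \<exists>p. positive p \<and> norm (a - p) \<le> e"
  shows "positive a"
proof -
  have "\<exists>p. positive p \<and> norm (a - p) \<le> inverse (real (Suc n))" for n
    by (rule assms) simp
  then obtain p where p: "\<And>n. positive (p n)" "\<And>n. norm (a - p n) \<le> inverse (real (Suc n))"
    by metis
  have "(\<lambda>n. p n - a) \<longlonglongrightarrow> 0"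
    using p(2) by (intro tendsto_norm_zero_cancel[OF tendsto_sandwich[OF _ _ tendsto_const LIMSEQ_inverse_real_of_nat]])
      (auto simp: norm_minus_commute)
  then have "p \<longlonglongrightarrow> a"
    by (simp add: LIM_zero_iff)
  then show ?thesis using p(1) by (rule positive_LIMSEQ)
qed

locale bimod_pair = M: semi_bimod M + N: semi_bimod N
  for M :: "('b::unital_cstar_algebra, 'm) bimod" and N :: "('b, 'n) bimod"
begin

definition tip :: "'m \<times> 'n \<Rightarrow> 'm \<times> 'n \<Rightarrow> 'b" where
  "tip u v = mip N (snd u) (mlact N (mip M (fst u) (fst v)) (snd v))"

abbreviation "C \<equiv> mcarrier M \<times> mcarrier N"

abbreviation "T \<equiv> pre_tensor M N"

lemma pre_ip_def: "mip T p q = (\<Sum>u\<leftarrow>p. \<Sum>v\<leftarrow>q. tip u v)"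
  by (simp add: pre_tensor_def tip_def case_prod_unfold)

lemma pre_ip_Nil [simp]: "mip T [] q = 0" "mip T p [] = 0"
  by (simp_all add: pre_ip_def sum_list_0)

lemma pre_ip_Cons_left: "mip T (u # p) q = (\<Sum>v\<leftarrow>q. tip u v) + mip T p q"
  by (simp add: pre_ip_def)

lemma pre_ip_Cons_right: "mip T p (v # q) = (\<Sum>u\<leftarrow>p. tip u v) + mip T p q"
  by (simp add: pre_ip_def sum_list_addf)

lemma pre_ip_append_right: "mip T p (q @ r) = mip T p q + mip T p r"
  by (simp add: pre_ip_def sum_list_addf)

lemma tip_star: "u \<in> C \<Longrightarrow> v \<in> C \<Longrightarrow> star (tip u v) = tip v u"
  unfolding tip_def by (auto simp: N.ip_star M.ip_star N.ip_lact)

lemma star_sum_list: "star (\<Sum>u\<leftarrow>p. f u) = (\<Sum>u\<leftarrow>p. star (f u) :: 'b)"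
  by (induction p) (simp_all add: star_add)

lemma pre_ip_star: "p \<in> lists C \<Longrightarrow> q \<in> lists C \<Longrightarrow> star (mip T p q) = mip T q p"
proof (induction p)
  case (Cons u p)
  have "(\<Sum>v\<leftarrow>q. star (tip u v)) = (\<Sum>v\<leftarrow>q. tip v u)"
    using Cons.prems by (intro arg_cong[of _ _ sum_list] map_cong) (auto simp: tip_star)
  with Cons show ?case
    by (simp add: pre_ip_Cons_left pre_ip_Cons_right star_add star_sum_list)
qed simp

lemma norm_tip_le:
  assumes "u \<in> C" "v \<in> C"
  shows "norm (tip u v) \<le> (mnorm M (fst u) * mnorm N (snd u)) * (mnorm M (fst v) * mnorm N (snd v))"
proof -
  have "norm (tip u v) \<le> mnorm N (snd u) * mnorm N (mlact N (mip M (fst u) (fst v)) (snd v))"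
    unfolding tip_def using assms by (intro N.Cauchy_Schwarz) auto
  also have "mnorm N (mlact N (mip M (fst u) (fst v)) (snd v)) \<le> norm (mip M (fst u) (fst v)) * mnorm N (snd v)"
    using assms by (intro N.mnorm_lact_le) auto
  also have "norm (mip M (fst u) (fst v)) \<le> mnorm M (fst u) * mnorm M (fst v)"
    using assms by (intro M.Cauchy_Schwarz) auto
  finally show ?thesis
    by (simp add: mult_left_mono mult_right_mono ac_simps)
qed

lemma norm_sum_tip_le:
  assumes "u \<in> C" "q \<in> lists C"
  shows "norm (\<Sum>v\<leftarrow>q. tip u v)
    \<le> (mnorm M (fst u) * mnorm N (snd u)) * (\<Sum>v\<leftarrow>q. mnorm M (fst v) * mnorm N (snd v))"
  using assms(2)
proof (induction q)
  case (Cons v q)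
  have "norm (tip u v + (\<Sum>v\<leftarrow>q. tip u v)) \<le> norm (tip u v) + norm (\<Sum>v\<leftarrow>q. tip u v)"
    by (rule norm_triangle_ineq)
  with Cons norm_tip_le[OF assms(1), of v] show ?case
    by (auto simp: distrib_left)
qed simp

text \<open>One step of an approximate Gram-Schmidt orthogonalisation: \<open>\<sigma> x\<close> is \<open>x\<close> minus an approximate
  projection of \<open>x\<close> onto the submodule generated by \<open>x\<^sub>1\<close>.\<close>

lemma approximate_projection:
  assumes x1: "x1 \<in> mcarrier M" and e: "0 < e"
  obtains \<sigma> g where "\<And>x. x \<in> mcarrier M \<Longrightarrow> \<sigma> x \<in> mcarrier M"
    "\<And>x y. x \<in> mcarrier M \<Longrightarrow> y \<in> mcarrier M \<Longrightarrow>
      mip M x y = mip M (\<sigma> x) (\<sigma> y) + star (g * mip M x1 x) * (g * mip M x1 y)"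
    "\<And>x. x \<in> mcarrier M \<Longrightarrow> mnorm M (\<sigma> x) \<le> mnorm M x"
    "(mnorm M (\<sigma> x1))\<^sup>2 \<le> 2 * e"
proof -
  define p where "p = mip M x1 x1"
  have p: "positive p" unfolding p_def using x1 by (rule M.ip_positive)
  obtain r where r: "(p + e *\<^sub>R 1) * r = 1" "r * (p + e *\<^sub>R 1) = 1" "norm r \<le> 1 / e" "star r = r"
    using ex_inverse_add[OF _ e] p unfolding positive_iff_selfadjoint_square by blast
  have pr: "p * r = 1 - e *\<^sub>R r" "r * p = 1 - e *\<^sub>R r"
    using r(1,2) by (simp_all add: algebra_simps)
  \<comment> \<open>The shift is 2 e and not e because this makes \<open>star g * g\<close> equal to
    2 r - r p r, the exact defect of the regularised projection x -> x1 r <x1, x>.\<close>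
  have "positive (p + (2 * e) *\<^sub>R (1::'b))"
    using p e by (intro positive_add positive_scaleR) (auto simp: positive_def intro: exI[of _ 1])
  then obtain k where k: "p + (2 * e) *\<^sub>R 1 = star k * k" unfolding positive_def by blast
  define g where "g = k * r"
  have gg: "star g * g = r + r - r * p * r"
  proof -
    have "star g * g = r * (p + (2 * e) *\<^sub>R 1) * r"
      unfolding g_def k by (simp add: star_mult r mult.assoc)
    also have "\<dots> = (r * (p + e *\<^sub>R 1)) * r + e *\<^sub>R (r * r)"
      by (simp add: algebra_simps scaleR_2 flip: scaleR_add_left)
    also have "\<dots> = r + e *\<^sub>R (r * r)" by (simp add: r)
    also have "e *\<^sub>R (r * r) = r - r * p * r"
      unfolding pr by (simp add: left_diff_distrib)
    finally show ?thesis by simp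
  qed
  define \<sigma> where "\<sigma> x = msub M x (mract M x1 (r * mip M x1 x))" for x
  have \<sigma>: "\<sigma> x \<in> mcarrier M" if "x \<in> mcarrier M" for x
    unfolding \<sigma>_def using x1 that by simp
  have split: "mip M x y = mip M (\<sigma> x) (\<sigma> y) + star (g * mip M x1 x) * (g * mip M x1 y)"
    if x: "x \<in> mcarrier M" and y: "y \<in> mcarrier M" for x y
  proof -
    have 1: "mip M (\<sigma> x) (\<sigma> y) = mip M x y - mip M x x1 * r * mip M x1 y
        - (mip M x x1 * r * mip M x1 y - mip M x x1 * (r * p * r) * mip M x1 y)"
      unfolding \<sigma>_def using x y x1
      by (simp add: M.ip_simps M.ip_star star_mult r algebra_simps p_def)
    have 2: "star (g * mip M x1 x) * (g * mip M x1 y) = mip M x x1 * (star g * g) * mip M x1 y"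
      using x x1 by (simp add: star_mult M.ip_star mult.assoc)
    show ?thesis unfolding 1 2 gg by (simp add: algebra_simps)
  qed
  show thesis
  proof (rule that[OF \<sigma> split])
    fix x assume x: "x \<in> mcarrier M"
    have "positive (mip M x x - mip M (\<sigma> x) (\<sigma> x))"
      using split[OF x x] positive_star_mult[of "g * mip M x1 x"] by simp
    then have "norm (mip M (\<sigma> x) (\<sigma> x)) \<le> norm (mip M x x)"
      using x \<sigma> by (intro positive_norm_mono M.ip_positive)
    then show "mnorm M (\<sigma> x) \<le> mnorm M x" unfolding mnorm_def by simp
  next
    have er: "norm (e *\<^sub>R r) \<le> 1" using r(3) e by (simp add: field_simps)
    have "mip M (\<sigma> x1) (\<sigma> x1) = p - p * (star g * g) * p"
      using split[OF x1 x1] unfolding p_def[symmetric]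
      by (simp add: star_mult positive_selfadjoint[OF p] mult.assoc algebra_simps)
    also have "p * (star g * g) * p = p * (r * p) + (p * r) * p - (p * r) * p * (r * p)"
      unfolding gg by (simp add: algebra_simps)
    \<comment> \<open>With a = e r one has p r = r p = 1 - a, so the remainder is a p a = e a (1 -
      a); it is small because a has norm at most 1.\<close>
    also have "p - \<dots> = e *\<^sub>R ((e *\<^sub>R r) * (1 - e *\<^sub>R r))"
    proof -
      define a where "a = e *\<^sub>R r"
      have pa: "p * r = 1 - a" "r * p = 1 - a" "a * p = e *\<^sub>R (1 - a)"
        using pr unfolding a_def by simp_all
      have "p - (p * (1 - a) + (1 - a) * p - (1 - a) * p * (1 - a)) = a * p * a"
        by (simp add: algebra_simps)
      also have "\<dots> = e *\<^sub>R (a * (1 - a))"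
        unfolding pa by (simp add: algebra_simps)
      finally show ?thesis unfolding pa a_def[symmetric] .
    qed
    finally have "norm (mip M (\<sigma> x1) (\<sigma> x1)) \<le> e * norm ((e *\<^sub>R r) * (1 - e *\<^sub>R r))"
      using e by simp
    also have "norm ((e *\<^sub>R r) * (1 - e *\<^sub>R r)) \<le> 1 * (1 + 1)"
      using er norm_one_cstar_le[where 'b = 'b] norm_triangle_ineq4[of 1 "e *\<^sub>R r"]
      by (intro order_trans[OF norm_mult_ineq] mult_mono) auto
    finally show "(mnorm M (\<sigma> x1))\<^sup>2 \<le> 2 * e" using e by (simp add: M.mnorm_square)
  qed
qed

lemma pre_ip_positive: "p \<in> lists C \<Longrightarrow> positive (mip T p p)"
proof (induction "length p" arbitrary: p)
  case (Suc n)
  then obtain u1 q where p: "p = u1 # q" and u1: "u1 \<in> C" and q: "q \<in> lists C" "length q = n"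
    by (cases p) auto
  define S where "S = (\<Sum>v\<leftarrow>q. mnorm M (fst v) * mnorm N (snd v))"
  define n1 where "n1 = mnorm N (snd u1)"
  \<comment> \<open>K times the norm of the modified first vector bounds all terms in which that
    vector occurs.\<close>
  define K where "K = n1 * (mnorm M (fst u1) * n1) + 2 * n1 * S"
  have S: "0 \<le> S" unfolding S_def by (intro sum_list_nonneg) auto
  have K: "0 \<le> K" "0 \<le> n1" unfolding K_def n1_def using S by simp_all
  show ?case
  proof (rule positive_if_approximable)
    fix d :: real assume d: "0 < d"
    \<comment> \<open>Chosen so that the modified first vector has norm at most d / (K + 1).\<close>
    define e where "e = (d / (K + 1))\<^sup>2 / 2"
    have e: "0 < e" using d K unfolding e_def by simp
    obtain \<sigma> g where \<sigma>: "\<And>x. x \<in> mcarrier M \<Longrightarrow> \<sigma> x \<in> mcarrier M"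
      and split: "\<And>x y. x \<in> mcarrier M \<Longrightarrow> y \<in> mcarrier M \<Longrightarrow>
        mip M x y = mip M (\<sigma> x) (\<sigma> y) + star (g * mip M (fst u1) x) * (g * mip M (fst u1) y)"
      and \<sigma>_le: "\<And>x. x \<in> mcarrier M \<Longrightarrow> mnorm M (\<sigma> x) \<le> mnorm M x"
      and small: "(mnorm M (\<sigma> (fst u1)))\<^sup>2 \<le> 2 * e"
    proof (rule approximate_projection[of "fst u1" e])
      show "fst u1 \<in> mcarrier M" using u1 by auto
    qed (use e in \<open>blast+\<close>)
    define s where "s = (\<lambda>u :: 'm \<times> 'n. (\<sigma> (fst u), snd u))"
    define w where "w u = mlact N (g * mip M (fst u1) (fst u)) (snd u)" for u
    define W where "W r = msum N (map w r)" for r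
    have sC: "s u \<in> C" "w u \<in> mcarrier N" if "u \<in> C" for u
      using that \<sigma> unfolding s_def w_def by auto
    have W [simp]: "W r \<in> mcarrier N" if "r \<in> lists C" for r
      using that by (induction r) (auto simp: W_def msum_def sC)
    have W0: "W [] = mzero N" unfolding W_def msum_def by simp
    have WC: "W (u # r) = madd N (w u) (W r)" for u r
      unfolding W_def msum_def by simp
    \<comment> \<open>The rank one part is a product of the form \<open>star h * k\<close>; moving h
      through the left action turns it into an inner product of vectors of N.\<close>
    have tip: "tip u v = tip (s u) (s v) + mip N (w u) (w v)" if "u \<in> C" "v \<in> C" for u v
    proof -
      have "mip N (w u) (w v)
          = mip N (snd u) (mlact N (star (g * mip M (fst u1) (fst u)) * (g * mip M (fst u1) (fst v))) (snd v))"
        unfolding w_def using that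
          N.ip_lact[of "snd u" "mlact N (g * mip M (fst u1) (fst v)) (snd v)" "g * mip M (fst u1) (fst u)"]
          N.ip_lact_mult[of "snd u" "snd v" "star (g * mip M (fst u1) (fst u))" "g * mip M (fst u1) (fst v)"]
        by (simp add: mem_Times_iff)
      then show ?thesis
        unfolding tip_def s_def using split[of "fst u" "fst v"] that by (auto simp: N.ip_lact_add)
    qed
    have row: "(\<Sum>v\<leftarrow>r. tip u v) = (\<Sum>v\<leftarrow>map s r. tip (s u) v) + mip N (w u) (W r)"
      if "u \<in> C" "r \<in> lists C" for u r
      using that(2)
    proof (induction r)
      case Nil
      show ?case using that(1) sC by (simp add: W0 N.ip_zero_right)
    next
      case (Cons v r)
      then show ?case using that(1) sC by (simp add: WC N.ip_add_right tip)
    qed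
    have all: "mip T r t = mip T (map s r) (map s t) + mip N (W r) (W t)"
      if "r \<in> lists C" "t \<in> lists C" for r t
      using that(1)
    proof (induction r)
      case Nil
      show ?case using that(2) by (simp add: W0 N.ip_zero_left)
    next
      case (Cons u r)
      then show ?case using that(2) sC by (simp add: WC N.ip_add_left pre_ip_Cons_left row)
    qed
    define a where "a = mip T (map s q) (map s q) + mip N (W p) (W p)"
    have sq: "map s q \<in> lists C"
      using q(1) by (induction q) (simp_all only: list.map Cons_in_lists_iff sC lists.Nil simp_thms)
    have "positive a"
      unfolding a_def
    proof (rule positive_add)
      show "positive (mip T (map s q) (map s q))"
        using q(2) sq by (intro Suc.hyps(1)) simp
      show "positive (mip N (W p) (W p))"
        by (intro N.ip_positive W Suc.prems)
    qed
    moreover have "norm (mip T p p - a) \<le> d"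
    proof -
      let ?z = "mnorm M (\<sigma> (fst u1))"
      have "mip T p p - a = mip T (s u1 # map s q) (s u1 # map s q) - mip T (map s q) (map s q)"
        unfolding a_def using all[OF Suc.prems Suc.prems] by (simp add: p)
      also have "\<dots> = tip (s u1) (s u1) + (\<Sum>v\<leftarrow>map s q. tip v (s u1)) + (\<Sum>v\<leftarrow>map s q. tip (s u1) v)"
        by (simp add: pre_ip_Cons_left pre_ip_Cons_right)
      also have "(\<Sum>v\<leftarrow>map s q. tip v (s u1)) = star (\<Sum>v\<leftarrow>map s q. tip (s u1) v)"
        unfolding star_sum_list using sq sC[OF u1]
        by (intro arg_cong[of _ _ sum_list] map_cong) (auto simp: tip_star)
      finally have "norm (mip T p p - a) \<le> norm (tip (s u1) (s u1))
          + norm (\<Sum>v\<leftarrow>map s q. tip (s u1) v) + norm (\<Sum>v\<leftarrow>map s q. tip (s u1) v)"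
        by (metis norm_triangle_le add_mono norm_triangle_ineq norm_star order_refl)
      moreover have "norm (tip (s u1) (s u1)) \<le> (?z * n1) * (mnorm M (fst u1) * n1)"
        using norm_tip_le[OF sC(1)[OF u1] sC(1)[OF u1]] \<sigma>_le[of "fst u1"] u1
        by (intro order_trans[OF norm_tip_le] mult_mono) (auto simp: n1_def s_def \<sigma>)
      moreover have "norm (\<Sum>v\<leftarrow>map s q. tip (s u1) v) \<le> (?z * n1) * S"
      proof -
        have "(\<Sum>v\<leftarrow>map s q. mnorm M (fst v) * mnorm N (snd v)) \<le> S"
          unfolding S_def map_map comp_def s_def fst_conv snd_conv using q(1) \<sigma>_le
          by (intro sum_list_mono mult_right_mono) auto
        then show ?thesis
          using norm_sum_tip_le[OF sC(1)[OF u1] sq] K unfolding s_def n1_def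
          by (elim order_trans) (auto intro!: mult_left_mono)
      qed
      ultimately have le: "norm (mip T p p - a) \<le> ?z * K"
        unfolding K_def by (simp add: algebra_simps)
      have "?z\<^sup>2 \<le> (d / (K + 1))\<^sup>2"
        using small unfolding e_def by simp
      then have "?z \<le> d / (K + 1)"
        by (rule power2_le_imp_le) (use d K in simp)
      then have "?z * K \<le> d / (K + 1) * (K + 1)"
        using K d by (intro mult_mono) auto
      moreover have "d / (K + 1) * (K + 1) = d" using K by simp
      ultimately show ?thesis using le by linarith
    qed
    ultimately show "\<exists>a. positive a \<and> norm (mip T p p - a) \<le> d" by blast
  qed
qed simp

section \<open>The algebraic tensor product as a semi-inner product bimodule\<close>

lemma pre_tensor_simps [simp]:
  "mcarrier T = lists C" "madd T = (@)" "mzero T = []"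
  "mlact T b = map (\<lambda>(x, y). (mlact M b x, y))"
  "mract T p b = map (\<lambda>(x, y). (x, mract N y b)) p"
  by (simp_all add: pre_tensor_def)

lemma pre_tensor_semi_bimod: "semi_bimod T"
proof
  fix p q r :: "('m \<times> 'n) list" and a b and c
  assume p: "p \<in> mcarrier T"
  then have p': "p \<in> lists C" by simp
  show "mract T p b \<in> mcarrier T" "mlact T b p \<in> mcarrier T"
    using p' by (induction p) auto
  show "positive (mip T p p)" using p' by (rule pre_ip_positive)
  assume q: "q \<in> mcarrier T"
  then have q': "q \<in> lists C" by simp
  show "mip T p (madd T q r) = mip T p q + mip T p r"
    by (simp add: pre_ip_append_right)
  show "star (mip T p q) = mip T q p"
    using p' q' by (rule pre_ip_star)
  have row: "sum_list (map f p) = sum_list (map h p) * c" if "\<And>u. u \<in> C \<Longrightarrow> f u = h u * c" for f h and c :: 'b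
    using p' that by (induction p) (auto simp: distrib_right)
  have row2: "sum_list (map f p) = sum_list (map h p) + sum_list (map h' p)"
    if "\<And>u. u \<in> C \<Longrightarrow> f u = h u + h' u" for f h h' :: "'m \<times> 'n \<Rightarrow> 'b"
    using p' that by (induction p) auto
  show "mip T p (mract T q b) = mip T p q * b"
    using q'
  proof (induction q)
    case (Cons v q)
    then have v: "fst v \<in> mcarrier M" "snd v \<in> mcarrier N" by auto
    have "(\<Sum>u\<leftarrow>p. tip u (fst v, mract N (snd v) b)) = (\<Sum>u\<leftarrow>p. tip u v) * b"
      by (intro row) (auto simp: v tip_def mem_Times_iff N.ip_lact_ract)
    with Cons show ?case by (auto simp: pre_ip_Cons_right distrib_right case_prod_unfold)
  qed simp
  show "mip T p (mlact T (scaleC c 1) q) = mip T p q * scaleC c 1"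
    using q'
  proof (induction q)
    case (Cons v q)
    then have v: "fst v \<in> mcarrier M" "snd v \<in> mcarrier N" by auto
    have "(\<Sum>u\<leftarrow>p. tip u (mlact M (scaleC c 1) (fst v), snd v)) = (\<Sum>u\<leftarrow>p. tip u v) * scaleC c 1"
      by (intro row) (auto simp: v tip_def mem_Times_iff M.ip_scalar mult_scaleC_right N.ip_lact_scaleC)
    with Cons show ?case by (auto simp: pre_ip_Cons_right distrib_right case_prod_unfold)
  qed simp
  show "mip T p (mlact T (a + b) q) = mip T p (mlact T a q) + mip T p (mlact T b q)"
    using q'
  proof (induction q)
    case (Cons v q)
    then have v: "fst v \<in> mcarrier M" "snd v \<in> mcarrier N" by auto
    have "(\<Sum>u\<leftarrow>p. tip u (mlact M (a + b) (fst v), snd v))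
        = (\<Sum>u\<leftarrow>p. tip u (mlact M a (fst v), snd v)) + (\<Sum>u\<leftarrow>p. tip u (mlact M b (fst v), snd v))"
      by (intro row2) (auto simp: v tip_def mem_Times_iff M.ip_lact_add N.ip_lact_add)
    with Cons show ?case by (auto simp: pre_ip_Cons_right case_prod_unfold)
  qed simp
  have same: "mip T p (map f q) = mip T p (map h q)"
    if "\<And>u v. u \<in> C \<Longrightarrow> v \<in> C \<Longrightarrow> tip u (f v) = tip u (h v)" for f h
  proof -
    have "(\<Sum>v\<leftarrow>map f q. tip u v) = (\<Sum>v\<leftarrow>map h q. tip u v)" if "u \<in> C" for u
      using q' \<open>u \<in> C\<close> by (induction q) (simp_all add: \<open>\<And>u v. u \<in> C \<Longrightarrow> v \<in> C \<Longrightarrow> tip u (f v) = tip u (h v)\<close>)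
    then show ?thesis
      using p' by (induction p) (simp_all add: pre_ip_Cons_left)
  qed
  show "mip T p (mlact T (a * b) q) = mip T p (mlact T a (mlact T b q))"
    unfolding pre_tensor_simps map_map
    by (rule same) (auto simp: tip_def mem_Times_iff M.ip_lact_mult)
  have "mip T p (map (\<lambda>(x, y). (mlact M 1 x, y)) q) = mip T p (map (\<lambda>v. v) q)"
    by (rule same) (auto simp: tip_def mem_Times_iff M.ip_lact_one)
  then show "mip T p (mlact T 1 q) = mip T p q" by simp
  show "mip T (mlact T b p) q = mip T p (mlact T (star b) q)"
  proof -
    have "(\<Sum>v\<leftarrow>q. tip (mlact M b (fst u), snd u) v) = (\<Sum>v\<leftarrow>mlact T (star b) q. tip u v)" if "u \<in> C" for u
      using q' \<open>u \<in> C\<close> by (induction q) (auto simp: tip_def mem_Times_iff M.ip_lact)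
    then show ?thesis
      using p' by (induction p) (auto simp: pre_ip_Cons_left case_prod_unfold)
  qed
qed auto

lemma elem_tensor_ip:
  assumes "x \<in> mcarrier M" "y \<in> mcarrier N" "x' \<in> mcarrier M" "y' \<in> mcarrier N"
  shows "mip (tensor M N) (elem_tensor M N x y) (elem_tensor M N x' y')
    = mip N y (mlact N (mip M x x') y')"
  unfolding tensor_def elem_tensor_def
  using assms by (simp add: semi_bimod.hclass_ip[OF pre_tensor_semi_bimod]) (simp add: pre_ip_def tip_def)

lemma elem_tensor_closed:
  "x \<in> mcarrier M \<Longrightarrow> y \<in> mcarrier N \<Longrightarrow> elem_tensor M N x y \<in> mcarrier (tensor M N)"
  unfolding tensor_def elem_tensor_def by (simp add: semi_bimod.hclass_closed[OF pre_tensor_semi_bimod])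

lemma elem_tensor_lact:
  "x \<in> mcarrier M \<Longrightarrow> y \<in> mcarrier N \<Longrightarrow>
    mlact (tensor M N) b (elem_tensor M N x y) = elem_tensor M N (mlact M b x) y"
  unfolding tensor_def elem_tensor_def by (simp add: semi_bimod.hclass_lact[OF pre_tensor_semi_bimod])

text \<open>The difference of X and Y is orthogonal to all finite sums of elementary tensors;
  approximating it by such a sum bounds its squared norm by e times its norm for every e >
  0.\<close>

lemma tensor_ext:
  assumes X: "X \<in> mcarrier (tensor M N)" and Y: "Y \<in> mcarrier (tensor M N)"
    and eq: "\<And>x y. x \<in> mcarrier M \<Longrightarrow> y \<in> mcarrier N \<Longrightarrow>
      mip (tensor M N) (elem_tensor M N x y) X = mip (tensor M N) (elem_tensor M N x y) Y"
  shows "X = Y"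
proof -
  interpret T: semi_bimod T by (rule pre_tensor_semi_bimod)
  interpret H: pre_hilbert_bimod "tensor M N"
    unfolding tensor_def by (intro hilbert_pre_hilbert_bimod T.hilbert_hcompletion)
  have hc: "hclass T p \<in> mcarrier (tensor M N)" if "p \<in> lists C" for p
    unfolding tensor_def using that by (intro T.hclass_closed) simp
  have list: "mip (tensor M N) (hclass T p) X = mip (tensor M N) (hclass T p) Y" if "p \<in> lists C" for p
    using that
  proof (induction p)
    case Nil
    then show ?case using X Y H.ip_zero_left T.hclass_zero unfolding tensor_def by simp
  next
    case (Cons u p)
    then have "hclass T (u # p) = madd (tensor M N) (elem_tensor M N (fst u) (snd u)) (hclass T p)"
      unfolding tensor_def elem_tensor_def using T.hclass_add[of "[u]" p] by auto
    then show ?case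
      using Cons X Y eq[of "fst u" "snd u"] hc[of p] elem_tensor_closed[of "fst u" "snd u"]
      by (auto simp: H.ip_add_left)
  qed
  let ?Z = "msub (tensor M N) X Y"
  have Z: "?Z \<in> mcarrier (tensor M N)" using X Y by simp
  have "mnorm (tensor M N) ?Z * mnorm (tensor M N) ?Z \<le> 0"
  proof (rule le_if_le_add_mult_epsilon)
    fix e :: real assume e: "0 < e"
    obtain p where p: "p \<in> lists C" "mdist (tensor M N) ?Z (hclass T p) < e"
      using T.hclass_dense[of ?Z e] Z e unfolding tensor_def by auto
    have 0: "mip (tensor M N) (hclass T p) ?Z = 0"
      using list[OF p(1)] hc[OF p(1)] X Y by (simp add: H.ip_sub_right)
    have "mnorm (tensor M N) ?Z * mnorm (tensor M N) ?Z
        = norm (mip (tensor M N) ?Z ?Z - mip (tensor M N) (hclass T p) ?Z)"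
      unfolding 0 by (simp add: H.mnorm_mult_self)
    also have "\<dots> \<le> mdist (tensor M N) ?Z (hclass T p) * mnorm (tensor M N) ?Z"
      using H.ip_diff_le[OF Z Z hc[OF p(1)] Z] Z by simp
    also have "\<dots> \<le> e * mnorm (tensor M N) ?Z"
      using p(2) by (intro mult_right_mono) auto
    finally show "mnorm (tensor M N) ?Z * mnorm (tensor M N) ?Z \<le> 0 + mnorm (tensor M N) ?Z * e"
      by (simp add: mult.commute)
  qed
  then have "mdist (tensor M N) X Y = 0"
    unfolding mdist_def using mult_pos_pos[of "mnorm (tensor M N) ?Z"] H.mnorm_nonneg[of ?Z]
    by (simp add: mult_le_0_iff)
  then show ?thesis using X Y by (rule H.eq_if_mdist_0[rotated 2])
qed

end

section \<open>First-order expansions and products of operators\<close>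

lemma blinfun_compose_id [simp]: "(id_blinfun o\<^sub>L A) = A" "(A o\<^sub>L id_blinfun) = A"
  by (auto intro: blinfun_eqI)

lemma blinfun_compose_simps:
  "((A + B) o\<^sub>L C) = (A o\<^sub>L C) + (B o\<^sub>L C)" "(A o\<^sub>L (D + C)) = (A o\<^sub>L D) + (A o\<^sub>L C)"
  "((A - B) o\<^sub>L C) = (A o\<^sub>L C) - (B o\<^sub>L C)" "(A o\<^sub>L (D - C)) = (A o\<^sub>L D) - (A o\<^sub>L C)"
  "((r *\<^sub>R A) o\<^sub>L C) = r *\<^sub>R (A o\<^sub>L C)" "(A o\<^sub>L (r *\<^sub>R C)) = r *\<^sub>R (A o\<^sub>L C)"
  by (auto intro!: blinfun_eqI simp: blinfun.bilinear_simps)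

text \<open>The head of the list acts first, in accordance with \<open>kern_ptens\<close>, where the
  operator of the left tensor factor acts first.\<close>

primrec opprod :: "('a::real_normed_vector \<Rightarrow>\<^sub>L 'a) list \<Rightarrow> 'a \<Rightarrow>\<^sub>L 'a" where
  "opprod [] = id_blinfun"
| "opprod (A # As) = opprod As o\<^sub>L A"

text \<open>An expansion with error o(\<tau>), uniform in the index. Indices are lengths as well as
  lists of lengths, so the same notion serves for single vectors and for products over
  partitions.\<close>

definition first_order ::
  "'i set \<Rightarrow> ('i \<Rightarrow> real) \<Rightarrow> ('i \<Rightarrow> 'v::real_normed_vector) \<Rightarrow> 'v \<Rightarrow> 'v \<Rightarrow> bool" where
  "first_order I \<tau> A A\<^sub>0 A\<^sub>1 \<longleftrightarrow>
    (\<forall>e>0. \<exists>d>0. \<forall>i\<in>I. \<tau> i \<le> d \<longrightarrow> norm (A i - (A\<^sub>0 + \<tau> i *\<^sub>R A\<^sub>1)) \<le> e * \<tau> i)"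

lemma first_orderD:
  assumes "first_order I \<tau> A A\<^sub>0 A\<^sub>1" "0 < e"
  obtains d where "0 < d" "\<And>i. i \<in> I \<Longrightarrow> \<tau> i \<le> d \<Longrightarrow> norm (A i - (A\<^sub>0 + \<tau> i *\<^sub>R A\<^sub>1)) \<le> e * \<tau> i"
  using assms unfolding first_order_def by blast

lemma first_orderI:
  assumes "\<And>e. 0 < e \<Longrightarrow> \<exists>d>0. \<forall>i\<in>I. \<tau> i \<le> d \<longrightarrow> norm (A i - (A\<^sub>0 + \<tau> i *\<^sub>R A\<^sub>1)) \<le> e * \<tau> i"
  shows "first_order I \<tau> A A\<^sub>0 A\<^sub>1"
  using assms unfolding first_order_def by blast

lemma first_order_cong:
  "first_order I \<tau> A A\<^sub>0 A\<^sub>1 \<Longrightarrow> (\<And>i. i \<in> I \<Longrightarrow> B i = A i) \<Longrightarrow> B\<^sub>0 = A\<^sub>0 \<Longrightarrow> first_order I \<tau> B B\<^sub>0 A\<^sub>1"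
  unfolding first_order_def by simp

lemma first_order_reindex:
  "first_order I \<tau> A A\<^sub>0 A\<^sub>1 \<Longrightarrow> (\<And>j. j \<in> J \<Longrightarrow> h j \<in> I) \<Longrightarrow> (\<And>j. j \<in> J \<Longrightarrow> \<tau> (h j) = m j) \<Longrightarrow>
    first_order J m (\<lambda>j. A (h j)) A\<^sub>0 A\<^sub>1"
  unfolding first_order_def by metis

lemma first_order_zero: "(\<And>i. i \<in> I \<Longrightarrow> 0 \<le> \<tau> i) \<Longrightarrow> first_order I \<tau> (\<lambda>i. 0) 0 0"
  by (intro first_orderI exI[of _ 1]) simp

lemma first_order_add:
  assumes "first_order I \<tau> A A\<^sub>0 A\<^sub>1" "first_order I \<tau> B B\<^sub>0 B\<^sub>1"
  shows "first_order I \<tau> (\<lambda>i. A i + B i) (A\<^sub>0 + B\<^sub>0) (A\<^sub>1 + B\<^sub>1)"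
proof (rule first_orderI)
  fix e :: real assume "0 < e"
  then have e2: "0 < e / 2" by simp
  obtain d where d: "0 < d" "\<And>i. i \<in> I \<Longrightarrow> \<tau> i \<le> d \<Longrightarrow> norm (A i - (A\<^sub>0 + \<tau> i *\<^sub>R A\<^sub>1)) \<le> e / 2 * \<tau> i"
    using first_orderD[OF assms(1) e2] by blast
  obtain c where c: "0 < c" "\<And>i. i \<in> I \<Longrightarrow> \<tau> i \<le> c \<Longrightarrow> norm (B i - (B\<^sub>0 + \<tau> i *\<^sub>R B\<^sub>1)) \<le> e / 2 * \<tau> i"
    using first_orderD[OF assms(2) e2] by blast
  have "norm (A i + B i - (A\<^sub>0 + B\<^sub>0 + \<tau> i *\<^sub>R (A\<^sub>1 + B\<^sub>1))) \<le> e * \<tau> i" if "i \<in> I" "\<tau> i \<le> min d c" for i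
  proof -
    have "norm ((A i - (A\<^sub>0 + \<tau> i *\<^sub>R A\<^sub>1)) + (B i - (B\<^sub>0 + \<tau> i *\<^sub>R B\<^sub>1))) \<le> e / 2 * \<tau> i + e / 2 * \<tau> i"
      using that by (intro norm_triangle_le add_mono d c) auto
    then show ?thesis by (simp add: algebra_simps)
  qed
  then show "\<exists>d>0. \<forall>i\<in>I. \<tau> i \<le> d \<longrightarrow> norm (A i + B i - (A\<^sub>0 + B\<^sub>0 + \<tau> i *\<^sub>R (A\<^sub>1 + B\<^sub>1))) \<le> e * \<tau> i"
    using d(1) c(1) by (intro exI[of _ "min d c"]) simp
qed

lemma first_order_bounded_linear:
  assumes "first_order I \<tau> A A\<^sub>0 A\<^sub>1" and h: "bounded_linear h" and pos: "\<And>i. i \<in> I \<Longrightarrow> 0 \<le> \<tau> i"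
  shows "first_order I \<tau> (\<lambda>i. h (A i)) (h A\<^sub>0) (h A\<^sub>1)"
proof (rule first_orderI)
  fix e :: real assume e: "0 < e"
  interpret h: bounded_linear h by fact
  obtain K where K: "0 < K" "\<And>x. norm (h x) \<le> norm x * K" using h.pos_bounded by blast
  have "0 < e / K" using e K by simp
  then obtain d where d: "0 < d" "\<And>i. i \<in> I \<Longrightarrow> \<tau> i \<le> d \<Longrightarrow> norm (A i - (A\<^sub>0 + \<tau> i *\<^sub>R A\<^sub>1)) \<le> e / K * \<tau> i"
    using first_orderD[OF assms(1)] by blast
  have "norm (h (A i) - (h A\<^sub>0 + \<tau> i *\<^sub>R h A\<^sub>1)) \<le> e * \<tau> i" if "i \<in> I" "\<tau> i \<le> d" for i
  proof -
    have "norm (h (A i) - (h A\<^sub>0 + \<tau> i *\<^sub>R h A\<^sub>1)) = norm (h (A i - (A\<^sub>0 + \<tau> i *\<^sub>R A\<^sub>1)))"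
      by (simp add: h.diff h.add h.scaleR)
    also have "\<dots> \<le> (e / K * \<tau> i) * K"
      using d(2)[OF that] K by (intro order_trans[OF K(2)] mult_right_mono) auto
    finally show ?thesis using K by simp
  qed
  with d(1) show "\<exists>d>0. \<forall>i\<in>I. \<tau> i \<le> d \<longrightarrow> norm (h (A i) - (h A\<^sub>0 + \<tau> i *\<^sub>R h A\<^sub>1)) \<le> e * \<tau> i"
    by blast
qed

lemma first_order_norm_le:
  fixes A :: "'a::real_normed_vector \<Rightarrow>\<^sub>L 'a"
  assumes "norm (A - (id_blinfun + l *\<^sub>R L)) \<le> e * l" "0 \<le> l"
  shows "norm A \<le> 1 + (norm L + e) * l" "norm (A - id_blinfun) \<le> (norm L + e) * l"
proof -
  have "norm (A - id_blinfun) \<le> norm (A - (id_blinfun + l *\<^sub>R L)) + norm (l *\<^sub>R L)"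
    using norm_triangle_ineq[of "A - (id_blinfun + l *\<^sub>R L)" "l *\<^sub>R L"] by simp
  then show *: "norm (A - id_blinfun) \<le> (norm L + e) * l"
    using assms by (simp add: algebra_simps)
  have "norm A \<le> norm (id_blinfun :: 'a \<Rightarrow>\<^sub>L 'a) + norm (A - id_blinfun)"
    using norm_triangle_ineq[of id_blinfun "A - id_blinfun"] by simp
  then show "norm A \<le> 1 + (norm L + e) * l"
    using * norm_blinfun_id_le[where 'a = 'a] by linarith
qed

lemma norm_opprod_le:
  assumes "\<And>i. i \<in> set is \<Longrightarrow> norm (A i) \<le> exp (c * \<tau> i)"
  shows "norm (opprod (map A is)) \<le> exp (c * (\<Sum>i\<leftarrow>is. \<tau> i))"
  using assms
proof (induction "is")
  case Nil
  show ?case using norm_blinfun_id_le by simp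
next
  case (Cons i "is")
  have "norm (opprod (map A is) o\<^sub>L A i) \<le> norm (opprod (map A is)) * norm (A i)"
    by (rule norm_blinfun_compose)
  also have "\<dots> \<le> exp (c * (\<Sum>i\<leftarrow>is. \<tau> i)) * exp (c * \<tau> i)"
    using Cons by (intro mult_mono) auto
  finally show ?case by (simp add: exp_add[symmetric] algebra_simps)
qed

text \<open>Factors are exchanged one at a time; each exchange costs e times its length, and the
  other factors grow at most exponentially in the total length.\<close>

lemma norm_opprod_diff_le:
  assumes "\<And>i. i \<in> set is \<Longrightarrow> norm (A i) \<le> exp (c * \<tau> i)"
    "\<And>i. i \<in> set is \<Longrightarrow> norm (B i) \<le> exp (c * \<tau> i)"
    "\<And>i. i \<in> set is \<Longrightarrow> norm (A i - B i) \<le> e * \<tau> i"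
    "\<And>i. i \<in> set is \<Longrightarrow> 0 \<le> \<tau> i" "0 \<le> c" "0 \<le> e"
  shows "norm (opprod (map A is) - opprod (map B is)) \<le> e * (\<Sum>i\<leftarrow>is. \<tau> i) * exp (c * (\<Sum>i\<leftarrow>is. \<tau> i))"
  using assms(1-4)
proof (induction "is")
  case (Cons i "is")
  define t where "t = (\<Sum>i\<leftarrow>is. \<tau> i)"
  define P Q where "P = opprod (map A is)" and "Q = opprod (map B is)"
  have t: "0 \<le> t" unfolding t_def using Cons.prems(4) by (intro sum_list_nonneg) auto
  have i: "0 \<le> \<tau> i" using Cons.prems(4) by simp
  have IH: "norm (P - Q) \<le> e * t * exp (c * t)"
    unfolding P_def Q_def t_def using Cons by simp
  have Q: "norm Q \<le> exp (c * t)"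
    unfolding Q_def t_def using Cons.prems by (intro norm_opprod_le) auto
  have "(P o\<^sub>L A i) - (Q o\<^sub>L B i) = ((P - Q) o\<^sub>L A i) + (Q o\<^sub>L (A i - B i))"
    by (simp add: blinfun_compose_simps)
  also have "norm \<dots> \<le> (e * t * exp (c * t)) * exp (c * \<tau> i) + exp (c * t) * (e * \<tau> i)"
    using IH Q Cons.prems t assms(5,6)
    by (intro norm_triangle_le add_mono order_trans[OF norm_blinfun_compose] mult_mono) auto
  also have "exp (c * t) * (e * \<tau> i) \<le> (exp (c * t) * exp (c * \<tau> i)) * (e * \<tau> i)"
    using assms(5,6) i by (intro mult_right_mono) auto
  also have "(e * t * exp (c * t)) * exp (c * \<tau> i) + (exp (c * t) * exp (c * \<tau> i)) * (e * \<tau> i)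
      = e * (\<tau> i + t) * exp (c * (\<tau> i + t))"
    by (simp add: distrib_left distrib_right exp_add)
  finally show ?case unfolding P_def Q_def t_def by simp
qed simp

text \<open>Splitting off one factor A i from a product of length t adds its own first-order error
  and the cross term t L (A i - 1). The cross terms are of second order and accumulate to at most (c
  t) squared; the exponential absorbs the growth of the products.\<close>

lemma opprod_first_order_le:
  fixes A :: "'i \<Rightarrow> 'a::real_normed_vector \<Rightarrow>\<^sub>L 'a"
  assumes "\<And>i. i \<in> set is \<Longrightarrow> norm (A i - (id_blinfun + \<tau> i *\<^sub>R L)) \<le> e * \<tau> i"
    "\<And>i. i \<in> set is \<Longrightarrow> 0 \<le> \<tau> i" "0 \<le> e"
  defines "c \<equiv> norm L + e"
  shows "norm (opprod (map A is) - (id_blinfun + (\<Sum>i\<leftarrow>is. \<tau> i) *\<^sub>R L))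
    \<le> (e * (\<Sum>i\<leftarrow>is. \<tau> i) + (c * (\<Sum>i\<leftarrow>is. \<tau> i))\<^sup>2) * exp (c * (\<Sum>i\<leftarrow>is. \<tau> i))"
  using assms(1,2)
proof (induction "is")
  case (Cons i "is")
  define t where "t = (\<Sum>i\<leftarrow>is. \<tau> i)"
  define P where "P = opprod (map A is)"
  have c: "0 \<le> c" unfolding c_def using assms(3) by simp
  have t: "0 \<le> t" unfolding t_def using Cons.prems(2) by (intro sum_list_nonneg) auto
  have i: "0 \<le> \<tau> i" using Cons.prems(2) by simp
  have IH: "norm (P - (id_blinfun + t *\<^sub>R L)) \<le> (e * t + (c * t)\<^sup>2) * exp (c * t)"
    unfolding P_def t_def using Cons by simp
  have Ai: "norm (A i - (id_blinfun + \<tau> i *\<^sub>R L)) \<le> e * \<tau> i" using Cons.prems(1) by simp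
  have "norm (A i) \<le> 1 + c * \<tau> i" and A1: "norm (A i - id_blinfun) \<le> c * \<tau> i"
    unfolding c_def using first_order_norm_le[OF Ai i] by auto
  then have A2: "norm (A i) \<le> exp (c * \<tau> i)"
    using exp_ge_add_one_self[of "c * \<tau> i"] by linarith
  have "(P o\<^sub>L A i) - (id_blinfun + (\<tau> i + t) *\<^sub>R L)
      = ((P - (id_blinfun + t *\<^sub>R L)) o\<^sub>L A i) + (A i - (id_blinfun + \<tau> i *\<^sub>R L)) + t *\<^sub>R (L o\<^sub>L (A i - id_blinfun))"
    by (simp add: blinfun_compose_simps algebra_simps)
  also have "norm \<dots> \<le> ((e * t + (c * t)\<^sup>2) * exp (c * t)) * exp (c * \<tau> i) + e * \<tau> i + t * (c * (c * \<tau> i))"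
  proof (intro norm_triangle_le add_mono)
    show "norm ((P - (id_blinfun + t *\<^sub>R L)) o\<^sub>L A i) \<le> ((e * t + (c * t)\<^sup>2) * exp (c * t)) * exp (c * \<tau> i)"
      using IH A2 t assms(3) by (intro order_trans[OF norm_blinfun_compose] mult_mono) auto
    have "norm (L o\<^sub>L (A i - id_blinfun)) \<le> c * (c * \<tau> i)"
      using A1 c assms(3) by (intro order_trans[OF norm_blinfun_compose] mult_mono) (auto simp: c_def)
    then show "norm (t *\<^sub>R (L o\<^sub>L (A i - id_blinfun))) \<le> t * (c * (c * \<tau> i))"
      using t by (simp add: mult_left_mono)
  qed (rule Ai)
  also have "\<dots> \<le> (e * t + (c * t)\<^sup>2) * exp (c * (\<tau> i + t)) + (e * \<tau> i + t * (c * (c * \<tau> i))) * exp (c * (\<tau> i + t))"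
  proof -
    have "(e * \<tau> i + t * (c * (c * \<tau> i))) * 1 \<le> (e * \<tau> i + t * (c * (c * \<tau> i))) * exp (c * (\<tau> i + t))"
      using c t i assms(3) by (intro mult_left_mono) auto
    then show ?thesis by (simp add: distrib_left exp_add mult_ac)
  qed
  also have "\<dots> = (e * (\<tau> i + t) + ((c * t)\<^sup>2 + c\<^sup>2 * (t * \<tau> i))) * exp (c * (\<tau> i + t))"
    by (simp add: algebra_simps power2_eq_square)
  also have "\<dots> \<le> (e * (\<tau> i + t) + (c * (\<tau> i + t))\<^sup>2) * exp (c * (\<tau> i + t))"
  proof -
    have "(c * (\<tau> i + t))\<^sup>2 = (c * t)\<^sup>2 + c\<^sup>2 * (t * \<tau> i) + (c\<^sup>2 * (t * \<tau> i) + (c * \<tau> i)\<^sup>2)"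
      by (simp add: algebra_simps power2_eq_square)
    moreover have "0 \<le> c\<^sup>2 * (t * \<tau> i) + (c * \<tau> i)\<^sup>2" using t i by simp
    ultimately have "(c * t)\<^sup>2 + c\<^sup>2 * (t * \<tau> i) \<le> (c * (\<tau> i + t))\<^sup>2" by linarith
    then show ?thesis by (intro mult_right_mono add_left_mono) auto
  qed
  finally show ?case unfolding P_def t_def by simp
qed (simp add: id_blinfun.rep_eq)

text \<open>The bound of \<open>opprod_first_order_le\<close> depends on the list only through its
  sum, so the expansion is uniform over all ways to divide a short interval.\<close>

lemma first_order_opprod:
  fixes A :: "'i \<Rightarrow> 'a::real_normed_vector \<Rightarrow>\<^sub>L 'a"
  assumes A: "first_order I \<tau> A id_blinfun L" and pos: "\<And>i. i \<in> I \<Longrightarrow> 0 \<le> \<tau> i"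
  shows "first_order (lists I) (\<lambda>is. \<Sum>i\<leftarrow>is. \<tau> i) (\<lambda>is. opprod (map A is)) id_blinfun L"
proof (rule first_orderI)
  fix e :: real assume e: "0 < e"
  define e0 where "e0 = min (e / 4) 1"
  have e0: "0 < e0" "e0 \<le> e / 4" "e0 \<le> 1" unfolding e0_def using e by auto
  obtain d0 where d0: "0 < d0"
    "\<And>i. i \<in> I \<Longrightarrow> \<tau> i \<le> d0 \<Longrightarrow> norm (A i - (id_blinfun + \<tau> i *\<^sub>R L)) \<le> e0 * \<tau> i"
    using first_orderD[OF A e0(1)] by blast
  define c where "c = norm L + e0"
  have c: "0 < c" unfolding c_def using e0 by (simp add: add_nonneg_pos)
  \<comment> \<open>The three bounds make the expansion of each factor available, keep exp (c t)
    below 2, and make (c t) squared at most e t / 4.\<close>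
  define d where "d = min d0 (min (ln 2 / c) (e / (4 * c\<^sup>2)))"
  have d: "0 < d" "d \<le> d0" "d \<le> ln 2 / c" "d \<le> e / (4 * c\<^sup>2)"
    unfolding d_def using d0 c e by auto
  have "norm (opprod (map A is) - (id_blinfun + (\<Sum>i\<leftarrow>is. \<tau> i) *\<^sub>R L)) \<le> e * (\<Sum>i\<leftarrow>is. \<tau> i)"
    if "is": "is \<in> lists I" "(\<Sum>i\<leftarrow>is. \<tau> i) \<le> d" for "is"
  proof -
    define t where "t = (\<Sum>i\<leftarrow>is. \<tau> i)"
    have t: "0 \<le> t" "t \<le> d" unfolding t_def using "is" pos by (auto intro!: sum_list_nonneg)
    have mem: "\<tau> i \<le> t" "i \<in> I" if "i \<in> set is" for i
    proof -
      show "i \<in> I" using "is" that by auto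
      show "\<tau> i \<le> t" unfolding t_def
        using that "is" pos by (intro member_le_sum_list) auto
    qed
    have small: "norm (A i - (id_blinfun + \<tau> i *\<^sub>R L)) \<le> e0 * \<tau> i" if "i \<in> set is" for i
      using mem[OF that] t d by (intro d0(2)) auto
    have "norm (opprod (map A is) - (id_blinfun + t *\<^sub>R L)) \<le> (e0 * t + (c * t)\<^sup>2) * exp (c * t)"
      unfolding t_def c_def
      by (rule opprod_first_order_le) (use small mem pos e0 in auto)
    also have "\<dots> \<le> (e / 4 * t + e / 4 * t) * 2"
    proof (intro mult_mono add_mono)
      have "c\<^sup>2 * t \<le> e / 4"
      proof -
        have "c\<^sup>2 * t \<le> c\<^sup>2 * (e / (4 * c\<^sup>2))" using t d(4) by (intro mult_left_mono) auto
        then show ?thesis using c by simp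
      qed
      then show "(c * t)\<^sup>2 \<le> e / 4 * t"
        using mult_right_mono[of "c\<^sup>2 * t" "e / 4" t] t by (simp add: power2_eq_square mult_ac)
      have "c * t \<le> c * (ln 2 / c)" using t d(3) c by (intro mult_left_mono) auto
      then have "c * t \<le> ln 2" using c by simp
      then show "exp (c * t) \<le> 2" by (simp add: ln_ge_iff)
    qed (use e0 t e in auto)
    also have "\<dots> = e * t" by simp
    finally show ?thesis unfolding t_def .
  qed
  then show "\<exists>d>0. \<forall>is\<in>lists I. (\<Sum>i\<leftarrow>is. \<tau> i) \<le> d \<longrightarrow>
      norm (opprod (map A is) - (id_blinfun + (\<Sum>i\<leftarrow>is. \<tau> i) *\<^sub>R L)) \<le> e * (\<Sum>i\<leftarrow>is. \<tau> i)"
    using d(1) by blast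
qed

lemma first_order_tendsto:
  assumes "first_order {0..} (\<lambda>r. r) A A\<^sub>0 A\<^sub>1"
  shows "(A \<longlongrightarrow> A\<^sub>0) (at 0 within {0..})"
proof -
  obtain d where d: "0 < d" "\<And>r. r \<in> {0..} \<Longrightarrow> r \<le> d \<Longrightarrow> norm (A r - (A\<^sub>0 + r *\<^sub>R A\<^sub>1)) \<le> 1 * r"
    using first_orderD[OF assms, of 1] by auto
  have "((\<lambda>r. A r - (A\<^sub>0 + r *\<^sub>R A\<^sub>1)) \<longlongrightarrow> 0) (at 0 within {0..})"
  proof (rule Lim_null_comparison)
    show "\<forall>\<^sub>F r in at 0 within {0..}. norm (A r - (A\<^sub>0 + r *\<^sub>R A\<^sub>1)) \<le> r"
      unfolding eventually_at using d by (intro exI[of _ d]) (auto simp: dist_norm)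
    show "((\<lambda>r::real. r) \<longlongrightarrow> 0) (at 0 within {0..})" by (intro tendsto_eq_intros) auto
  qed
  moreover have "((\<lambda>r. A\<^sub>0 + r *\<^sub>R A\<^sub>1) \<longlongrightarrow> A\<^sub>0) (at 0 within {0..})"
    by (intro tendsto_eq_intros) auto
  ultimately show ?thesis
    using tendsto_add by fastforce
qed

lemma first_order_quotient:
  assumes A: "first_order {0..} (\<lambda>r. r) A A\<^sub>0 A\<^sub>1"
  shows "((\<lambda>r. (1 / r) *\<^sub>R (A r - A\<^sub>0)) \<longlongrightarrow> A\<^sub>1) (at_right 0)"
proof (rule tendstoI)
  fix e :: real assume e: "0 < e"
  then have "0 < e / 2" by simp
  then obtain d where d: "0 < d" "\<And>r. r \<in> {0..} \<Longrightarrow> r \<le> d \<Longrightarrow> norm (A r - (A\<^sub>0 + r *\<^sub>R A\<^sub>1)) \<le> e / 2 * r"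
    using first_orderD[OF A] by blast
  have "dist ((1 / r) *\<^sub>R (A r - A\<^sub>0)) A\<^sub>1 < e" if "0 < r" "r < d" for r
  proof -
    have "(1 / r) *\<^sub>R (A r - A\<^sub>0) - A\<^sub>1 = (1 / r) *\<^sub>R (A r - (A\<^sub>0 + r *\<^sub>R A\<^sub>1))"
      using that by (simp add: algebra_simps)
    then have "dist ((1 / r) *\<^sub>R (A r - A\<^sub>0)) A\<^sub>1 = norm (A r - (A\<^sub>0 + r *\<^sub>R A\<^sub>1)) / r"
      using that by (simp add: dist_norm)
    also have "\<dots> \<le> e / 2" using d(2)[of r] that by (simp add: field_simps)
    finally show ?thesis using e by simp
  qed
  then show "\<forall>\<^sub>F r in at_right 0. dist ((1 / r) *\<^sub>R (A r - A\<^sub>0)) A\<^sub>1 < e"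
    unfolding eventually_at_right_field using d(1) by auto
qed

lemma first_order_vector_derivative:
  assumes A: "first_order {0..} (\<lambda>r. r) A A\<^sub>0 A\<^sub>1"
  shows "vector_derivative A (at 0 within {0..}) = A\<^sub>1"
proof (rule vector_derivative_within)
  show "at 0 within {0::real..} \<noteq> bot"
    by (simp add: at_within_Ici_at_right)
  \<comment> \<open>At r = 0 the permitted error is e * 0, so the expansion is exact there.\<close>
  have "A 0 = A\<^sub>0"
    using first_orderD[OF A, of 1] by (metis atLeast_iff diff_add_cancel less_eq_real_def mult_zero_right
        norm_le_zero_iff order_refl scaleR_zero_left add.right_neutral right_minus_eq zero_less_one)
  show "(A has_vector_derivative A\<^sub>1) (at 0 within {0..})"
    unfolding has_vector_derivative_def has_derivative_within_alt
  proof (intro conjI bounded_linear_scaleR_left allI impI)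
    fix e :: real assume "0 < e"
    then obtain d where d: "0 < d" "\<And>r. r \<in> {0..} \<Longrightarrow> r \<le> d \<Longrightarrow> norm (A r - (A\<^sub>0 + r *\<^sub>R A\<^sub>1)) \<le> e * r"
      using first_orderD[OF A] by blast
    have "norm (A r - A 0 - (r - 0) *\<^sub>R A\<^sub>1) \<le> e * norm (r - 0)" if "r \<in> {0..}" "norm (r - 0) < d" for r
      using d(2)[of r] that \<open>A 0 = A\<^sub>0\<close> by (simp add: algebra_simps)
    then show "\<exists>d>0. \<forall>r\<in>{0..}. norm (r - 0) < d \<longrightarrow> norm (A r - A 0 - (r - 0) *\<^sub>R A\<^sub>1) \<le> e * norm (r - 0)"
      using d(1) by blast
  qed
qed

section \<open>Uniformly continuous semigroups\<close>

locale operator_semigroup =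
  fixes K :: "real \<Rightarrow> 'a::banach \<Rightarrow>\<^sub>L 'a"
  assumes at_zero: "K 0 = id_blinfun"
    and semigroup: "0 \<le> t \<Longrightarrow> 0 \<le> s \<Longrightarrow> K (t + s) = K s o\<^sub>L K t"
    and tendsto_zero: "(K \<longlongrightarrow> id_blinfun) (at 0 within {0..})"
begin

lemma near_zero:
  assumes "0 < e"
  obtains d where "0 < d" "\<And>r. 0 \<le> r \<Longrightarrow> r < d \<Longrightarrow> norm (K r - id_blinfun) < e"
proof -
  obtain d where d: "0 < d" "\<And>r. r \<in> {0..} \<Longrightarrow> r \<noteq> 0 \<Longrightarrow> dist r 0 < d \<Longrightarrow> dist (K r) id_blinfun < e"
    using tendstoD[OF tendsto_zero assms] unfolding eventually_at by blast
  show thesis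
    by (rule that[OF d(1)]) (use d(2) at_zero assms in \<open>force simp: dist_norm\<close>)
qed

text \<open>The operators have norm at most 2 on [0, d); advancing by d / 2 stays within that range
  and multiplies the bound by at most 2 at each step.\<close>

lemma bounded_on_interval:
  obtains B where "0 < B" "\<And>r. 0 \<le> r \<Longrightarrow> r \<le> T \<Longrightarrow> norm (K r) \<le> B"
proof -
  obtain d where d: "0 < d" "\<And>r. 0 \<le> r \<Longrightarrow> r < d \<Longrightarrow> norm (K r - id_blinfun) < 1"
    using near_zero[of 1] by auto
  have small: "norm (K r) \<le> 2" if "0 \<le> r" "r < d" for r
    using norm_triangle_ineq[of "K r - id_blinfun" id_blinfun] norm_blinfun_id_le[where 'a = 'a] d(2)[OF that]
    by simp
  have step: "norm (K r) \<le> 2 ^ Suc n" if "0 \<le> r" "r \<le> real n * (d / 2)" for r n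
    using that
  proof (induction n arbitrary: r)
    case 0
    then show ?case using small[of r] d by auto
  next
    case (Suc n)
    show ?case
    proof (cases "r < d")
      case True
      then have "norm (K r) \<le> 2 * 1" using small[of r] Suc.prems by simp
      also have "\<dots> \<le> 2 * 2 ^ Suc n" by (intro mult_left_mono one_le_power) auto
      finally show ?thesis by simp
    next
      case False
      have "K r = K (d / 2) o\<^sub>L K (r - d / 2)"
        using semigroup[of "r - d / 2" "d / 2"] False d by simp
      then have "norm (K r) \<le> norm (K (d / 2)) * norm (K (r - d / 2))"
        by (simp add: norm_blinfun_compose)
      also have "\<dots> \<le> 2 * 2 ^ Suc n"
        using Suc False d by (intro mult_mono small Suc.IH) (auto simp: algebra_simps)
      finally show ?thesis by simp
    qed
  qed
  obtain n where "T < real n * (d / 2)"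
    using ex_less_of_nat_mult[of "d / 2" T] d by auto
  then show thesis
    by (intro that[of "2 ^ Suc n"] step) auto
qed

lemma diff_le:
  assumes "0 \<le> s" "s \<le> t"
  shows "norm (K t - K s) \<le> norm (K s) * norm (K (t - s) - id_blinfun)"
proof -
  have "K t = K s o\<^sub>L K (t - s)" using semigroup[of "t - s" s] assms by simp
  then have "K t - K s = (K s o\<^sub>L (K (t - s) - id_blinfun))"
    by (simp add: blinfun_compose_simps)
  then show ?thesis by (simp add: norm_blinfun_compose)
qed

text \<open>By \<open>diff_le\<close> an increment anywhere is an increment at 0 composed with the
  operator at the smaller argument. The bound up to t + 1 covers both sides of t.\<close>

theorem continuous: "continuous_on {0..} K"
  unfolding continuous_on_iff
proof (intro ballI allI impI)
  fix t e :: real assume t: "t \<in> {0..}" and e: "0 < e"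
  obtain B where B: "0 < B" "\<And>r. 0 \<le> r \<Longrightarrow> r \<le> t + 1 \<Longrightarrow> norm (K r) \<le> B"
    using bounded_on_interval by blast
  obtain d where d: "0 < d" "\<And>r. 0 \<le> r \<Longrightarrow> r < d \<Longrightarrow> norm (K r - id_blinfun) < e / B"
    using near_zero[of "e / B"] e B by auto
  have *: "norm (K p - K q) < e" if "0 \<le> q" "q \<le> p" "p \<le> t + 1" "p - q < d" for p q
  proof -
    have "norm (K p - K q) \<le> norm (K q) * norm (K (p - q) - id_blinfun)"
      using that by (intro diff_le) auto
    also have "\<dots> \<le> B * norm (K (p - q) - id_blinfun)"
      using B that by (intro mult_right_mono) auto
    also have "\<dots> < B * (e / B)" using B d that by (intro mult_strict_left_mono) auto
    finally show ?thesis using B by simp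
  qed
  have "dist (K s) (K t) < e" if "s \<in> {0..}" "dist s t < min d 1" for s
  proof (cases "s \<le> t")
    case True
    then show ?thesis using *[of s t] that t
      by (simp add: dist_norm norm_minus_commute abs_if split: if_splits)
  next
    case False
    then show ?thesis using *[of t s] that t
      by (simp add: dist_norm abs_if split: if_splits)
  qed
  then show "\<exists>d>0. \<forall>s\<in>{0..}. dist s t < d \<longrightarrow> dist (K s) (K t) < e"
    using d(1) by (intro exI[of _ "min d 1"]) simp
qed

lemma integral_approx:
  assumes "0 \<le> p" "p \<le> q" "\<And>s. s \<in> {p..q} \<Longrightarrow> norm (K s - C) \<le> e"
  shows "norm (integral {p..q} K - (q - p) *\<^sub>R C) \<le> e * (q - p)"
proof -
  have c: "continuous_on {p..q} K"
    by (rule continuous_on_subset[OF continuous]) (use assms in auto)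
  have "integral {p..q} (\<lambda>s. K s - C) = integral {p..q} K - (q - p) *\<^sub>R C"
    using assms(2) by (subst integral_diff) (auto intro: integrable_continuous_real c)
  moreover have "norm (integral {p..q} (\<lambda>s. K s - C)) \<le> e * (q - p)"
    using assms by (intro integral_bound continuous_intros c) auto
  ultimately show ?thesis by simp
qed

text \<open>With \<open>V\<close> the mean of \<open>K\<close> over a short interval, \<open>V (K t - 1) / t\<close> converges by the fundamental
  theorem of calculus, and \<open>V\<close> is close to the identity.\<close>

theorem differentiable: "\<exists>L. first_order {0..} (\<lambda>r. r) K id_blinfun L"
proof -
  obtain d0 where d0: "0 < d0" "\<And>r. 0 \<le> r \<Longrightarrow> r < d0 \<Longrightarrow> norm (K r - id_blinfun) < 1 / 2"
    using near_zero[of "1 / 2"] by auto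
  define a where "a = d0 / 2"
  have a: "0 < a" unfolding a_def using d0 by simp
  have int: "K integrable_on {p..q}" if "0 \<le> p" for p q
    using that by (intro integrable_continuous_real continuous_on_subset[OF continuous]) auto
  define V where "V = (1 / a) *\<^sub>R integral {0..a} K"
  define D where "D t = (1 / t) *\<^sub>R (K t - id_blinfun)" for t
  have "norm (integral {0..a} K - (a - 0) *\<^sub>R id_blinfun) \<le> 1 / 2 * (a - 0)"
    using d0 a by (intro integral_approx) (auto simp: a_def intro: less_imp_le)
  moreover have "V - id_blinfun = (1 / a) *\<^sub>R (integral {0..a} K - (a - 0) *\<^sub>R id_blinfun)"
    unfolding V_def using a by (simp add: scaleR_diff_right)
  ultimately have "norm (V - id_blinfun) \<le> (1 / a) * (1 / 2 * (a - 0))"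
    using a by (simp only: norm_scaleR) (intro mult_mono, auto)
  then have V: "norm (V - id_blinfun) \<le> 1 / 2"
    using a by simp
  have VD: "V o\<^sub>L (K t - id_blinfun) = (1 / a) *\<^sub>R (integral {a..a + t} K - integral {0..t} K)" if t: "0 \<le> t" for t
  proof -
    \<comment> \<open>Composition with K t shifts the interval of integration by t; splitting the
      integral over [0, a + t] in two ways leaves only the two end pieces.\<close>
    have "integral {0..a} K o\<^sub>L K t = integral {0..a} ((\<lambda>A. A o\<^sub>L K t) \<circ> K)"
      using integral_linear[OF int[of 0 a] bounded_bilinear.bounded_linear_left[OF bounded_bilinear_blinfun_compose, of "K t"]] by simp
    also have "\<dots> = integral {0..a} (K \<circ> (+) t)"
      using t by (intro integral_cong) (simp add: semigroup)
    also have "\<dots> = integral {t..a + t} K"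
      using integral_shift_Icc_real[of 0 a K t] by simp
    finally have "integral {0..a} K o\<^sub>L K t = integral {t..a + t} K" .
    moreover have "integral {0..t} K + integral {t..a + t} K = integral {0..a} K + integral {a..a + t} K"
      using t a int by (simp add: Henstock_Kurzweil_Integration.integral_combine)
    then have "integral {t..a + t} K - integral {0..a} K = integral {a..a + t} K - integral {0..t} K"
      by (simp add: algebra_simps)
    ultimately show ?thesis
      unfolding V_def by (simp add: blinfun_compose_simps scaleR_diff_right[symmetric])
  qed
  define W where "W = (1 / a) *\<^sub>R (K a - id_blinfun)"
  have VDW: "\<exists>d>0. \<forall>t. 0 < t \<and> t < d \<longrightarrow> norm ((V o\<^sub>L D t) - W) \<le> e" if e: "0 < e" for e
  proof -
    \<comment> \<open>Each of the two end pieces contributes an error e' t, and their sum is divided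
      by a t.\<close>
    define e' where "e' = e * a / 2"
    have e': "0 < e'" unfolding e'_def using e a by simp
    obtain d1 where d1: "0 < d1" "\<And>r. 0 \<le> r \<Longrightarrow> r < d1 \<Longrightarrow> norm (K r - id_blinfun) < e'"
      using near_zero[OF e'] by blast
    obtain d2 where d2: "0 < d2" "\<And>s. s \<in> {0..} \<Longrightarrow> dist s a < d2 \<Longrightarrow> dist (K s) (K a) < e'"
      using continuous[unfolded continuous_on_iff] a e' by (metis atLeast_iff less_eq_real_def)
    have "norm ((V o\<^sub>L D t) - W) \<le> e" if t: "0 < t" "t < min d1 d2" for t
    proof -
      have 1: "norm (integral {a..a + t} K - (a + t - a) *\<^sub>R K a) \<le> e' * (a + t - a)"
        using t a d2(2) by (intro integral_approx) (auto simp: dist_norm intro!: less_imp_le)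
      have 2: "norm (integral {0..t} K - (t - 0) *\<^sub>R id_blinfun) \<le> e' * (t - 0)"
        using t d1 by (intro integral_approx) (auto intro: less_imp_le)
      have "(V o\<^sub>L D t) - W = (1 / (a * t)) *\<^sub>R ((integral {a..a + t} K - t *\<^sub>R K a) - (integral {0..t} K - t *\<^sub>R id_blinfun))"
        unfolding D_def W_def blinfun_compose_simps(6) using t a by (simp add: VD algebra_simps)
      also have "norm \<dots> \<le> (1 / (a * t)) * (e' * t + e' * t)"
      proof -
        have "norm ((integral {a..a + t} K - t *\<^sub>R K a) - (integral {0..t} K - t *\<^sub>R id_blinfun)) \<le> e' * t + e' * t"
          using 1 2 norm_triangle_ineq4[of "integral {a..a + t} K - t *\<^sub>R K a" "integral {0..t} K - t *\<^sub>R id_blinfun"]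
          by simp
        then show ?thesis using t a by (simp only: norm_scaleR) (intro mult_mono, auto)
      qed
      also have "\<dots> = e" unfolding e'_def using a t by (simp add: field_simps)
      finally show ?thesis .
    qed
    then show ?thesis using d1(1) d2(1) by (intro exI[of _ "min d1 d2"]) simp
  qed
  have cauchy: "\<exists>d>0. \<forall>t s. 0 < t \<and> t < d \<and> 0 < s \<and> s < d \<longrightarrow> norm (D t - D s) \<le> e" if e: "0 < e" for e
  proof -
    have "0 < e / 4" using e by simp
    then obtain d where d: "0 < d" "\<And>t. 0 < t \<Longrightarrow> t < d \<Longrightarrow> norm ((V o\<^sub>L D t) - W) \<le> e / 4"
      using VDW by blast
    have "norm (D t - D s) \<le> e" if "0 < t" "t < d" "0 < s" "s < d" for t s
    proof -
      \<comment> \<open>As V is within 1 / 2 of the identity, the last term is at most half of the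
        norm being estimated and is absorbed on the left.\<close>
      have "D t - D s = (((V o\<^sub>L D t) - W) - ((V o\<^sub>L D s) - W)) - ((V - id_blinfun) o\<^sub>L (D t - D s))"
        by (simp add: blinfun_compose_simps)
      also have "norm \<dots> \<le> (e / 4 + e / 4) + 1 / 2 * norm (D t - D s)"
      proof -
        have 1: "norm ((V o\<^sub>L D t) - W) \<le> e / 4" "norm ((V o\<^sub>L D s) - W) \<le> e / 4"
          using d(2) that by auto
        have 2: "norm ((V - id_blinfun) o\<^sub>L (D t - D s)) \<le> 1 / 2 * norm (D t - D s)"
          by (rule order_trans[OF norm_blinfun_compose mult_right_mono[OF V norm_ge_zero]])
        have "norm (((V o\<^sub>L D t) - W) - ((V o\<^sub>L D s) - W)) \<le> e / 4 + e / 4"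
          using 1 norm_triangle_ineq4[of "(V o\<^sub>L D t) - W" "(V o\<^sub>L D s) - W"] by linarith
        then show ?thesis
          using 2 norm_triangle_ineq4[of "((V o\<^sub>L D t) - W) - ((V o\<^sub>L D s) - W)" "(V - id_blinfun) o\<^sub>L (D t - D s)"]
          by linarith
      qed
      finally show ?thesis by simp
    qed
    with d(1) show ?thesis by blast
  qed
  define S where "S n = D (inverse (real (Suc n)))" for n
  have inv: "\<exists>N. \<forall>n\<ge>N. inverse (real (Suc n)) < d" if "0 < d" for d :: real
    using order_tendstoD(2)[OF LIMSEQ_inverse_real_of_nat that] by (simp add: eventually_sequentially)
  have "Cauchy S"
  proof (rule CauchyI)
    fix e :: real assume e: "0 < e"
    obtain d where d: "0 < d" "\<And>t s. 0 < t \<Longrightarrow> t < d \<Longrightarrow> 0 < s \<Longrightarrow> s < d \<Longrightarrow> norm (D t - D s) \<le> e / 2"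
      using cauchy[of "e / 2"] e by auto
    obtain N where N: "\<And>n. n \<ge> N \<Longrightarrow> inverse (real (Suc n)) < d" using inv[OF d(1)] by blast
    have "norm (S m - S n) < e" if "m \<ge> N" "n \<ge> N" for m n
    proof -
      have "norm (S m - S n) \<le> e / 2"
        unfolding S_def using N that by (intro d(2)) auto
      then show ?thesis using e by simp
    qed
    then show "\<exists>M. \<forall>m\<ge>M. \<forall>n\<ge>M. norm (S m - S n) < e" by blast
  qed
  then obtain L where L: "S \<longlonglongrightarrow> L" using Cauchy_convergent convergent_def by blast
  have "first_order {0..} (\<lambda>r. r) K id_blinfun L"
  proof (rule first_orderI)
    fix e :: real assume e: "0 < e"
    obtain d where d: "0 < d" "\<And>t s. 0 < t \<Longrightarrow> t < d \<Longrightarrow> 0 < s \<Longrightarrow> s < d \<Longrightarrow> norm (D t - D s) \<le> e"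
      using cauchy[OF e] by blast
    have "norm (K t - (id_blinfun + t *\<^sub>R L)) \<le> e * t" if t: "0 \<le> t" "t \<le> d / 2" for t
    proof (cases "t = 0")
      case True
      then show ?thesis by (simp add: at_zero)
    next
      case False
      obtain N where N: "\<And>n. n \<ge> N \<Longrightarrow> inverse (real (Suc n)) < d" using inv[OF d(1)] by blast
      have "norm (D t - L) \<le> e"
      proof (rule LIMSEQ_le_const2)
        show "(\<lambda>n. norm (D t - S n)) \<longlonglongrightarrow> norm (D t - L)" by (intro tendsto_intros L)
        show "\<exists>N. \<forall>n\<ge>N. norm (D t - S n) \<le> e"
          unfolding S_def using N False t d(1) by (intro exI[of _ N] allI impI d(2)) auto
      qed
      moreover have "K t - (id_blinfun + t *\<^sub>R L) = t *\<^sub>R (D t - L)"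
        unfolding D_def using False by (simp add: algebra_simps)
      ultimately show ?thesis
        using t mult_left_mono[of "norm (D t - L)" e t] by (simp add: mult.commute)
    qed
    then show "\<exists>d>0. \<forall>t\<in>{0..}. t \<le> d \<longrightarrow> norm (K t - (id_blinfun + t *\<^sub>R L)) \<le> e * t"
      using d(1) by (intro exI[of _ "d / 2"]) auto
  qed
  then show ?thesis by blast
qed

end

section \<open>Operators given by pairs of vectors\<close>

definition kern :: "('b::unital_cstar_algebra, 'm) bimod \<Rightarrow> 'm \<Rightarrow> 'm \<Rightarrow> 'b \<Rightarrow>\<^sub>L 'b" where
  "kern M x y = Blinfun (\<lambda>b. mip M x (mlact M b y))"

text \<open>Effect on \<open>kern\<close> of two-sided coefficients of a vector: in its first
  argument, where they enter through adjoints and multiply from the left, and for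
  \<open>sandwich_right\<close> in its second argument, where they multiply from the right.\<close>

abbreviation sandwich :: "'b::unital_cstar_algebra \<Rightarrow> 'b \<Rightarrow> ('b \<Rightarrow>\<^sub>L 'b) \<Rightarrow> 'b \<Rightarrow>\<^sub>L 'b" where
  "sandwich k l A \<equiv> blinfun_mult_right l o\<^sub>L (A o\<^sub>L blinfun_mult_right k)"

abbreviation sandwich_right :: "'b::unital_cstar_algebra \<Rightarrow> 'b \<Rightarrow> ('b \<Rightarrow>\<^sub>L 'b) \<Rightarrow> 'b \<Rightarrow>\<^sub>L 'b" where
  "sandwich_right k l A \<equiv> blinfun_mult_left l o\<^sub>L (A o\<^sub>L blinfun_mult_left k)"

lemma bounded_linear_sandwich:
  fixes P Q :: "'a::real_normed_vector \<Rightarrow>\<^sub>L 'a"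
  shows "bounded_linear (\<lambda>A. P o\<^sub>L (A o\<^sub>L Q))"
  using bounded_linear_compose[OF bounded_bilinear.bounded_linear_right[OF bounded_bilinear_blinfun_compose, of P]
      bounded_bilinear.bounded_linear_left[OF bounded_bilinear_blinfun_compose, of Q]] .

lemma norm_blinfun_one_le:
  "norm (blinfun_apply K (1::'b::unital_cstar_algebra)) \<le> norm (K :: 'b \<Rightarrow>\<^sub>L 'c::real_normed_vector)"
  using norm_blinfun[of K 1] mult_left_le[OF norm_one_cstar_le[where 'b = 'b] norm_ge_zero[of K]]
  by linarith

context semi_bimod
begin

lemma bounded_linear_kern:
  assumes "x \<in> mcarrier M" "y \<in> mcarrier M"
  shows "bounded_linear (\<lambda>b. mip M x (mlact M b y))"
proof (rule bounded_linear_intro[where K = "mnorm M x * mnorm M y"])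
  fix b
  have "norm (mip M x (mlact M b y)) \<le> mnorm M x * mnorm M (mlact M b y)"
    using assms by (intro Cauchy_Schwarz) auto
  also have "\<dots> \<le> mnorm M x * (norm b * mnorm M y)"
    using assms by (intro mult_left_mono mnorm_lact_le) auto
  finally show "norm (mip M x (mlact M b y)) \<le> norm b * (mnorm M x * mnorm M y)"
    by (simp add: mult_ac)
qed (use assms in \<open>simp_all add: ip_lact_add ip_lact_scaleR\<close>)

lemma kern_apply:
  "x \<in> mcarrier M \<Longrightarrow> y \<in> mcarrier M \<Longrightarrow> blinfun_apply (kern M x y) b = mip M x (mlact M b y)"
  unfolding kern_def by (simp add: bounded_linear_Blinfun_apply bounded_linear_kern)

lemma kern_apply_one:
  "x \<in> mcarrier M \<Longrightarrow> y \<in> mcarrier M \<Longrightarrow> blinfun_apply (kern M x y) 1 = mip M x y"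
  by (simp add: kern_apply ip_lact_one)

lemma norm_kern_le:
  assumes "x \<in> mcarrier M" "y \<in> mcarrier M"
  shows "norm (kern M x y) \<le> mnorm M x * mnorm M y"
proof (rule norm_blinfun_bound)
  fix b
  have "norm (mip M x (mlact M b y)) \<le> mnorm M x * mnorm M (mlact M b y)"
    using assms by (intro Cauchy_Schwarz) auto
  also have "\<dots> \<le> mnorm M x * (norm b * mnorm M y)"
    using assms by (intro mult_left_mono mnorm_lact_le) auto
  finally show "norm (blinfun_apply (kern M x y) b) \<le> mnorm M x * mnorm M y * norm b"
    using assms by (simp add: kern_apply mult_ac)
qed simp

lemma kern_sub_left:
  "x \<in> mcarrier M \<Longrightarrow> x' \<in> mcarrier M \<Longrightarrow> y \<in> mcarrier M \<Longrightarrow>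
    kern M (msub M x x') y = kern M x y - kern M x' y"
  by (rule blinfun_eqI) (simp add: kern_apply blinfun.bilinear_simps ip_sub_left)

lemma kern_sub_right:
  "x \<in> mcarrier M \<Longrightarrow> y \<in> mcarrier M \<Longrightarrow> y' \<in> mcarrier M \<Longrightarrow>
    kern M x (msub M y y') = kern M x y - kern M x y'"
  by (rule blinfun_eqI) (simp add: kern_apply blinfun.bilinear_simps ip_lact_sub_right)

lemma kern_add_left:
  "x \<in> mcarrier M \<Longrightarrow> x' \<in> mcarrier M \<Longrightarrow> y \<in> mcarrier M \<Longrightarrow>
    kern M (madd M x x') y = kern M x y + kern M x' y"
  by (rule blinfun_eqI) (simp add: kern_apply blinfun.bilinear_simps ip_add_left)

lemma kern_add_right:
  "x \<in> mcarrier M \<Longrightarrow> y \<in> mcarrier M \<Longrightarrow> y' \<in> mcarrier M \<Longrightarrow>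
    kern M x (madd M y y') = kern M x y + kern M x y'"
  by (rule blinfun_eqI) (simp add: kern_apply blinfun.bilinear_simps ip_lact_add_right)

lemma kern_zero_left: "x \<in> mcarrier M \<Longrightarrow> kern M (mzero M) x = 0"
  by (rule blinfun_eqI) (simp add: kern_apply ip_zero_left)

lemma kern_zero_right: "x \<in> mcarrier M \<Longrightarrow> kern M x (mzero M) = 0"
  by (rule blinfun_eqI) (simp add: kern_apply ip_lact_right ip_zero_right)

lemma kern_sandwich_left:
  "x \<in> mcarrier M \<Longrightarrow> y \<in> mcarrier M \<Longrightarrow>
    kern M (mract M (mlact M k x) l) y = sandwich (star k) (star l) (kern M x y)"
  by (rule blinfun_eqI)
    (simp add: kern_apply ip_ract_left ip_lact ip_lact_mult)

lemma kern_sandwich_right: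
  "x \<in> mcarrier M \<Longrightarrow> y \<in> mcarrier M \<Longrightarrow>
    kern M x (mract M (mlact M k y) l) = sandwich_right k l (kern M x y)"
  by (rule blinfun_eqI)
    (simp add: kern_apply ip_lact_ract ip_lact_mult)

lemma norm_kern_diff_le:
  assumes "x \<in> mcarrier M" "y \<in> mcarrier M" "x' \<in> mcarrier M" "y' \<in> mcarrier M"
  shows "norm (kern M x y - kern M x' y') \<le> mdist M x x' * mnorm M y + mnorm M x' * mdist M y y'"
proof -
  have "kern M x y - kern M x' y' = kern M (msub M x x') y + kern M x' (msub M y y')"
    using assms by (simp add: kern_sub_left kern_sub_right)
  also have "norm \<dots> \<le> mdist M x x' * mnorm M y + mnorm M x' * mdist M y y'"
    unfolding mdist_def using assms by (intro norm_triangle_le add_mono norm_kern_le) auto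
  finally show ?thesis .
qed

text \<open>The length of x - y is <x, x> - <x, y> minus the adjoint of <x, y> - <y, y>. Only the
  operators of the pairs (x, x), (x, y) and (y, y) occur, so no separate information on (y, x) is
  called for.\<close>

lemma mdist_square_kern:
  assumes "x \<in> mcarrier M" "y \<in> mcarrier M"
  shows "(mdist M x y)\<^sup>2 \<le> norm (kern M x x - kern M x y) + norm (kern M x y - kern M y y)"
proof -
  let ?a = "mip M x x - mip M x y" and ?b = "mip M x y - mip M y y"
  have "(mdist M x y)\<^sup>2 = norm (?a - star ?b)"
    using assms by (simp add: mdist_square star_diff ip_star)
  then have "(mdist M x y)\<^sup>2 \<le> norm ?a + norm ?b"
    using norm_triangle_ineq4[of ?a "star ?b"] by simp
  moreover have "?a = blinfun_apply (kern M x x - kern M x y) 1" "?b = blinfun_apply (kern M x y - kern M y y) 1"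
    using assms by (simp_all add: blinfun.bilinear_simps kern_apply_one)
  then have "norm ?a \<le> norm (kern M x x - kern M x y)" "norm ?b \<le> norm (kern M x y - kern M y y)"
    by (simp_all only: norm_blinfun_one_le)
  ultimately show ?thesis by linarith
qed

end

text \<open>Membership is asked from some index on, because the tensor power with exponent 0 lies in
  the fibre at 0 instead of the fibre at t.\<close>

lemma (in pre_hilbert_bimod) mlim_eqI:
  assumes s: "\<And>n. n \<ge> k \<Longrightarrow> s n \<in> mcarrier M" and l: "mconv M s l"
  shows "mlim M s = l"
  unfolding mlim_def
proof (rule the_equality)
  show "mconv M s l" by fact
next
  fix l' assume l': "mconv M s l'"
  have cl: "l \<in> mcarrier M" "l' \<in> mcarrier M" using l l' unfolding mconv_def by auto
  have "(\<lambda>n. mdist M (s n) l + mdist M (s n) l') \<longlonglongrightarrow> 0 + 0"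
    using l l' unfolding mconv_def by (intro tendsto_add) auto
  moreover have "mdist M l' l \<le> mdist M (s n) l + mdist M (s n) l'" if "n \<ge> k" for n
    using mdist_triangle[of l' "s n" l] mdist_commute[of l' "s n"] s[OF that] cl by simp
  ultimately have "mdist M l' l \<le> 0"
    by (intro LIMSEQ_le_const[of "\<lambda>n. mdist M (s n) l + mdist M (s n) l'"]) auto
  then show "l' = l" using cl by (intro eq_if_mdist_0 order_antisym) auto
qed

section \<open>Product systems\<close>

text \<open>Factors are given by labels carrying a length and a vector, so that the blocks of a
  partition can be labels themselves, as in \<open>gprod_concat\<close>.\<close>

primrec gprod ::
  "('b::unital_cstar_algebra, 'e, 'z) psys_scheme \<Rightarrow> ('i \<Rightarrow> real) \<Rightarrow> ('i \<Rightarrow> 'e) \<Rightarrow> 'i list \<Rightarrow> 'e" where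
  "gprod E \<tau> a [] = alg_iso E 1"
| "gprod E \<tau> a (i # is) = ptens E (\<tau> i) (\<Sum>j\<leftarrow>is. \<tau> j) (a i) (gprod E \<tau> a is)"

abbreviation zprod ::
  "('b::unital_cstar_algebra, 'e, 'z) psys_scheme \<Rightarrow> (real \<Rightarrow> 'e) \<Rightarrow> real list \<Rightarrow> 'e" where
  "zprod E z \<equiv> gprod E (\<lambda>r. r) z"

context product_system
begin

lemma fib_pre_hilbert: "0 \<le> t \<Longrightarrow> pre_hilbert_bimod (fib E t)"
  by (intro hilbert_pre_hilbert_bimod fibre)

lemma fib_semi: "0 \<le> t \<Longrightarrow> semi_bimod (fib E t)"
  by (intro hilbert_semi_bimod fibre)

lemma fib_pair: "0 \<le> t \<Longrightarrow> 0 \<le> s \<Longrightarrow> bimod_pair (fib E t) (fib E s)"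
  by (simp add: bimod_pair_def fib_semi)

lemma ptens_closed [simp]:
  assumes "0 \<le> t" "0 \<le> s" "x \<in> mcarrier (fib E t)" "y \<in> mcarrier (fib E s)"
  shows "ptens E t s x y \<in> mcarrier (fib E (t + s))"
  using mult_iso[OF assms(1,2)] bimod_pair.elem_tensor_closed[OF fib_pair[OF assms(1,2)] assms(3,4)]
  unfolding ptens_def bimod_unitary_def by blast

lemma ptens_ip:
  assumes "0 \<le> t" "0 \<le> s" "x \<in> mcarrier (fib E t)" "y \<in> mcarrier (fib E s)"
    "x' \<in> mcarrier (fib E t)" "y' \<in> mcarrier (fib E s)"
  shows "mip (fib E (t + s)) (ptens E t s x y) (ptens E t s x' y')
    = mip (fib E s) y (mlact (fib E s) (mip (fib E t) x x') y')"
  using mult_iso[OF assms(1,2)] bimod_pair.elem_tensor_closed[OF fib_pair[OF assms(1,2)]]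
    bimod_pair.elem_tensor_ip[OF fib_pair[OF assms(1,2)]] assms(3-)
  unfolding ptens_def bimod_unitary_def ip_preserving_def by simp

lemma ptens_lact:
  assumes "0 \<le> t" "0 \<le> s" "x \<in> mcarrier (fib E t)" "y \<in> mcarrier (fib E s)"
  shows "mlact (fib E (t + s)) b (ptens E t s x y) = ptens E t s (mlact (fib E t) b x) y"
  using mult_iso[OF assms(1,2)] bimod_pair.elem_tensor_closed[OF fib_pair[OF assms(1,2)] assms(3,4)]
    bimod_pair.elem_tensor_lact[OF fib_pair[OF assms(1,2)] assms(3,4)]
  unfolding ptens_def bimod_unitary_def bimod_linear_def by metis

text \<open>The unitary \<open>mult_iso\<close> transports the separation of points by elementary
  tensors from the tensor product to the fibre.\<close>

lemma ptens_ext: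
  assumes ts: "0 \<le> t" "0 \<le> s" and x: "x \<in> mcarrier (fib E (t + s))" and y: "y \<in> mcarrier (fib E (t + s))"
    and eq: "\<And>u v. u \<in> mcarrier (fib E t) \<Longrightarrow> v \<in> mcarrier (fib E s) \<Longrightarrow>
      mip (fib E (t + s)) (ptens E t s u v) x = mip (fib E (t + s)) (ptens E t s u v) y"
  shows "x = y"
proof -
  interpret P: bimod_pair "fib E t" "fib E s" using ts by (rule fib_pair)
  have U: "bimod_unitary (tensor (fib E t) (fib E s)) (fib E (t + s)) (mult_iso E t s)"
    using ts by (rule mult_iso)
  then obtain X Y where XY: "X \<in> mcarrier (tensor (fib E t) (fib E s))" "Y \<in> mcarrier (tensor (fib E t) (fib E s))"
    "x = mult_iso E t s X" "y = mult_iso E t s Y"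
    using x y unfolding bimod_unitary_def by blast
  have "X = Y"
    using XY(1,2)
  proof (rule P.tensor_ext)
    fix u v assume "u \<in> mcarrier (fib E t)" "v \<in> mcarrier (fib E s)"
    then show "mip (tensor (fib E t) (fib E s)) (elem_tensor (fib E t) (fib E s) u v) X
        = mip (tensor (fib E t) (fib E s)) (elem_tensor (fib E t) (fib E s) u v) Y"
      using eq[of u v] U XY P.elem_tensor_closed[of u v]
      unfolding ptens_def bimod_unitary_def ip_preserving_def by simp
  qed
  then show ?thesis using XY by simp
qed

text \<open>Inner products of tensors are nested: the first operator applied to b is the algebra
  element inserted between y and y'. Products of vectors thereby become products of operators, and
  units become semigroups.\<close>

lemma kern_ptens:
  assumes ts: "0 \<le> t" "0 \<le> s" and x: "x \<in> mcarrier (fib E t)" "x' \<in> mcarrier (fib E t)"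
    and y: "y \<in> mcarrier (fib E s)" "y' \<in> mcarrier (fib E s)"
  shows "kern (fib E (t + s)) (ptens E t s x y) (ptens E t s x' y') = kern (fib E s) y y' o\<^sub>L kern (fib E t) x x'"
proof -
  interpret T: semi_bimod "fib E t" using ts by (intro fib_semi)
  interpret S: semi_bimod "fib E s" using ts by (intro fib_semi)
  interpret TS: semi_bimod "fib E (t + s)" using ts by (intro fib_semi) simp
  show ?thesis
    by (rule blinfun_eqI)
      (use assms in \<open>simp add: TS.kern_apply T.kern_apply S.kern_apply ptens_lact ptens_ip\<close>)
qed

lemma mdist_ptens_le:
  assumes ts: "0 \<le> t" "0 \<le> s" and x: "x \<in> mcarrier (fib E t)" "x' \<in> mcarrier (fib E t)"
    and y: "y \<in> mcarrier (fib E s)" "y' \<in> mcarrier (fib E s)"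
  shows "mdist (fib E (t + s)) (ptens E t s x y) (ptens E t s x' y')
    \<le> mdist (fib E t) x x' * mnorm (fib E s) y + mnorm (fib E t) x' * mdist (fib E s) y y'"
proof -
  interpret T: semi_bimod "fib E t" using ts by (intro fib_semi)
  interpret S: semi_bimod "fib E s" using ts by (intro fib_semi)
  interpret TS: semi_bimod "fib E (t + s)" using ts by (intro fib_semi) simp
  have norm: "mnorm (fib E (t + s)) (ptens E t s u v) \<le> mnorm (fib E t) u * mnorm (fib E s) v"
    if "u \<in> mcarrier (fib E t)" "v \<in> mcarrier (fib E s)" for u v
  proof -
    have "norm (mip (fib E s) v (mlact (fib E s) (mip (fib E t) u u) v))
        \<le> mnorm (fib E s) v * (norm (mip (fib E t) u u) * mnorm (fib E s) v)"
      using that by (intro order_trans[OF S.Cauchy_Schwarz] mult_left_mono S.mnorm_lact_le) auto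
    then show ?thesis
      using that ts by (subst TS.mnorm_le_iff)
        (simp_all add: ptens_ip T.mnorm_square[symmetric] power_mult_distrib power2_eq_square mult_ac)
  qed
  have "mdist (fib E (t + s)) (ptens E t s x y) (ptens E t s x' y)
      = mnorm (fib E (t + s)) (ptens E t s (msub (fib E t) x x') y)"
    unfolding mdist_def mnorm_def using assms
    by (simp add: TS.ip_simps ptens_ip T.ip_simps S.ip_lact_diff)
  moreover have "mdist (fib E (t + s)) (ptens E t s x' y) (ptens E t s x' y')
      = mnorm (fib E (t + s)) (ptens E t s x' (msub (fib E s) y y'))"
    unfolding mdist_def mnorm_def using assms
    by (simp add: TS.ip_simps ptens_ip S.ip_simps S.ip_lact_sub_right)
  ultimately show ?thesis
    using norm[of "msub (fib E t) x x'" y] norm[of x' "msub (fib E s) y y'"] assms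
      TS.mdist_triangle[of "ptens E t s x y" "ptens E t s x' y" "ptens E t s x' y'"]
    by (simp add: mdist_def)
qed

lemma alg_iso_closed [simp]: "alg_iso E b \<in> mcarrier (fib E 0)"
  using alg_iso unfolding bimod_unitary_def by (auto simp: regular_bimod_def)

lemma kern_alg_iso_one: "kern (fib E 0) (alg_iso E 1) (alg_iso E 1) = id_blinfun"
proof -
  interpret Z: semi_bimod "fib E 0" by (intro fib_semi) simp
  have "mlact (fib E 0) b (alg_iso E 1) = alg_iso E b" for b
    using alg_iso unfolding bimod_unitary_def bimod_linear_def
    by (auto simp: regular_bimod_def) (metis mult.right_neutral)
  moreover have "mip (fib E 0) (alg_iso E 1) (alg_iso E b) = b" for b
    using alg_iso unfolding bimod_unitary_def ip_preserving_def by (simp add: regular_bimod_def)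
  ultimately show ?thesis
    by (intro blinfun_eqI) (simp add: Z.kern_apply)
qed

lemma ptens_alg_iso_one:
  assumes "0 \<le> t" "x \<in> mcarrier (fib E t)"
  shows "ptens E 0 t (alg_iso E 1) x = x" "ptens E t 0 x (alg_iso E 1) = x"
  using alg_left[OF assms] alg_right[OF assms] hilbert_bimodule.lact_one[OF fibre]
    hilbert_bimodule.ract_one[OF fibre] assms by auto

definition fib_list :: "('i \<Rightarrow> real) \<Rightarrow> ('i \<Rightarrow> 'e) \<Rightarrow> 'i list \<Rightarrow> bool" where
  "fib_list \<tau> a is \<longleftrightarrow> (\<forall>i\<in>set is. 0 \<le> \<tau> i \<and> a i \<in> mcarrier (fib E (\<tau> i)))"

lemma fib_list_simps [simp]:
  "fib_list \<tau> a []" "fib_list \<tau> a (i # is) \<longleftrightarrow> 0 \<le> \<tau> i \<and> a i \<in> mcarrier (fib E (\<tau> i)) \<and> fib_list \<tau> a is"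
  "fib_list \<tau> a (is @ js) \<longleftrightarrow> fib_list \<tau> a is \<and> fib_list \<tau> a js"
  unfolding fib_list_def by auto

lemma fib_list_nonneg: "fib_list \<tau> a is \<Longrightarrow> 0 \<le> (\<Sum>i\<leftarrow>is. \<tau> i)"
  by (induction "is") auto

lemma gprod_closed: "fib_list \<tau> a is \<Longrightarrow> gprod E \<tau> a is \<in> mcarrier (fib E (\<Sum>i\<leftarrow>is. \<tau> i))"
proof (induction "is")
  case (Cons i "is")
  then show ?case using fib_list_nonneg[of \<tau> a "is"] by simp
qed simp

lemma gprod_append:
  assumes "fib_list \<tau> a is" "fib_list \<tau> a js"
  shows "gprod E \<tau> a (is @ js) = ptens E (\<Sum>i\<leftarrow>is. \<tau> i) (\<Sum>j\<leftarrow>js. \<tau> j) (gprod E \<tau> a is) (gprod E \<tau> a js)"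
  using assms(1)
proof (induction "is")
  case Nil
  show ?case
    using assms(2) fib_list_nonneg[OF assms(2)] by (simp add: ptens_alg_iso_one gprod_closed)
next
  case (Cons i "is")
  then show ?case
    using assms(2) fib_list_nonneg[OF assms(2)] fib_list_nonneg[of \<tau> a "is"]
    by (simp add: assoc gprod_closed)
qed

lemma kern_gprod:
  "fib_list \<tau> a is \<Longrightarrow> fib_list \<tau> b is \<Longrightarrow>
    kern (fib E (\<Sum>i\<leftarrow>is. \<tau> i)) (gprod E \<tau> a is) (gprod E \<tau> b is)
      = opprod (map (\<lambda>i. kern (fib E (\<tau> i)) (a i) (b i)) is)"
proof (induction "is")
  case (Cons i "is")
  then show ?case
    using fib_list_nonneg[of \<tau> a "is"] by (simp add: kern_ptens gprod_closed)
qed (simp add: kern_alg_iso_one)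

text \<open>Associativity in the form of \<open>gprod_append\<close>. The statements on lengths and
  fibres are proved in the same induction, which relies on them.\<close>

lemma gprod_concat:
  assumes "\<And>R. R \<in> set Rs \<Longrightarrow> fib_list \<tau> a R"
  shows "gprod E (\<lambda>R. \<Sum>i\<leftarrow>R. \<tau> i) (gprod E \<tau> a) Rs = gprod E \<tau> a (concat Rs)"
    "(\<Sum>R\<leftarrow>Rs. \<Sum>i\<leftarrow>R. \<tau> i) = (\<Sum>i\<leftarrow>concat Rs. \<tau> i)" "fib_list \<tau> a (concat Rs)"
    "fib_list (\<lambda>R. \<Sum>i\<leftarrow>R. \<tau> i) (gprod E \<tau> a) Rs"
proof -
  have "gprod E (\<lambda>R. \<Sum>i\<leftarrow>R. \<tau> i) (gprod E \<tau> a) Rs = gprod E \<tau> a (concat Rs) \<and>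
    (\<Sum>R\<leftarrow>Rs. \<Sum>i\<leftarrow>R. \<tau> i) = (\<Sum>i\<leftarrow>concat Rs. \<tau> i) \<and> fib_list \<tau> a (concat Rs) \<and>
    fib_list (\<lambda>R. \<Sum>i\<leftarrow>R. \<tau> i) (gprod E \<tau> a) Rs"
    using assms
  proof (induction Rs)
    case (Cons R Rs)
    then show ?case
      using fib_list_nonneg[of \<tau> a R] by (simp add: gprod_append gprod_closed)
  qed simp
  then show "gprod E (\<lambda>R. \<Sum>i\<leftarrow>R. \<tau> i) (gprod E \<tau> a) Rs = gprod E \<tau> a (concat Rs)"
    "(\<Sum>R\<leftarrow>Rs. \<Sum>i\<leftarrow>R. \<tau> i) = (\<Sum>i\<leftarrow>concat Rs. \<tau> i)" "fib_list \<tau> a (concat Rs)"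
    "fib_list (\<lambda>R. \<Sum>i\<leftarrow>R. \<tau> i) (gprod E \<tau> a) Rs"
    by auto
qed

lemma gprod_map:
  "gprod E \<tau> a (map f is) = gprod E (\<lambda>i. \<tau> (f i)) (\<lambda>i. a (f i)) is"
  by (induction "is") (simp_all add: comp_def)

definition is_section :: "(real \<Rightarrow> 'e) \<Rightarrow> bool" where
  "is_section z \<longleftrightarrow> (\<forall>t\<ge>0. z t \<in> mcarrier (fib E t))"

lemma fib_list_section:
  "is_section z \<Longrightarrow> (\<And>r. r \<in> set P \<Longrightarrow> 0 \<le> r) \<Longrightarrow> fib_list (\<lambda>r. r) z P"
  unfolding is_section_def fib_list_def by auto

lemma zprod_closed:
  "is_section z \<Longrightarrow> (\<And>r. r \<in> set P \<Longrightarrow> 0 \<le> r) \<Longrightarrow> zprod E z P \<in> mcarrier (fib E (sum_list P))"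
  using gprod_closed[OF fib_list_section] by simp

lemma zprod_single: "is_section z \<Longrightarrow> 0 \<le> r \<Longrightarrow> zprod E z [r] = z r"
  unfolding is_section_def by (simp add: ptens_alg_iso_one)

lemma unit_section: "is_unit E u \<Longrightarrow> is_section u"
  unfolding is_unit_def is_section_def by auto

lemma zprod_unit: "is_unit E u \<Longrightarrow> (\<And>r. r \<in> set P \<Longrightarrow> 0 \<le> r) \<Longrightarrow> zprod E u P = u (sum_list P)"
  unfolding is_unit_def by (induction P) (auto simp: sum_list_nonneg)

text \<open>\<open>tpow\<close> appends factors on the right and \<open>gprod\<close> on the left;
  with equal factors the two orders agree.\<close>

lemma tpow_eq_zprod:
  assumes "is_section z" "0 \<le> s"
  shows "tpow E s (z s) m = zprod E z (replicate m s)"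
proof (induction m)
  case (Suc m)
  have "zprod E z (replicate m s @ [s])
      = ptens E (sum_list (replicate m s)) s (zprod E z (replicate m s)) (z s)"
    using assms by (subst gprod_append) (auto intro: fib_list_section simp: ptens_alg_iso_one is_section_def)
  then show ?case
    by (simp add: Suc sum_list_replicate replicate_append_same[symmetric] del: replicate.simps gprod.simps)
      (simp add: replicate_append_same)
qed simp

section \<open>Limits of products over partitions\<close>

text \<open>A limit over all partitions as the mesh tends to 0. Pieces are strictly positive:
  partitions of equal length then have a common refinement, and 0 has only the empty
  partition.\<close>

definition partition_limit :: "(real \<Rightarrow> 'e) \<Rightarrow> (real \<Rightarrow> 'e) \<Rightarrow> bool" where
  "partition_limit z \<zeta> \<longleftrightarrow> (\<forall>t\<ge>0. \<zeta> t \<in> mcarrier (fib E t) \<and>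
    (\<forall>e>0. \<exists>d>0. \<forall>P. (\<forall>p\<in>set P. 0 < p \<and> p \<le> d) \<and> sum_list P = t \<longrightarrow>
      mdist (fib E t) (zprod E z P) (\<zeta> t) \<le> e))"

lemma partition_limitD:
  assumes "partition_limit z \<zeta>" "0 \<le> t" "0 < e"
  obtains d where "0 < d" "\<And>P. (\<And>p. p \<in> set P \<Longrightarrow> 0 < p \<and> p \<le> d) \<Longrightarrow> sum_list P = t \<Longrightarrow>
      mdist (fib E t) (zprod E z P) (\<zeta> t) \<le> e"
  using assms unfolding partition_limit_def by metis

lemma partition_limit_section: "partition_limit z \<zeta> \<Longrightarrow> is_section \<zeta>"
  unfolding partition_limit_def is_section_def by blast

lemma ex_partition:
  assumes "0 \<le> t" "0 < d"
  obtains P where "\<And>p. p \<in> set P \<Longrightarrow> 0 < p \<and> p \<le> d" "sum_list P = (t::real)"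
proof (cases "t = 0")
  case True
  then show thesis by (intro that[of "[]"]) auto
next
  case False
  obtain n where n: "t < real n * d" using ex_less_of_nat_mult[OF assms(2)] by blast
  then have "0 < real n * d" using assms(1) by linarith
  then have "0 < n" using assms(2) by (simp add: zero_less_mult_iff)
  moreover from this n False assms have "0 < t / real n" "t / real n \<le> d"
    by (simp_all add: pos_divide_le_eq mult.commute)
  ultimately show thesis
    by (intro that[of "replicate n (t / real n)"]) (auto simp: sum_list_replicate)
qed

lemma unit_partition_limit: "is_unit E u \<Longrightarrow> partition_limit u u"
proof -
  assume u: "is_unit E u"
  have "mdist (fib E t) (zprod E u P) (u t) \<le> e"
    if "\<forall>p\<in>set P. 0 < p \<and> p \<le> 1" "sum_list P = t" "0 < e" "0 \<le> t" for P t e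
  proof -
    interpret semi_bimod "fib E t" using that by (intro fib_semi)
    have "zprod E u P = u t"
      using zprod_unit[OF u, of P] that by (simp add: less_imp_le)
    then show ?thesis
      using that unit_section[OF u] unfolding is_section_def by simp
  qed
  then show ?thesis
    using unit_section[OF u] unfolding partition_limit_def is_section_def
    by (intro allI impI conjI exI[of _ 1]) auto
qed

text \<open>Fine partitions of [0, t] and [0, s] concatenate to a fine partition of [0, t + s], and
  the product over the concatenation is the tensor product of the two products.\<close>

lemma partition_limit_unit:
  assumes z: "is_section z" and lim: "partition_limit z \<zeta>" and ext: "\<zeta> \<in> extensional {0..}"
  shows "is_unit E \<zeta>"
proof -
  have \<zeta>: "\<zeta> t \<in> mcarrier (fib E t)" if "0 \<le> t" for t
    using partition_limit_section[OF lim] that unfolding is_section_def by blast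
  have zP: "zprod E z P \<in> mcarrier (fib E (sum_list P))" if "\<And>p. p \<in> set P \<Longrightarrow> 0 < p" for P
    using that by (intro zprod_closed[OF z]) (auto intro: less_imp_le)
  have "\<zeta> 0 = alg_iso E 1"
  proof -
    interpret pre_hilbert_bimod "fib E 0" by (intro fib_pre_hilbert) simp
    have "mdist (fib E 0) (alg_iso E 1) (\<zeta> 0) \<le> 0"
    proof (rule field_le_epsilon)
      fix e :: real assume "0 < e"
      then obtain d where "\<And>P. (\<And>p. p \<in> set P \<Longrightarrow> 0 < p \<and> p \<le> d) \<Longrightarrow> sum_list P = 0 \<Longrightarrow>
          mdist (fib E 0) (zprod E z P) (\<zeta> 0) \<le> e"
        using partition_limitD[OF lim order_refl \<open>0 < e\<close>] by blast
      \<comment> \<open>The empty partition, whose product is 1, is always fine enough.\<close>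
      from this[of "[]"] show "mdist (fib E 0) (alg_iso E 1) (\<zeta> 0) \<le> 0 + e" by simp
    qed
    then show ?thesis using eq_if_mdist_0[of "alg_iso E 1" "\<zeta> 0"] \<zeta> by (simp add: order_antisym)
  qed
  moreover have "ptens E t s (\<zeta> t) (\<zeta> s) = \<zeta> (t + s)" if ts: "0 \<le> t" "0 \<le> s" for t s
  proof -
    interpret T: semi_bimod "fib E t" using ts by (intro fib_semi)
    interpret S: semi_bimod "fib E s" using ts by (intro fib_semi)
    interpret TS: pre_hilbert_bimod "fib E (t + s)" using ts by (intro fib_pre_hilbert) simp
    have "mdist (fib E (t + s)) (ptens E t s (\<zeta> t) (\<zeta> s)) (\<zeta> (t + s)) \<le> 0"
    proof (rule le_if_le_add_mult_epsilon)
      fix e' :: real assume e': "0 < e'"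
      \<comment> \<open>The cap at 1 bounds the norm of the approximating product by that of its
        limit plus 1, so the error stays linear in e'.\<close>
      define e where "e = min e' 1"
      have e: "0 < e" "e \<le> e'" "e \<le> 1" unfolding e_def using e' by auto
      obtain d1 where d1: "0 < d1" "\<And>P. (\<And>p. p \<in> set P \<Longrightarrow> 0 < p \<and> p \<le> d1) \<Longrightarrow> sum_list P = t \<Longrightarrow>
          mdist (fib E t) (zprod E z P) (\<zeta> t) \<le> e"
        using partition_limitD[OF lim ts(1) e(1)] by blast
      obtain d2 where d2: "0 < d2" "\<And>P. (\<And>p. p \<in> set P \<Longrightarrow> 0 < p \<and> p \<le> d2) \<Longrightarrow> sum_list P = s \<Longrightarrow>
          mdist (fib E s) (zprod E z P) (\<zeta> s) \<le> e"
        using partition_limitD[OF lim ts(2) e(1)] by blast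
      obtain d3 where d3: "0 < d3" "\<And>P. (\<And>p. p \<in> set P \<Longrightarrow> 0 < p \<and> p \<le> d3) \<Longrightarrow> sum_list P = t + s \<Longrightarrow>
          mdist (fib E (t + s)) (zprod E z P) (\<zeta> (t + s)) \<le> e"
        using partition_limitD[OF lim _ e(1), of "t + s"] ts by auto
      define d where "d = min d1 (min d2 d3)"
      have d: "0 < d" "d \<le> d1" "d \<le> d2" "d \<le> d3" unfolding d_def using d1 d2 d3 by auto
      obtain P where P: "\<And>p. p \<in> set P \<Longrightarrow> 0 < p \<and> p \<le> d" "sum_list P = t"
        using ex_partition[OF ts(1) d(1)] by blast
      obtain Q where Q: "\<And>p. p \<in> set Q \<Longrightarrow> 0 < p \<and> p \<le> d" "sum_list Q = s"
        using ex_partition[OF ts(2) d(1)] by blast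
      let ?p = "zprod E z P" and ?q = "zprod E z Q"
      have p: "?p \<in> mcarrier (fib E t)" using zP[of P] P by auto
      have q: "?q \<in> mcarrier (fib E s)" using zP[of Q] Q by auto
      have 1: "mdist (fib E t) ?p (\<zeta> t) \<le> e" using P d by (intro d1(2)) force+
      have 2: "mdist (fib E s) ?q (\<zeta> s) \<le> e" using Q d by (intro d2(2)) force+
      have "zprod E z (P @ Q) = ptens E t s ?p ?q"
        using P Q by (subst gprod_append) (auto intro!: fib_list_section z less_imp_le)
      moreover have "mdist (fib E (t + s)) (zprod E z (P @ Q)) (\<zeta> (t + s)) \<le> e"
        using P Q d by (intro d3(2)) force+
      ultimately have 3: "mdist (fib E (t + s)) (ptens E t s ?p ?q) (\<zeta> (t + s)) \<le> e" by simp
      have "mdist (fib E (t + s)) (ptens E t s ?p ?q) (ptens E t s (\<zeta> t) (\<zeta> s))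
          \<le> mdist (fib E t) ?p (\<zeta> t) * mnorm (fib E s) ?q + mnorm (fib E t) (\<zeta> t) * mdist (fib E s) ?q (\<zeta> s)"
        using ts p q \<zeta> by (intro mdist_ptens_le) auto
      also have "\<dots> \<le> e * (mnorm (fib E s) (\<zeta> s) + 1) + mnorm (fib E t) (\<zeta> t) * e"
        using 1 2 S.mnorm_diff_le[OF q \<zeta>[OF ts(2)]] e by (intro add_mono mult_mono) auto
      finally have "mdist (fib E (t + s)) (ptens E t s (\<zeta> t) (\<zeta> s)) (\<zeta> (t + s))
          \<le> (e * (mnorm (fib E s) (\<zeta> s) + 1) + mnorm (fib E t) (\<zeta> t) * e) + e"
        using TS.mdist_triangle[of "ptens E t s (\<zeta> t) (\<zeta> s)" "ptens E t s ?p ?q" "\<zeta> (t + s)"] 3 ts p q \<zeta>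
        by (simp add: TS.mdist_commute)
      also have "\<dots> = (mnorm (fib E s) (\<zeta> s) + mnorm (fib E t) (\<zeta> t) + 2) * e"
        by (simp add: algebra_simps)
      also have "\<dots> \<le> (mnorm (fib E s) (\<zeta> s) + mnorm (fib E t) (\<zeta> t) + 2) * e'"
        using e by (intro mult_left_mono) auto
      finally show "mdist (fib E (t + s)) (ptens E t s (\<zeta> t) (\<zeta> s)) (\<zeta> (t + s))
          \<le> 0 + (mnorm (fib E s) (\<zeta> s) + mnorm (fib E t) (\<zeta> t) + 2) * e'" by simp
    qed
    then show ?thesis
      using ts \<zeta> by (intro TS.eq_if_mdist_0 order_antisym) auto
  qed
  ultimately show ?thesis
    unfolding is_unit_def using \<zeta> ext by (auto simp: PiE_def)
qed

abbreviation tangent :: "(real \<Rightarrow> 'e) \<Rightarrow> (real \<Rightarrow> 'e) \<Rightarrow> ('b \<Rightarrow>\<^sub>L 'b) \<Rightarrow> bool" where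
  "tangent z w L \<equiv> first_order {0..} (\<lambda>r. r) (\<lambda>r. kern (fib E r) (z r) (w r)) id_blinfun L"

text \<open>The operator of two products over a partition is the product of the operators of the
  pieces, and its first-order estimate is uniform over partitions of t. At fixed t it therefore
  persists as the mesh tends to 0.\<close>

lemma partition_limit_tangent:
  assumes z: "is_section z" "partition_limit z \<zeta>" and w: "is_section w" "partition_limit w \<eta>"
    and L: "tangent z w L"
  shows "tangent \<zeta> \<eta> L"
proof (rule first_orderI)
  fix e :: real assume e: "0 < e"
  have "first_order (lists {0..}) (\<lambda>is. \<Sum>i\<leftarrow>is. i)
      (\<lambda>P. opprod (map (\<lambda>r. kern (fib E r) (z r) (w r)) P)) id_blinfun L"
    using L by (rule first_order_opprod) auto
  then have fo: "first_order (lists {0..}) sum_list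
      (\<lambda>P. opprod (map (\<lambda>r. kern (fib E r) (z r) (w r)) P)) id_blinfun L"
    by simp
  obtain d where d: "0 < d" "\<And>P. P \<in> lists {0..} \<Longrightarrow> sum_list P \<le> d \<Longrightarrow>
      norm (opprod (map (\<lambda>r. kern (fib E r) (z r) (w r)) P) - (id_blinfun + sum_list P *\<^sub>R L)) \<le> e * sum_list P"
    using first_orderD[OF fo e] by blast
  have "norm (kern (fib E t) (\<zeta> t) (\<eta> t) - (id_blinfun + t *\<^sub>R L)) \<le> e * t" if t: "0 \<le> t" "t \<le> d" for t
  proof (rule le_if_le_add_mult_epsilon)
    fix f' :: real assume f': "0 < f'"
    define f where "f = min f' 1"
    have f: "0 < f" "f \<le> f'" "f \<le> 1" unfolding f_def using f' by auto
    interpret semi_bimod "fib E t" using t by (intro fib_semi)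
    have c: "\<zeta> t \<in> mcarrier (fib E t)" "\<eta> t \<in> mcarrier (fib E t)"
      using z w t partition_limit_section unfolding is_section_def by auto
    obtain d1 where d1: "0 < d1" "\<And>P. (\<And>p. p \<in> set P \<Longrightarrow> 0 < p \<and> p \<le> d1) \<Longrightarrow> sum_list P = t \<Longrightarrow>
        mdist (fib E t) (zprod E z P) (\<zeta> t) \<le> f"
      using partition_limitD[OF z(2) t(1) f(1)] by blast
    obtain d2 where d2: "0 < d2" "\<And>P. (\<And>p. p \<in> set P \<Longrightarrow> 0 < p \<and> p \<le> d2) \<Longrightarrow> sum_list P = t \<Longrightarrow>
        mdist (fib E t) (zprod E w P) (\<eta> t) \<le> f"
      using partition_limitD[OF w(2) t(1) f(1)] by blast
    obtain P where P: "\<And>p. p \<in> set P \<Longrightarrow> 0 < p \<and> p \<le> min d1 d2" "sum_list P = t"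
      using ex_partition[OF t(1), of "min d1 d2"] d1 d2 by auto
    have nn: "\<And>p. p \<in> set P \<Longrightarrow> 0 \<le> p" using P(1) by (auto intro: less_imp_le)
    let ?z = "zprod E z P" and ?w = "zprod E w P"
    have cc: "?z \<in> mcarrier (fib E t)" "?w \<in> mcarrier (fib E t)"
      using zprod_closed[OF z(1) nn] zprod_closed[OF w(1) nn] P(2) by auto
    have "kern (fib E t) ?z ?w = opprod (map (\<lambda>r. kern (fib E r) (z r) (w r)) P)"
      using kern_gprod[of "\<lambda>r. r" z P w] fib_list_section[OF z(1) nn] fib_list_section[OF w(1) nn] P(2)
      by simp
    then have 1: "norm (kern (fib E t) ?z ?w - (id_blinfun + t *\<^sub>R L)) \<le> e * t"
      using d(2)[of P] nn P t by auto
    have dz: "mdist (fib E t) (\<zeta> t) ?z \<le> f" using d1(2)[OF _ P(2)] P(1) c cc by (simp add: mdist_commute)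
    have dw: "mdist (fib E t) (\<eta> t) ?w \<le> f" using d2(2)[OF _ P(2)] P(1) c cc by (simp add: mdist_commute)
    have "norm (kern (fib E t) (\<zeta> t) (\<eta> t) - kern (fib E t) ?z ?w)
        \<le> mdist (fib E t) (\<zeta> t) ?z * mnorm (fib E t) (\<eta> t) + mnorm (fib E t) ?z * mdist (fib E t) (\<eta> t) ?w"
      using c cc by (intro norm_kern_diff_le)
    also have "\<dots> \<le> f * mnorm (fib E t) (\<eta> t) + (mnorm (fib E t) (\<zeta> t) + 1) * f"
      using dz dw f mnorm_diff_le[OF cc(1) c(1)] c cc
      by (intro add_mono mult_mono) (auto simp: mdist_commute)
    also have "\<dots> = (mnorm (fib E t) (\<eta> t) + mnorm (fib E t) (\<zeta> t) + 1) * f"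
      by (simp add: algebra_simps)
    also have "\<dots> \<le> (mnorm (fib E t) (\<eta> t) + mnorm (fib E t) (\<zeta> t) + 1) * f'"
      using f by (intro mult_left_mono) auto
    finally have 2: "norm (kern (fib E t) (\<zeta> t) (\<eta> t) - kern (fib E t) ?z ?w)
        \<le> (mnorm (fib E t) (\<eta> t) + mnorm (fib E t) (\<zeta> t) + 1) * f'" .
    have eq: "kern (fib E t) (\<zeta> t) (\<eta> t) - (id_blinfun + t *\<^sub>R L) = (kern (fib E t) (\<zeta> t) (\<eta> t) - kern (fib E t) ?z ?w)
        + (kern (fib E t) ?z ?w - (id_blinfun + t *\<^sub>R L))" by simp
    show "norm (kern (fib E t) (\<zeta> t) (\<eta> t) - (id_blinfun + t *\<^sub>R L))
        \<le> e * t + (mnorm (fib E t) (\<eta> t) + mnorm (fib E t) (\<zeta> t) + 1) * f'"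
      using 1 2 arg_cong[OF eq, of norm] norm_triangle_ineq[of "kern (fib E t) (\<zeta> t) (\<eta> t) - kern (fib E t) ?z ?w"
          "kern (fib E t) ?z ?w - (id_blinfun + t *\<^sub>R L)"] by linarith
  qed
  then show "\<exists>d>0. \<forall>t\<in>{0..}. t \<le> d \<longrightarrow>
      norm (kern (fib E t) (\<zeta> t) (\<eta> t) - (id_blinfun + t *\<^sub>R L)) \<le> e * t"
    using d(1) by auto
qed

end

section \<open>Common refinements and convergence of products over partitions\<close>

lemma common_refinement:
  fixes P Q :: "real list"
  assumes "\<And>p. p \<in> set P \<Longrightarrow> 0 < p" "\<And>q. q \<in> set Q \<Longrightarrow> 0 < q" "sum_list P = sum_list Q"
  shows "\<exists>Rs Ss. concat Rs = concat Ss \<and> map sum_list Rs = P \<and> map sum_list Ss = Q \<and>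
    (\<forall>r\<in>set (concat Rs). 0 \<le> r)"
  using assms
proof (induction "length P + length Q" arbitrary: P Q rule: less_induct)
  case less
  have pos: "0 < sum_list L" if "\<And>x. x \<in> set L \<Longrightarrow> 0 < x" "L \<noteq> []" for L :: "real list"
    using that by (induction L) (auto intro: add_pos_nonneg simp: sum_list_nonneg less_imp_le)
  show ?case
  proof (cases P)
    case Nil
    then have "Q = []" using less.prems pos[of Q] by fastforce
    with Nil show ?thesis by (intro exI[of _ "[]"]) auto
  next
    case P: (Cons p P')
    show ?thesis
    proof (cases Q)
      case Nil
      then show ?thesis using less.prems pos[of P] P by fastforce
    next
      case Q: (Cons q Q')
      have pq: "0 < p" "0 < q" using less.prems P Q by auto
      consider "p < q" | "p = q" | "q < p" by linarith
      then show ?thesis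
      proof cases
        case 1
        \<comment> \<open>The shorter first piece p is cut off the longer piece q. The rest q - p
          heads the second partition, and its block gets p back afterwards.\<close>
        have "\<exists>Rs Ss. concat Rs = concat Ss \<and> map sum_list Rs = P' \<and> map sum_list Ss = (q - p) # Q' \<and>
            (\<forall>r\<in>set (concat Rs). 0 \<le> r)"
          using less.prems P Q 1 by (intro less.hyps) auto
        then obtain Rs Ss where *: "concat Rs = concat Ss" "map sum_list Rs = P'"
          "map sum_list Ss = (q - p) # Q'" "\<forall>r\<in>set (concat Rs). 0 \<le> r"
          by (elim exE conjE) (rule that)
        then obtain S Ss' where "Ss = S # Ss'" "sum_list S = q - p" "map sum_list Ss' = Q'"
          by (cases Ss) auto
        with * P Q pq show ?thesis
          by (intro exI[of _ "[p] # Rs"] exI[of _ "(p # S) # Ss'"]) auto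
      next
        case 2
        have "\<exists>Rs Ss. concat Rs = concat Ss \<and> map sum_list Rs = P' \<and> map sum_list Ss = Q' \<and>
            (\<forall>r\<in>set (concat Rs). 0 \<le> r)"
          using less.prems P Q 2 by (intro less.hyps) auto
        then obtain Rs Ss where "concat Rs = concat Ss" "map sum_list Rs = P'"
          "map sum_list Ss = Q'" "\<forall>r\<in>set (concat Rs). 0 \<le> r"
          by (elim exE conjE) (rule that)
        with P Q pq 2 show ?thesis
          by (intro exI[of _ "[p] # Rs"] exI[of _ "[q] # Ss"]) auto
      next
        case 3
        have "\<exists>Rs Ss. concat Rs = concat Ss \<and> map sum_list Rs = (p - q) # P' \<and> map sum_list Ss = Q' \<and>
            (\<forall>r\<in>set (concat Rs). 0 \<le> r)"
          using less.prems P Q 3 by (intro less.hyps) auto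
        then obtain Rs Ss where *: "concat Rs = concat Ss" "map sum_list Rs = (p - q) # P'"
          "map sum_list Ss = Q'" "\<forall>r\<in>set (concat Rs). 0 \<le> r"
          by (elim exE conjE) (rule that)
        then obtain S Rs' where "Rs = S # Rs'" "sum_list S = p - q" "map sum_list Rs' = P'"
          by (cases Rs) auto
        with * P Q pq show ?thesis
          by (intro exI[of _ "(q # S) # Rs'"] exI[of _ "[q] # Ss"]) auto
      qed
    qed
  qed
qed

context product_system
begin

text \<open>Uniformity over all partitions of a short interval is what makes the products Cauchy.\<close>

definition uniformly_tangent :: "(real \<Rightarrow> 'e) \<Rightarrow> (real \<Rightarrow> 'e) \<Rightarrow> ('b \<Rightarrow>\<^sub>L 'b) \<Rightarrow> bool" where
  "uniformly_tangent z w L \<longleftrightarrow> first_order (lists {0..}) sum_list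
    (\<lambda>R. kern (fib E (sum_list R)) (z (sum_list R)) (zprod E w R)) id_blinfun L"

lemma uniformly_tangent_tangent:
  assumes "is_section w" "uniformly_tangent z w L"
  shows "tangent z w L"
proof -
  have "first_order {0..} (\<lambda>r. r)
      (\<lambda>r. kern (fib E (sum_list [r])) (z (sum_list [r])) (zprod E w [r])) id_blinfun L"
    by (rule first_order_reindex[OF assms(2)[unfolded uniformly_tangent_def], of "{0..}" "\<lambda>r. [r]"]) auto
  then show ?thesis
    by (rule first_order_cong) (use zprod_single[OF assms(1)] in auto)
qed

lemma first_order_zprod:
  assumes "is_section z" "is_section w" "tangent z w L"
  shows "first_order (lists {0..}) sum_list
    (\<lambda>R. kern (fib E (sum_list R)) (zprod E z R) (zprod E w R)) id_blinfun L"
proof -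
  have "first_order (lists {0..}) (\<lambda>is. \<Sum>i\<leftarrow>is. i)
      (\<lambda>P. opprod (map (\<lambda>r. kern (fib E r) (z r) (w r)) P)) id_blinfun L"
    using assms(3) by (rule first_order_opprod) auto
  then have "first_order (lists {0..}) sum_list
      (\<lambda>P. opprod (map (\<lambda>r. kern (fib E r) (z r) (w r)) P)) id_blinfun L"
    by simp
  then show ?thesis
  proof (rule first_order_cong)
    fix R :: "real list" assume "R \<in> lists {0..}"
    then have "\<And>r. r \<in> set R \<Longrightarrow> 0 \<le> r" by auto
    then show "kern (fib E (sum_list R)) (zprod E z R) (zprod E w R)
        = opprod (map (\<lambda>r. kern (fib E r) (z r) (w r)) R)"
      using kern_gprod[of "\<lambda>r. r" z R w] fib_list_section[OF assms(1)] fib_list_section[OF assms(2)] by simp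
  qed simp
qed

text \<open>A unit equals the product of its values over any partition, so the uniform estimate for
  products applies to its single values.\<close>

lemma unit_uniformly_tangent:
  assumes "is_unit E x" "is_section w" "tangent x w L"
  shows "uniformly_tangent x w L"
  unfolding uniformly_tangent_def
  by (rule first_order_cong[OF first_order_zprod[OF unit_section[OF assms(1)] assms(2,3)]])
    (use zprod_unit[OF assms(1)] in auto)

text \<open>The coarse product has the factors \<open>a1\<close>, the fine one the block products
  \<open>a2\<close>. The operators of all three pairs have the same expansion with derivative L, so
  their products over the blocks are close and \<open>mdist_square_kern\<close> bounds the distance.
  The mixed pair is exactly what uniform tangency controls.\<close>

lemma refinement_close:
  assumes z: "is_section z" and L: "uniformly_tangent z z L" and t: "0 \<le> t" and e: "0 < e"
  obtains d where "0 < d"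
    "\<And>Rs. Rs \<in> lists (lists {0..}) \<Longrightarrow> (\<And>R. R \<in> set Rs \<Longrightarrow> sum_list R \<le> d) \<Longrightarrow> sum_list (concat Rs) = t \<Longrightarrow>
      mdist (fib E t) (zprod E z (map sum_list Rs)) (zprod E z (concat Rs)) \<le> e"
proof -
  define a1 where "a1 R = z (sum_list R)" for R :: "real list"
  define a2 where "a2 R = zprod E z R" for R :: "real list"
  define A where "A x y R = kern (fib E (sum_list R)) (x R) (y R)" for x y and R :: "real list"
  have T: "tangent z z L" using z L by (rule uniformly_tangent_tangent)
  have fo12: "first_order (lists {0..}) sum_list (A a1 a2) id_blinfun L"
    using L unfolding uniformly_tangent_def A_def a1_def a2_def .
  have fo22: "first_order (lists {0..}) sum_list (A a2 a2) id_blinfun L"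
    using first_order_zprod[OF z z T] unfolding A_def a2_def .
  have fo11: "first_order (lists {0..}) sum_list (A a1 a1) id_blinfun L"
    unfolding A_def a1_def
    by (rule first_order_reindex[OF T, of "lists {0..}" sum_list]) (auto simp: sum_list_nonneg)
  define c where "c = norm L + 1"
  have c: "0 \<le> c" unfolding c_def by simp
  \<comment> \<open>Makes the total error 4 e0 t exp (c t) at most e squared; t + 1 in place of t
    keeps the denominator positive.\<close>
  define e0 where "e0 = min 1 (e\<^sup>2 / (4 * (t + 1) * exp (c * t)))"
  have e0: "0 < e0" "e0 \<le> 1" "e0 \<le> e\<^sup>2 / (4 * (t + 1) * exp (c * t))"
    unfolding e0_def using e t by auto
  have bound: "4 * e0 * t * exp (c * t) \<le> e\<^sup>2"
  proof -
    have "4 * e0 * t * exp (c * t) \<le> e0 * (4 * (t + 1) * exp (c * t))"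
      using e0 t by (simp add: algebra_simps)
    also have "\<dots> \<le> e\<^sup>2 / (4 * (t + 1) * exp (c * t)) * (4 * (t + 1) * exp (c * t))"
      using e0 t by (intro mult_right_mono) auto
    also have "\<dots> = e\<^sup>2" using t by simp
    finally show ?thesis .
  qed
  obtain d1 where d1: "0 < d1" "\<And>R. R \<in> lists {0..} \<Longrightarrow> sum_list R \<le> d1 \<Longrightarrow>
      norm (A a1 a1 R - (id_blinfun + sum_list R *\<^sub>R L)) \<le> e0 * sum_list R"
    using first_orderD[OF fo11 e0(1)] by blast
  obtain d2 where d2: "0 < d2" "\<And>R. R \<in> lists {0..} \<Longrightarrow> sum_list R \<le> d2 \<Longrightarrow>
      norm (A a1 a2 R - (id_blinfun + sum_list R *\<^sub>R L)) \<le> e0 * sum_list R"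
    using first_orderD[OF fo12 e0(1)] by blast
  obtain d3 where d3: "0 < d3" "\<And>R. R \<in> lists {0..} \<Longrightarrow> sum_list R \<le> d3 \<Longrightarrow>
      norm (A a2 a2 R - (id_blinfun + sum_list R *\<^sub>R L)) \<le> e0 * sum_list R"
    using first_orderD[OF fo22 e0(1)] by blast
  define d where "d = min d1 (min d2 d3)"
  have d: "0 < d" "d \<le> d1" "d \<le> d2" "d \<le> d3" unfolding d_def using d1 d2 d3 by auto
  have "mdist (fib E t) (zprod E z (map sum_list Rs)) (zprod E z (concat Rs)) \<le> e"
    if Rs: "Rs \<in> lists (lists {0..})" and small: "\<And>R. R \<in> set Rs \<Longrightarrow> sum_list R \<le> d"
      and sum: "sum_list (concat Rs) = t" for Rs
  proof -
    interpret semi_bimod "fib E t" using t by (rule fib_semi)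
    have mem: "R \<in> lists {0..}" "0 \<le> sum_list R" if "R \<in> set Rs" for R
      using Rs that by (auto simp: sum_list_nonneg)
    have fl: "fib_list (\<lambda>r. r) z R" if "R \<in> set Rs" for R
      using mem[OF that] by (intro fib_list_section[OF z]) auto
    note C = gprod_concat[of Rs "\<lambda>r. r" z, OF fl, simplified]
    have fl1: "fib_list sum_list a1 Rs"
      using mem z unfolding fib_list_def a1_def is_section_def by auto
    have fl2: "fib_list sum_list a2 Rs"
      using C(4) unfolding a2_def .
    have sumRs: "(\<Sum>R\<leftarrow>Rs. sum_list R) = t" using C(2) sum by simp
    have g1: "gprod E sum_list a1 Rs = zprod E z (map sum_list Rs)"
      unfolding a1_def gprod_map ..
    have g2: "gprod E sum_list a2 Rs = zprod E z (concat Rs)"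
      unfolding a2_def using C(1) .
    have cl: "gprod E sum_list a1 Rs \<in> mcarrier (fib E t)" "gprod E sum_list a2 Rs \<in> mcarrier (fib E t)"
      using gprod_closed[OF fl1] gprod_closed[OF fl2] sumRs by simp_all
    have k: "kern (fib E t) (gprod E sum_list x Rs) (gprod E sum_list y Rs) = opprod (map (A x y) Rs)"
      if "fib_list sum_list x Rs" "fib_list sum_list y Rs" for x y
      using kern_gprod[OF that] sumRs unfolding A_def by simp
    have ub: "norm X \<le> exp (c * l)" if "norm (X - (id_blinfun + l *\<^sub>R L)) \<le> e0 * l" "0 \<le> l" for X :: "'b \<Rightarrow>\<^sub>L 'b" and l
    proof -
      have "norm X \<le> 1 + (norm L + e0) * l" using that by (rule first_order_norm_le)
      also have "\<dots> \<le> 1 + c * l"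
        using e0 that(2) unfolding c_def by (intro add_left_mono mult_right_mono) auto
      also have "\<dots> \<le> exp (c * l)" by (rule exp_ge_add_one_self)
      finally show ?thesis .
    qed
    have est: "norm (opprod (map (A x y) Rs) - opprod (map (A x' y') Rs)) \<le> 2 * e0 * t * exp (c * t)"
      if 1: "\<And>R. R \<in> set Rs \<Longrightarrow> norm (A x y R - (id_blinfun + sum_list R *\<^sub>R L)) \<le> e0 * sum_list R"
      and 2: "\<And>R. R \<in> set Rs \<Longrightarrow> norm (A x' y' R - (id_blinfun + sum_list R *\<^sub>R L)) \<le> e0 * sum_list R"
      for x y x' y'
    proof -
      have "norm (opprod (map (A x y) Rs) - opprod (map (A x' y') Rs))
          \<le> 2 * e0 * (\<Sum>R\<leftarrow>Rs. sum_list R) * exp (c * (\<Sum>R\<leftarrow>Rs. sum_list R))"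
      proof (rule norm_opprod_diff_le)
        fix R assume R: "R \<in> set Rs"
        show "norm (A x y R) \<le> exp (c * sum_list R)" "norm (A x' y' R) \<le> exp (c * sum_list R)"
          using 1[OF R] 2[OF R] mem(2)[OF R] by (auto intro: ub)
        have "norm ((A x y R - (id_blinfun + sum_list R *\<^sub>R L)) - (A x' y' R - (id_blinfun + sum_list R *\<^sub>R L)))
            \<le> e0 * sum_list R + e0 * sum_list R"
          using 1[OF R] 2[OF R] norm_triangle_ineq4 order_trans add_mono by meson
        then show "norm (A x y R - A x' y' R) \<le> 2 * e0 * sum_list R" by simp
      qed (use mem c e0 in auto)
      then show ?thesis unfolding sumRs .
    qed
    have s1: "norm (A a1 a1 R - (id_blinfun + sum_list R *\<^sub>R L)) \<le> e0 * sum_list R"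
      and s2: "norm (A a1 a2 R - (id_blinfun + sum_list R *\<^sub>R L)) \<le> e0 * sum_list R"
      and s3: "norm (A a2 a2 R - (id_blinfun + sum_list R *\<^sub>R L)) \<le> e0 * sum_list R" if "R \<in> set Rs" for R
      using d1(2)[OF mem(1)[OF that]] d2(2)[OF mem(1)[OF that]] d3(2)[OF mem(1)[OF that]] small[OF that] d
      by auto
    have "(mdist (fib E t) (gprod E sum_list a1 Rs) (gprod E sum_list a2 Rs))\<^sup>2
        \<le> norm (opprod (map (A a1 a1) Rs) - opprod (map (A a1 a2) Rs))
          + norm (opprod (map (A a1 a2) Rs) - opprod (map (A a2 a2) Rs))"
      using mdist_square_kern[OF cl] by (simp only: k fl1 fl2)
    also have "\<dots> \<le> 2 * e0 * t * exp (c * t) + 2 * e0 * t * exp (c * t)"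
      by (intro add_mono est s1 s2 s3)
    also have "\<dots> \<le> e\<^sup>2" using bound by simp
    finally show ?thesis
      unfolding g1 g2 by (rule power2_le_imp_le) (use e in simp)
  qed
  with d(1) show thesis by (rule that)
qed

lemma sum_list_concat: "sum_list (concat Rs) = sum_list (map sum_list Rs)"
  by (induction Rs) auto

text \<open>Both products are compared with the product over a common refinement, each within e /
  2.\<close>

lemma partitions_close:
  assumes z: "is_section z" and L: "uniformly_tangent z z L" and t: "0 \<le> t" and e: "0 < e"
  obtains d where "0 < d" "\<And>P Q. (\<And>p. p \<in> set P \<Longrightarrow> 0 < p \<and> p \<le> d) \<Longrightarrow> (\<And>q. q \<in> set Q \<Longrightarrow> 0 < q \<and> q \<le> d) \<Longrightarrow>
    sum_list P = t \<Longrightarrow> sum_list Q = t \<Longrightarrow> mdist (fib E t) (zprod E z P) (zprod E z Q) \<le> e"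
proof -
  interpret semi_bimod "fib E t" using t by (rule fib_semi)
  have e2: "0 < e / 2" using e by simp
  obtain d where d: "0 < d"
    "\<And>Rs. Rs \<in> lists (lists {0..}) \<Longrightarrow> (\<And>R. R \<in> set Rs \<Longrightarrow> sum_list R \<le> d) \<Longrightarrow> sum_list (concat Rs) = t \<Longrightarrow>
      mdist (fib E t) (zprod E z (map sum_list Rs)) (zprod E z (concat Rs)) \<le> e / 2"
    using refinement_close[OF z L t e2] by blast
  have "mdist (fib E t) (zprod E z P) (zprod E z Q) \<le> e"
    if P: "\<And>p. p \<in> set P \<Longrightarrow> 0 < p \<and> p \<le> d" and Q: "\<And>q. q \<in> set Q \<Longrightarrow> 0 < q \<and> q \<le> d"
      and sum: "sum_list P = t" "sum_list Q = t" for P Q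
  proof -
    have "\<exists>Rs Ss. concat Rs = concat Ss \<and> map sum_list Rs = P \<and> map sum_list Ss = Q \<and>
        (\<forall>r\<in>set (concat Rs). 0 \<le> r)"
      using P Q sum by (intro common_refinement) auto
    then obtain Rs Ss where RS: "concat Rs = concat Ss" "map sum_list Rs = P" "map sum_list Ss = Q"
      "\<forall>r\<in>set (concat Rs). 0 \<le> r" by (elim exE conjE) (rule that)
    have sc: "sum_list (concat Rs) = t" using sum RS by (metis sum_list_concat)
    have Rl: "Rs \<in> lists (lists {0..})" "Ss \<in> lists (lists {0..})" using RS(1,4) by (auto, metis RS(1) UN_I set_concat)
    have mR: "sum_list R \<le> d" if "R \<in> set Rs" for R using P RS(2) that by auto
    have mS: "sum_list R \<le> d" if "R \<in> set Ss" for R using Q RS(3) that by auto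
    have 1: "mdist (fib E t) (zprod E z P) (zprod E z (concat Rs)) \<le> e / 2"
      using d(2)[OF Rl(1) mR sc] RS(2) by simp
    have 2: "mdist (fib E t) (zprod E z Q) (zprod E z (concat Rs)) \<le> e / 2"
      using d(2)[OF Rl(2) mS] sc RS(1,3) by simp
    have cl: "zprod E z P \<in> mcarrier (fib E t)" "zprod E z Q \<in> mcarrier (fib E t)"
      using zprod_closed[OF z, of P] zprod_closed[OF z, of Q] P Q sum by (auto intro: less_imp_le)
    have "zprod E z (concat Rs) \<in> mcarrier (fib E t)"
      using zprod_closed[OF z, of "concat Rs"] RS(4) sc by auto
    then show ?thesis
      using mdist_triangle[of "zprod E z P" "zprod E z (concat Rs)" "zprod E z Q"] cl 1 2
      by (simp add: mdist_commute)
  qed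
  with d(1) show thesis by (rule that)
qed

text \<open>Products over partitions form a Cauchy net as the mesh tends to 0. Equidistant
  partitions become arbitrarily fine, so the limit along them is the limit over all
  partitions.\<close>

theorem trotter_convergence:
  assumes z: "is_section z" "z 0 = alg_iso E 1" and L: "uniformly_tangent z z L"
  shows "0 \<le> t \<Longrightarrow> mconv (fib E t) (\<lambda>m. tpow E (t / real m) (z (t / real m)) m) (trotter_limit E z t)"
    and "partition_limit z (trotter_limit E z)"
proof -
  have main: "mconv (fib E t) (\<lambda>m. tpow E (t / real m) (z (t / real m)) m) (trotter_limit E z t) \<and>
      trotter_limit E z t \<in> mcarrier (fib E t) \<and>
      (\<forall>e>0. \<exists>d>0. \<forall>P. (\<forall>p\<in>set P. 0 < p \<and> p \<le> d) \<and> sum_list P = t \<longrightarrow>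
        mdist (fib E t) (zprod E z P) (trotter_limit E z t) \<le> e)"
    if t: "0 \<le> t" for t
  proof -
    interpret pre_hilbert_bimod "fib E t" using t by (rule fib_pre_hilbert)
    define s where "s m = tpow E (t / real m) (z (t / real m)) m" for m
    have tl: "trotter_limit E z t = mlim (fib E t) s"
      unfolding trotter_limit_def s_def using t by simp
    \<comment> \<open>For t = 0 the pieces t / m vanish and form no admissible partition; as z 0 is
      1, their product equals that of the empty partition.\<close>
    have s_zprod: "s m = zprod E z (if t = 0 then [] else replicate m (t / real m))" if "0 < m" for m
    proof (cases "t = 0")
      case True
      have "zprod E z (replicate k 0) = alg_iso E 1" for k
        by (induction k) (auto simp: z(2) ptens_alg_iso_one sum_list_replicate)
      then show ?thesis
        unfolding s_def using True tpow_eq_zprod[OF z(1), of 0 m] by simp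
    next
      case False
      then show ?thesis unfolding s_def using tpow_eq_zprod[OF z(1), of "t / real m" m] t by simp
    qed
    define P where "P m = (if t = 0 then [] else replicate m (t / real m))" for m
    have P: "sum_list (P m) = t" "\<And>p. p \<in> set (P m) \<Longrightarrow> 0 < p \<and> p \<le> t / real m" if "0 < m" for m
      using that t unfolding P_def by (auto simp: sum_list_replicate split: if_splits)
    have sP: "s m = zprod E z (P m)" if "0 < m" for m using s_zprod[OF that] unfolding P_def .
    have s_closed: "s m \<in> mcarrier (fib E t)" if "0 < m" for m
      unfolding sP[OF that] using zprod_closed[OF z(1), of "P m"] P[OF that] by (auto intro: less_imp_le)
    have mesh: "\<exists>N>0. \<forall>m\<ge>N. \<forall>p\<in>set (P m). 0 < p \<and> p \<le> d" if d: "0 < d" for d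
    proof -
      obtain N where N: "t < real N * d" using ex_less_of_nat_mult[OF d] by blast
      have "p \<le> d" if m: "m \<ge> Suc N" "p \<in> set (P m)" for m p
      proof -
        have "p \<le> t / real m" using P(2)[of m p] m by auto
        also have "t \<le> real m * d"
          using N m d by (smt (verit, best) mult_right_mono of_nat_le_iff Suc_leD)
        then have "t / real m \<le> d" using m by (simp add: pos_divide_le_eq mult.commute)
        finally show ?thesis .
      qed
      moreover have "0 < p" if "m \<ge> Suc N" "p \<in> set (P m)" for m p
        using P(2)[of m p] that by simp
      ultimately show ?thesis by (intro exI[of _ "Suc N"]) simp
    qed
    \<comment> \<open>The shift removes the term m = 0, which lies in the fibre at 0.\<close>
    have "(\<lambda>m. s (Suc m)) \<in> mCauchy (fib E t)"
    proof (rule mCauchyI)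
      fix e :: real assume e: "0 < e"
      then have e2: "0 < e / 2" by simp
      obtain d where d: "0 < d" "\<And>P Q. (\<And>p. p \<in> set P \<Longrightarrow> 0 < p \<and> p \<le> d) \<Longrightarrow> (\<And>q. q \<in> set Q \<Longrightarrow> 0 < q \<and> q \<le> d) \<Longrightarrow>
          sum_list P = t \<Longrightarrow> sum_list Q = t \<Longrightarrow> mdist (fib E t) (zprod E z P) (zprod E z Q) \<le> e / 2"
        using partitions_close[OF z(1) L t e2] by blast
      obtain N where N: "0 < N" "\<forall>m\<ge>N. \<forall>p\<in>set (P m). 0 < p \<and> p \<le> d" using mesh[OF d(1)] by blast
      have "mdist (fib E t) (s (Suc m)) (s (Suc n)) < e" if "m \<ge> N" "n \<ge> N" for m n
      proof -
        have "mdist (fib E t) (s (Suc m)) (s (Suc n)) \<le> e / 2"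
          unfolding sP[OF zero_less_Suc]
          by (rule d(2)) (use N(2)[rule_format, of "Suc m"] N(2)[rule_format, of "Suc n"] that P(1) in auto)
        then show ?thesis using e by simp
      qed
      then show "\<exists>N. \<forall>m\<ge>N. \<forall>n\<ge>N. mdist (fib E t) (s (Suc m)) (s (Suc n)) < e" by blast
    qed (simp add: s_closed)
    then obtain l where "mconv (fib E t) (\<lambda>m. s (Suc m)) l"
      using hilbert_bimodule.complete[OF fibre[OF t]] by blast
    then have l: "l \<in> mcarrier (fib E t)" "(\<lambda>m. mdist (fib E t) (s (Suc m)) l) \<longlonglongrightarrow> 0"
      unfolding mconv_def by auto
    have lim: "(\<lambda>m. mdist (fib E t) (s m) l) \<longlonglongrightarrow> 0"
      using l(2) by (rule LIMSEQ_imp_Suc)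
    then have conv: "mconv (fib E t) s l" using l(1) unfolding mconv_def by blast
    then have tl': "trotter_limit E z t = l"
      unfolding tl by (intro mlim_eqI[of 1]) (auto intro: s_closed)
    have "\<exists>d>0. \<forall>Q. (\<forall>q\<in>set Q. 0 < q \<and> q \<le> d) \<and> sum_list Q = t \<longrightarrow> mdist (fib E t) (zprod E z Q) l \<le> e"
      if e: "0 < e" for e
    proof -
      have e2: "0 < e / 2" using e by simp
      obtain d where d: "0 < d" "\<And>P Q. (\<And>p. p \<in> set P \<Longrightarrow> 0 < p \<and> p \<le> d) \<Longrightarrow> (\<And>q. q \<in> set Q \<Longrightarrow> 0 < q \<and> q \<le> d) \<Longrightarrow>
          sum_list P = t \<Longrightarrow> sum_list Q = t \<Longrightarrow> mdist (fib E t) (zprod E z P) (zprod E z Q) \<le> e / 2"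
        using partitions_close[OF z(1) L t e2] by blast
      obtain N where N: "0 < N" "\<forall>m\<ge>N. \<forall>p\<in>set (P m). 0 < p \<and> p \<le> d" using mesh[OF d(1)] by blast
      obtain N' where N': "\<And>m. m \<ge> N' \<Longrightarrow> mdist (fib E t) (s m) l < e / 2"
        using order_tendstoD(2)[OF lim e2] unfolding eventually_sequentially by blast
      have "mdist (fib E t) (zprod E z Q) l \<le> e" if Q: "\<forall>q\<in>set Q. 0 < q \<and> q \<le> d" "sum_list Q = t" for Q
      proof -
        define m where "m = max N N'"
        have m: "0 < m" "N \<le> m" "N' \<le> m" unfolding m_def using N by auto
        have 1: "mdist (fib E t) (zprod E z Q) (s m) \<le> e / 2"
          unfolding sP[OF m(1)] using N m Q P(1)[OF m(1)] by (intro d(2)) auto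
        have "zprod E z Q \<in> mcarrier (fib E t)"
          using zprod_closed[OF z(1), of Q] Q by (auto intro: less_imp_le)
        then show ?thesis
          using 1 N'[OF m(3)] mdist_triangle[of "zprod E z Q" "s m" l] s_closed[OF m(1)] l(1) by simp
      qed
      with d(1) show ?thesis by blast
    qed
    with conv l(1) show ?thesis unfolding tl' s_def by blast
  qed
  then show "0 \<le> t \<Longrightarrow> mconv (fib E t) (\<lambda>m. tpow E (t / real m) (z (t / real m)) m) (trotter_limit E z t)"
    by blast
  show "partition_limit z (trotter_limit E z)"
    unfolding partition_limit_def using main by blast
qed

lemma trotter_limit_extensional: "trotter_limit E z \<in> extensional {0..}"
  unfolding trotter_limit_def by simp

end

lemma trotter_limit_cong:
  "(\<And>r. 0 \<le> r \<Longrightarrow> z r = w r) \<Longrightarrow> trotter_limit E z = trotter_limit E w"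
  unfolding trotter_limit_def by (intro restrict_ext) simp

section \<open>Affine combinations of units\<close>

text \<open>Coefficients on both sides allow \<open>lbox\<close> and \<open>rbox\<close> to be
  treated at once, with 1 on the respective other side.\<close>

definition comb ::
  "('b::unital_cstar_algebra, 'e, 'z) psys_scheme \<Rightarrow> ('b \<times> (real \<Rightarrow> 'e) \<times> 'b) list \<Rightarrow> real \<Rightarrow> 'e" where
  "comb E ps r = msum (fib E r) (map (\<lambda>(k, x, l). mract (fib E r) (mlact (fib E r) k (x r)) l) ps)"

lemma comb_simps [simp]:
  "comb E [] r = mzero (fib E r)"
  "comb E ((k, x, l) # ps) r = madd (fib E r) (mract (fib E r) (mlact (fib E r) k (x r)) l) (comb E ps r)"
  by (simp_all add: comb_def msum_def)

text \<open>Value of the combination at 0, where every unit is 1, and hence the constant term of its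
  expansions; an affine combination is one of weight 1.\<close>

abbreviation weight :: "('b::unital_cstar_algebra \<times> 'x \<times> 'b) list \<Rightarrow> 'b" where
  "weight ps \<equiv> (\<Sum>(k, x, l)\<leftarrow>ps. k * l)"

context product_system
begin

lemma comb_section:
  assumes "\<forall>(k, x, l)\<in>set ps. is_section x"
  shows "is_section (comb E ps)"
  unfolding is_section_def
proof (intro allI impI)
  fix t :: real assume t: "0 \<le> t"
  interpret semi_bimod "fib E t" using t by (rule fib_semi)
  show "comb E ps t \<in> mcarrier (fib E t)"
    using assms
  proof (induction ps)
    case (Cons p ps)
    obtain k x l where p: "p = (k, x, l)" by (cases p)
    have "is_section x" using Cons.prems p by simp
    moreover have "comb E ps t \<in> mcarrier (fib E t)" using Cons.IH Cons.prems by simp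
    ultimately show ?case using p t unfolding is_section_def by simp
  qed simp
qed

text \<open>Each summand has the constant term b -> star l star k b, multiplication by the adjoint
  of k l. The index set is left general because both lengths and partitions occur.\<close>

lemma first_order_comb_left:
  assumes pos: "\<And>i. i \<in> I \<Longrightarrow> 0 \<le> \<tau> i" and w: "\<And>i. i \<in> I \<Longrightarrow> w i \<in> mcarrier (fib E (\<tau> i))"
    and ps: "\<forall>(k, x, l)\<in>set ps. is_section x \<and>
      (\<exists>L. first_order I \<tau> (\<lambda>i. kern (fib E (\<tau> i)) (x (\<tau> i)) (w i)) id_blinfun L)"
  shows "\<exists>L. first_order I \<tau> (\<lambda>i. kern (fib E (\<tau> i)) (comb E ps (\<tau> i)) (w i))
    (blinfun_mult_right (star (weight ps))) L"
  using ps
proof (induction ps)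
  case Nil
  have "first_order I \<tau> (\<lambda>i. kern (fib E (\<tau> i)) (comb E [] (\<tau> i)) (w i)) (blinfun_mult_right (star (weight []))) 0"
  proof (rule first_order_cong[OF first_order_zero[OF pos]])
    fix i assume i: "i \<in> I"
    interpret semi_bimod "fib E (\<tau> i)" using pos[OF i] by (rule fib_semi)
    show "kern (fib E (\<tau> i)) (comb E [] (\<tau> i)) (w i) = 0" using w[OF i] by (simp add: kern_zero_left)
  qed (auto intro: blinfun_eqI)
  then show ?case by blast
next
  case (Cons p ps)
  obtain k x l where p: "p = (k, x, l)" by (cases p)
  have x: "is_section x" using Cons.prems p by simp
  have psec: "is_section (comb E ps)" using Cons.prems by (intro comb_section) auto
  obtain L where L: "first_order I \<tau> (\<lambda>i. kern (fib E (\<tau> i)) (x (\<tau> i)) (w i)) id_blinfun L"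
    using Cons.prems p by auto
  obtain L' where L': "first_order I \<tau> (\<lambda>i. kern (fib E (\<tau> i)) (comb E ps (\<tau> i)) (w i))
      (blinfun_mult_right (star (weight ps))) L'"
    using Cons.IH Cons.prems by auto
  have "first_order I \<tau> (\<lambda>i. sandwich (star k) (star l) (kern (fib E (\<tau> i)) (x (\<tau> i)) (w i))
        + kern (fib E (\<tau> i)) (comb E ps (\<tau> i)) (w i))
      (sandwich (star k) (star l) id_blinfun + blinfun_mult_right (star (weight ps)))
      (sandwich (star k) (star l) L + L')"
    by (intro first_order_add first_order_bounded_linear[OF L bounded_linear_sandwich] L' pos)
  then have "first_order I \<tau> (\<lambda>i. kern (fib E (\<tau> i)) (comb E (p # ps) (\<tau> i)) (w i))
      (blinfun_mult_right (star (weight (p # ps)))) (sandwich (star k) (star l) L + L')"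
  proof (rule first_order_cong)
    fix i assume i: "i \<in> I"
    interpret semi_bimod "fib E (\<tau> i)" using pos[OF i] by (rule fib_semi)
    show "kern (fib E (\<tau> i)) (comb E (p # ps) (\<tau> i)) (w i)
        = sandwich (star k) (star l) (kern (fib E (\<tau> i)) (x (\<tau> i)) (w i)) + kern (fib E (\<tau> i)) (comb E ps (\<tau> i)) (w i)"
      using w[OF i] x psec pos[OF i] unfolding p is_section_def by (simp add: kern_add_left kern_sandwich_left)
  qed (auto intro!: blinfun_eqI simp: p blinfun.bilinear_simps star_add star_mult distrib_right mult.assoc)
  then show ?case by blast
qed

lemma first_order_comb_right:
  assumes pos: "\<And>i. i \<in> I \<Longrightarrow> 0 \<le> \<tau> i" and w: "\<And>i. i \<in> I \<Longrightarrow> w i \<in> mcarrier (fib E (\<tau> i))"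
    and ps: "\<forall>(k, x, l)\<in>set ps. is_section x \<and>
      (\<exists>L. first_order I \<tau> (\<lambda>i. kern (fib E (\<tau> i)) (w i) (x (\<tau> i))) id_blinfun L)"
  shows "\<exists>L. first_order I \<tau> (\<lambda>i. kern (fib E (\<tau> i)) (w i) (comb E ps (\<tau> i)))
    (blinfun_mult_left (weight ps)) L"
  using ps
proof (induction ps)
  case Nil
  have "first_order I \<tau> (\<lambda>i. kern (fib E (\<tau> i)) (w i) (comb E [] (\<tau> i))) (blinfun_mult_left (weight [])) 0"
  proof (rule first_order_cong[OF first_order_zero[OF pos]])
    fix i assume i: "i \<in> I"
    interpret semi_bimod "fib E (\<tau> i)" using pos[OF i] by (rule fib_semi)
    show "kern (fib E (\<tau> i)) (w i) (comb E [] (\<tau> i)) = 0" using w[OF i] by (simp add: kern_zero_right)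
  qed (auto intro: blinfun_eqI)
  then show ?case by blast
next
  case (Cons p ps)
  obtain k x l where p: "p = (k, x, l)" by (cases p)
  have x: "is_section x" using Cons.prems p by simp
  have psec: "is_section (comb E ps)" using Cons.prems by (intro comb_section) auto
  obtain L where L: "first_order I \<tau> (\<lambda>i. kern (fib E (\<tau> i)) (w i) (x (\<tau> i))) id_blinfun L"
    using Cons.prems p by auto
  obtain L' where L': "first_order I \<tau> (\<lambda>i. kern (fib E (\<tau> i)) (w i) (comb E ps (\<tau> i)))
      (blinfun_mult_left (weight ps)) L'"
    using Cons.IH Cons.prems by auto
  have "first_order I \<tau> (\<lambda>i. sandwich_right k l (kern (fib E (\<tau> i)) (w i) (x (\<tau> i)))
        + kern (fib E (\<tau> i)) (w i) (comb E ps (\<tau> i)))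
      (sandwich_right k l id_blinfun + blinfun_mult_left (weight ps))
      (sandwich_right k l L + L')"
    by (intro first_order_add first_order_bounded_linear[OF L bounded_linear_sandwich] L' pos)
  then have "first_order I \<tau> (\<lambda>i. kern (fib E (\<tau> i)) (w i) (comb E (p # ps) (\<tau> i)))
      (blinfun_mult_left (weight (p # ps))) (sandwich_right k l L + L')"
  proof (rule first_order_cong)
    fix i assume i: "i \<in> I"
    interpret semi_bimod "fib E (\<tau> i)" using pos[OF i] by (rule fib_semi)
    show "kern (fib E (\<tau> i)) (w i) (comb E (p # ps) (\<tau> i))
        = sandwich_right k l (kern (fib E (\<tau> i)) (w i) (x (\<tau> i))) + kern (fib E (\<tau> i)) (w i) (comb E ps (\<tau> i))"
      using w[OF i] x psec pos[OF i] unfolding p is_section_def by (simp add: kern_add_right kern_sandwich_right)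
  qed (auto intro!: blinfun_eqI simp: p blinfun.bilinear_simps distrib_left mult.assoc)
  then show ?case by blast
qed

lemma blinfun_mult_one: "blinfun_mult_right (1::'b) = id_blinfun" "blinfun_mult_left (1::'b) = id_blinfun"
  by (auto intro!: blinfun_eqI)

text \<open>The two arguments are expanded in turn. Against a unit the combination has a plain
  expansion; since the unit agrees with its products over partitions, this expansion is uniform over
  partitions. Expanding the remaining argument linearly in the units then gives uniform tangency of
  the combination with itself.\<close>

lemma comb_tangent:
  assumes S: "\<And>u. u \<in> S \<Longrightarrow> is_unit E u" "\<And>u v. u \<in> S \<Longrightarrow> v \<in> S \<Longrightarrow> \<exists>L. tangent u v L"
    and ps: "\<forall>(k, x, l)\<in>set ps. x \<in> S" and one: "weight ps = 1"
  shows "u \<in> S \<Longrightarrow> \<exists>L. tangent u (comb E ps) L"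
    and "u \<in> S \<Longrightarrow> \<exists>L. tangent (comb E ps) u L"
    and "\<exists>L. uniformly_tangent (comb E ps) (comb E ps) L"
    and "comb E ps 0 = alg_iso E 1"
proof -
  have sec: "is_section x" if "x \<in> S" for x using unit_section[OF S(1)[OF that]] .
  have csec: "is_section (comb E ps)" using ps sec by (intro comb_section) auto
  show right: "\<exists>L. tangent u (comb E ps) L" if u: "u \<in> S" for u
  proof -
    have "\<exists>L. first_order {0..} (\<lambda>r. r) (\<lambda>r. kern (fib E r) (u r) (comb E ps r)) (blinfun_mult_left (weight ps)) L"
    proof (rule first_order_comb_right)
      show "\<forall>(k, x, l)\<in>set ps. is_section x \<and> (\<exists>L. tangent u x L)"
        using sec ps S(2)[OF u] by fast
    qed (use sec[OF u] in \<open>auto simp: is_section_def\<close>)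
    then show ?thesis by (simp add: one blinfun_mult_one)
  qed
  show "\<exists>L. tangent (comb E ps) u L" if u: "u \<in> S" for u
  proof -
    have "\<exists>L. first_order {0..} (\<lambda>r. r) (\<lambda>r. kern (fib E r) (comb E ps r) (u r)) (blinfun_mult_right (star (weight ps))) L"
    proof (rule first_order_comb_left)
      show "\<forall>(k, x, l)\<in>set ps. is_section x \<and> (\<exists>L. tangent x u L)"
        using sec ps S(2)[OF _ u] by fast
    qed (use sec[OF u] in \<open>auto simp: is_section_def\<close>)
    then show ?thesis by (simp add: one blinfun_mult_one)
  qed
  have "\<exists>L. uniformly_tangent x (comb E ps) L" if "x \<in> S" for x
    using right[OF that] unit_uniformly_tangent[OF S(1)[OF that] csec] by blast
  then show "\<exists>L. uniformly_tangent (comb E ps) (comb E ps) L"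
  proof -
    assume *: "\<And>x. x \<in> S \<Longrightarrow> \<exists>L. uniformly_tangent x (comb E ps) L"
    have "\<exists>L. first_order (lists {0..}) sum_list
        (\<lambda>R. kern (fib E (sum_list R)) (comb E ps (sum_list R)) (zprod E (comb E ps) R))
        (blinfun_mult_right (star (weight ps))) L"
    proof (rule first_order_comb_left)
      show "\<forall>(k, x, l)\<in>set ps. is_section x \<and> (\<exists>L. first_order (lists {0..}) sum_list
          (\<lambda>R. kern (fib E (sum_list R)) (x (sum_list R)) (zprod E (comb E ps) R)) id_blinfun L)"
        using * sec ps unfolding uniformly_tangent_def by fast
    qed (auto intro!: zprod_closed[OF csec] sum_list_nonneg)
    then show ?thesis
      unfolding uniformly_tangent_def one by (simp add: blinfun_mult_one)
  qed
  show "comb E ps 0 = alg_iso E 1"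
  proof -
    interpret pre_hilbert_bimod "fib E 0" by (intro fib_pre_hilbert) simp
    let ?o = "alg_iso E 1"
    \<comment> \<open>On the generator of the fibre at 0 the left and right actions agree, so k and
      l on either side amount to k l on the right.\<close>
    have o: "mlact (fib E 0) k ?o = mract (fib E 0) ?o k" for k
      using alg_left[of 0 ?o k] alg_right[of 0 ?o k] alg_left[of 0 "alg_iso E k" 1] alg_right[of 0 "alg_iso E k" 1]
        hilbert_bimodule.lact_one[OF fibre] hilbert_bimodule.ract_one[OF fibre] by simp
    have "mip (fib E 0) w (comb E ps 0) = mip (fib E 0) w ?o * weight ps" if w: "w \<in> mcarrier (fib E 0)" for w
      using ps
    proof (induction ps)
      case Nil
      then show ?case using w by (simp add: ip_zero_right)
    next
      case (Cons p ps)
      obtain k x l where p: "p = (k, x, l)" by (cases p)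
      have "x \<in> S" using Cons.prems p by simp
      then have x: "x 0 = ?o" using S(1) unfolding is_unit_def by blast
      have "is_section (comb E ps)"
        using Cons.prems sec by (intro comb_section) auto
      then have "comb E ps 0 \<in> mcarrier (fib E 0)"
        unfolding is_section_def by simp
      then show ?case
        using Cons w by (simp add: p x o ip_simps distrib_left mult.assoc)
    qed
    then show ?thesis using one csec by (intro ip_ext) (auto simp: is_section_def)
  qed
qed

end

section \<open>Continuous units\<close>

lemma kernel_eq_kern: "kernel E u v t = kern (fib E t) (u t) (v t)"
  by (simp add: kernel_def kern_def)

context product_system
begin

definition close :: "(real \<Rightarrow> 'e) \<Rightarrow> (real \<Rightarrow> 'e) \<Rightarrow> bool" where
  "close u v \<longleftrightarrow> ((\<lambda>r. mdist (fib E r) (u r) (v r)) \<longlongrightarrow> 0) (at 0 within {0..})"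

lemma unitD:
  assumes "is_unit E u"
  shows "0 \<le> t \<Longrightarrow> u t \<in> mcarrier (fib E t)" "u 0 = alg_iso E 1"
    "0 \<le> t \<Longrightarrow> 0 \<le> s \<Longrightarrow> ptens E t s (u t) (u s) = u (t + s)"
  using assms unfolding is_unit_def by auto

lemma kernel_zero: "is_unit E u \<Longrightarrow> is_unit E v \<Longrightarrow> kernel E u v 0 = id_blinfun"
  by (simp add: kernel_eq_kern unitD kern_alg_iso_one)

lemma kernel_add:
  assumes "is_unit E u" "is_unit E v" "0 \<le> t" "0 \<le> s"
  shows "kernel E u v (t + s) = (kernel E u v s o\<^sub>L kernel E u v t)"
  using kern_ptens[of t s "u t" "v t" "u s" "v s"] assms by (simp add: kernel_eq_kern unitD)

lemma kernel_semigroup: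
  "is_unit E u \<Longrightarrow> is_unit E v \<Longrightarrow> (kernel E u v \<longlongrightarrow> id_blinfun) (at 0 within {0..}) \<Longrightarrow>
    operator_semigroup (kernel E u v)"
  by unfold_locales (auto simp: kernel_zero kernel_add)

text \<open>The semigroup law reduces continuity on the half-line to continuity at 0.\<close>

lemma continuous_units_iff:
  "continuous_units E S \<longleftrightarrow> (\<forall>u\<in>S. is_unit E u) \<and>
    (\<forall>u\<in>S. \<forall>v\<in>S. (kernel E u v \<longlongrightarrow> id_blinfun) (at 0 within {0..}))"
proof -
  have "continuous_on {0..} (kernel E u v) \<longleftrightarrow> (kernel E u v \<longlongrightarrow> id_blinfun) (at 0 within {0..})"
    if "is_unit E u" "is_unit E v" for u v
  proof
    assume "continuous_on {0..} (kernel E u v)"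
    then have "(kernel E u v \<longlongrightarrow> kernel E u v 0) (at 0 within {0..})"
      unfolding continuous_on_def by simp
    then show "(kernel E u v \<longlongrightarrow> id_blinfun) (at 0 within {0..})"
      using kernel_zero[OF that] by simp
  next
    assume "(kernel E u v \<longlongrightarrow> id_blinfun) (at 0 within {0..})"
    then show "continuous_on {0..} (kernel E u v)"
      by (intro operator_semigroup.continuous kernel_semigroup that)
  qed
  then show ?thesis unfolding continuous_units_def by blast
qed

lemma tangent_generator:
  assumes "is_unit E u" "is_unit E v" "(kernel E u v \<longlongrightarrow> id_blinfun) (at 0 within {0..})"
  shows "tangent u v (generator E u v)"
proof -
  obtain L where "first_order {0..} (\<lambda>r. r) (kernel E u v) id_blinfun L"
    using operator_semigroup.differentiable[OF kernel_semigroup[OF assms]] by blast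
  then have "tangent u v L" "generator E u v = L"
    using first_order_vector_derivative by (auto simp: generator_def kernel_eq_kern[abs_def])
  then show ?thesis by simp
qed

lemma generator_eqI: "tangent u v L \<Longrightarrow> generator E u v = L"
  using first_order_vector_derivative by (auto simp: generator_def kernel_eq_kern[abs_def])

lemma tangent_kernel_tendsto:
  "tangent u v L \<Longrightarrow> (kernel E u v \<longlongrightarrow> id_blinfun) (at 0 within {0..})"
  using first_order_tendsto by (simp add: kernel_eq_kern[abs_def])

lemma eventually_nonneg: "\<forall>\<^sub>F r in at 0 within {0::real..}. 0 \<le> r"
  unfolding eventually_at by (intro exI[of _ 1]) auto

text \<open>By \<open>mdist_square_kern\<close> the squared distance is bounded by differences of
  the three operators, which share the limit 1.\<close>

lemma close_if_kernel:
  assumes u: "is_unit E u" and v: "is_unit E v"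
    and lim: "(kernel E u u \<longlongrightarrow> id_blinfun) (at 0 within {0..})" "(kernel E u v \<longlongrightarrow> id_blinfun) (at 0 within {0..})"
      "(kernel E v v \<longlongrightarrow> id_blinfun) (at 0 within {0..})"
  shows "close u v"
  unfolding close_def
proof (rule Lim_null_comparison)
  let ?g = "\<lambda>r. sqrt (norm (kernel E u u r - kernel E u v r) + norm (kernel E u v r - kernel E v v r))"
  show "\<forall>\<^sub>F r in at 0 within {0..}. norm (mdist (fib E r) (u r) (v r)) \<le> ?g r"
    using eventually_nonneg
  proof eventually_elim
    case (elim r)
    interpret semi_bimod "fib E r" using elim by (rule fib_semi)
    show ?case
      using mdist_square_kern[of "u r" "v r"] unitD(1)[OF u elim] unitD(1)[OF v elim]
      by (simp add: kernel_eq_kern real_le_rsqrt)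
  qed
  have "(?g \<longlongrightarrow> sqrt (norm (id_blinfun - id_blinfun :: 'b \<Rightarrow>\<^sub>L 'b) + norm (id_blinfun - id_blinfun :: 'b \<Rightarrow>\<^sub>L 'b)))
      (at 0 within {0..})"
    by (intro tendsto_intros lim)
  then show "(?g \<longlongrightarrow> 0) (at 0 within {0..})" by simp
qed

text \<open>Converse of \<open>close_if_kernel\<close>: the operator depends continuously on both
  vectors, so everything close to one w with continuous semigroup behaves like w near 0.\<close>

lemma kernel_tendsto_if_close:
  assumes w: "is_section w" "(kernel E w w \<longlongrightarrow> id_blinfun) (at 0 within {0..})"
    and u: "is_section u" "close u w" and v: "is_section v" "close v w"
  shows "(kernel E u v \<longlongrightarrow> id_blinfun) (at 0 within {0..})"
proof -
  let ?du = "\<lambda>r. mdist (fib E r) (u r) (w r)" and ?dv = "\<lambda>r. mdist (fib E r) (v r) (w r)"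
  have "((\<lambda>r. norm (kernel E w w r)) \<longlongrightarrow> norm (id_blinfun :: 'b \<Rightarrow>\<^sub>L 'b)) (at 0 within {0..})"
    by (intro tendsto_intros w)
  \<comment> \<open>The operator at 1 is <w r, w r>, so a norm below 4 bounds the vector by
    2.\<close>
  then have "\<forall>\<^sub>F r in at 0 within {0..}. norm (kernel E w w r) < 4"
    using norm_blinfun_id_le[where 'a = 'b] by (intro order_tendstoD) auto
  then have ev: "\<forall>\<^sub>F r in at 0 within {0..}. norm (kernel E u v r - kernel E w w r) \<le> ?du r * (2 + ?dv r) + 2 * ?dv r"
    using eventually_nonneg
  proof eventually_elim
    case (elim r)
    interpret semi_bimod "fib E r" using elim(2) by (rule fib_semi)
    have c: "u r \<in> mcarrier (fib E r)" "v r \<in> mcarrier (fib E r)" "w r \<in> mcarrier (fib E r)"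
      using u v w elim(2) unfolding is_section_def by auto
    have "norm (mip (fib E r) (w r) (w r)) \<le> 2\<^sup>2"
      using norm_blinfun_one_le[of "kernel E w w r"] elim(1) c by (simp add: kernel_eq_kern kern_apply_one)
    then have nw: "mnorm (fib E r) (w r) \<le> 2" by (simp add: mnorm_le_iff)
    have "norm (kernel E u v r - kernel E w w r) \<le> ?du r * mnorm (fib E r) (v r) + mnorm (fib E r) (w r) * ?dv r"
      unfolding kernel_eq_kern using c by (intro norm_kern_diff_le)
    also have "\<dots> \<le> ?du r * (2 + ?dv r) + 2 * ?dv r"
      using nw mnorm_diff_le[OF c(2,3)] by (intro add_mono mult_left_mono mult_right_mono) auto
    finally show ?case .
  qed
  have "((\<lambda>r. ?du r * (2 + ?dv r) + 2 * ?dv r) \<longlongrightarrow> 0 * (2 + 0) + 2 * 0) (at 0 within {0..})"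
    using u v unfolding close_def by (intro tendsto_intros)
  then have "((\<lambda>r. kernel E u v r - kernel E w w r) \<longlongrightarrow> 0) (at 0 within {0..})"
    by (intro Lim_null_comparison[OF ev]) simp
  from tendsto_add[OF this w(2)] show ?thesis by simp
qed

end

section \<open>Units continuous together with a fixed base unit\<close>

locale based_product_system = product_system E
  for E :: "('b::unital_cstar_algebra, 'e, 'z) psys_scheme" +
  fixes \<omega> :: "real \<Rightarrow> 'e"
  assumes base: "continuous_units E {\<omega>}"
begin

abbreviation "U \<equiv> units_cont_with E \<omega>"

lemma base_unit: "is_unit E \<omega>"
  and base_kernel: "(kernel E \<omega> \<omega> \<longlongrightarrow> id_blinfun) (at 0 within {0..})"
  using base unfolding continuous_units_iff by auto

text \<open>The defining condition speaks of pairs formed by x and the base; closeness to the base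
  yields continuity for all pairs from \<open>U\<close> at once and is preserved by
  morphisms.\<close>

lemma U_iff: "x \<in> U \<longleftrightarrow> is_unit E x \<and> close x \<omega>"
proof
  assume "x \<in> U"
  then show "is_unit E x \<and> close x \<omega>"
    unfolding units_cont_with_def continuous_units_iff using close_if_kernel[of x \<omega>] by auto
next
  assume x: "is_unit E x \<and> close x \<omega>"
  have c: "close \<omega> \<omega>"
    by (rule close_if_kernel[OF base_unit base_unit base_kernel base_kernel base_kernel])
  have "(kernel E u v \<longlongrightarrow> id_blinfun) (at 0 within {0..})" if "u \<in> {x, \<omega>}" "v \<in> {x, \<omega>}" for u v
  proof (rule kernel_tendsto_if_close[OF unit_section[OF base_unit] base_kernel])
    show "is_section u" "close u \<omega>" "is_section v" "close v \<omega>"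
      using that x c base_unit by (auto intro: unit_section)
  qed
  then show "x \<in> U"
    unfolding units_cont_with_def continuous_units_iff using x base_unit by auto
qed

lemma base_U [simp]: "\<omega> \<in> U"
  using base unfolding units_cont_with_def by simp

lemma U_unit: "x \<in> U \<Longrightarrow> is_unit E x"
  by (simp add: U_iff)

lemma U_section: "x \<in> U \<Longrightarrow> is_section x"
  by (simp add: U_unit unit_section)

lemma U_closed: "x \<in> U \<Longrightarrow> 0 \<le> r \<Longrightarrow> x r \<in> mcarrier (fib E r)"
  using U_section unfolding is_section_def by blast

lemma U_tangent: "x \<in> U \<Longrightarrow> y \<in> U \<Longrightarrow> tangent x y (generator E x y)"
  by (rule tangent_generator[OF _ _ kernel_tendsto_if_close[OF unit_section[OF base_unit] base_kernel]])
    (auto simp: U_iff unit_section)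

text \<open>The limit unit has the same first-order expansions as the combination it is built from,
  so its generators can be computed from the combination without looking at tensor powers.\<close>

lemma trotter_comb:
  assumes ps: "\<forall>(k, x, l)\<in>set ps. x \<in> U" and one: "weight ps = 1"
  defines "z \<equiv> comb E ps"
  shows "trotter_limit E z \<in> U"
    and "y \<in> U \<Longrightarrow> tangent y z (generator E y (trotter_limit E z))"
    and "0 \<le> t \<Longrightarrow> mconv (fib E t) (\<lambda>m. tpow E (t / real m) (z (t / real m)) m) (trotter_limit E z t)"
    and "is_section z" "z 0 = alg_iso E 1"
proof -
  let ?\<zeta> = "trotter_limit E z"
  have S: "\<And>u v. u \<in> U \<Longrightarrow> v \<in> U \<Longrightarrow> \<exists>L. tangent u v L" using U_tangent by blast
  have C1: "\<exists>L. tangent y z L" if "y \<in> U" for y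
    unfolding z_def by (rule comb_tangent(1)[of U ps y]) (use U_unit S ps one that in auto)
  have C2: "\<exists>L. tangent z y L" if "y \<in> U" for y
    unfolding z_def by (rule comb_tangent(2)[of U ps y]) (use U_unit S ps one that in auto)
  have C3: "\<exists>L. uniformly_tangent z z L"
    unfolding z_def by (rule comb_tangent(3)[of U ps]) (use U_unit S ps one in auto)
  show zsec: "is_section z" unfolding z_def using ps U_section by (intro comb_section) auto
  show z0: "z 0 = alg_iso E 1" unfolding z_def by (rule comb_tangent(4)[of U ps]) (use U_unit S ps one in auto)
  obtain L where L: "uniformly_tangent z z L" using C3 by blast
  note T = trotter_convergence[OF zsec z0 L]
  show "0 \<le> t \<Longrightarrow> mconv (fib E t) (\<lambda>m. tpow E (t / real m) (z (t / real m)) m) (?\<zeta> t)"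
    by (rule T(1))
  have unit: "is_unit E ?\<zeta>"
    by (rule partition_limit_unit[OF zsec T(2) trotter_limit_extensional])
  have right: "tangent y ?\<zeta> L" if "y \<in> U" "tangent y z L" for y L
    using partition_limit_tangent[OF U_section[OF that(1)] unit_partition_limit[OF U_unit[OF that(1)]] zsec T(2) that(2)] .
  show "tangent y z (generator E y ?\<zeta>)" if y: "y \<in> U" for y
  proof -
    obtain L where L: "tangent y z L" using C1[OF y] by blast
    then show ?thesis using generator_eqI[OF right[OF y L]] by simp
  qed
  obtain L1 where "tangent \<omega> z L1" using C1[OF base_U] by blast
  then have "tangent \<omega> ?\<zeta> L1" by (intro right) auto
  moreover obtain L2 where "tangent z \<omega> L2" using C2[OF base_U] by blast
  then have "tangent ?\<zeta> \<omega> L2"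
    using partition_limit_tangent[OF zsec T(2) U_section[OF base_U] unit_partition_limit[OF base_unit]] by blast
  moreover have "tangent ?\<zeta> ?\<zeta> L"
    using partition_limit_tangent[OF zsec T(2) zsec T(2) uniformly_tangent_tangent[OF zsec L]] .
  ultimately show "?\<zeta> \<in> U"
    unfolding U_iff
    using unit close_if_kernel[OF unit base_unit tangent_kernel_tendsto tangent_kernel_tendsto base_kernel] by blast
qed

text \<open>To be read as <x, b y>: the semi-inner product of the index is the value at b = 1, and
  the middle argument records the left action.\<close>

definition D :: "(real \<Rightarrow> 'e) \<Rightarrow> (real \<Rightarrow> 'e) \<Rightarrow> 'b \<Rightarrow> 'b" where
  "D x y b = blinfun_apply (generator E x y - generator E x \<omega> - generator E \<omega> y + generator E \<omega> \<omega>) b"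

definition Dq :: "(real \<Rightarrow> 'e) \<Rightarrow> (real \<Rightarrow> 'e) \<Rightarrow> 'b \<Rightarrow> real \<Rightarrow> 'b" where
  "Dq x y b r = (1 / r) *\<^sub>R mip (fib E r) (msub (fib E r) (x r) (\<omega> r))
    (mlact (fib E r) b (msub (fib E r) (y r) (\<omega> r)))"

text \<open>The identity operators cancel in the alternating sum of the four expansions, so dividing
  by r leaves the alternating sum of the derivatives. Laws for \<open>D\<close> are obtained as
  limits of laws valid in the fibres.\<close>

lemma Dq_tendsto:
  assumes x: "is_section x" and y: "is_section y"
    and L: "tangent x y L1" "tangent x \<omega> L2" "tangent \<omega> y L3" "tangent \<omega> \<omega> L4"
  shows "(Dq x y b \<longlongrightarrow> blinfun_apply (L1 - L2 - L3 + L4) b) (at_right 0)"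
proof -
  let ?k = "\<lambda>u v r. kern (fib E r) (u r) (v r)"
  let ?q = "\<lambda>u v r. (1 / r) *\<^sub>R (?k u v r - id_blinfun)"
  have "((\<lambda>r. blinfun_apply (?q x y r - ?q x \<omega> r - ?q \<omega> y r + ?q \<omega> \<omega> r) b)
      \<longlongrightarrow> blinfun_apply (L1 - L2 - L3 + L4) b) (at_right 0)"
    by (intro tendsto_intros blinfun.tendsto first_order_quotient L)
  moreover have "\<forall>\<^sub>F r in at_right 0. blinfun_apply (?q x y r - ?q x \<omega> r - ?q \<omega> y r + ?q \<omega> \<omega> r) b = Dq x y b r"
    unfolding eventually_at_right_field
  proof (intro exI[of _ 1] conjI allI impI)
    fix r :: real assume r: "0 < r"
    interpret semi_bimod "fib E r" using r by (intro fib_semi) simp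
    have c: "x r \<in> mcarrier (fib E r)" "y r \<in> mcarrier (fib E r)" "\<omega> r \<in> mcarrier (fib E r)"
      using x y r U_closed[OF base_U] unfolding is_section_def by auto
    have "Dq x y b r = (1 / r) *\<^sub>R blinfun_apply (?k x y r - ?k x \<omega> r - (?k \<omega> y r - ?k \<omega> \<omega> r)) b"
      unfolding Dq_def using c
      by (simp add: kern_apply[symmetric] kern_sub_left kern_sub_right blinfun.bilinear_simps algebra_simps)
    then show "blinfun_apply (?q x y r - ?q x \<omega> r - ?q \<omega> y r + ?q \<omega> \<omega> r) b = Dq x y b r"
      by (simp add: blinfun.bilinear_simps algebra_simps)
  qed simp
  ultimately show ?thesis
    using tendsto_cong by fast
qed

lemma D_tendsto: "x \<in> U \<Longrightarrow> y \<in> U \<Longrightarrow> (Dq x y b \<longlongrightarrow> D x y b) (at_right 0)"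
  unfolding D_def by (intro Dq_tendsto U_section U_tangent base_U)

lemma D_comb_tendsto:
  assumes "\<forall>(k, x, l)\<in>set ps. x \<in> U" "weight ps = 1" "y \<in> U"
  shows "(Dq y (comb E ps) b \<longlongrightarrow> D y (trotter_limit E (comb E ps)) b) (at_right 0)"
  unfolding D_def
  by (intro Dq_tendsto U_section U_tangent base_U trotter_comb assms)

lemma D_unique:
  assumes "(Dq x y b \<longlongrightarrow> p) (at_right 0)" "\<And>r. 0 < r \<Longrightarrow> Dq x y b r = f r" "(f \<longlongrightarrow> q) (at_right 0)"
  shows "p = q"
proof -
  have "\<forall>\<^sub>F r in at_right 0. Dq x y b r = f r"
    unfolding eventually_at_right_field using assms(2) by (intro exI[of _ 1]) auto
  then have "(f \<longlongrightarrow> p) (at_right 0)" using assms(1) tendsto_cong by fast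
  then show ?thesis using assms(3) by (intro tendsto_unique[of "at_right 0"]) auto
qed

lemma D_star:
  assumes "x \<in> U" "y \<in> U"
  shows "star (D x y b) = D y x (star b)"
proof (rule D_unique[symmetric, OF D_tendsto[OF assms(2,1)]])
  show "((\<lambda>r. star (Dq x y b r)) \<longlongrightarrow> star (D x y b)) (at_right 0)"
    by (intro tendsto_intros D_tendsto assms)
  fix r :: real assume r: "0 < r"
  interpret semi_bimod "fib E r" using r by (intro fib_semi) simp
  show "Dq y x (star b) r = star (Dq x y b r)"
    unfolding Dq_def using U_closed[OF assms(1)] U_closed[OF assms(2)] U_closed[OF base_U] r
    by (simp add: star_scaleR ip_star ip_lact)
qed

lemma D_zero: "x \<in> U \<Longrightarrow> D x \<omega> b = 0"
proof (rule D_unique[OF D_tendsto])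
  fix r :: real assume x: "x \<in> U" and r: "0 < r"
  interpret semi_bimod "fib E r" using r by (intro fib_semi) simp
  show "Dq x \<omega> b r = 0"
    unfolding Dq_def using U_closed[OF x] U_closed[OF base_U] r by (simp add: ip_lact_sub_right)
qed auto

lemma D_bilinear: "D x y (a + b) = D x y a + D x y b"
  by (simp add: D_def blinfun.add_right)

lemma D_scaleC:
  assumes "x \<in> U" "y \<in> U"
  shows "D x y (scaleC c b) = D x y b * scaleC c 1"
proof (rule D_unique[OF D_tendsto[OF assms]])
  show "((\<lambda>r. Dq x y b r * scaleC c 1) \<longlongrightarrow> D x y b * scaleC c 1) (at_right 0)"
    by (intro tendsto_intros D_tendsto assms)
  fix r :: real assume r: "0 < r"
  interpret semi_bimod "fib E r" using r by (intro fib_semi) simp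
  show "Dq x y (scaleC c b) r = Dq x y b r * scaleC c 1"
    unfolding Dq_def using U_closed[OF assms(1)] U_closed[OF assms(2)] U_closed[OF base_U] r
    by (simp add: ip_lact_scaleC mult_scaleC_right scaleR_scaleC scaleC_scaleC mult.commute)
qed

lemma filterlim_inverse_Suc: "filterlim (\<lambda>n. inverse (real (Suc n))) (at_right 0) sequentially"
  by (intro tendsto_imp_filterlim_at_right LIMSEQ_inverse_real_of_nat) auto

lemma D_positive:
  assumes x: "x \<in> U"
  shows "positive (D x x 1)"
proof (rule positive_LIMSEQ)
  \<comment> \<open>Closedness of the positive cone is available for sequences, so the limit is
    taken along 1 / (n + 1).\<close>
  show "(\<lambda>n. Dq x x 1 (inverse (real (Suc n)))) \<longlonglongrightarrow> D x x 1"
    by (rule filterlim_compose[OF D_tendsto[OF x x] filterlim_inverse_Suc])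
  fix n
  define r where "r = inverse (real (Suc n))"
  have r: "0 < r" unfolding r_def by simp
  interpret semi_bimod "fib E r" using r by (intro fib_semi) simp
  show "positive (Dq x x 1 (inverse (real (Suc n))))"
    unfolding Dq_def r_def[symmetric] using U_closed[OF x] U_closed[OF base_U] r
    by (intro positive_scaleR) (auto simp: ip_lact_one intro: ip_positive)
qed

text \<open>With coefficients of sum 1, the combination minus \<omega> is the same combination of
  the differences x - \<omega>. Left coefficients move into the middle argument of
  \<open>D\<close>.\<close>

lemma D_lbox:
  assumes ps: "\<forall>(k, x)\<in>set ps. x \<in> U" and one: "(\<Sum>(k, x)\<leftarrow>ps. k) = 1" and y: "y \<in> U"
  shows "lbox E ps \<in> U" "D y (lbox E ps) b = (\<Sum>(k, x)\<leftarrow>ps. D y x (b * k))"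
    and "lbox E ps = trotter_limit E (comb E (map (\<lambda>(k, x). (k, x, 1)) ps))"
proof -
  let ?qs = "map (\<lambda>(k, x). (k, x, 1 :: 'b)) ps"
  show eq: "lbox E ps = trotter_limit E (comb E ?qs)"
    unfolding lbox_def
  proof (rule trotter_limit_cong)
    fix r :: real assume r: "0 \<le> r"
    then interpret hilbert_bimodule "fib E r" by (rule fibre)
    show "msum (fib E r) (map (\<lambda>(k, x). mlact (fib E r) k (x r)) ps) = comb E ?qs r"
      using ps r by (induction ps) (auto simp: msum_def ract_one lact_closed U_closed)
  qed
  have qs: "\<forall>(k, x, l)\<in>set ?qs. x \<in> U" using ps by auto
  have w: "weight ?qs = 1" using one by (simp add: case_prod_unfold comp_def)
  show "lbox E ps \<in> U" unfolding eq by (rule trotter_comb[OF qs w])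
  show "D y (lbox E ps) b = (\<Sum>(k, x)\<leftarrow>ps. D y x (b * k))"
    unfolding eq
  proof (rule D_unique[OF D_comb_tendsto[OF qs w y]])
    show "((\<lambda>r. \<Sum>(k, x)\<leftarrow>ps. Dq y x (b * k) r) \<longlongrightarrow> (\<Sum>(k, x)\<leftarrow>ps. D y x (b * k))) (at_right 0)"
      using ps by (induction ps) (auto intro!: tendsto_intros D_tendsto y)
    fix r :: real assume r: "0 < r"
    interpret semi_bimod "fib E r" using r by (intro fib_semi) simp
    let ?u = "msub (fib E r) (y r) (\<omega> r)"
    have u: "?u \<in> mcarrier (fib E r)" and w0: "\<omega> r \<in> mcarrier (fib E r)"
      using U_closed[OF y] U_closed[OF base_U] r by auto
    have cl: "comb E (map (\<lambda>(k, x). (k, x, 1)) ps) r \<in> mcarrier (fib E r)"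
      if "\<forall>(k, x)\<in>set ps. x \<in> U" for ps :: "('b \<times> (real \<Rightarrow> 'e)) list"
      using that r U_closed by (induction ps) auto
    \<comment> \<open>A sublist has another coefficient sum, so the induction weights \<omega> by
      the sum of the current list.\<close>
    have "(1 / r) *\<^sub>R (mip (fib E r) ?u (mlact (fib E r) b (comb E ?qs r))
        - mip (fib E r) ?u (mlact (fib E r) (b * (\<Sum>(k, x)\<leftarrow>ps. k)) (\<omega> r))) = (\<Sum>(k, x)\<leftarrow>ps. Dq y x (b * k) r)"
      using ps
    proof (induction ps)
      case Nil
      have "mip (fib E r) ?u (mlact (fib E r) 0 (\<omega> r)) = 0"
        using ip_lact_scaleR[OF u w0, of 0 0] by simp
      then show ?case using u by (simp add: ip_lact_right ip_zero_right)
    next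
      case (Cons p ps)
      obtain k x where p: "p = (k, x)" by (cases p)
      have x: "x r \<in> mcarrier (fib E r)" using Cons.prems p U_closed r by auto
      have ps: "\<forall>(k, x)\<in>set ps. x \<in> U" using Cons.prems by simp
      note IH = Cons.IH[OF ps]
      have 1: "mip (fib E r) ?u (mlact (fib E r) b (comb E (map (\<lambda>(k, x). (k, x, 1)) (p # ps)) r))
          = mip (fib E r) ?u (mlact (fib E r) (b * k) (x r))
            + mip (fib E r) ?u (mlact (fib E r) b (comb E (map (\<lambda>(k, x). (k, x, 1)) ps) r))"
        using cl[OF ps] u x by (simp add: p ip_lact_add_right ip_lact_ract ip_lact_mult)
      have 2: "mip (fib E r) ?u (mlact (fib E r) (b * (\<Sum>(k, x)\<leftarrow>p # ps. k)) (\<omega> r))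
          = mip (fib E r) ?u (mlact (fib E r) (b * k) (\<omega> r))
            + mip (fib E r) ?u (mlact (fib E r) (b * (\<Sum>(k, x)\<leftarrow>ps. k)) (\<omega> r))"
        using u w0 by (simp add: p distrib_left ip_lact_add)
      have 3: "Dq y x (b * k) r = (1 / r) *\<^sub>R (mip (fib E r) ?u (mlact (fib E r) (b * k) (x r))
          - mip (fib E r) ?u (mlact (fib E r) (b * k) (\<omega> r)))"
        using u w0 x by (simp add: Dq_def ip_lact_sub_right)
      have "(\<Sum>(k, x)\<leftarrow>p # ps. Dq y x (b * k) r) = Dq y x (b * k) r + (\<Sum>(k, x)\<leftarrow>ps. Dq y x (b * k) r)"
        by (simp add: p)
      then show ?case
        unfolding 1 2 3 IH[symmetric] by (simp add: algebra_simps)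
    qed
    then show "Dq y (comb E ?qs) b r = (\<Sum>(k, x)\<leftarrow>ps. Dq y x (b * k) r)"
      unfolding one using cl[OF ps] u w0 by (simp add: Dq_def ip_lact_sub_right)
  qed
qed

text \<open>As for \<open>D_lbox\<close>, except that right coefficients leave the inner product as
  right factors.\<close>

lemma D_rbox:
  assumes ps: "\<forall>(x, k)\<in>set ps. x \<in> U" and one: "(\<Sum>(x, k)\<leftarrow>ps. k) = 1" and y: "y \<in> U"
  shows "rbox E ps \<in> U" "D y (rbox E ps) b = (\<Sum>(x, k)\<leftarrow>ps. D y x b * k)"
    and "rbox E ps = trotter_limit E (comb E (map (\<lambda>(x, k). (1, x, k)) ps))"
proof -
  let ?qs = "map (\<lambda>(x, k). (1 :: 'b, x, k)) ps"
  show eq: "rbox E ps = trotter_limit E (comb E ?qs)"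
    unfolding rbox_def
  proof (rule trotter_limit_cong)
    fix r :: real assume r: "0 \<le> r"
    then interpret hilbert_bimodule "fib E r" by (rule fibre)
    show "msum (fib E r) (map (\<lambda>(x, k). mract (fib E r) (x r) k) ps) = comb E ?qs r"
      using ps r by (induction ps) (auto simp: msum_def lact_one U_closed)
  qed
  have qs: "\<forall>(k, x, l)\<in>set ?qs. x \<in> U" using ps by auto
  have w: "weight ?qs = 1" using one by (simp add: case_prod_unfold comp_def)
  show "rbox E ps \<in> U" unfolding eq by (rule trotter_comb[OF qs w])
  show "D y (rbox E ps) b = (\<Sum>(x, k)\<leftarrow>ps. D y x b * k)"
    unfolding eq
  proof (rule D_unique[OF D_comb_tendsto[OF qs w y]])
    show "((\<lambda>r. \<Sum>(x, k)\<leftarrow>ps. Dq y x b r * k) \<longlongrightarrow> (\<Sum>(x, k)\<leftarrow>ps. D y x b * k)) (at_right 0)"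
      using ps by (induction ps) (auto intro!: tendsto_intros D_tendsto y)
    fix r :: real assume r: "0 < r"
    interpret semi_bimod "fib E r" using r by (intro fib_semi) simp
    let ?u = "msub (fib E r) (y r) (\<omega> r)"
    have u: "?u \<in> mcarrier (fib E r)" and w0: "\<omega> r \<in> mcarrier (fib E r)"
      using U_closed[OF y] U_closed[OF base_U] r by auto
    have cl: "comb E (map (\<lambda>(x, k). (1, x, k)) ps) r \<in> mcarrier (fib E r)"
      if "\<forall>(x, k)\<in>set ps. x \<in> U" for ps :: "((real \<Rightarrow> 'e) \<times> 'b) list"
      using that r U_closed by (induction ps) auto
    have "(1 / r) *\<^sub>R (mip (fib E r) ?u (mlact (fib E r) b (comb E ?qs r))
        - mip (fib E r) ?u (mlact (fib E r) b (\<omega> r)) * (\<Sum>(x, k)\<leftarrow>ps. k)) = (\<Sum>(x, k)\<leftarrow>ps. Dq y x b r * k)"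
      using ps
    proof (induction ps)
      case Nil
      then show ?case using u by (simp add: ip_lact_right ip_zero_right)
    next
      case (Cons p ps)
      obtain x k where p: "p = (x, k)" by (cases p)
      have x: "x r \<in> mcarrier (fib E r)" using Cons.prems p U_closed r by auto
      have ps: "\<forall>(x, k)\<in>set ps. x \<in> U" using Cons.prems by simp
      note IH = Cons.IH[OF ps]
      have 1: "mip (fib E r) ?u (mlact (fib E r) b (comb E (map (\<lambda>(x, k). (1, x, k)) (p # ps)) r))
          = mip (fib E r) ?u (mlact (fib E r) b (x r)) * k
            + mip (fib E r) ?u (mlact (fib E r) b (comb E (map (\<lambda>(x, k). (1, x, k)) ps) r))"
        using cl[OF ps] u x ip_lact_mult[of ?u "x r" b 1]
        by (simp add: p ip_lact_add_right ip_lact_ract)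
      have 2: "mip (fib E r) ?u (mlact (fib E r) b (\<omega> r)) * (\<Sum>(x, k)\<leftarrow>p # ps. k)
          = mip (fib E r) ?u (mlact (fib E r) b (\<omega> r)) * k
            + mip (fib E r) ?u (mlact (fib E r) b (\<omega> r)) * (\<Sum>(x, k)\<leftarrow>ps. k)"
        by (simp add: p distrib_left)
      have 3: "Dq y x b r * k = (1 / r) *\<^sub>R (mip (fib E r) ?u (mlact (fib E r) b (x r)) * k
          - mip (fib E r) ?u (mlact (fib E r) b (\<omega> r)) * k)"
        using u w0 x by (simp add: Dq_def ip_lact_sub_right left_diff_distrib)
      have "(\<Sum>(x, k)\<leftarrow>p # ps. Dq y x b r * k) = Dq y x b r * k + (\<Sum>(x, k)\<leftarrow>ps. Dq y x b r * k)"
        by (simp add: p)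
      then show ?case
        unfolding 1 2 3 IH[symmetric] by (simp add: algebra_simps)
    qed
    then show "Dq y (comb E ?qs) b r = (\<Sum>(x, k)\<leftarrow>ps. Dq y x b r * k)"
      unfolding one using cl[OF ps] u w0 by (simp add: Dq_def ip_lact_sub_right)
  qed
qed

lemma unit_bimod_simps [simp]:
  "mcarrier (unit_bimod E \<omega>) = U"
  "madd (unit_bimod E \<omega>) x y = lbox E [(1, x), (1, y), (- 1, \<omega>)]"
  "mzero (unit_bimod E \<omega>) = \<omega>"
  "mlact (unit_bimod E \<omega>) b x = lbox E [(b, x), (1 - b, \<omega>)]"
  "mract (unit_bimod E \<omega>) x b = rbox E [(x, b), (\<omega>, 1 - b)]"
  "mip (unit_bimod E \<omega>) x y = D x y 1"
  by (simp_all add: unit_bimod_def D_def)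

text \<open>\<open>D\<close> vanishes when its second argument is \<omega>, so the correcting
  multiples of \<omega> in the sum and in both actions contribute nothing; the laws are then laws of
  coefficients in \<open>D\<close>.\<close>

theorem unit_semi_bimod: "semi_bimod (unit_bimod E \<omega>)"
proof
  have lact: "D z (lbox E [(a, x), (1 - a, \<omega>)]) b = D z x (b * a)" if "z \<in> U" "x \<in> U" for z x a b
    using D_lbox(2)[of "[(a, x), (1 - a, \<omega>)]" z b] that by (simp add: D_zero)
  have lactU: "lbox E [(a, x), (1 - a, \<omega>)] \<in> U" if "x \<in> U" for x a
    using D_lbox(1)[of "[(a, x), (1 - a, \<omega>)]" \<omega>] that by simp
  fix x y z :: "real \<Rightarrow> 'e" and a b :: 'b and c
  assume x: "x \<in> mcarrier (unit_bimod E \<omega>)"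
  show "mlact (unit_bimod E \<omega>) b x \<in> mcarrier (unit_bimod E \<omega>)"
    using x lactU by simp
  show "mract (unit_bimod E \<omega>) x b \<in> mcarrier (unit_bimod E \<omega>)"
    using D_rbox(1)[of "[(x, b), (\<omega>, 1 - b)]" \<omega>] x by simp
  show "mip (unit_bimod E \<omega>) x (mzero (unit_bimod E \<omega>)) = 0"
    using x by (simp add: D_zero)
  show "positive (mip (unit_bimod E \<omega>) x x)"
    using x by (simp add: D_positive)
  assume y: "y \<in> mcarrier (unit_bimod E \<omega>)"
  show "madd (unit_bimod E \<omega>) x y \<in> mcarrier (unit_bimod E \<omega>)"
    using D_lbox(1)[of "[(1, x), (1, y), (- 1, \<omega>)]" \<omega>] x y by simp
  show "mip (unit_bimod E \<omega>) x (mract (unit_bimod E \<omega>) y b) = mip (unit_bimod E \<omega>) x y * b"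
    using D_rbox(2)[of "[(y, b), (\<omega>, 1 - b)]" x 1] x y by (simp add: D_zero)
  show "star (mip (unit_bimod E \<omega>) x y) = mip (unit_bimod E \<omega>) y x"
    using x y by (simp add: D_star)
  show "mip (unit_bimod E \<omega>) (mlact (unit_bimod E \<omega>) b x) y
      = mip (unit_bimod E \<omega>) x (mlact (unit_bimod E \<omega>) (star b) y)"
  proof -
    have "D (lbox E [(b, x), (1 - b, \<omega>)]) y 1 = star (D y (lbox E [(b, x), (1 - b, \<omega>)]) 1)"
      using D_star[of y "lbox E [(b, x), (1 - b, \<omega>)]" 1] x y lactU by simp
    also have "\<dots> = D x y (star b)" using x y by (simp add: lact D_star)
    finally show ?thesis using x y by (simp add: lact)
  qed
  show "mip (unit_bimod E \<omega>) x (mlact (unit_bimod E \<omega>) (a + b) y)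
      = mip (unit_bimod E \<omega>) x (mlact (unit_bimod E \<omega>) a y) + mip (unit_bimod E \<omega>) x (mlact (unit_bimod E \<omega>) b y)"
    using x y by (simp add: lact D_bilinear)
  show "mip (unit_bimod E \<omega>) x (mlact (unit_bimod E \<omega>) (a * b) y)
      = mip (unit_bimod E \<omega>) x (mlact (unit_bimod E \<omega>) a (mlact (unit_bimod E \<omega>) b y))"
    using x y lactU by (simp add: lact)
  show "mip (unit_bimod E \<omega>) x (mlact (unit_bimod E \<omega>) 1 y) = mip (unit_bimod E \<omega>) x y"
    using x y lact[of x y 1 1] by simp
  show "mip (unit_bimod E \<omega>) x (mlact (unit_bimod E \<omega>) (scaleC c 1) y) = mip (unit_bimod E \<omega>) x y * scaleC c 1"
    using x y by (simp add: lact D_scaleC)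
  assume z: "z \<in> mcarrier (unit_bimod E \<omega>)"
  show "mip (unit_bimod E \<omega>) x (madd (unit_bimod E \<omega>) y z) = mip (unit_bimod E \<omega>) x y + mip (unit_bimod E \<omega>) x z"
    using D_lbox(2)[of "[(1, y), (1, z), (- 1, \<omega>)]" x 1] x y z by (simp add: D_zero)
qed simp

end

section \<open>Adjoints and operator norms\<close>

lemma right_linear_zero:
  assumes "pre_hilbert_bimod M" "pre_hilbert_bimod N" "right_linear M N T"
  shows "T (mzero M) = mzero N"
proof -
  interpret M: pre_hilbert_bimod M by fact
  interpret N: pre_hilbert_bimod N by fact
  have T: "T (mzero M) \<in> mcarrier N" "T (mract M (mzero M) 0) = mract N (T (mzero M)) 0"
    using assms(3) M.zero_closed unfolding right_linear_def by blast+
  have "mract M (mzero M) 0 = mzero M"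
    by (intro M.ip_ext) (auto simp: M.ip_ract_right M.ip_zero_right)
  moreover have "mract N (T (mzero M)) 0 = mzero N"
    using T by (intro N.ip_ext) (auto simp: N.ip_ract_right N.ip_zero_right)
  ultimately show ?thesis using T by simp
qed

text \<open>The vector is normalised by right multiplication with the real multiple 1 / n of the
  unit, since scalars act through the algebra. Boundedness makes the supremum an upper
  bound.\<close>

lemma mopnorm_bound:
  assumes "semi_bimod M" "semi_bimod N" and T: "right_linear M N T" "bounded_map M N T" and x: "x \<in> mcarrier M"
  shows "mnorm N (T x) \<le> mopnorm M N T * mnorm M x"
proof -
  interpret M: semi_bimod M by fact
  interpret N: semi_bimod N by fact
  obtain C where C: "\<And>x. x \<in> mcarrier M \<Longrightarrow> mnorm N (T x) \<le> C * mnorm M x"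
    using T(2) unfolding bounded_map_def by blast
  show ?thesis
  proof (cases "mnorm M x = 0")
    case True
    then show ?thesis using C[OF x] by simp
  next
    case False
    define n where "n = mnorm M x"
    have n: "0 < n" using False unfolding n_def by (simp add: order_less_le)
    define b where "b = (1 / n) *\<^sub>R (1::'a)"
    have y: "mract M x b \<in> mcarrier M" using x by simp
    have "mnorm M (mract M x b) \<le> n * norm b" using M.mnorm_ract_le[OF x] unfolding n_def .
    also have "norm b \<le> 1 / n"
      unfolding b_def using norm_one_cstar_le[where 'b = 'a] n by (simp add: divide_right_mono)
    then have "n * norm b \<le> 1" using n by (simp add: field_simps)
    finally have y1: "mnorm M (mract M x b) \<le> 1" .
    have Tx: "T x \<in> mcarrier N" and Ty: "T (mract M x b) = mract N (T x) b"
      using T(1) x unfolding right_linear_def by auto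
    have "mip N (mract N (T x) b) (mract N (T x) b) = ((1 / n) * (1 / n)) *\<^sub>R mip N (T x) (T x)"
      using Tx by (simp add: N.ip_simps b_def star_scaleR)
    then have "norm (mip N (mract N (T x) b) (mract N (T x) b)) = (1 / n)\<^sup>2 * norm (mip N (T x) (T x))"
      by (simp add: power2_eq_square)
    then have nTy: "mnorm N (T (mract M x b)) = mnorm N (T x) / n"
      unfolding Ty mnorm_def using n by (simp add: real_sqrt_mult)
    have "mnorm N (T (mract M x b)) \<le> mopnorm M N T"
      unfolding mopnorm_def
    proof (rule cSup_upper)
      show "mnorm N (T (mract M x b)) \<in> {mnorm N (T x) |x. x \<in> mcarrier M \<and> mnorm M x \<le> 1}"
        using y y1 by blast
      show "bdd_above {mnorm N (T x) |x. x \<in> mcarrier M \<and> mnorm M x \<le> 1}"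
      proof (rule bdd_aboveI[of _ "\<bar>C\<bar>"])
        fix s assume "s \<in> {mnorm N (T x) |x. x \<in> mcarrier M \<and> mnorm M x \<le> 1}"
        then obtain x where "x \<in> mcarrier M" "mnorm M x \<le> 1" "s = mnorm N (T x)" by blast
        then have "s \<le> C * mnorm M x" "C * mnorm M x \<le> \<bar>C\<bar> * mnorm M x" "\<bar>C\<bar> * mnorm M x \<le> \<bar>C\<bar>"
          using C by (auto intro!: mult_right_mono mult_left_le)
        then show "s \<le> \<bar>C\<bar>" by simp
      qed
    qed
    then show ?thesis unfolding nTy n_def[symmetric] using n by (simp add: pos_divide_le_eq)
  qed
qed

locale adjointable_bimod_map = M: pre_hilbert_bimod M + N: pre_hilbert_bimod N
  for M :: "('b::unital_cstar_algebra, 'm) bimod" and N :: "('b, 'n) bimod" +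
  fixes T :: "'m \<Rightarrow> 'n"
  assumes linear: "bimod_linear M N T" and adjointable: "adjointable M N T"
begin

abbreviation "T' \<equiv> madjoint M N T"

lemma closed: "x \<in> mcarrier M \<Longrightarrow> T x \<in> mcarrier N"
  using linear unfolding bimod_linear_def right_linear_def by blast

lemma adjoint_closed [simp]: "y \<in> mcarrier N \<Longrightarrow> T' y \<in> mcarrier M"
  and adjoint: "x \<in> mcarrier M \<Longrightarrow> y \<in> mcarrier N \<Longrightarrow> mip N (T x) y = mip M x (T' y)"
proof -
  have ex: "\<exists>!z. z \<in> mcarrier M \<and> (\<forall>x\<in>mcarrier M. mip N (T x) y = mip M x z)" if y: "y \<in> mcarrier N" for y
  proof -
    obtain S where S: "S \<in> mcarrier N \<rightarrow> mcarrier M"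
      "\<And>x y. x \<in> mcarrier M \<Longrightarrow> y \<in> mcarrier N \<Longrightarrow> mip N (T x) y = mip M x (S y)"
      using adjointable unfolding adjointable_def by blast
    show ?thesis
    proof (rule ex1I[of _ "S y"])
      show "S y \<in> mcarrier M \<and> (\<forall>x\<in>mcarrier M. mip N (T x) y = mip M x (S y))"
        using S y by auto
      fix z assume "z \<in> mcarrier M \<and> (\<forall>x\<in>mcarrier M. mip N (T x) y = mip M x z)"
      then show "z = S y" using S y by (intro M.ip_ext) auto
    qed
  qed
  have "T' y \<in> mcarrier M \<and> (\<forall>x\<in>mcarrier M. mip N (T x) y = mip M x (T' y))" if "y \<in> mcarrier N" for y
    unfolding madjoint_def by (rule theI'[OF ex[OF that]])
  then show "y \<in> mcarrier N \<Longrightarrow> T' y \<in> mcarrier M"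
    "x \<in> mcarrier M \<Longrightarrow> y \<in> mcarrier N \<Longrightarrow> mip N (T x) y = mip M x (T' y)"
    by auto
qed

lemma lact: "x \<in> mcarrier M \<Longrightarrow> T (mlact M b x) = mlact N b (T x)"
  using linear unfolding bimod_linear_def by blast

lemma adjoint_linear: "bimod_linear N M T'"
  unfolding bimod_linear_def right_linear_def
proof (intro conjI ballI allI)
  fix x y b assume x: "x \<in> mcarrier N"
  show "T' (mract N x b) = mract M (T' x) b"
    using x by (intro M.ip_ext) (auto simp: adjoint[symmetric] N.ip_ract_right M.ip_ract_right closed)
  show "T' (mlact N b x) = mlact M b (T' x)"
  proof (rule M.ip_ext)
    fix z assume z: "z \<in> mcarrier M"
    have "mip M z (T' (mlact N b x)) = mip N (T (mlact M (star b) z)) x"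
      using x z by (simp add: adjoint[symmetric] N.ip_lact_right closed lact)
    also have "\<dots> = mip M z (mlact M b (T' x))"
      using x z by (simp add: adjoint M.ip_lact_right)
    finally show "mip M z (T' (mlact N b x)) = mip M z (mlact M b (T' x))" .
  qed (use x in auto)
  assume y: "y \<in> mcarrier N"
  show "T' (madd N x y) = madd M (T' x) (T' y)"
    using x y by (intro M.ip_ext) (auto simp: adjoint[symmetric] N.ip_add_right M.ip_add_right closed)
qed auto

text \<open>The squared norm of T' y is the norm of <T (T' y), y>; Cauchy-Schwarz and cancellation
  finish.\<close>

lemma adjoint_bound:
  assumes C: "0 \<le> C" "\<And>x. x \<in> mcarrier M \<Longrightarrow> mnorm N (T x) \<le> C * mnorm M x" and y: "y \<in> mcarrier N"
  shows "mnorm M (T' y) \<le> C * mnorm N y"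
proof (cases "mnorm M (T' y) = 0")
  case True
  then show ?thesis using C by simp
next
  case False
  then have pos: "0 < mnorm M (T' y)" by (simp add: order_less_le)
  have "mnorm M (T' y) * mnorm M (T' y) = norm (mip N (T (T' y)) y)"
    using y by (simp add: M.mnorm_mult_self adjoint)
  also have "\<dots> \<le> mnorm N (T (T' y)) * mnorm N y"
    using y by (intro N.Cauchy_Schwarz closed) auto
  also have "\<dots> \<le> (C * mnorm M (T' y)) * mnorm N y"
    using y by (intro mult_right_mono C) auto
  finally show ?thesis using pos by (simp add: mult_ac)
qed

end

section \<open>Morphisms of product systems\<close>

text \<open>Collects what a morphism and its family of adjoints have in common, so that both can be
  applied to units and to limits of tensor powers.\<close>

locale bounded_morphism = E: product_system E + F: product_system F
  for E :: "('b::unital_cstar_algebra, 'e, 'z) psys_scheme" and F :: "('b, 'f, 'y) psys_scheme" +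
  fixes \<theta> :: "real \<Rightarrow> 'e \<Rightarrow> 'f" and C :: real
  assumes linear: "0 \<le> t \<Longrightarrow> bimod_linear (fib E t) (fib F t) (\<theta> t)"
    and mult: "0 \<le> t \<Longrightarrow> 0 \<le> s \<Longrightarrow> x \<in> mcarrier (fib E t) \<Longrightarrow> y \<in> mcarrier (fib E s) \<Longrightarrow>
      \<theta> (t + s) (ptens E t s x y) = ptens F t s (\<theta> t x) (\<theta> s y)"
    and one: "\<theta> 0 (alg_iso E 1) = alg_iso F 1"
    and bounded: "0 \<le> t \<Longrightarrow> bounded_map (fib E t) (fib F t) (\<theta> t)"
    and C_nonneg: "0 \<le> C"
    and bound_near_zero: "\<exists>d>0. \<forall>t x. 0 < t \<and> t < d \<and> x \<in> mcarrier (fib E t) \<longrightarrow>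
      mnorm (fib F t) (\<theta> t x) \<le> C * mnorm (fib E t) x"
begin

abbreviation "\<Theta> \<equiv> family_map \<theta>"

lemma closed: "0 \<le> t \<Longrightarrow> x \<in> mcarrier (fib E t) \<Longrightarrow> \<theta> t x \<in> mcarrier (fib F t)"
  and add: "0 \<le> t \<Longrightarrow> x \<in> mcarrier (fib E t) \<Longrightarrow> y \<in> mcarrier (fib E t) \<Longrightarrow>
    \<theta> t (madd (fib E t) x y) = madd (fib F t) (\<theta> t x) (\<theta> t y)"
  and ract: "0 \<le> t \<Longrightarrow> x \<in> mcarrier (fib E t) \<Longrightarrow> \<theta> t (mract (fib E t) x b) = mract (fib F t) (\<theta> t x) b"
  and lact: "0 \<le> t \<Longrightarrow> x \<in> mcarrier (fib E t) \<Longrightarrow> \<theta> t (mlact (fib E t) b x) = mlact (fib F t) b (\<theta> t x)"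
  using linear[of t] unfolding bimod_linear_def right_linear_def by auto

lemma zero: "0 \<le> t \<Longrightarrow> \<theta> t (mzero (fib E t)) = mzero (fib F t)"
  using linear[of t] unfolding bimod_linear_def by (intro right_linear_zero E.fib_pre_hilbert F.fib_pre_hilbert) auto

lemma sub: "0 \<le> t \<Longrightarrow> x \<in> mcarrier (fib E t) \<Longrightarrow> y \<in> mcarrier (fib E t) \<Longrightarrow>
    \<theta> t (msub (fib E t) x y) = msub (fib F t) (\<theta> t x) (\<theta> t y)"
  using semi_bimod.lact_closed[OF E.fib_semi] by (simp add: msub_def add lact)

lemma family_apply: "0 \<le> t \<Longrightarrow> \<Theta> x t = \<theta> t (x t)"
  by (simp add: family_map_def)

lemma family_unit:
  assumes u: "is_unit E u"
  shows "is_unit F (\<Theta> u)"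
  unfolding is_unit_def
proof (intro conjI allI impI)
  show "\<Theta> u \<in> (\<Pi>\<^sub>E t\<in>{0..}. mcarrier (fib F t))"
    using E.unitD(1)[OF u] unfolding family_map_def by (auto simp: closed)
  show "\<Theta> u 0 = alg_iso F 1"
    using E.unitD(2)[OF u] by (simp add: family_apply one)
  show "ptens F t s (\<Theta> u t) (\<Theta> u s) = \<Theta> u (t + s)" if "0 \<le> t" "0 \<le> s" for t s
    using that E.unitD[OF u] mult[of t s "u t" "u s"] by (simp add: family_apply)
qed

lemma family_close:
  assumes u: "E.is_section u" and v: "E.is_section v" and close: "E.close u v"
  shows "F.close (\<Theta> u) (\<Theta> v)"
  unfolding F.close_def
proof (rule Lim_null_comparison)
  obtain d where d: "0 < d" "\<And>t x. 0 < t \<Longrightarrow> t < d \<Longrightarrow> x \<in> mcarrier (fib E t) \<Longrightarrow>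
      mnorm (fib F t) (\<theta> t x) \<le> C * mnorm (fib E t) x"
    using bound_near_zero by blast
  have "norm (mdist (fib F r) (\<Theta> u r) (\<Theta> v r)) \<le> C * mdist (fib E r) (u r) (v r)" if r: "0 < r" "r < d" for r
  proof -
    interpret Er: semi_bimod "fib E r" using r by (intro E.fib_semi) simp
    interpret Fr: semi_bimod "fib F r" using r by (intro F.fib_semi) simp
    have "u r \<in> mcarrier (fib E r)" "v r \<in> mcarrier (fib E r)"
      using u v r unfolding E.is_section_def by auto
    then show ?thesis
      using d(2)[OF r, of "msub (fib E r) (u r) (v r)"] r by (simp add: mdist_def family_apply sub)
  qed
  then show "\<forall>\<^sub>F r in at 0 within {0..}. norm (mdist (fib F r) (\<Theta> u r) (\<Theta> v r)) \<le> C * mdist (fib E r) (u r) (v r)"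
    unfolding eventually_at using d(1) by (intro exI[of _ d]) auto
  show "((\<lambda>r. C * mdist (fib E r) (u r) (v r)) \<longlongrightarrow> 0) (at 0 within {0..})"
    using tendsto_mult[OF tendsto_const close[unfolded E.close_def], of C] by simp
qed

lemma family_comb:
  assumes "\<forall>(k, x, l)\<in>set ps. E.is_section x" "0 \<le> r"
  shows "\<theta> r (comb E ps r) = comb F (map (\<lambda>(k, x, l). (k, \<Theta> x, l)) ps) r"
  using assms(1)
proof (induction ps)
  case Nil
  then show ?case using assms(2) by (simp add: zero)
next
  case (Cons p ps)
  obtain k x l where p: "p = (k, x, l)" by (cases p)
  interpret semi_bimod "fib E r" using assms(2) by (rule E.fib_semi)
  have "E.is_section (comb E ps)" using Cons.prems by (intro E.comb_section) simp
  then show ?case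
    using Cons assms(2) by (simp add: p E.is_section_def add ract lact family_apply)
qed

lemma family_tpow:
  assumes "0 \<le> s" "x \<in> mcarrier (fib E s)"
  shows "\<theta> (real m * s) (tpow E s x m) = tpow F s (\<theta> s x) m \<and> tpow E s x m \<in> mcarrier (fib E (real m * s))"
proof (induction m)
  case 0
  then show ?case by (simp add: one)
next
  case (Suc m)
  have "real (Suc m) * s = real m * s + s" by (simp add: algebra_simps)
  then show ?case
    using Suc assms mult[of "real m * s" s "tpow E s x m" x] E.ptens_closed[of "real m * s" s "tpow E s x m" x]
    by simp
qed

text \<open>At fixed t the map \<open>\<theta> t\<close> is bounded and so commutes with the norm
  limit; by multiplicativity it acts on tensor powers factor by factor.\<close>

lemma family_trotter:
  assumes z: "E.is_section z"
    and lim: "\<And>t. 0 \<le> t \<Longrightarrow> mconv (fib E t) (\<lambda>m. tpow E (t / real m) (z (t / real m)) m) (trotter_limit E z t)"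
  shows "\<Theta> (trotter_limit E z) = trotter_limit F (\<lambda>r. \<theta> r (z r))"
proof -
  have "\<theta> t (trotter_limit E z t) = mlim (fib F t) (\<lambda>m. tpow F (t / real m) (\<theta> (t / real m) (z (t / real m))) m)"
    if t: "0 \<le> t" for t
  proof -
    interpret Et: semi_bimod "fib E t" using t by (rule E.fib_semi)
    interpret Ft: pre_hilbert_bimod "fib F t" using t by (rule F.fib_pre_hilbert)
    let ?s = "\<lambda>m. tpow E (t / real m) (z (t / real m)) m"
    let ?r = "\<lambda>m. tpow F (t / real m) (\<theta> (t / real m) (z (t / real m))) m"
    obtain K where K: "\<And>x. x \<in> mcarrier (fib E t) \<Longrightarrow> mnorm (fib F t) (\<theta> t x) \<le> K * mnorm (fib E t) x"
      using bounded[OF t] unfolding bounded_map_def by blast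
    have l: "trotter_limit E z t \<in> mcarrier (fib E t)" using lim[OF t] unfolding mconv_def by blast
    have m: "?r m = \<theta> t (?s m)" "?s m \<in> mcarrier (fib E t)" if "m \<ge> 1" for m
    proof -
      have "z (t / real m) \<in> mcarrier (fib E (t / real m))" using z t unfolding E.is_section_def by simp
      then show "?r m = \<theta> t (?s m)" "?s m \<in> mcarrier (fib E t)"
        using family_tpow[of "t / real m" "z (t / real m)" m] that t by auto
    qed
    have "(\<lambda>m. mdist (fib F t) (?r m) (\<theta> t (trotter_limit E z t))) \<longlonglongrightarrow> 0"
    proof (rule Lim_null_comparison)
      show "\<forall>\<^sub>F m in sequentially. norm (mdist (fib F t) (?r m) (\<theta> t (trotter_limit E z t)))
          \<le> K * mdist (fib E t) (?s m) (trotter_limit E z t)"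
        unfolding eventually_sequentially
      proof (intro exI[of _ 1] allI impI)
        fix k :: nat assume k: "1 \<le> k"
        show "norm (mdist (fib F t) (?r k) (\<theta> t (trotter_limit E z t)))
            \<le> K * mdist (fib E t) (?s k) (trotter_limit E z t)"
          using K[of "msub (fib E t) (?s k) (trotter_limit E z t)"] m[OF k] l t by (simp add: mdist_def sub)
      qed
      show "(\<lambda>m. K * mdist (fib E t) (?s m) (trotter_limit E z t)) \<longlonglongrightarrow> 0"
        using tendsto_mult[OF tendsto_const, of _ 0 sequentially K] lim[OF t] unfolding mconv_def by simp
    qed
    then have "mconv (fib F t) ?r (\<theta> t (trotter_limit E z t))"
      unfolding mconv_def using closed[OF t l] by blast
    then have "mlim (fib F t) ?r = \<theta> t (trotter_limit E z t)"
      using m closed[OF t] by (intro Ft.mlim_eqI[of 1]) auto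
    then show ?thesis by simp
  qed
  then show ?thesis
    unfolding family_map_def by (subst (2) trotter_limit_def) (intro restrict_ext, simp)
qed

end

locale based_morphism = bounded_morphism E F \<theta> C
  for E :: "('b::unital_cstar_algebra, 'e, 'z) psys_scheme" and F :: "('b, 'f, 'y) psys_scheme" and \<theta> C +
  fixes \<omega> :: "real \<Rightarrow> 'e"
  assumes base: "continuous_units E {\<omega>}" and base': "continuous_units F {family_map \<theta> \<omega>}"
begin

sublocale E: based_product_system E \<omega>
  by unfold_locales (rule base)

sublocale F: based_product_system F "family_map \<theta> \<omega>"
  by unfold_locales (rule base')

sublocale EU: semi_bimod "unit_bimod E \<omega>" by (rule E.unit_semi_bimod)

sublocale FU: semi_bimod "unit_bimod F (family_map \<theta> \<omega>)" by (rule F.unit_semi_bimod)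

lemma family_U: "x \<in> E.U \<Longrightarrow> \<Theta> x \<in> F.U"
  unfolding F.U_iff using E.U_iff[of x] E.U_section[of x] E.U_section[OF E.base_U]
  by (auto intro: family_unit family_close)

lemma family_trotter_comb:
  assumes ps: "\<forall>(k, x, l)\<in>set ps. x \<in> E.U" and one: "weight ps = 1"
  shows "\<Theta> (trotter_limit E (comb E ps)) = trotter_limit F (comb F (map (\<lambda>(k, x, l). (k, \<Theta> x, l)) ps))"
proof -
  have "\<Theta> (trotter_limit E (comb E ps)) = trotter_limit F (\<lambda>r. \<theta> r (comb E ps r))"
    by (intro family_trotter E.trotter_comb[OF ps one])
  also have "\<dots> = trotter_limit F (comb F (map (\<lambda>(k, x, l). (k, \<Theta> x, l)) ps))"
    using ps E.U_section by (intro trotter_limit_cong family_comb) auto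
  finally show ?thesis .
qed

lemma family_lbox:
  assumes ps: "\<forall>(k, x)\<in>set ps. x \<in> E.U" and one: "(\<Sum>(k, x)\<leftarrow>ps. k) = 1"
  shows "\<Theta> (lbox E ps) = lbox F (map (\<lambda>(k, x). (k, \<Theta> x)) ps)"
proof -
  let ?qs = "map (\<lambda>(k, x). (k, \<Theta> x)) ps"
  have qs: "\<forall>(k, x)\<in>set ?qs. x \<in> F.U" "(\<Sum>(k, x)\<leftarrow>?qs. k) = 1"
    using ps one family_U by (auto simp: case_prod_unfold comp_def)
  have "\<Theta> (lbox E ps) = \<Theta> (trotter_limit E (comb E (map (\<lambda>(k, x). (k, x, 1)) ps)))"
    using E.D_lbox(3)[OF ps one E.base_U] by simp
  also have "\<dots> = trotter_limit F (comb F (map (\<lambda>(k, x, l). (k, \<Theta> x, l)) (map (\<lambda>(k, x). (k, x, 1)) ps)))"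
    using ps one by (intro family_trotter_comb) (auto simp: case_prod_unfold comp_def)
  also have "\<dots> = lbox F ?qs"
    using F.D_lbox(3)[OF qs F.base_U] by (simp add: case_prod_unfold comp_def)
  finally show ?thesis .
qed

lemma family_rbox:
  assumes ps: "\<forall>(x, k)\<in>set ps. x \<in> E.U" and one: "(\<Sum>(x, k)\<leftarrow>ps. k) = 1"
  shows "\<Theta> (rbox E ps) = rbox F (map (\<lambda>(x, k). (\<Theta> x, k)) ps)"
proof -
  let ?qs = "map (\<lambda>(x, k). (\<Theta> x, k)) ps"
  have qs: "\<forall>(x, k)\<in>set ?qs. x \<in> F.U" "(\<Sum>(x, k)\<leftarrow>?qs. k) = 1"
    using ps one family_U by (auto simp: case_prod_unfold comp_def)
  have "\<Theta> (rbox E ps) = \<Theta> (trotter_limit E (comb E (map (\<lambda>(x, k). (1, x, k)) ps)))"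
    using E.D_rbox(3)[OF ps one E.base_U] by simp
  also have "\<dots> = trotter_limit F (comb F (map (\<lambda>(k, x, l). (k, \<Theta> x, l)) (map (\<lambda>(x, k). (1, x, k)) ps)))"
    using ps one by (intro family_trotter_comb) (auto simp: case_prod_unfold comp_def)
  also have "\<dots> = rbox F ?qs"
    using F.D_rbox(3)[OF qs F.base_U] by (simp add: case_prod_unfold comp_def)
  finally show ?thesis .
qed

lemma family_linear: "bimod_linear (unit_bimod E \<omega>) (unit_bimod F (family_map \<theta> \<omega>)) \<Theta>"
  unfolding bimod_linear_def right_linear_def
  by (auto simp: family_U family_lbox family_rbox)

text \<open>The bound C for the fibre maps near 0 passes, squared, to the difference quotients of
  the inner products and so to their limits.\<close>

lemma family_norm:
  assumes x: "x \<in> E.U"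
  shows "mnorm (unit_bimod F (family_map \<theta> \<omega>)) (\<Theta> x) \<le> C * mnorm (unit_bimod E \<omega>) x"
proof -
  have "norm (F.D (\<Theta> x) (\<Theta> x) 1) \<le> C\<^sup>2 * norm (E.D x x 1)"
  proof (rule tendsto_le)
    show "((\<lambda>r. norm (F.Dq (\<Theta> x) (\<Theta> x) 1 r)) \<longlongrightarrow> norm (F.D (\<Theta> x) (\<Theta> x) 1)) (at_right 0)"
      by (intro tendsto_intros F.D_tendsto family_U x)
    show "((\<lambda>r. C\<^sup>2 * norm (E.Dq x x 1 r)) \<longlongrightarrow> C\<^sup>2 * norm (E.D x x 1)) (at_right 0)"
      by (intro tendsto_intros E.D_tendsto x)
    obtain d where d: "0 < d" "\<And>t x. 0 < t \<Longrightarrow> t < d \<Longrightarrow> x \<in> mcarrier (fib E t) \<Longrightarrow>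
        mnorm (fib F t) (\<theta> t x) \<le> C * mnorm (fib E t) x"
      using bound_near_zero by blast
    have "norm (F.Dq (\<Theta> x) (\<Theta> x) 1 r) \<le> C\<^sup>2 * norm (E.Dq x x 1 r)" if r: "0 < r" "r < d" for r
    proof -
      interpret Er: semi_bimod "fib E r" using r by (intro E.fib_semi) simp
      interpret Fr: semi_bimod "fib F r" using r by (intro F.fib_semi) simp
      let ?u = "msub (fib E r) (x r) (\<omega> r)"
      have c: "x r \<in> mcarrier (fib E r)" "\<omega> r \<in> mcarrier (fib E r)"
        using E.U_closed[OF x] E.U_closed[OF E.base_U] r by auto
      have "(mnorm (fib F r) (\<theta> r ?u))\<^sup>2 \<le> (C * mnorm (fib E r) ?u)\<^sup>2"
        using d(2)[OF r] c by (intro power_mono) auto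
      then have "norm (mip (fib F r) (\<theta> r ?u) (\<theta> r ?u)) \<le> C\<^sup>2 * norm (mip (fib E r) ?u ?u)"
        by (simp add: Fr.mnorm_square Er.mnorm_square power_mult_distrib)
      then show ?thesis
        unfolding F.Dq_def E.Dq_def using r c closed
        by (simp add: family_apply sub[symmetric] Fr.ip_lact_one Er.ip_lact_one divide_right_mono)
    qed
    then show "\<forall>\<^sub>F r in at_right 0. norm (F.Dq (\<Theta> x) (\<Theta> x) 1 r) \<le> C\<^sup>2 * norm (E.Dq x x 1 r)"
      unfolding eventually_at_right_field using d(1) by auto
  qed simp
  then show ?thesis
    using C_nonneg by (subst FU.mnorm_le_iff) (simp_all add: power_mult_distrib EU.mnorm_square)
qed

lemma family_lipschitz: "lipschitz_map (unit_bimod E \<omega>) (unit_bimod F (family_map \<theta> \<omega>)) \<Theta> C"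
proof
  fix x y assume x: "x \<in> mcarrier (unit_bimod E \<omega>)" and y: "y \<in> mcarrier (unit_bimod E \<omega>)"
  show "\<Theta> x \<in> mcarrier (unit_bimod F (\<Theta> \<omega>))" using x by (simp add: family_U)
  have "\<Theta> (msub (unit_bimod E \<omega>) x y) = msub (unit_bimod F (\<Theta> \<omega>)) (\<Theta> x) (\<Theta> y)"
    using family_linear x y EU.lact_closed[OF y, of "- 1"]
    unfolding bimod_linear_def right_linear_def msub_def by metis
  then show "mdist (unit_bimod F (\<Theta> \<omega>)) (\<Theta> x) (\<Theta> y) \<le> C * mdist (unit_bimod E \<omega>) x y"
    using family_norm[of "msub (unit_bimod E \<omega>) x y"] EU.sub_closed[OF x y] unfolding mdist_def by simp
qed (rule C_nonneg)

end

section \<open>Continuous product systems\<close>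

text \<open>For w = g y - g y' adjointness gives <w, w> = <f w, y - y'>; Cauchy-Schwarz and
  cancellation of the norm of w yield the constant of f.\<close>

lemma lipschitz_map_adjoint:
  assumes "lipschitz_map M N f C"
    and f: "\<And>x. x \<in> mcarrier M \<Longrightarrow> mnorm N (f x) \<le> C * mnorm M x"
    and g: "\<And>y. y \<in> mcarrier N \<Longrightarrow> g y \<in> mcarrier M"
    and adj: "\<And>x y. x \<in> mcarrier M \<Longrightarrow> y \<in> mcarrier N \<Longrightarrow> mip N (f x) y = mip M x (g y)"
  shows "lipschitz_map N M g C"
proof -
  interpret f: lipschitz_map M N f C by fact
  show ?thesis
  proof
    fix y y' assume y: "y \<in> mcarrier N" and y': "y' \<in> mcarrier N"
    let ?w = "msub M (g y) (g y')"
    have w: "?w \<in> mcarrier M" using y y' g by simp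
    have "mip M ?w ?w = mip M ?w (g y) - mip M ?w (g y')"
      using w g[OF y] g[OF y'] by (rule f.M.ip_sub_right)
    also have "\<dots> = mip N (f ?w) (msub N y y')"
      using w y y' by (simp only: adj[symmetric] f.N.ip_sub_right f.closed)
    finally have "mnorm M ?w * mnorm M ?w = norm (mip N (f ?w) (msub N y y'))"
      by (simp add: f.M.mnorm_mult_self)
    also have "\<dots> \<le> mnorm N (f ?w) * mdist N y y'"
      unfolding mdist_def using w y y' by (intro f.N.Cauchy_Schwarz) auto
    also have "\<dots> \<le> (C * mnorm M ?w) * mdist N y y'"
      using w by (intro mult_right_mono f) auto
    finally have *: "mnorm M ?w * mnorm M ?w \<le> mnorm M ?w * (C * mdist N y y')" by (simp add: mult_ac)
    show "mdist M (g y) (g y') \<le> C * mdist N y y'"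
    proof (cases "mnorm M ?w = 0")
      case True
      then show ?thesis using f.C_nonneg unfolding mdist_def by simp
    next
      case False
      then have "0 < mnorm M ?w" by (simp add: order_less_le)
      then show ?thesis using * unfolding mdist_def by simp
    qed
  qed (use g f.C_nonneg in auto)
qed

lemma (in product_system) close_trans:
  assumes "is_section u" "is_section v" "is_section w" "close u v" "close v w"
  shows "close u w"
  unfolding close_def
proof (rule Lim_null_comparison)
  have le: "norm (mdist (fib E r) (u r) (w r)) \<le> mdist (fib E r) (u r) (v r) + mdist (fib E r) (v r) (w r)"
    if r: "0 \<le> r" for r
  proof -
    interpret semi_bimod "fib E r" using r by (rule fib_semi)
    show ?thesis using mdist_triangle[of "u r" "v r" "w r"] assms r unfolding is_section_def by simp
  qed
  show "\<forall>\<^sub>F r in at 0 within {0..}. norm (mdist (fib E r) (u r) (w r))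
      \<le> mdist (fib E r) (u r) (v r) + mdist (fib E r) (v r) (w r)"
    by (rule eventually_mono[OF eventually_nonneg le])
  show "((\<lambda>r. mdist (fib E r) (u r) (v r) + mdist (fib E r) (v r) (w r)) \<longlongrightarrow> 0) (at 0 within {0..})"
    using tendsto_add[OF assms(4,5)[unfolded close_def]] by simp
qed

lemma (in based_product_system) D_minus: "D x y (- b) = - D x y b"
  by (simp add: D_def blinfun.minus_right)

text \<open>On a single fibre the embedding is isometric, so the distance can be measured in the
  ambient module, where both curves start at the same point and are continuous.\<close>

lemma (in continuous_product_system) cont_sections_close:
  assumes x: "x \<in> cont_sections E" and y: "y \<in> cont_sections E" and eq: "x 0 = y 0"
  shows "close x y"
  unfolding close_def
proof (rule Lim_null_comparison)
  interpret A: semi_bimod "amb E" by (rule hilbert_semi_bimod[OF amb])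
  let ?i = "\<lambda>x t. emb E t (x t)"
  have emb_closed: "emb E t a \<in> mcarrier (amb E)" if "0 \<le> t" "a \<in> mcarrier (fib E t)" for t a
    using emb[OF that(1)] that(2) unfolding right_linear_def by blast
  have c: "x t \<in> mcarrier (fib E t)" "y t \<in> mcarrier (fib E t)" if "0 \<le> t" for t
    using x y that unfolding cont_sections_def by auto
  have le: "norm (mdist (fib E t) (x t) (y t))
      \<le> mdist (amb E) (?i x t) (?i x 0) + mdist (amb E) (?i y t) (?i y 0)" if t: "0 \<le> t" for t
  proof -
    interpret Ft: semi_bimod "fib E t" using t by (rule fib_semi)
    have "(mdist (fib E t) (x t) (y t))\<^sup>2 = (mdist (amb E) (?i x t) (?i y t))\<^sup>2"
      using emb[OF t] c[OF t] emb_closed[OF t] unfolding ip_preserving_def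
      by (simp add: Ft.mdist_square A.mdist_square)
    then have "mdist (fib E t) (x t) (y t) = mdist (amb E) (?i x t) (?i y t)"
      by (simp add: power2_eq_iff_nonneg)
    also have "\<dots> \<le> mdist (amb E) (?i x t) (?i x 0) + mdist (amb E) (?i x 0) (?i y t)"
      using c[OF t] c[of 0] t by (intro A.mdist_triangle emb_closed) auto
    also have "mdist (amb E) (?i x 0) (?i y t) = mdist (amb E) (?i y t) (?i y 0)"
      unfolding eq using c[OF t] c[of 0] t by (intro A.mdist_commute emb_closed) auto
    finally show ?thesis by simp
  qed
  show "\<forall>\<^sub>F t in at 0 within {0..}. norm (mdist (fib E t) (x t) (y t))
      \<le> mdist (amb E) (?i x t) (?i x 0) + mdist (amb E) (?i y t) (?i y 0)"
    by (rule eventually_mono[OF eventually_nonneg le])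
  have "((\<lambda>t. mdist (amb E) (?i u t) (?i u 0)) \<longlongrightarrow> 0) (at 0 within {0..})" if "u \<in> cont_sections E" for u
    using that unfolding cont_sections_def mcont_on_def by auto
  from tendsto_add[OF this[OF x] this[OF y]]
  show "((\<lambda>t. mdist (amb E) (?i x t) (?i x 0) + mdist (amb E) (?i y t) (?i y 0)) \<longlongrightarrow> 0) (at 0 within {0..})"
    by simp
qed

locale cps_map = E: continuous_product_system E + F: continuous_product_system F
  for E :: "('b::unital_cstar_algebra, 'e, 'h) cpsys" and F :: "('b, 'f, 'k) cpsys" +
  fixes \<theta> :: "real \<Rightarrow> 'e \<Rightarrow> 'f"
  assumes morphism: "cps_morphism E F \<theta>"
begin

abbreviation "\<theta>' t \<equiv> madjoint (fib E t) (fib F t) (\<theta> t)"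

lemma fibre_map: "0 \<le> t \<Longrightarrow> adjointable_bimod_map (fib E t) (fib F t) (\<theta> t)"
  using morphism E.fib_pre_hilbert F.fib_pre_hilbert unfolding cps_morphism_def bimod_morphism_def
  by (intro adjointable_bimod_map.intro adjointable_bimod_map_axioms.intro) auto

text \<open>A finite upper limit lies below some natural number, which then bounds the operator
  norms on an interval to the right of 0.\<close>

lemma bound_near_zero:
  "\<exists>C\<ge>0. \<exists>d>0. \<forall>t x. 0 < t \<and> t < d \<and> x \<in> mcarrier (fib E t) \<longrightarrow>
    mnorm (fib F t) (\<theta> t x) \<le> C * mnorm (fib E t) x"
proof -
  let ?f = "\<lambda>t. ereal (mopnorm (fib E t) (fib F t) (\<theta> t))"
  have "Limsup (at_right 0) ?f \<noteq> \<infinity>" using morphism unfolding cps_morphism_def by auto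
  then obtain n :: nat where "Limsup (at_right 0) ?f < ereal (real n)" using less_PInf_Ex_of_nat by blast
  then have "\<forall>\<^sub>F t in at_right 0. ?f t < ereal (real n)" by (rule Limsup_lessD)
  then obtain d where d: "0 < d" "\<And>t. 0 < t \<Longrightarrow> t < d \<Longrightarrow> mopnorm (fib E t) (fib F t) (\<theta> t) < real n"
    unfolding eventually_at_right_field by auto
  have "mnorm (fib F t) (\<theta> t x) \<le> real n * mnorm (fib E t) x" if t: "0 < t" "t < d" "x \<in> mcarrier (fib E t)" for t x
  proof -
    interpret semi_bimod "fib E t" using t by (intro E.fib_semi) simp
    have "mnorm (fib F t) (\<theta> t x) \<le> mopnorm (fib E t) (fib F t) (\<theta> t) * mnorm (fib E t) x"
      using t morphism E.fib_semi F.fib_semi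
      unfolding cps_morphism_def bimod_morphism_def bimod_linear_def by (intro mopnorm_bound) auto
    also have "\<dots> \<le> real n * mnorm (fib E t) x"
      using d(2)[OF t(1,2)] by (intro mult_right_mono) auto
    finally show ?thesis .
  qed
  with d(1) show ?thesis by (intro exI[of _ "real n"]) auto
qed

text \<open>Both sides have the same inner products with elementary tensors, and by
  \<open>ptens_ext\<close> these separate points.\<close>

lemma adjoint_mult:
  assumes ts: "0 \<le> t" "0 \<le> s" and x: "x \<in> mcarrier (fib F t)" and y: "y \<in> mcarrier (fib F s)"
  shows "\<theta>' (t + s) (ptens F t s x y) = ptens E t s (\<theta>' t x) (\<theta>' s y)"
proof -
  interpret T: adjointable_bimod_map "fib E t" "fib F t" "\<theta> t" using ts by (intro fibre_map)
  interpret S: adjointable_bimod_map "fib E s" "fib F s" "\<theta> s" using ts by (intro fibre_map)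
  interpret TS: adjointable_bimod_map "fib E (t + s)" "fib F (t + s)" "\<theta> (t + s)" using ts by (intro fibre_map) simp
  show ?thesis
  proof (rule E.ptens_ext[OF ts])
    fix u v assume u: "u \<in> mcarrier (fib E t)" and v: "v \<in> mcarrier (fib E s)"
    have "mip (fib E (t + s)) (ptens E t s u v) (\<theta>' (t + s) (ptens F t s x y))
        = mip (fib F (t + s)) (\<theta> (t + s) (ptens E t s u v)) (ptens F t s x y)"
      using ts u v x y by (intro TS.adjoint[symmetric]) auto
    also have "\<theta> (t + s) (ptens E t s u v) = ptens F t s (\<theta> t u) (\<theta> s v)"
      using morphism ts u v unfolding cps_morphism_def by blast
    also have "mip (fib F (t + s)) (ptens F t s (\<theta> t u) (\<theta> s v)) (ptens F t s x y)
        = mip (fib F s) (\<theta> s v) (mlact (fib F s) (mip (fib E t) u (\<theta>' t x)) y)"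
      using ts u v x y T.closed S.closed by (simp add: F.ptens_ip T.adjoint)
    also have "\<dots> = mip (fib E s) v (mlact (fib E s) (mip (fib E t) u (\<theta>' t x)) (\<theta>' s y))"
      using v y S.adjoint_linear unfolding bimod_linear_def by (simp add: S.adjoint)
    also have "\<dots> = mip (fib E (t + s)) (ptens E t s u v) (ptens E t s (\<theta>' t x) (\<theta>' s y))"
      using ts u v x y by (simp add: E.ptens_ip)
    finally show "mip (fib E (t + s)) (ptens E t s u v) (\<theta>' (t + s) (ptens F t s x y))
        = mip (fib E (t + s)) (ptens E t s u v) (ptens E t s (\<theta>' t x) (\<theta>' s y))" .
  qed (use ts x y in auto)
qed

lemma adjoint_one: "\<theta>' 0 (alg_iso F 1) = alg_iso E 1"
proof -
  interpret Z: adjointable_bimod_map "fib E 0" "fib F 0" "\<theta> 0" by (intro fibre_map) simp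
  show ?thesis
  proof (rule Z.M.ip_ext)
    fix z assume z: "z \<in> mcarrier (fib E 0)"
    then obtain b where b: "z = alg_iso E b"
      using E.alg_iso unfolding bimod_unitary_def by (auto simp: regular_bimod_def)
    have "mip (fib E 0) z (\<theta>' 0 (alg_iso F 1)) = mip (fib F 0) (alg_iso F b) (alg_iso F 1)"
      using z morphism unfolding b cps_morphism_def by (simp flip: Z.adjoint)
    also have "\<dots> = mip (fib E 0) z (alg_iso E 1)"
      using E.alg_iso F.alg_iso unfolding b bimod_unitary_def ip_preserving_def by (simp add: regular_bimod_def)
    finally show "mip (fib E 0) z (\<theta>' 0 (alg_iso F 1)) = mip (fib E 0) z (alg_iso E 1)" .
  qed auto
qed

lemma ex_bounded_morphisms: "\<exists>C. bounded_morphism E F \<theta> C \<and> bounded_morphism F E \<theta>' C"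
proof -
  obtain C d where C: "0 \<le> C" "0 < d" "\<And>t x. 0 < t \<Longrightarrow> t < d \<Longrightarrow> x \<in> mcarrier (fib E t) \<Longrightarrow>
      mnorm (fib F t) (\<theta> t x) \<le> C * mnorm (fib E t) x"
    using bound_near_zero by blast
  have "bounded_morphism E F \<theta> C"
  proof
    show "\<exists>d>0. \<forall>t x. 0 < t \<and> t < d \<and> x \<in> mcarrier (fib E t) \<longrightarrow>
        mnorm (fib F t) (\<theta> t x) \<le> C * mnorm (fib E t) x"
      using C by blast
  qed (use C morphism in \<open>auto simp: cps_morphism_def bimod_morphism_def\<close>)
  moreover have "bounded_morphism F E \<theta>' C"
  proof
    fix t :: real assume t: "0 \<le> t"
    interpret T: adjointable_bimod_map "fib E t" "fib F t" "\<theta> t" using t by (intro fibre_map)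
    show "bimod_linear (fib F t) (fib E t) (\<theta>' t)" by (rule T.adjoint_linear)
    obtain K where K: "\<And>x. x \<in> mcarrier (fib E t) \<Longrightarrow> mnorm (fib F t) (\<theta> t x) \<le> K * mnorm (fib E t) x"
      using morphism t unfolding cps_morphism_def bimod_morphism_def bounded_map_def by blast
    have "mnorm (fib F t) (\<theta> t x) \<le> \<bar>K\<bar> * mnorm (fib E t) x" if "x \<in> mcarrier (fib E t)" for x
      using K[OF that] mult_right_mono[OF abs_ge_self[of K] T.M.mnorm_nonneg[of x]] by linarith
    then show "bounded_map (fib F t) (fib E t) (\<theta>' t)"
      unfolding bounded_map_def using T.adjoint_bound[of "\<bar>K\<bar>"] by auto
  next
    have "mnorm (fib E t) (\<theta>' t x) \<le> C * mnorm (fib F t) x" if "0 < t" "t < d" "x \<in> mcarrier (fib F t)" for t x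
    proof -
      interpret T: adjointable_bimod_map "fib E t" "fib F t" "\<theta> t" using that by (intro fibre_map) simp
      show ?thesis using C that by (intro T.adjoint_bound) auto
    qed
    then show "\<exists>d>0. \<forall>t x. 0 < t \<and> t < d \<and> x \<in> mcarrier (fib F t) \<longrightarrow>
        mnorm (fib E t) (\<theta>' t x) \<le> C * mnorm (fib F t) x"
      using C(2) by blast
  qed (use C adjoint_mult adjoint_one in auto)
  ultimately show ?thesis by blast
qed

text \<open>Moving one \<theta> to the other side turns the operator of \<theta>\<omega> with itself
  into that of \<omega> with \<theta>'\<theta>\<omega>. The latter is a continuous section with
  value 1 at 0, as is \<omega>, so the two are close and the operators converge to 1.\<close>

lemma family_base_units:
  assumes \<omega>: "\<omega> \<in> base_units E"
  shows "family_map \<theta> \<omega> \<in> base_units F" "E.close (family_map \<theta>' (family_map \<theta> \<omega>)) \<omega>"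
    "is_unit E (family_map \<theta>' (family_map \<theta> \<omega>))"
proof -
  obtain C where "bounded_morphism E F \<theta> C" and "bounded_morphism F E \<theta>' C"
    using ex_bounded_morphisms by blast
  then interpret \<theta>: bounded_morphism E F \<theta> C + adj: bounded_morphism F E \<theta>' C by auto
  let ?\<eta> = "family_map \<theta>' (family_map \<theta> \<omega>)"
  have cs: "\<omega> \<in> cont_sections E" and cu: "continuous_units E {\<omega>}"
    using \<omega> unfolding base_units_def by auto
  interpret B: based_product_system E \<omega> by unfold_locales (rule cu)
  have csF: "family_map \<theta> \<omega> \<in> cont_sections F"
    using morphism cs unfolding cps_morphism_def by blast
  then have csE: "?\<eta> \<in> cont_sections E"
    using morphism unfolding cps_morphism_def by blast
  show \<eta>u: "is_unit E ?\<eta>" by (intro adj.family_unit \<theta>.family_unit B.base_unit)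
  show close: "E.close ?\<eta> \<omega>"
    using E.unitD(2)[OF \<eta>u] E.unitD(2)[OF B.base_unit]
    by (intro E.cont_sections_close csE cs) simp
  have "(kernel E \<omega> ?\<eta> \<longlongrightarrow> id_blinfun) (at 0 within {0..})"
    using \<eta>u close B.base_U B.base_unit unfolding B.U_iff
    by (intro E.kernel_tendsto_if_close[OF E.unit_section[OF B.base_unit] B.base_kernel]) (auto intro: E.unit_section)
  moreover have eq: "kernel F (family_map \<theta> \<omega>) (family_map \<theta> \<omega>) r = kernel E \<omega> ?\<eta> r" if r: "0 \<le> r" for r
  proof -
    interpret R: adjointable_bimod_map "fib E r" "fib F r" "\<theta> r" using r by (intro fibre_map)
    have w: "\<omega> r \<in> mcarrier (fib E r)" using B.base_U r by (intro B.U_closed)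
    show ?thesis
    proof (rule blinfun_eqI)
      fix b
      have "mip (fib F r) (\<theta> r (\<omega> r)) (mlact (fib F r) b (\<theta> r (\<omega> r)))
          = mip (fib E r) (\<omega> r) (mlact (fib E r) b (\<theta>' r (\<theta> r (\<omega> r))))"
        using w R.closed R.adjoint_linear unfolding bimod_linear_def by (simp add: R.adjoint)
      then show "blinfun_apply (kernel F (family_map \<theta> \<omega>) (family_map \<theta> \<omega>) r) b
          = blinfun_apply (kernel E \<omega> ?\<eta> r) b"
        using w r R.closed by (simp add: kernel_eq_kern R.M.kern_apply R.N.kern_apply \<theta>.family_apply adj.family_apply)
    qed
  qed
  have "\<forall>\<^sub>F r in at 0 within {0..}. kernel F (family_map \<theta> \<omega>) (family_map \<theta> \<omega>) r = kernel E \<omega> ?\<eta> r"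
    by (rule eventually_mono[OF E.eventually_nonneg eq])
  ultimately have "(kernel F (family_map \<theta> \<omega>) (family_map \<theta> \<omega>) \<longlongrightarrow> id_blinfun) (at 0 within {0..})"
    using tendsto_cong by fast
  then show "family_map \<theta> \<omega> \<in> base_units F"
    using csF \<theta>.family_unit[OF B.base_unit] unfolding base_units_def F.continuous_units_iff by simp
qed

text \<open>The adjoint of \<open>ind(\<theta>)\<close> is induced by \<open>y \<mapsto> \<theta>\<^sup>*y \<boxplus> (-\<theta>\<^sup>*\<theta>\<omega>) \<boxplus> \<omega>\<close>.\<close>

theorem ind_map_properties:
  assumes \<omega>: "\<omega> \<in> base_units E"
  shows "family_map \<theta> ` units_cont_with E \<omega> \<subseteq> units_cont_with F (family_map \<theta> \<omega>)"
    and "\<exists>C. based_morphism E F \<theta> C \<omega>"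
    and "bimod_morphism (ind E \<omega>) (ind F (family_map \<theta> \<omega>)) (ind_map E F \<omega> \<theta>)"
proof -
  obtain C where bm: "bounded_morphism E F \<theta> C" and bm': "bounded_morphism F E \<theta>' C"
    using ex_bounded_morphisms by blast
  have cu: "continuous_units E {\<omega>}" "continuous_units F {family_map \<theta> \<omega>}"
    using \<omega> family_base_units[OF \<omega>] unfolding base_units_def by auto
  have based: "based_morphism E F \<theta> C \<omega>"
    using bm cu by (intro based_morphism.intro based_morphism_axioms.intro)
  then show "\<exists>C. based_morphism E F \<theta> C \<omega>" by blast
  interpret based_morphism E F \<theta> C \<omega> by (rule based)
  interpret adj: bounded_morphism F E \<theta>' C by (rule bm')
  show "family_map \<theta> ` units_cont_with E \<omega> \<subseteq> units_cont_with F (family_map \<theta> \<omega>)"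
    using family_U by blast
  let ?M = "unit_bimod E \<omega>" and ?N = "unit_bimod F (family_map \<theta> \<omega>)"
  let ?\<eta> = "family_map \<theta>' (family_map \<theta> \<omega>)"
  interpret f: lipschitz_map ?M ?N "family_map \<theta>" C by (rule family_lipschitz)
  have \<eta>U: "?\<eta> \<in> E.U" using family_base_units[OF \<omega>] by (simp add: E.U_iff)
  \<comment> \<open>The bound near 0 makes \<theta>'y close to \<theta>'\<theta>\<omega>, which in
    turn is close to \<omega>.\<close>
  have adjU: "family_map \<theta>' y \<in> E.U" if y: "y \<in> F.U" for y
  proof -
    have "E.close (family_map \<theta>' y) ?\<eta>"
      using y F.U_section F.base_U by (intro adj.family_close) (auto simp: F.U_iff)
    moreover have "E.close ?\<eta> \<omega>" using family_base_units[OF \<omega>] by blast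
    moreover have u: "is_unit E (family_map \<theta>' y)" using y by (intro adj.family_unit F.U_unit)
    ultimately show ?thesis
      unfolding E.U_iff using E.close_trans[OF E.unit_section[OF u] E.U_section[OF \<eta>U] E.U_section[OF E.base_U]]
      by blast
  qed
  define g where "g y = lbox E [(1, family_map \<theta>' y), (- 1, ?\<eta>), (1, \<omega>)]" for y
  have gU: "g y \<in> E.U" if "y \<in> F.U" for y
    unfolding g_def using E.D_lbox(1)[of _ \<omega>] adjU[OF that] \<eta>U by simp
  \<comment> \<open>In the fibres <\<theta>x - \<theta>\<omega>, y - \<theta>\<omega>> equals <x -
    \<omega>, \<theta>'y - \<theta>'\<theta>\<omega>>. Inserting \<omega> on the right splits this
    into the two quotients over the base \<omega>, and their difference is what \<open>g\<close>
    encodes.\<close>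
  have adj_eq: "mip ?N (family_map \<theta> x) y = mip ?M x (g y)" if x: "x \<in> E.U" and y: "y \<in> F.U" for x y
  proof -
    have "E.D x (g y) 1 = E.D x (family_map \<theta>' y) 1 - E.D x ?\<eta> 1"
      unfolding g_def using E.D_lbox(2)[of "[(1, family_map \<theta>' y), (- 1, ?\<eta>), (1, \<omega>)]" x 1] adjU[OF y] \<eta>U x
      by (simp add: E.D_zero E.D_minus)
    moreover have "F.D (family_map \<theta> x) y 1 = E.D x (family_map \<theta>' y) 1 - E.D x ?\<eta> 1"
    proof (rule F.D_unique[OF F.D_tendsto[OF family_U[OF x] y]])
      show "((\<lambda>r. E.Dq x (family_map \<theta>' y) 1 r - E.Dq x ?\<eta> 1 r) \<longlongrightarrow>
          E.D x (family_map \<theta>' y) 1 - E.D x ?\<eta> 1) (at_right 0)"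
        by (intro tendsto_intros E.D_tendsto x adjU y \<eta>U)
      fix r :: real assume r: "0 < r"
      interpret R: adjointable_bimod_map "fib E r" "fib F r" "\<theta> r" using r by (intro fibre_map) simp
      have c: "x r \<in> mcarrier (fib E r)" "\<omega> r \<in> mcarrier (fib E r)" "y r \<in> mcarrier (fib F r)"
        using E.U_closed[OF x] E.U_closed[OF E.base_U] F.U_closed[OF y] r by auto
      have t: "\<theta> r (x r) \<in> mcarrier (fib F r)" "\<theta> r (\<omega> r) \<in> mcarrier (fib F r)" using R.closed c by auto
      show "F.Dq (family_map \<theta> x) y 1 r = E.Dq x (family_map \<theta>' y) 1 r - E.Dq x ?\<eta> 1 r"
        unfolding F.Dq_def E.Dq_def using r c t
        by (simp add: family_apply adj.family_apply R.N.ip_lact_one R.M.ip_lact_one R.N.ip_simps R.M.ip_simps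
            R.adjoint algebra_simps)
    qed
    ultimately show ?thesis using x y by simp
  qed
  have gl: "lipschitz_map ?N ?M g C"
    by (rule lipschitz_map_adjoint[OF family_lipschitz]) (use family_norm gU adj_eq in auto)
  interpret g: lipschitz_map ?N ?M g C by (rule gl)
  have "bounded_map (ind E \<omega>) (ind F (family_map \<theta> \<omega>)) f.ext"
    unfolding bounded_map_def ind_def using f.ext_bounded family_norm by auto
  moreover have "adjointable (ind E \<omega>) (ind F (family_map \<theta> \<omega>)) f.ext"
    unfolding adjointable_def ind_def
    using ext_adjoint[OF family_lipschitz gl] adj_eq by (intro exI[of _ g.ext]) auto
  moreover have "bimod_linear (ind E \<omega>) (ind F (family_map \<theta> \<omega>)) f.ext"
    unfolding ind_def by (rule f.ext_bimod_linear[OF family_linear])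
  ultimately show "bimod_morphism (ind E \<omega>) (ind F (family_map \<theta> \<omega>)) (ind_map E F \<omega> \<theta>)"
    unfolding bimod_morphism_def ind_map_def f.cont_ext_eq by blast
qed

end

section \<open>Functoriality of the index\<close>

lemma lipschitz_map_comp:
  assumes "lipschitz_map M N f C" "lipschitz_map N L g D"
  shows "lipschitz_map M L (\<lambda>x. g (f x)) (D * C)"
proof -
  interpret f: lipschitz_map M N f C by fact
  interpret g: lipschitz_map N L g D by fact
  show ?thesis
  proof
    fix x y assume xy: "x \<in> mcarrier M" "y \<in> mcarrier M"
    show "g (f x) \<in> mcarrier L" using xy by simp
    have "mdist L (g (f x)) (g (f y)) \<le> D * mdist N (f x) (f y)"
      using xy by (intro g.lipschitz) auto
    also have "\<dots> \<le> D * (C * mdist M x y)"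
      using xy g.C_nonneg by (intro mult_left_mono f.lipschitz)
    finally show "mdist L (g (f x)) (g (f y)) \<le> D * C * mdist M x y" by (simp add: mult.assoc)
  qed (simp add: f.C_nonneg g.C_nonneg)
qed

lemma is_cont_ext_cong:
  "is_cont_ext M N f T \<Longrightarrow> (\<And>x. x \<in> mcarrier M \<Longrightarrow> f x = g x) \<Longrightarrow> is_cont_ext M N g T"
  unfolding is_cont_ext_def by simp

lemma is_cont_ext_cont_ext: "lipschitz_map M N f C \<Longrightarrow> is_cont_ext M N f (cont_ext M N f)"
  using lipschitz_map.is_cont_ext_ext lipschitz_map.cont_ext_eq by metis

lemma cont_ext_eqI: "lipschitz_map M N f C \<Longrightarrow> is_cont_ext M N f T \<Longrightarrow> cont_ext M N f = T"
  using lipschitz_map.is_cont_ext_unique lipschitz_map.cont_ext_eq by metis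


text \<open>Both composites are continuous extensions of the same map on M, so uniqueness turns a
  commuting square of units into one of completions.\<close>

lemma cont_ext_comp_eq:
  assumes f: "lipschitz_map M N f C" and g: "lipschitz_map N L g D"
    and f': "lipschitz_map M N' f' C'" and g': "lipschitz_map N' L g' D'"
    and eq: "\<And>x. x \<in> mcarrier M \<Longrightarrow> g (f x) = g' (f' x)" and X: "X \<in> mcarrier (hcompletion M)"
  shows "cont_ext N L g (cont_ext M N f X) = cont_ext N' L g' (cont_ext M N' f' X)"
proof -
  have M: "semi_bimod M" using f unfolding lipschitz_map_def by blast
  have c: "\<And>x. x \<in> mcarrier M \<Longrightarrow> f x \<in> mcarrier N" "\<And>x. x \<in> mcarrier M \<Longrightarrow> f' x \<in> mcarrier N'"
    using lipschitz_map.closed[OF f] lipschitz_map.closed[OF f'] by auto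
  have "is_cont_ext M L (\<lambda>x. g (f x)) (\<lambda>X\<in>mcarrier (hcompletion M). cont_ext N L g (cont_ext M N f X))"
    using c by (intro is_cont_ext_comp[OF M is_cont_ext_cont_ext[OF f] is_cont_ext_cont_ext[OF g]]) auto
  moreover have "is_cont_ext M L (\<lambda>x. g' (f' x)) (\<lambda>X\<in>mcarrier (hcompletion M). cont_ext N' L g' (cont_ext M N' f' X))"
    using c by (intro is_cont_ext_comp[OF M is_cont_ext_cont_ext[OF f'] is_cont_ext_cont_ext[OF g']]) auto
  then have "is_cont_ext M L (\<lambda>x. g (f x)) (\<lambda>X\<in>mcarrier (hcompletion M). cont_ext N' L g' (cont_ext M N' f' X))"
    by (rule is_cont_ext_cong) (simp add: eq)
  ultimately have "(\<lambda>X\<in>mcarrier (hcompletion M). cont_ext N L g (cont_ext M N f X))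
      = (\<lambda>X\<in>mcarrier (hcompletion M). cont_ext N' L g' (cont_ext M N' f' X))"
    using cont_ext_eqI[OF lipschitz_map_comp[OF f g]] by metis
  from fun_cong[OF this, of X] show ?thesis using X by simp
qed

lemma (in semi_bimod) lipschitz_map_id:
  assumes "\<And>x. x \<in> mcarrier M \<Longrightarrow> f x = x"
  shows "lipschitz_map M M f 1"
  by unfold_locales (simp_all add: assms)

lemma (in semi_bimod) cont_ext_id:
  assumes f: "\<And>x. x \<in> mcarrier M \<Longrightarrow> f x = x" and X: "X \<in> mcarrier (hcompletion M)"
  shows "cont_ext M M f X = X"
proof -
  have "is_cont_ext M M f (\<lambda>X\<in>mcarrier (hcompletion M). X)"
    unfolding is_cont_ext_def mcont_map_def using f hclass_closed by auto
  then have "cont_ext M M f = (\<lambda>X\<in>mcarrier (hcompletion M). X)"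
    by (rule cont_ext_eqI[OF lipschitz_map_id[OF f], rotated])
  then show ?thesis using X by simp
qed

section \<open>Change of the base unit\<close>

context based_product_system
begin

text \<open>To first order x is sent to x - \<omega> + \<omega>', so the difference from the
  respective base is unchanged. The map preserves inner products, whence the constant 1.\<close>

lemma base_change_lipschitz:
  assumes \<omega>': "continuous_units E {\<omega>'}" "close \<omega>' \<omega>"
  shows "lipschitz_map (unit_bimod E \<omega>) (unit_bimod E \<omega>') (\<lambda>x. lbox E [(1, x), (- 1, \<omega>), (1, \<omega>')]) 1"
proof -
  interpret B: based_product_system E \<omega>' by unfold_locales (rule \<omega>')
  interpret M: semi_bimod "unit_bimod E \<omega>" by (rule unit_semi_bimod)
  interpret N: semi_bimod "unit_bimod E \<omega>'" by (rule B.unit_semi_bimod)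
  let ?f = "\<lambda>x. lbox E [(1, x), (- 1, \<omega>), (1, \<omega>')]"
  have \<omega>'U: "\<omega>' \<in> U" unfolding U_iff using B.base_unit \<omega>' by blast
  have sym: "close \<omega> \<omega>'"
    using close_if_kernel[OF base_unit B.base_unit base_kernel _ B.base_kernel]
      tangent_kernel_tendsto[OF U_tangent[OF base_U \<omega>'U]] by blast
  have sub: "x \<in> B.U" if "x \<in> U" for x
    using that close_trans[OF U_section[OF that] U_section[OF base_U] U_section[OF \<omega>'U] _ sym]
    unfolding B.U_iff U_iff by blast
  have fU: "?f x \<in> B.U" and fD: "B.D z (?f x) b = B.D z x b - B.D z \<omega> b" if "x \<in> U" "z \<in> B.U" for x z b
    using B.D_lbox(1,2)[of "[(1, x), (- 1, \<omega>), (1, \<omega>')]" z] sub[OF that(1)] sub[OF base_U] that(2)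
    by (simp_all add: B.D_zero B.D_minus)
  have fD': "B.D (?f x) z 1 = B.D x z 1 - B.D \<omega> z 1" if x: "x \<in> U" and z: "z \<in> B.U" for x z
  proof -
    have "B.D (?f x) z 1 = star (B.D z (?f x) 1)"
      using B.D_star[OF z fU[OF x z], of 1] by simp
    also have "\<dots> = B.D x z 1 - B.D \<omega> z 1"
      using B.D_star[OF z sub[OF x], of 1] B.D_star[OF z sub[OF base_U], of 1] by (simp add: fD x z star_diff)
    finally show ?thesis .
  qed
  have ip: "mip (unit_bimod E \<omega>') (?f x) (?f y) = mip (unit_bimod E \<omega>) x y" if x: "x \<in> U" and y: "y \<in> U" for x y
  proof -
    \<comment> \<open>Expanding both arguments gives an alternating sum in which the generators
      involving \<omega>' cancel, leaving the form over \<omega>.\<close>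
    have "B.D (?f x) (?f y) 1 = B.D x y 1 - B.D x \<omega> 1 - (B.D \<omega> y 1 - B.D \<omega> \<omega> 1)"
      using fU[OF y B.base_U] by (simp add: fD' fD x y sub[OF x] sub[OF y] sub[OF base_U])
    also have "\<dots> = D x y 1"
      unfolding B.D_def D_def by (simp add: blinfun.bilinear_simps)
    finally show ?thesis by simp
  qed
  show ?thesis
  proof
    fix x y assume x: "x \<in> mcarrier (unit_bimod E \<omega>)" and y: "y \<in> mcarrier (unit_bimod E \<omega>)"
    then have xy: "x \<in> U" "y \<in> U" by auto
    have f: "?f z \<in> mcarrier (unit_bimod E \<omega>')" if "z \<in> U" for z using fU[OF that B.base_U] by simp
    show "?f x \<in> mcarrier (unit_bimod E \<omega>')" using xy(1) by (rule f)
    have "(mdist (unit_bimod E \<omega>') (?f x) (?f y))\<^sup>2 = (mdist (unit_bimod E \<omega>) x y)\<^sup>2"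
      unfolding N.mdist_square[OF f[OF xy(1)] f[OF xy(2)]] M.mdist_square[OF x y]
      by (simp only: ip xy)
    then show "mdist (unit_bimod E \<omega>') (?f x) (?f y) \<le> 1 * mdist (unit_bimod E \<omega>) x y"
      by (simp add: power2_eq_iff_nonneg)
  qed simp
qed

end

lemma base_units_based:
  "continuous_product_system E \<Longrightarrow> \<omega> \<in> base_units E \<Longrightarrow> based_product_system E \<omega>"
  unfolding continuous_product_system_def base_units_def
  by (intro based_product_system.intro based_product_system_axioms.intro) auto

text \<open>Base units are continuous sections with the common value 1 at 0.\<close>

lemma base_units_close:
  assumes E: "continuous_product_system E" and "\<omega> \<in> base_units E" "\<omega>' \<in> base_units E"
  shows "product_system.close E \<omega>' \<omega>"
proof -
  interpret E: continuous_product_system E by fact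
  show ?thesis
    using assms(2,3) unfolding base_units_def continuous_units_def
    by (intro E.cont_sections_close) (auto simp: E.unitD(2))
qed

lemma base_change_lipschitz_map:
  assumes E: "continuous_product_system E" and \<omega>: "\<omega> \<in> base_units E" "\<omega>' \<in> base_units E"
  shows "lipschitz_map (unit_bimod E \<omega>) (unit_bimod E \<omega>') (\<lambda>x. lbox E [(1, x), (- 1, \<omega>), (1, \<omega>')]) 1"
  using based_product_system.base_change_lipschitz[OF base_units_based[OF E \<omega>(1)], of \<omega>']
    base_units_close[OF E \<omega>] \<omega>(2) unfolding base_units_def by blast

theorem proposition3p10:
  fixes E :: "('b::unital_cstar_algebra, 'e, 'h) cpsys"
    and F :: "('b, 'f, 'k) cpsys"
    and G :: "('b, 'g, 'l) cpsys"
  assumes "continuous_product_system E"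
    and "continuous_product_system F"
    and "continuous_product_system G"
  shows
    "(\<forall>\<omega>\<in>base_units E. hilbert_bimodule (ind E \<omega>)) \<and>
     (\<forall>\<theta>. \<forall>\<omega>\<in>base_units E. cps_morphism E F \<theta> \<longrightarrow>
        family_map \<theta> \<omega> \<in> base_units F \<and>
        family_map \<theta> ` units_cont_with E \<omega> \<subseteq> units_cont_with F (family_map \<theta> \<omega>) \<and>
        (\<exists>!T. is_cont_ext (unit_bimod E \<omega>) (unit_bimod F (family_map \<theta> \<omega>)) (family_map \<theta>) T) \<and>
        bimod_morphism (ind E \<omega>) (ind F (family_map \<theta> \<omega>)) (ind_map E F \<omega> \<theta>)) \<and>
     (\<forall>\<theta>. \<forall>\<omega>\<in>base_units E. \<forall>\<omega>'\<in>base_units E. cps_morphism E F \<theta> \<longrightarrow>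
        (\<forall>X\<in>mcarrier (ind E \<omega>).
           ind_map E F \<omega>' \<theta> (ind_base_change E \<omega> \<omega>' X) =
           ind_base_change F (family_map \<theta> \<omega>) (family_map \<theta> \<omega>') (ind_map E F \<omega> \<theta> X))) \<and>
     (\<forall>\<omega>\<in>base_units E. \<forall>X\<in>mcarrier (ind E \<omega>). ind_map E E \<omega> (\<lambda>t x. x) X = X) \<and>
     (\<forall>\<theta> \<psi>. \<forall>\<omega>\<in>base_units E. cps_morphism E F \<theta> \<longrightarrow> cps_morphism F G \<psi> \<longrightarrow>
        (\<forall>X\<in>mcarrier (ind E \<omega>).
           ind_map E G \<omega> (\<lambda>t x. \<psi> t (\<theta> t x)) X =
           ind_map F G (family_map \<theta> \<omega>) \<psi> (ind_map E F \<omega> \<theta> X)))"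
proof -
  have semi: "semi_bimod (unit_bimod E \<omega>)" if "\<omega> \<in> base_units E" for \<omega>
    by (rule based_product_system.unit_semi_bimod[OF base_units_based[OF assms(1) that]])
  have EF: "cps_map E F \<theta>" if "cps_morphism E F \<theta>" for \<theta>
    using assms that by (intro cps_map.intro cps_map_axioms.intro)
  have FG: "cps_map F G \<psi>" if "cps_morphism F G \<psi>" for \<psi>
    using assms that by (intro cps_map.intro cps_map_axioms.intro)
  have lip: "\<exists>C. lipschitz_map (unit_bimod E \<omega>) (unit_bimod F (family_map \<theta> \<omega>)) (family_map \<theta>) C"
    if "cps_morphism E F \<theta>" "\<omega> \<in> base_units E" for \<theta> \<omega>
    using cps_map.ind_map_properties(2)[OF EF[OF that(1)] that(2)] based_morphism.family_lipschitz by blast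
  have lip': "\<exists>C. lipschitz_map (unit_bimod F \<omega>) (unit_bimod G (family_map \<psi> \<omega>)) (family_map \<psi>) C"
    if "cps_morphism F G \<psi>" "\<omega> \<in> base_units F" for \<psi> \<omega>
    using cps_map.ind_map_properties(2)[OF FG[OF that(1)] that(2)] based_morphism.family_lipschitz by blast
  have baseF: "family_map \<theta> \<omega> \<in> base_units F" if "cps_morphism E F \<theta>" "\<omega> \<in> base_units E" for \<theta> \<omega>
    by (rule cps_map.family_base_units(1)[OF EF[OF that(1)] that(2)])
  have comp: "family_map (\<lambda>t x. \<psi> t (\<theta> t x)) x = family_map \<psi> (family_map \<theta> x)"
    for \<psi> :: "real \<Rightarrow> 'f \<Rightarrow> 'g" and \<theta> :: "real \<Rightarrow> 'e \<Rightarrow> 'f" and x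
    unfolding family_map_def by (intro restrict_ext) simp
  have 1: "hilbert_bimodule (ind E \<omega>)" if "\<omega> \<in> base_units E" for \<omega>
    unfolding ind_def by (rule semi_bimod.hilbert_hcompletion[OF semi[OF that]])
  have 2: "family_map \<theta> ` units_cont_with E \<omega> \<subseteq> units_cont_with F (family_map \<theta> \<omega>)"
    "\<exists>!T. is_cont_ext (unit_bimod E \<omega>) (unit_bimod F (family_map \<theta> \<omega>)) (family_map \<theta>) T"
    "bimod_morphism (ind E \<omega>) (ind F (family_map \<theta> \<omega>)) (ind_map E F \<omega> \<theta>)"
    if "cps_morphism E F \<theta>" "\<omega> \<in> base_units E" for \<theta> \<omega>
    using cps_map.ind_map_properties[OF EF[OF that(1)] that(2)] lip[OF that] lipschitz_map.ex1_cont_ext by blast+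
  \<comment> \<open>Affine combinations are preserved by \<theta>, so the square commutes on units
    and therefore on the completions.\<close>
  have 3: "ind_map E F \<omega>' \<theta> (ind_base_change E \<omega> \<omega>' X)
      = ind_base_change F (family_map \<theta> \<omega>) (family_map \<theta> \<omega>') (ind_map E F \<omega> \<theta> X)"
    if \<theta>: "cps_morphism E F \<theta>" and \<omega>: "\<omega> \<in> base_units E" "\<omega>' \<in> base_units E" and X: "X \<in> mcarrier (ind E \<omega>)"
    for \<theta> \<omega> \<omega>' X
  proof -
    obtain C where C: "lipschitz_map (unit_bimod E \<omega>) (unit_bimod F (family_map \<theta> \<omega>)) (family_map \<theta>) C"
      using lip[OF \<theta> \<omega>(1)] by blast
    obtain C' where C': "lipschitz_map (unit_bimod E \<omega>') (unit_bimod F (family_map \<theta> \<omega>')) (family_map \<theta>) C'"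
      using lip[OF \<theta> \<omega>(2)] by blast
    obtain K where "based_morphism E F \<theta> K \<omega>"
      using cps_map.ind_map_properties(2)[OF EF[OF \<theta>] \<omega>(1)] by blast
    then interpret based_morphism E F \<theta> K \<omega> .
    have \<omega>'U: "\<omega>' \<in> E.U"
      using base_units_close[OF assms(1) \<omega>] \<omega>(2) unfolding E.U_iff base_units_def continuous_units_def by blast
    show ?thesis
      unfolding ind_map_def ind_base_change_def
    proof (rule cont_ext_comp_eq)
      show "family_map \<theta> (lbox E [(1, x), (- 1, \<omega>), (1, \<omega>')])
          = lbox F [(1, family_map \<theta> x), (- 1, family_map \<theta> \<omega>), (1, family_map \<theta> \<omega>')]"
        if "x \<in> mcarrier (unit_bimod E \<omega>)" for x
        using family_lbox[of "[(1, x), (- 1, \<omega>), (1, \<omega>')]"] that \<omega>'U by simp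
    qed (use X in \<open>auto intro!: C C' base_change_lipschitz_map assms \<omega> baseF[OF \<theta>] simp: ind_def\<close>)
  qed
  have 4: "ind_map E E \<omega> (\<lambda>t x. x) X = X" if \<omega>: "\<omega> \<in> base_units E" and X: "X \<in> mcarrier (ind E \<omega>)" for \<omega> X
  proof -
    interpret E: based_product_system E \<omega> by (rule base_units_based[OF assms(1) \<omega>])
    \<comment> \<open>Units take the default value at negative parameters, so the restriction built
      into \<open>family_map\<close> changes nothing.\<close>
    have id: "family_map (\<lambda>t x. x) x = x" if "is_unit E x" for x
      using that unfolding family_map_def is_unit_def by (intro extensionalityI[of _ "{0..}"]) (auto simp: PiE_def)
    show ?thesis
      unfolding ind_map_def id[OF E.base_unit]
      using semi_bimod.cont_ext_id[OF semi[OF \<omega>]] id E.U_unit X unfolding ind_def by simp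
  qed
  have 5: "ind_map E G \<omega> (\<lambda>t x. \<psi> t (\<theta> t x)) X = ind_map F G (family_map \<theta> \<omega>) \<psi> (ind_map E F \<omega> \<theta> X)"
    if \<theta>: "cps_morphism E F \<theta>" and \<psi>: "cps_morphism F G \<psi>" and \<omega>: "\<omega> \<in> base_units E"
      and X: "X \<in> mcarrier (ind E \<omega>)" for \<theta> \<psi> \<omega> X
  proof -
    obtain C where C: "lipschitz_map (unit_bimod E \<omega>) (unit_bimod F (family_map \<theta> \<omega>)) (family_map \<theta>) C"
      using lip[OF \<theta> \<omega>] by blast
    obtain D where D: "lipschitz_map (unit_bimod F (family_map \<theta> \<omega>))
        (unit_bimod G (family_map \<psi> (family_map \<theta> \<omega>))) (family_map \<psi>) D"
      using lip'[OF \<psi> baseF[OF \<theta> \<omega>]] by blast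
    have M: "semi_bimod (unit_bimod E \<omega>)" by (rule semi[OF \<omega>])
    \<comment> \<open>The composite of the extensions continuously extends the composite map;
      uniqueness identifies it with the extension that defines the left-hand side.\<close>
    have "is_cont_ext (unit_bimod E \<omega>) (unit_bimod G (family_map \<psi> (family_map \<theta> \<omega>)))
        (\<lambda>x. family_map \<psi> (family_map \<theta> x))
        (\<lambda>X\<in>mcarrier (hcompletion (unit_bimod E \<omega>)). ind_map F G (family_map \<theta> \<omega>) \<psi> (ind_map E F \<omega> \<theta> X))"
      unfolding ind_map_def using lipschitz_map.closed[OF C]
      by (intro is_cont_ext_comp[OF M is_cont_ext_cont_ext[OF C] is_cont_ext_cont_ext[OF D]]) auto
    from cont_ext_eqI[OF lipschitz_map_comp[OF C D] this] show ?thesis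
      using X unfolding ind_map_def[of E G] comp ind_def by simp
  qed
  show ?thesis
    by (intro conjI ballI allI impI; (rule 1 2 3 4 5 baseF; assumption))
qed

end
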